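(* Let $M=\mathbb{R}^4\times S^3$ be the cohomogeneity one manifold with group diagram $\mathrm{SU}(2)^2\supset\Delta\mathrm{SU}(2)\supset\{1\}$. (1) There is a family of $\mathrm{SU}(2)^2$-invariant coclosed $G_2$-structures on $M$, parametrised by triples of smooth odd functions $A_1,A_2,A_3:[0,\infty)\to\mathbb{R}$, positive on $(0,\infty)$, with $A_i(t)=\frac{t}{2}+O(t^3)$ at $t=0$, together with a non-zero parameter $b_0\in\mathbb{R}$. That is, for every such $(A_1,A_2,A_3,b_0)$ there are unique functions $B_1,B_2,B_3:[0,\infty)\to\mathbb{R}$ (continuous on $[0,\infty)$, differentiable on $(0,\infty)$) with $B_1(0)=B_2(0)=B_3(0)=b_0$ such that the 3-form $\varphi=\varphi_{A,B}$ on the principal part of $M$ (defined in the context) satisfies $d{*_\varphi}\varphi=0$; and this $\varphi$ extends to a smooth $\mathrm{SU}(2)^2$-invariant coclosed $G_2$-structure on $M$. (2) Moreover, every $\mathrm{SU}(2)^2$-invariant coclosed $G_2$-structure on $M$ constructed from a half-flat $\mathrm{SU}(3)$-structure (as defined in the context) belongs to this family.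
   Context: A $G_2$-structure on a 7-manifold is a smooth positive 3-form $\varphi$ (pointwise linearly equivalent to $e^{123}-e^{167}-e^{527}-e^{563}-e^{415}-e^{426}-e^{437}$ on $\mathbb{R}^7$); it induces a metric $g_\varphi$, an orientation and a Hodge star $*_\varphi$. It is coclosed if $d{*_\varphi}\varphi=0$. A smooth function on $[0,\infty)$ is called odd (even) if its odd (even) extension to $\mathbb{R}$ is smooth. The manifold: $M=\mathbb{R}^4\times S^3\subset\mathbb{H}\times\mathbb{H}$, with $G=\mathrm{SU}(2)^2$ (unit quaternions) acting by $(a_1,a_2)\cdot(p,q)=(a_1p,\,a_1q\bar a_2)$. With $\gamma(t)=(t,1)$, $t\ge 0$, the isotropy group of $\gamma(0)$ is the diagonal $\Delta\mathrm{SU}(2)$ and that of $\gamma(t)$, $t>0$, is trivial; the singular orbit is $\{0\}\times S^3\cong \mathrm{SU}(2)^2/\Delta\mathrm{SU}(2)$. The principal part $M\setminus(\{0\}\times S^3)$ is identified with $(0,\infty)\times G$ via $(t,g)\mapsto g\cdot\gamma(t)$. Let $T_1,T_2,T_3$ be a basis of $\mathfrak{su}(2)$ with $[T_i,T_j]=2\epsilon_{ijk}T_k$, let $T_i^{\pm}=(T_i,\pm T_i)\in\mathfrak{su}(2)\oplus\mathfrak{su}(2)$, and let $\eta_i^{\pm}$ be the left-invariant 1-forms on $G$ forming the dual basis of $\{T_i^+,T_i^-\}$. For functions $A_i,B_i$ ($i=1,2,3$), nowhere zero on $(0,\infty)$, set $$\omega=4\sum_{i}A_iB_i\,\eta_i^-\wedge\eta_i^+,\qquad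 \Omega_1=8B_1B_2B_3\,\eta_1^-\wedge\eta_2^-\wedge\eta_3^- -4\sum_{i,j,k}\epsilon_{ijk}A_iA_jB_k\,\eta_i^+\wedge\eta_j^+\wedge\eta_k^-,$$ $$\Omega_2=-8A_1A_2A_3\,\eta_1^+\wedge\eta_2^+\wedge\eta_3^+ +4\sum_{i,j,k}\epsilon_{ijk}B_iB_jA_k\,\eta_i^-\wedge\eta_j^-\wedge\eta_k^+,$$ and $$\varphi_{A,B}=dt\wedge\omega+\Omega_1,\qquad {*_\varphi}\varphi_{A,B}=\tfrac12\omega^2-dt\wedge\Omega_2 .$$ For each $t$ the triple $(\omega,\Omega_1,\Omega_2)$ is a half-flat $\mathrm{SU}(3)$-structure on $\{t\}\times G$ (i.e. $d\Omega_1=0$ and $d\omega^2=0$ there), and $\varphi_{A,B}$ induces the metric $dt^2+\sum_i(2A_i)^2\eta_i^+\otimes\eta_i^++\sum_i(2B_i)^2\eta_i^-\otimes\eta_i^-$. An $\mathrm{SU}(2)^2$-invariant $G_2$-structure on $M$ is said to be constructed from a half-flat $\mathrm{SU}(3)$-structure if its restriction to the principal part $(0,\infty)\times G$ is of the form $\varphi_{A,B}$ for some functions $A_i,B_i$ of $t$, nowhere zero on $(0,\infty)$ ($t$ being the arc-length parameter along the normal geodesic $\gamma$). *)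

theory Defs
  imports "HOL-Analysis.Analysis" "HOL-Library.Landau_Symbols"
begin

section \<open>Smooth maps and differential forms on smooth retracts\<close>

text \<open>\<open>Ck_on\<close> and \<open>smooth_on\<close> are meant for open sets \<open>U\<close>; all partial derivatives up to order \<open>k\<close>
  exist and are continuous.\<close>

fun Ck_on :: "nat \<Rightarrow> ('a::euclidean_space \<Rightarrow> 'b::real_normed_vector) \<Rightarrow> 'a set \<Rightarrow> bool" where
  "Ck_on 0 f U \<longleftrightarrow> continuous_on U f"
| "Ck_on (Suc k) f U \<longleftrightarrow> (\<forall>x\<in>U. f differentiable at x) \<and>
     (\<forall>v. Ck_on k (\<lambda>x. frechet_derivative f (at x) v) U)"

definition smooth_on :: "('a::euclidean_space \<Rightarrow> 'b::real_normed_vector) \<Rightarrow> 'a set \<Rightarrow> bool" where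
  "smooth_on f U \<longleftrightarrow> (\<forall>k. Ck_on k f U)"

text \<open>A \<open>k\<close>-covector is a function on lists of vectors of which only the values on lists of
  length \<open>k\<close> matter; a differential form assigns a covector to each point.\<close>

type_synonym 'v covec = "'v list \<Rightarrow> real"
type_synonym 'v dform = "'v \<Rightarrow> 'v list \<Rightarrow> real"

definition oneform :: "('v \<Rightarrow> real) \<Rightarrow> 'v covec" where
  "oneform f vs = f (hd vs)"

text \<open>Wedge product of a \<open>p\<close>-covector with another covector, as a sum over shuffles: \<open>I\<close> is the set
  of positions of the arguments of the first factor, and the sign is that of the permutation
  listing \<open>I\<close> in increasing order followed by its complement. No factorials are
  needed: the wedge of one-forms evaluates to a determinant.\<close>

definition shuffle_sign :: "nat set \<Rightarrow> real" where
  "shuffle_sign I = (- 1) ^ (\<Sum>I + card I * (card I - 1) div 2)"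

definition wedge :: "nat \<Rightarrow> 'v covec \<Rightarrow> 'v covec \<Rightarrow> 'v covec" where
  "wedge p \<alpha> \<beta> vs =
     (\<Sum>I | I \<subseteq> {..<length vs} \<and> card I = p. shuffle_sign I * \<alpha> (nths vs I) * \<beta> (nths vs (- I)))"

definition wedge_list :: "'v covec list \<Rightarrow> 'v covec" where
  "wedge_list \<alpha>s = foldr (wedge 1) \<alpha>s (\<lambda>_. 1)"

definition pullback ::
  "('a::real_normed_vector \<Rightarrow> 'b::real_normed_vector) \<Rightarrow> 'b dform \<Rightarrow> 'a dform" where
  "pullback f \<alpha> x vs = \<alpha> (f x) (map (frechet_derivative f (at x)) vs)"

text \<open>The manifolds below are submanifolds \<open>S\<close> of a Euclidean space given together with a smooth
  retraction \<open>r\<close> of an open neighbourhood \<open>U\<close> onto \<open>S\<close>. Then \<open>T\<^sub>xS\<close> is the image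
  of the derivative of \<open>r\<close> at \<open>x \<in> S\<close>. A form \<open>\<alpha>\<close> on \<open>S\<close> is smooth iff \<open>r\<^sup>*\<alpha>\<close> is
  smooth on \<open>U\<close>, and \<open>d\<alpha>\<close> is the restriction of \<open>d(r\<^sup>*\<alpha>)\<close> to \<open>S\<close>, because \<open>d\<close>
  commutes with pullbacks and \<open>\<alpha>\<close> is the restriction of \<open>r\<^sup>*\<alpha>\<close>.\<close>

definition tangent :: "('a::real_normed_vector \<Rightarrow> 'a) \<Rightarrow> 'a \<Rightarrow> 'a set" where
  "tangent r x = range (frechet_derivative r (at x))"

definition smooth_form ::
  "nat \<Rightarrow> 'a set \<Rightarrow> ('a \<Rightarrow> 'a) \<Rightarrow> ('a::euclidean_space) dform \<Rightarrow> bool" where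
  "smooth_form k U r \<alpha> \<longleftrightarrow> (\<forall>vs. length vs = k \<longrightarrow> smooth_on (\<lambda>x. pullback r \<alpha> x vs) U)"

definition ext_deriv ::
  "('a::real_normed_vector \<Rightarrow> 'a) \<Rightarrow> 'a dform \<Rightarrow> 'a dform" where
  "ext_deriv r \<alpha> x vs =
     (\<Sum>i<length vs. (- 1) ^ i *
        frechet_derivative (\<lambda>y. pullback r \<alpha> y (take i vs @ drop (Suc i) vs)) (at x) (vs ! i))"

definition closed_form ::
  "nat \<Rightarrow> 'a set \<Rightarrow> ('a \<Rightarrow> 'a) \<Rightarrow> ('a::real_normed_vector) dform \<Rightarrow> bool" where
  "closed_form k S r \<alpha> \<longleftrightarrow> (\<forall>x\<in>S.
     (\<forall>vs. length vs = k \<longrightarrow> (\<lambda>y. pullback r \<alpha> y vs) differentiable (at x)) \<and>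
     (\<forall>vs. length vs = Suc k \<longrightarrow> set vs \<subseteq> tangent r x \<longrightarrow> ext_deriv r \<alpha> x vs = 0))"

section \<open>The model on \<open>\<real>\<^sup>7\<close>\<close>

definition coframe7 :: "(real^7) covec list" where
  "coframe7 = map (\<lambda>i. oneform (\<lambda>v. v $ i)) [1, 2, 3, 4, 5, 6, 7]"

definition frame7 :: "(real^7) list" where
  "frame7 = map (\<lambda>i. axis i 1) [1, 2, 3, 4, 5, 6, 7]"

definition e3 :: "7 \<Rightarrow> 7 \<Rightarrow> 7 \<Rightarrow> (real^7) covec" where
  "e3 i j k = wedge_list [oneform (\<lambda>v. v $ i), oneform (\<lambda>v. v $ j), oneform (\<lambda>v. v $ k)]"

definition phi0 :: "(real^7) covec" where
  "phi0 vs = e3 1 2 3 vs - e3 1 6 7 vs - e3 5 2 7 vs - e3 5 6 3 vs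
           - e3 4 1 5 vs - e3 4 2 6 vs - e3 4 3 7 vs"

text \<open>Hodge star on \<open>p\<close>-covectors of \<open>\<real>\<^sup>7\<close> for the Euclidean metric and the orientation
  \<open>- e\<^sup>1\<^sup>2\<^sup>3\<^sup>4\<^sup>5\<^sup>6\<^sup>7\<close>, i.e. \<open>*e\<^sup>I = - sgn(I,I\<^sup>c) e\<^bsup>I\<^sup>c\<^esup>\<close>; hence the leading minus sign. This is the
  orientation induced by \<open>\<phi>\<^sub>0\<close> in the sense that
  \<open>(u \<lrcorner> \<phi>\<^sub>0) \<and> (v \<lrcorner> \<phi>\<^sub>0) \<and> \<phi>\<^sub>0 = 6 \<langle>u,v\<rangle> vol\<close>, and the one for which the Hodge dual of
  \<open>dt \<and> \<omega> + \<Omega>\<^sub>1\<close> is \<open>\<omega>\<^sup>2/2 - dt \<and> \<Omega>\<^sub>2\<close>. The positions in \<open>frame7\<close> are counted from 0.\<close>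

definition hodge7 :: "nat \<Rightarrow> (real^7) covec \<Rightarrow> (real^7) covec" where
  "hodge7 p \<alpha> vs =
     - (\<Sum>I | I \<subseteq> {..<7} \<and> card I = p.
          shuffle_sign I * \<alpha> (nths frame7 I) * wedge_list (nths coframe7 (- I)) vs)"

section \<open>\<open>G\<^sub>2\<close>-structures\<close>

text \<open>A linear isomorphism from \<open>\<real>\<^sup>7\<close> to the tangent space identifying \<open>\<phi>\<^sub>0\<close> with \<open>\<phi>\<close>.
  Its existence forces \<open>\<phi>\<close> to be multilinear and alternating on the tangent space.\<close>

definition adapted_frame ::
  "('a::real_normed_vector \<Rightarrow> 'a) \<Rightarrow> 'a dform \<Rightarrow> 'a \<Rightarrow> (real^7 \<Rightarrow> 'a) \<Rightarrow> bool" where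
  "adapted_frame r \<phi> x F \<longleftrightarrow> linear F \<and> bij_betw F UNIV (tangent r x) \<and>
     (\<forall>us. length us = 3 \<longrightarrow> \<phi> x (map F us) = phi0 us)"

definition G2_structure ::
  "'a set \<Rightarrow> 'a set \<Rightarrow> ('a \<Rightarrow> 'a) \<Rightarrow> ('a::euclidean_space) dform \<Rightarrow> bool" where
  "G2_structure S U r \<phi> \<longleftrightarrow> smooth_form 3 U r \<phi> \<and> (\<forall>x\<in>S. \<exists>F. adapted_frame r \<phi> x F)"

text \<open>The metric and orientation induced by \<open>\<phi>\<close> are those for which an adapted frame is an oriented
  isometry, so \<open>*\<^sub>\<phi>\<phi>\<close> is \<open>*\<phi>\<^sub>0\<close> transported along it. The choice of the frame is
  immaterial since the stabiliser \<open>G\<^sub>2\<close> of \<open>\<phi>\<^sub>0\<close> lies in \<open>SO(7)\<close>.\<close>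

definition star_phi :: "('a::real_normed_vector \<Rightarrow> 'a) \<Rightarrow> 'a dform \<Rightarrow> 'a dform" where
  "star_phi r \<phi> x vs =
     (let F = (SOME F. adapted_frame r \<phi> x F) in hodge7 3 phi0 (map (inv F) vs))"

definition coclosed ::
  "'a set \<Rightarrow> ('a \<Rightarrow> 'a) \<Rightarrow> ('a::euclidean_space) dform \<Rightarrow> bool" where
  "coclosed S r \<phi> \<longleftrightarrow> closed_form 4 S r (star_phi r \<phi>)"

section \<open>Quaternions and the cohomogeneity one manifold\<close>

text \<open>Real part and imaginary part; \<open>su(2)\<close> is the space of imaginary quaternions.\<close>

type_synonym quat = "real \<times> (real^3)"

definition qone :: quat where
  "qone = (1, 0)"

definition qmult :: "quat \<Rightarrow> quat \<Rightarrow> quat" (infixl "\<odot>" 70) where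
  "x \<odot> y = (fst x * fst y - snd x \<bullet> snd y,
             fst x *\<^sub>R snd y + fst y *\<^sub>R snd x + cross3 (snd x) (snd y))"

definition qcnj :: "quat \<Rightarrow> quat" where
  "qcnj x = (fst x, - snd x)"

definition M_man :: "(quat \<times> quat) set" where
  "M_man = {(p, q). norm q = 1}"

definition M_nbhd :: "(quat \<times> quat) set" where
  "M_nbhd = {(p, q). q \<noteq> 0}"

definition M_retr :: "quat \<times> quat \<Rightarrow> quat \<times> quat" where
  "M_retr = (\<lambda>(p, q). (p, sgn q))"

definition SU2sq :: "(quat \<times> quat) set" where
  "SU2sq = {(a1, a2). norm a1 = 1 \<and> norm a2 = 1}"

definition act :: "quat \<times> quat \<Rightarrow> quat \<times> quat \<Rightarrow> quat \<times> quat" where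
  "act = (\<lambda>(a1, a2) (p, q). (a1 \<odot> p, a1 \<odot> q \<odot> qcnj a2))"

definition gam :: "real \<Rightarrow> quat \<times> quat" where
  "gam t = (t *\<^sub>R qone, qone)"

definition invariant_form :: "nat \<Rightarrow> (quat \<times> quat) dform \<Rightarrow> bool" where
  "invariant_form k \<alpha> \<longleftrightarrow> (\<forall>a\<in>SU2sq. \<forall>x\<in>M_man. \<forall>vs. length vs = k \<longrightarrow> set vs \<subseteq> tangent M_retr x \<longrightarrow>
     pullback (act a) \<alpha> x vs = \<alpha> x vs)"

definition invariant_coclosed_G2 :: "(quat \<times> quat) dform \<Rightarrow> bool" where
  "invariant_coclosed_G2 \<phi> \<longleftrightarrow>
     G2_structure M_man M_nbhd M_retr \<phi> \<and> invariant_form 3 \<phi> \<and> coclosed M_man M_retr \<phi>"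

section \<open>The principal part \<open>(0,\<infinity>) \<times> G\<close>\<close>

type_synonym prin = "real \<times> quat \<times> quat"

definition N_man :: "prin set" where
  "N_man = {(t, g). t > 0 \<and> g \<in> SU2sq}"

definition N_retr :: "prin \<Rightarrow> prin" where
  "N_retr = (\<lambda>(t, g1, g2). (t, sgn g1, sgn g2))"

definition orbit_map :: "prin \<Rightarrow> quat \<times> quat" where
  "orbit_map = (\<lambda>(t, g). act g (gam t))"

definition levi_civita :: "3 \<Rightarrow> 3 \<Rightarrow> 3 \<Rightarrow> real" where
  "levi_civita i j k = cross3 (axis i 1) (axis j 1) $ k"

definition su2_basis :: "(3 \<Rightarrow> quat) \<Rightarrow> bool" where
  "su2_basis T \<longleftrightarrow> inj T \<and> independent (range T) \<and> span (range T) = {x. fst x = 0} \<and>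
     (\<forall>i j. T i \<odot> T j - T j \<odot> T i = (\<Sum>k\<in>UNIV. (2 * levi_civita i j k) *\<^sub>R T k))"

definition T_plus :: "(3 \<Rightarrow> quat) \<Rightarrow> 3 \<Rightarrow> quat \<times> quat" where
  "T_plus T i = (T i, T i)"

definition T_minus :: "(3 \<Rightarrow> quat) \<Rightarrow> 3 \<Rightarrow> quat \<times> quat" where
  "T_minus T i = (T i, - T i)"

text \<open>\<open>eta_plus\<close>, \<open>eta_minus\<close>: left-translate the \<open>G\<close>-component of a tangent vector at \<open>(t, g)\<close> to the
  identity, using that the inverse of a unit quaternion is its conjugate, and take its coordinate
  in the basis \<open>{T\<^sub>i\<^sup>+, T\<^sub>i\<^sup>-}\<close>.\<close>

definition T_pm :: "(3 \<Rightarrow> quat) \<Rightarrow> (quat \<times> quat) set" where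
  "T_pm T = range (T_plus T) \<union> range (T_minus T)"

definition left_trans :: "prin \<Rightarrow> prin \<Rightarrow> quat \<times> quat" where
  "left_trans = (\<lambda>(t, g1, g2) (s, v1, v2). (qcnj g1 \<odot> v1, qcnj g2 \<odot> v2))"

definition eta_plus :: "(3 \<Rightarrow> quat) \<Rightarrow> 3 \<Rightarrow> prin dform" where
  "eta_plus T i x = oneform (\<lambda>v. representation (T_pm T) (left_trans x v) (T_plus T i))"

definition eta_minus :: "(3 \<Rightarrow> quat) \<Rightarrow> 3 \<Rightarrow> prin dform" where
  "eta_minus T i x = oneform (\<lambda>v. representation (T_pm T) (left_trans x v) (T_minus T i))"

definition dt :: "prin covec" where
  "dt = oneform fst"

context
  fixes T :: "3 \<Rightarrow> quat" and A B :: "3 \<Rightarrow> real \<Rightarrow> real"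
begin

definition omega :: "prin dform" where
  "omega x vs = 4 * (\<Sum>i\<in>UNIV. A i (fst x) * B i (fst x) *
     wedge_list [eta_minus T i x, eta_plus T i x] vs)"

definition Omega1 :: "prin dform" where
  "Omega1 x vs =
     8 * B 1 (fst x) * B 2 (fst x) * B 3 (fst x) *
       wedge_list [eta_minus T 1 x, eta_minus T 2 x, eta_minus T 3 x] vs
     - 4 * (\<Sum>i\<in>UNIV. \<Sum>j\<in>UNIV. \<Sum>k\<in>UNIV.
         levi_civita i j k * A i (fst x) * A j (fst x) * B k (fst x) *
         wedge_list [eta_plus T i x, eta_plus T j x, eta_minus T k x] vs)"

definition Omega2 :: "prin dform" where
  "Omega2 x vs =
     - 8 * A 1 (fst x) * A 2 (fst x) * A 3 (fst x) *
       wedge_list [eta_plus T 1 x, eta_plus T 2 x, eta_plus T 3 x] vs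
     + 4 * (\<Sum>i\<in>UNIV. \<Sum>j\<in>UNIV. \<Sum>k\<in>UNIV.
         levi_civita i j k * B i (fst x) * B j (fst x) * A k (fst x) *
         wedge_list [eta_minus T i x, eta_minus T j x, eta_plus T k x] vs)"

definition phi_AB :: "prin dform" where
  "phi_AB x vs = wedge 1 dt (omega x) vs + Omega1 x vs"

definition star_phi_AB :: "prin dform" where
  "star_phi_AB x vs = 1 / 2 * wedge 2 (omega x) (omega x) vs - wedge 1 dt (Omega2 x) vs"

definition restricts_to :: "(quat \<times> quat) dform \<Rightarrow> bool" where
  "restricts_to \<phi> \<longleftrightarrow> (\<forall>x\<in>N_man. \<forall>vs. length vs = 3 \<longrightarrow> set vs \<subseteq> tangent N_retr x \<longrightarrow>
     pullback orbit_map \<phi> x vs = phi_AB x vs)"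

end

definition half_flat_type :: "(3 \<Rightarrow> quat) \<Rightarrow> (quat \<times> quat) dform \<Rightarrow> bool" where
  "half_flat_type T \<phi> \<longleftrightarrow>
     (\<exists>A B. (\<forall>i. \<forall>t>0. A i t \<noteq> 0 \<and> B i t \<noteq> 0) \<and> restricts_to T A B \<phi>)"

section \<open>The family\<close>

text \<open>Functions on \<open>[0,\<infinity>)\<close> are total functions of which only the values on \<open>[0,\<infinity>)\<close> matter.
  Continuity of the odd extension at 0 includes \<open>f 0 = 0\<close>.\<close>

definition odd_ext :: "(real \<Rightarrow> real) \<Rightarrow> real \<Rightarrow> real" where
  "odd_ext f t = (if t \<ge> 0 then f t else - f (- t))"

definition smooth_odd :: "(real \<Rightarrow> real) \<Rightarrow> bool" where
  "smooth_odd f \<longleftrightarrow> smooth_on (odd_ext f) UNIV"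

definition family_params :: "(3 \<Rightarrow> real \<Rightarrow> real) \<Rightarrow> real \<Rightarrow> bool" where
  "family_params A b0 \<longleftrightarrow> b0 \<noteq> 0 \<and>
     (\<forall>i. smooth_odd (A i) \<and> (\<forall>t>0. A i t > 0) \<and>
          (\<lambda>t. A i t - t / 2) \<in> O[at_right 0](\<lambda>t. t ^ 3))"

definition family_solution ::
  "(3 \<Rightarrow> quat) \<Rightarrow> (3 \<Rightarrow> real \<Rightarrow> real) \<Rightarrow> real \<Rightarrow> (3 \<Rightarrow> real \<Rightarrow> real) \<Rightarrow> bool" where
  "family_solution T A b0 B \<longleftrightarrow>
     (\<forall>i. continuous_on {0..} (B i) \<and> (\<forall>t>0. B i differentiable at t) \<and> B i 0 = b0) \<and>
     closed_form 4 N_man N_retr (star_phi_AB T A B)"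

end

theory Submission
  imports Defs
begin

text \<open>Write \<open>A\<^sub>i = t a\<^sub>i / 2\<close>. Closedness of \<open>*\<phi>\<^bsub>A,B\<^esub>\<close> is a first-order system for the products \<open>B\<^sub>i B\<^sub>j\<close>, and it is linear
  in \<open>g\<^sub>k = a\<^sub>i a\<^sub>j B\<^sub>i B\<^sub>j\<close> (\<open>i, j, k\<close> distinct), with a regular singular point at \<open>t = 0\<close>. Its indicial
  eigenvalues there are \<open>0\<close> (on the diagonal) and \<open>-6\<close>, so every initial value \<open>(b\<^sub>0\<^sup>2, b\<^sub>0\<^sup>2, b\<^sub>0\<^sup>2)\<close> has exactly one
  solution that stays bounded at \<open>0\<close>; it is even, smooth and positive, and determines the \<open>B\<^sub>k\<close> up to the sign fixed by \<open>b\<^sub>0\<close>.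
  The equations also force the \<open>t\<^sup>2\<close> coefficients of the \<open>B\<^sub>k\<close> to coincide, which is what allows \<open>\<phi>\<close> and \<open>*\<phi>\<close> to be
  written with smooth coefficients in terms of polynomial invariant forms across the singular orbit.

  Conversely, the components of an invariant \<open>\<phi>\<close> along the normal geodesic are smooth and even, and the six nonzero ones
  with two arguments tangent to \<open>\<real>\<^sup>4\<close> and one tangent to \<open>S\<^sup>3\<close> agree up to sign at \<open>t = 0\<close> by invariance under the diagonal
  isotropy group; the common value is nonzero because \<open>\<phi>\<close> is nondegenerate. The \<open>a\<^sub>i\<close> and \<open>B\<^sub>i\<close> are smooth functions of
  these components, after changing signs in pairs.\<close>

section \<open>Smooth maps\<close>

text \<open>On the singular orbit the isotropy group permutes the three axes up to rotation, so only
  sums over all axes extend there by themselves. A form that singles out one axis has to be built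
  with factors \<open>p \<odot> T i\<close>, and each factor \<open>p\<close> costs a power of
  \<open>t\<close>. As a consequence the half-sums of the paired coefficients
  \<open>a\<^sub>k B\<^sub>k\<close> and \<open>a\<^sub>i a\<^sub>j B\<^sub>k\<close> must agree for
  all \<open>k\<close> up to order \<open>t ^ 4\<close>, while their half-differences may be of
  order \<open>t\<^sup>2\<close>. For the half-sums this is a genuine condition on the
  \<open>B\<^sub>k\<close>, and it is read off from the differential equation at
  \<open>t = 0\<close>.

  Two features of the setting shape the rest. The dual form \<open>star_phi\<close> is transported
  along an arbitrarily chosen frame, so every linear bijection preserving \<open>phi0\<close> must
  be shown to be an isometry. And forms are differentiated through retractions, so closedness passes
  between the principal part and \<open>M\<close> by naturality of the exterior derivative under the
  orbit map; it reaches the singular orbit by continuity.\<close>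

lemma Ck_on_cong:
  assumes "open U" "\<And>x. x \<in> U \<Longrightarrow> f x = g x" "Ck_on k f U"
  shows "Ck_on k g U"
  using assms(2,3)
proof (induction k arbitrary: f g)
  case 0
  then show ?case using continuous_on_cong by force
next
  case (Suc k)
  have D: "(g has_derivative frechet_derivative f (at x)) (at x)" if "x \<in> U" for x
  proof -
    have "(f has_derivative frechet_derivative f (at x)) (at x)"
      using Suc.prems(2) that by (simp add: frechet_derivative_works[symmetric])
    then show ?thesis
      by (rule has_derivative_transform_within_open[OF _ assms(1) that Suc.prems(1)])
  qed
  then have eq: "frechet_derivative g (at x) = frechet_derivative f (at x)" if "x \<in> U" for x
    using frechet_derivative_at[OF D[OF that]] by simp
  have "Ck_on k (\<lambda>x. frechet_derivative g (at x) v) U" for v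
    by (rule Suc.IH[of "\<lambda>x. frechet_derivative f (at x) v"]) (use Suc.prems(2) in \<open>simp_all add: eq\<close>)
  then show ?case using D by (auto simp: differentiable_def)
qed

lemma Ck_on_SucI:
  assumes "open U" "\<And>x. x \<in> U \<Longrightarrow> (f has_derivative f' x) (at x)"
    "\<And>v. Ck_on k (\<lambda>x. f' x v) U"
  shows "Ck_on (Suc k) f U"
proof -
  have "f' x = frechet_derivative f (at x)" if "x \<in> U" for x
    using assms(2) frechet_derivative_at that by blast
  then have "Ck_on k (\<lambda>x. frechet_derivative f (at x) v) U" for v
    by (intro Ck_on_cong[OF assms(1) _ assms(3)[of v]]) auto
  then show ?thesis using assms(2) by (auto simp: differentiable_def)
qed

lemma Ck_on_has_derivative:
  assumes "Ck_on (Suc k) f U" "x \<in> U"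
  shows "(f has_derivative frechet_derivative f (at x)) (at x)"
  using assms by (simp add: frechet_derivative_works[symmetric])

lemma Ck_on_frechet: "Ck_on (Suc k) f U \<Longrightarrow> Ck_on k (\<lambda>x. frechet_derivative f (at x) v) U"
  by simp

lemma Ck_on_SucD: "Ck_on (Suc k) f U \<Longrightarrow> Ck_on k f U"
proof (induction k arbitrary: f)
  case 0
  then show ?case
    by (auto intro!: differentiable_imp_continuous_on simp: differentiable_on_def
        differentiable_at_withinI)
next
  case (Suc k)
  then have "\<And>v. Ck_on k (\<lambda>x. frechet_derivative f (at x) v) U"
    using Suc.IH[OF Ck_on_frechet[OF Suc.prems]] by blast
  then show ?case using Suc.prems by simp
qed

lemma Ck_on_imp_continuous_on: "Ck_on k f U \<Longrightarrow> continuous_on U f"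
  by (induction k) (auto intro!: differentiable_imp_continuous_on simp: differentiable_on_def
        differentiable_at_withinI)

lemma Ck_on_const: "Ck_on k (\<lambda>x. c) U"
  by (induction k arbitrary: c) (auto simp: frechet_derivative_const)

lemma Ck_on_bounded_linear:
  assumes "open U" "bounded_linear L"
  shows "Ck_on k L U"
proof (cases k)
  case 0
  then show ?thesis using assms(2) by (simp add: linear_continuous_on)
next
  case (Suc n)
  show ?thesis unfolding Suc
    by (rule Ck_on_SucI[OF assms(1) bounded_linear_imp_has_derivative[OF assms(2)]])
      (rule Ck_on_const)
qed

lemma Ck_on_compose_linear:
  assumes "open U" "bounded_linear L" "Ck_on k f U"
  shows "Ck_on k (\<lambda>x. L (f x)) U"
  using assms(3)
proof (induction k arbitrary: f)
  case 0
  then show ?case using assms(2) by (auto intro: bounded_linear.continuous_on)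
next
  case (Suc k)
  show ?case
    by (rule Ck_on_SucI[OF assms(1) bounded_linear.has_derivative[OF assms(2)
            Ck_on_has_derivative[OF Suc.prems]]])
      (auto intro!: Suc.IH Ck_on_frechet[OF Suc.prems])
qed

lemma Ck_on_add:
  assumes "open U" "Ck_on k f U" "Ck_on k g U"
  shows "Ck_on k (\<lambda>x. f x + g x) U"
  using assms(2,3)
proof (induction k arbitrary: f g)
  case 0
  then show ?case by (auto intro: continuous_on_add)
next
  case (Suc k)
  show ?case
    by (rule Ck_on_SucI[OF assms(1) has_derivative_add[OF Ck_on_has_derivative[OF Suc.prems(1)]
            Ck_on_has_derivative[OF Suc.prems(2)]]])
      (auto intro!: Suc.IH Ck_on_frechet[OF Suc.prems(1)] Ck_on_frechet[OF Suc.prems(2)])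
qed

text \<open>By the product rule the derivative is a sum of two bilinear terms; one factor has lost
  an order and the other is taken one order lower by \<open>Ck_on_SucD\<close>. Hence the induction
  is over all \<open>f\<close> and \<open>g\<close> together.\<close>

lemma Ck_on_bilinear:
  assumes "open U" "bounded_bilinear B" "Ck_on k f U" "Ck_on k g U"
  shows "Ck_on k (\<lambda>x. B (f x) (g x)) U"
  using assms(3,4)
proof (induction k arbitrary: f g)
  case 0
  then show ?case using assms(2) by (auto intro: bounded_bilinear.continuous_on)
next
  case (Suc k)
  show ?case
    by (rule Ck_on_SucI[OF assms(1) bounded_bilinear.FDERIV[OF assms(2)
            Ck_on_has_derivative[OF Suc.prems(1)] Ck_on_has_derivative[OF Suc.prems(2)]]])
      (auto intro!: Ck_on_add[OF assms(1)] Suc.IH Ck_on_frechet[OF Suc.prems(1)]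
        Ck_on_frechet[OF Suc.prems(2)] Suc.prems[THEN Ck_on_SucD])
qed

section \<open>Closure of smooth functions under algebraic operations\<close>

lemma smooth_on_const: "smooth_on (\<lambda>x. c) U"
  by (simp add: smooth_on_def Ck_on_const)

lemma smooth_on_bounded_linear: "open U \<Longrightarrow> bounded_linear L \<Longrightarrow> smooth_on L U"
  by (simp add: smooth_on_def Ck_on_bounded_linear)

lemma smooth_on_compose_linear:
  "open U \<Longrightarrow> bounded_linear L \<Longrightarrow> smooth_on f U \<Longrightarrow> smooth_on (\<lambda>x. L (f x)) U"
  by (simp add: smooth_on_def Ck_on_compose_linear)

lemma smooth_on_add: "open U \<Longrightarrow> smooth_on f U \<Longrightarrow> smooth_on g U \<Longrightarrow> smooth_on (\<lambda>x. f x + g x) U"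
  by (simp add: smooth_on_def Ck_on_add)

lemma smooth_on_uminus: "open U \<Longrightarrow> smooth_on f U \<Longrightarrow> smooth_on (\<lambda>x. - f x) U"
  by (rule smooth_on_compose_linear[OF _ bounded_linear_minus[OF bounded_linear_ident]])

lemma smooth_on_diff: "open U \<Longrightarrow> smooth_on f U \<Longrightarrow> smooth_on g U \<Longrightarrow> smooth_on (\<lambda>x. f x - g x) U"
  using smooth_on_add[OF _ _ smooth_on_uminus, of U f g] by simp

lemma smooth_on_bilinear:
  "open U \<Longrightarrow> bounded_bilinear B \<Longrightarrow> smooth_on f U \<Longrightarrow> smooth_on g U \<Longrightarrow> smooth_on (\<lambda>x. B (f x) (g x)) U"
  by (simp add: smooth_on_def Ck_on_bilinear)

lemmas smooth_on_mult = smooth_on_bilinear[OF _ bounded_bilinear_mult]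
lemmas smooth_on_scaleR = smooth_on_bilinear[OF _ bounded_bilinear_scaleR]
lemmas smooth_on_inner = smooth_on_bilinear[OF _ bounded_bilinear_inner]

lemma smooth_on_power:
  fixes f :: "'a::euclidean_space \<Rightarrow> 'b::real_normed_algebra_1"
  shows "open U \<Longrightarrow> smooth_on f U \<Longrightarrow> smooth_on (\<lambda>x. f x ^ n) U"
  by (induction n) (auto intro!: smooth_on_const smooth_on_mult)

lemma smooth_on_cong:
  "open U \<Longrightarrow> (\<And>x. x \<in> U \<Longrightarrow> f x = g x) \<Longrightarrow> smooth_on f U \<Longrightarrow> smooth_on g U"
  by (meson Ck_on_cong smooth_on_def)

lemma smooth_on_imp_continuous_on: "smooth_on f U \<Longrightarrow> continuous_on U f"
  using Ck_on_imp_continuous_on smooth_on_def by blast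

lemma smooth_on_has_derivative:
  "smooth_on f U \<Longrightarrow> x \<in> U \<Longrightarrow> (f has_derivative frechet_derivative f (at x)) (at x)"
  using Ck_on_has_derivative smooth_on_def by blast

lemma smooth_on_frechet: "smooth_on f U \<Longrightarrow> smooth_on (\<lambda>x. frechet_derivative f (at x) v) U"
  unfolding smooth_on_def using Ck_on_frechet by blast

text \<open>The derivative of \<open>1 / f\<close> is a polynomial in \<open>1 / f\<close> itself
  and a derivative of \<open>f\<close>, so the induction on the order feeds on its own conclusion
  and no higher chain rule is required.\<close>

lemma smooth_on_inverse:
  fixes f :: "'a::euclidean_space \<Rightarrow> real"
  assumes "open U" "smooth_on f U" "\<And>x. x \<in> U \<Longrightarrow> f x \<noteq> 0"
  shows "smooth_on (\<lambda>x. inverse (f x)) U"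
  unfolding smooth_on_def
proof
  fix k
  show "Ck_on k (\<lambda>x. inverse (f x)) U"
  proof (induction k)
    case 0
    then show ?case using assms smooth_on_imp_continuous_on by (auto intro!: continuous_on_inverse)
  next
    case (Suc k)
    have D: "((\<lambda>x. inverse (f x)) has_derivative
        (\<lambda>v. (- 1) * (frechet_derivative f (at x) v * (inverse (f x) * inverse (f x))))) (at x)"
      if "x \<in> U" for x
      using Deriv.has_derivative_inverse[OF assms(3)[OF that] smooth_on_has_derivative[OF assms(2) that]]
      by (simp add: mult.assoc mult.left_commute)
    have "Ck_on k (\<lambda>x. frechet_derivative f (at x) v) U" for v
      using assms(2) smooth_on_frechet smooth_on_def by blast
    then show ?case
      by (intro Ck_on_SucI[OF assms(1) D] Ck_on_bilinear[OF assms(1) bounded_bilinear_mult]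
          Ck_on_const Suc)
  qed
qed

lemma smooth_on_sqrt:
  fixes f :: "'a::euclidean_space \<Rightarrow> real"
  assumes "open U" "smooth_on f U" "\<And>x. x \<in> U \<Longrightarrow> f x > 0"
  shows "smooth_on (\<lambda>x. sqrt (f x)) U"
  unfolding smooth_on_def
proof
  fix k
  show "Ck_on k (\<lambda>x. sqrt (f x)) U"
  proof (induction k)
    case 0
    then show ?case using assms smooth_on_imp_continuous_on by (auto intro!: continuous_on_real_sqrt)
  next
    case (Suc k)
    \<comment> \<open>The factor \<open>1 / sqrt (f x)\<close> is written as
      \<open>sqrt (f x) * inverse (f x)\<close> so that the induction hypothesis for the square root
      applies.\<close>
    have D: "((\<lambda>x. sqrt (f x)) has_derivative
        (\<lambda>v. (1 / 2) * (frechet_derivative f (at x) v * (sqrt (f x) * inverse (f x))))) (at x)"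
      if "x \<in> U" for x
    proof -
      have "sqrt (f x) * inverse (f x) = inverse (sqrt (f x))"
        using assms(3)[OF that] by (simp add: field_simps)
      then show ?thesis
        by (auto intro!: derivative_eq_intros smooth_on_has_derivative[OF assms(2) that] 
           assms(3)[OF that] simp: field_simps)
    qed
    have "Ck_on k (\<lambda>x. frechet_derivative f (at x) v) U" for v
      using assms(2) smooth_on_frechet smooth_on_def by blast
    moreover have "Ck_on k (\<lambda>x. inverse (f x)) U"
      using smooth_on_inverse[OF assms(1,2)] assms(3) unfolding smooth_on_def
      by (metis less_numeral_extra(3))
    ultimately show ?case
      by (intro Ck_on_SucI[OF assms(1) D] Ck_on_bilinear[OF assms(1) bounded_bilinear_mult]
          Ck_on_const Suc)
  qed
qed

lemma smooth_on_compose_affine: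
  assumes "open U" "smooth_on f U" "bounded_linear L" "\<And>x. c + L x \<in> U"
  shows "smooth_on (\<lambda>x. f (c + L x)) UNIV"
  unfolding smooth_on_def
proof
  fix k
  have "Ck_on k f U" using assms(2) by (simp add: smooth_on_def)
  then show "Ck_on k (\<lambda>x. f (c + L x)) UNIV"
  proof (induction k arbitrary: f)
    case 0
    have "continuous_on UNIV (\<lambda>x. c + L x)"
      by (intro continuous_intros linear_continuous_on assms(3))
    then show ?case using 0 assms(4) by (auto intro: continuous_on_compose2)
  next
    case (Suc k)
    have D: "((\<lambda>x. f (c + L x)) has_derivative (\<lambda>v. frechet_derivative f (at (c + L x)) (L v))) (at x)" for x
    proof -
      have "((\<lambda>x. c + L x) has_derivative L) (at x)"
        using bounded_linear_imp_has_derivative[OF assms(3)] by (auto intro!: derivative_eq_intros)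
      from diff_chain_at[OF this Ck_on_has_derivative[OF Suc.prems assms(4)]]
      show ?thesis by (simp add: o_def)
    qed
    show ?case
      by (rule Ck_on_SucI[OF open_UNIV D]) (auto intro!: Suc.IH Ck_on_frechet[OF Suc.prems])
  qed
qed

section \<open>Smooth even functions\<close>

lemma Ck_on_real_SucI:
  fixes f :: "real \<Rightarrow> real"
  assumes "\<And>t. (f has_real_derivative f' t) (at t)" "Ck_on k f' UNIV"
  shows "Ck_on (Suc k) f UNIV"
  by (rule Ck_on_SucI[OF open_UNIV assms(1)[THEN has_field_derivative_imp_has_derivative]])
    (intro Ck_on_bilinear[OF open_UNIV bounded_bilinear_mult] assms(2) Ck_on_const)

lemma Ck_on_real_SucD:
  fixes f :: "real \<Rightarrow> real"
  assumes "Ck_on (Suc k) f UNIV"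
  shows "(f has_real_derivative deriv f t) (at t)" "Ck_on k (deriv f) UNIV"
proof -
  have D: "(f has_real_derivative frechet_derivative f (at t) 1) (at t)" for t
  proof (rule has_derivative_imp_has_field_derivative[OF Ck_on_has_derivative[OF assms UNIV_I]])
    have "linear (frechet_derivative f (at t))"
      by (rule has_derivative_linear[OF Ck_on_has_derivative[OF assms UNIV_I]])
    from linear_scale[OF this, of _ 1]
    show "x * frechet_derivative f (at t) 1 = frechet_derivative f (at t) x" for x
      by (metis mult.right_neutral real_scaleR_def)
  qed
  then have "deriv f = (\<lambda>t. frechet_derivative f (at t) 1)" using DERIV_imp_deriv by blast
  then show "(f has_real_derivative deriv f t) (at t)" "Ck_on k (deriv f) UNIV"
    using D Ck_on_frechet[OF assms, of 1] by auto
qed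

lemma smooth_on_deriv:
  fixes f :: "real \<Rightarrow> real"
  assumes "smooth_on f UNIV"
  shows "(f has_real_derivative deriv f t) (at t)" "smooth_on (deriv f) UNIV"
  using assms Ck_on_real_SucD unfolding smooth_on_def by blast+

text \<open>The substitution \<open>s = t u\<close> turns \<open>t ^ Suc n * scaled_mean n h t\<close> into \<open>\<integral>\<^sub>0\<^sup>t s ^ n * h s ds\<close>, so
  \<open>t * scaled_mean n h t\<close> solves \<open>t y' = - n y + t h\<close>; this form has no singularity at \<open>t = 0\<close>.\<close>

definition scaled_mean :: "nat \<Rightarrow> (real \<Rightarrow> real) \<Rightarrow> real \<Rightarrow> real" where
  "scaled_mean n h t = integral {0..1} (\<lambda>u. u ^ n * h (t * u))"

lemma scaled_mean_integrable:
  fixes h :: "real \<Rightarrow> real"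
  assumes "continuous_on UNIV h"
  shows "(\<lambda>u. u ^ n * h (t * u)) integrable_on {0..1}"
proof (rule integrable_continuous_real)
  show "continuous_on {0..1} (\<lambda>u. u ^ n * h (t * u))"
    by (intro continuous_intros continuous_on_compose2[OF assms]) auto
qed

lemma scaled_mean_continuous:
  assumes "continuous_on UNIV h"
  shows "continuous_on UNIV (scaled_mean n h)"
proof -
  have "continuous_on (UNIV \<times> cbox 0 1) (\<lambda>(t, u). u ^ n * h (t * u))"
    unfolding split_beta by (intro continuous_intros continuous_on_compose2[OF assms]) auto
  from integral_continuous_on_param[OF this] show ?thesis
    by (simp add: scaled_mean_def[abs_def])
qed

text \<open>Differentiation under the integral sign turns the weight \<open>u ^ n\<close> into
  \<open>u ^ Suc n\<close> and \<open>h\<close> into its derivative; for this reason both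
  \<open>n\<close> and \<open>h\<close> vary in the induction.\<close>

lemma Ck_on_scaled_mean:
  "Ck_on k h UNIV \<Longrightarrow> Ck_on k (scaled_mean n h) UNIV"
proof (induction k arbitrary: n h)
  case 0
  then show ?case by (simp add: scaled_mean_continuous)
next
  case (Suc k)
  note h = Ck_on_real_SucD[OF Suc.prems]
  have ch: "continuous_on UNIV h" "continuous_on UNIV (deriv h)"
    using Suc.prems h(2) Ck_on_imp_continuous_on by blast+
  have "((\<lambda>t. integral (cbox 0 1) (\<lambda>u. u ^ n * h (t * u))) has_field_derivative
      integral (cbox 0 1) (\<lambda>u. u ^ Suc n * deriv h (t * u))) (at t within UNIV)" for t
  proof (rule leibniz_rule_field_derivative[of UNIV 0 1 "\<lambda>t u. u ^ n * h (t * u)"])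
    show "((\<lambda>t. u ^ n * h (t * u)) has_real_derivative u ^ Suc n * deriv h (t * u)) (at t within UNIV)" for t u
    proof -
      have "((\<lambda>t. h (t * u)) has_real_derivative deriv h (t * u) * u) (at t)"
        by (rule DERIV_chain2[OF h(1)]) (auto intro!: derivative_eq_intros)
      from DERIV_cmult[OF this, of "u ^ n"] show ?thesis by (simp add: mult_ac)
    qed
    show "(\<lambda>u. u ^ n * h (t * u)) integrable_on cbox 0 1" for t
      using scaled_mean_integrable[OF ch(1)] by simp
    show "continuous_on (UNIV \<times> cbox 0 1) (\<lambda>(t, u). u ^ Suc n * deriv h (t * u))"
      unfolding split_beta by (intro continuous_intros continuous_on_compose2[OF ch(2)]) auto
  qed auto
  then have "(scaled_mean n h has_real_derivative scaled_mean (Suc n) (deriv h) t) (at t)" for t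
    by (simp add: scaled_mean_def[abs_def])
  then show ?case by (rule Ck_on_real_SucI) (rule Suc.IH[OF h(2)])
qed

lemma smooth_on_scaled_mean: "smooth_on h UNIV \<Longrightarrow> smooth_on (scaled_mean n h) UNIV"
  by (simp add: smooth_on_def Ck_on_scaled_mean)

lemma scaled_mean_0: "scaled_mean n h 0 = h 0 / real (Suc n)"
proof -
  have "((\<lambda>u. u ^ n * h 0) has_integral (1 ^ Suc n / real (Suc n) * h 0 - 0 ^ Suc n / real (Suc n) * h 0)) {0..1}"
    by (rule fundamental_theorem_of_calculus)
      (auto intro!: derivative_eq_intros simp: has_real_derivative_iff_has_vector_derivative[symmetric]
         simp del: power_Suc)
  from integral_unique[OF this] show ?thesis unfolding scaled_mean_def by simp
qed

lemma has_derivative_scaled_mean: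
  assumes "continuous_on UNIV h"
  shows "((\<lambda>t. t * scaled_mean n h t) has_real_derivative (h t - n * scaled_mean n h t)) (at t)"
proof (cases "t = 0")
  case True
  \<comment> \<open>At \<open>t = 0\<close> the difference quotient is
    \<open>scaled_mean n h\<close> itself, so continuity suffices; the formula through an
    antiderivative used in the other case divides by \<open>s ^ n\<close>.\<close>
  have "(\<lambda>s. scaled_mean n h s) \<midarrow>0\<rightarrow> scaled_mean n h 0"
    using scaled_mean_continuous[OF assms, of n] by (simp add: continuous_on_eq_continuous_at isCont_def)
  moreover have "h 0 - real n * scaled_mean n h 0 = scaled_mean n h 0"
    by (simp add: scaled_mean_0 field_simps)
  ultimately show ?thesis
    unfolding True has_field_derivative_iff
    by (subst LIM_equal[where g = "scaled_mean n h"]) auto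
next
  case False
  \<comment> \<open>A compact interval with \<open>t\<close> in its interior, on which
    \<open>s ^ n * h s\<close> has an antiderivative \<open>P\<close>.\<close>
  define T where "T = \<bar>t\<bar> + 1"
  have "continuous_on {-T..T} (\<lambda>s. s ^ n * h s)"
    by (intro continuous_intros continuous_on_subset[OF assms]) auto
  then obtain P where P: "\<And>x. x \<in> {-T..T} \<Longrightarrow>
      (P has_vector_derivative (x ^ n * h x)) (at x within {-T..T})"
    using antiderivative_continuous by blast
  have eq: "s * scaled_mean n h s = (P s - P 0) / s ^ n" if s: "\<bar>s\<bar> < T" "s \<noteq> 0" for s
  proof -
    have "((\<lambda>u. s * ((s * u) ^ n * h (s * u))) has_integral (P (s * 1) - P (s * 0))) {0..1}"
    proof (rule fundamental_theorem_of_calculus)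
      fix u :: real assume u: "u \<in> {0..1}"
      have "s * u' \<in> {-T..T}" if "u' \<in> {0..1}" for u'
      proof -
        have "\<bar>s\<bar> * \<bar>u'\<bar> \<le> \<bar>s\<bar> * 1" using that by (intro mult_left_mono) auto
        then show ?thesis using s by (auto simp: abs_mult[symmetric])
      qed
      then have "(\<lambda>u. s * u) ` {0..1} \<subseteq> {-T..T}" "s * u \<in> {-T..T}" using u by auto
      then have "(P has_vector_derivative (s * u) ^ n * h (s * u)) (at (s * u) within (\<lambda>u. s * u) ` {0..1})"
        using P has_vector_derivative_within_subset by blast
      moreover have "((\<lambda>u. s * u) has_vector_derivative s) (at u within {0..1})"
        by (auto simp flip: has_real_derivative_iff_has_vector_derivative intro!: derivative_eq_intros)
      ultimately have "((P \<circ> (\<lambda>u. s * u)) has_vector_derivative s *\<^sub>R ((s * u) ^ n * h (s * u))) (at u within {0..1})"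
        by (intro vector_diff_chain_within)
      then
      show "((\<lambda>u. P (s * u)) has_vector_derivative s * ((s * u) ^ n * h (s * u))) (at u within {0..1})"
        by (simp add: o_def)
    qed simp
    moreover have "((\<lambda>u. s * s ^ n * (u ^ n * h (s * u))) has_integral (s * s ^ n * scaled_mean n h s)) {0..1}"
      unfolding scaled_mean_def
      by (intro has_integral_mult_right integrable_integral scaled_mean_integrable[OF assms])
    ultimately have "P s - P 0 = s * s ^ n * scaled_mean n h s"
      by (intro has_integral_unique[of _ "P s - P 0"]) (auto simp: power_mult_distrib mult_ac)
    then show ?thesis using s by simp
  qed
  have "(P has_real_derivative t ^ n * h t) (at t)"
    using P[of t] at_within_interior[of t "{-T..T}"] 
    by (auto simp: T_def has_real_derivative_iff_has_vector_derivative abs_if split: if_splits)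
  then have "((\<lambda>s. (P s - P 0) / s ^ n) has_real_derivative
      ((t ^ n * h t) * t ^ n - (P t - P 0) * (n * t ^ (n - 1))) / (t ^ n * t ^ n)) (at t)"
    using False by (auto intro!: derivative_eq_intros)
  moreover have "P t - P 0 = t * t ^ n * scaled_mean n h t"
    using eq[of t] False by (simp add: T_def field_simps)
  then have "((t ^ n * h t) * t ^ n - (P t - P 0) * (n * t ^ (n - 1))) / (t ^ n * t ^ n)
      = h t - n * scaled_mean n h t"
    using False by (cases n) (simp_all add: field_simps)
  moreover have "open ({-T<..<T} - {0})" "t \<in> {-T<..<T} - {0}"
    using False by (auto simp: T_def)
  moreover have "(P s - P 0) / s ^ n = s * scaled_mean n h s" if "s \<in> {-T<..<T} - {0}" for s
    using eq[of s] that by auto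
  ultimately show ?thesis
    by (metis (no_types, lifting) has_field_derivative_transform_within_open)
qed

text \<open>Hadamard's lemma: the mean of \<open>deriv f (t * u)\<close> over \<open>u\<close> in
  [0, 1] is a smooth replacement for \<open>f t / t\<close>. Both sides have the same derivative and
  vanish at 0.\<close>

lemma divide_by_id_smooth:
  assumes "smooth_on f UNIV" "f 0 = 0"
  shows "f t = t * scaled_mean 0 (deriv f) t"
proof -
  let ?g = "\<lambda>t. f t - t * scaled_mean 0 (deriv f) t"
  have "continuous_on UNIV (deriv f)"
    using smooth_on_deriv(2)[OF assms(1)] smooth_on_imp_continuous_on by blast
  from DERIV_diff[OF smooth_on_deriv(1)[OF assms(1)] has_derivative_scaled_mean[OF this, of 0]]
  have "(?g has_real_derivative 0) (at t)" for t by simp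
  then have "?g t = ?g 0" by (rule DERIV_isconst_all[of ?g, rule_format]) 
  then show ?thesis using assms(2) by simp
qed

definition smooth_even :: "(real \<Rightarrow> real) \<Rightarrow> bool" where
  "smooth_even f \<longleftrightarrow> smooth_on f UNIV \<and> (\<forall>t. f (- t) = f t)"

lemma deriv_parity:
  fixes f :: "real \<Rightarrow> real"
  assumes "smooth_on f UNIV" "\<And>t. f (- t) = c * f t"
  shows "deriv f (- t) = - c * deriv f t"
proof -
  have "((\<lambda>t. f (- t)) has_real_derivative deriv f (- t) * (- 1)) (at t)"
    by (rule DERIV_chain2[OF smooth_on_deriv(1)[OF assms(1)]]) (auto intro!: derivative_eq_intros)
  moreover have "((\<lambda>t. f (- t)) has_real_derivative c * deriv f t) (at t)"
    unfolding assms(2) by (intro DERIV_cmult smooth_on_deriv(1)[OF assms(1)])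
  ultimately show ?thesis using DERIV_unique by force
qed

lemma scaled_mean_parity:
  assumes "\<And>t. h (- t) = c * h t"
  shows "scaled_mean n h (- t) = c * scaled_mean n h t"
  by (simp add: scaled_mean_def assms mult.left_commute[of _ c])

lemma smooth_odd_divide:
  assumes "smooth_on f UNIV" "\<And>t. f (- t) = - f t"
  shows "\<exists>g. smooth_even g \<and> (\<forall>t. f t = t * g t)"
proof (intro exI conjI allI)
  have "f 0 = 0" using assms(2)[of 0] by simp
  then show "f t = t * scaled_mean 0 (deriv f) t" for t by (rule divide_by_id_smooth[OF assms(1)])
  have "deriv f (- t) = 1 * deriv f t" for t
    using deriv_parity[OF assms(1), of "-1"] assms(2) by simp
  from scaled_mean_parity[of "deriv f", OF this]
  show "smooth_even (scaled_mean 0 (deriv f))"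
    using smooth_on_scaled_mean[OF smooth_on_deriv(2)[OF assms(1)]] by (simp add: smooth_even_def)
qed

text \<open>Two divisions by \<open>t\<close>: the first quotient is odd, hence divisible once more,
  and the second is even.\<close>

lemma smooth_even_divide:
  assumes "smooth_even f" "f 0 = 0"
  shows "\<exists>g. smooth_even g \<and> (\<forall>t. f t = t\<^sup>2 * g t)"
proof -
  have f: "smooth_on f UNIV" "\<And>t. f (- t) = 1 * f t" using assms(1) by (auto simp: smooth_even_def)
  have "smooth_on (scaled_mean 0 (deriv f)) UNIV"
    by (rule smooth_on_scaled_mean[OF smooth_on_deriv(2)[OF f(1)]])
  moreover have "scaled_mean 0 (deriv f) (- t) = - scaled_mean 0 (deriv f) t" for t
    using scaled_mean_parity[of "deriv f" "-1"] deriv_parity[OF f] by simp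
  ultimately have "\<exists>g. smooth_even g \<and> (\<forall>t. scaled_mean 0 (deriv f) t = t * g t)"
    by (rule smooth_odd_divide)
  then obtain g where "smooth_even g" "\<And>t. scaled_mean 0 (deriv f) t = t * g t"
    by blast
  then show ?thesis using divide_by_id_smooth[OF f(1) assms(2)]
    by (intro exI[of _ g]) (simp add: power2_eq_square)
qed

lemma smooth_even_const: "smooth_even (\<lambda>t. c)"
  by (simp add: smooth_even_def smooth_on_const)

lemma smooth_even_add: "smooth_even f \<Longrightarrow> smooth_even g \<Longrightarrow> smooth_even (\<lambda>t. f t + g t)"
  by (simp add: smooth_even_def smooth_on_add)

lemma smooth_even_diff: "smooth_even f \<Longrightarrow> smooth_even g \<Longrightarrow> smooth_even (\<lambda>t. f t - g t)"
  by (simp add: smooth_even_def smooth_on_diff)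

lemma smooth_even_uminus: "smooth_even f \<Longrightarrow> smooth_even (\<lambda>t. - f t)"
  by (simp add: smooth_even_def smooth_on_uminus)

lemma smooth_even_mult: "smooth_even f \<Longrightarrow> smooth_even g \<Longrightarrow> smooth_even (\<lambda>t. f t * g t)"
  by (simp add: smooth_even_def smooth_on_mult)

lemma smooth_even_divide': 
  "smooth_even f \<Longrightarrow> smooth_even g \<Longrightarrow> (\<And>t. g t \<noteq> 0) \<Longrightarrow> smooth_even (\<lambda>t. f t / g t)"
  by (simp add: smooth_even_def smooth_on_mult smooth_on_inverse divide_inverse)

lemma smooth_even_sqrt: "smooth_even f \<Longrightarrow> (\<And>t. f t > 0) \<Longrightarrow> smooth_even (\<lambda>t. sqrt (f t))"
  by (simp add: smooth_even_def smooth_on_sqrt)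

lemma smooth_even_square: "smooth_even (\<lambda>t. t\<^sup>2)"
  by (simp add: smooth_even_def smooth_on_power smooth_on_bounded_linear)

lemma smooth_even_power: "smooth_even f \<Longrightarrow> smooth_even (\<lambda>t. f t ^ n)"
  by (simp add: smooth_even_def smooth_on_power)

lemmas smooth_even_intros = smooth_even_const smooth_even_add smooth_even_diff smooth_even_uminus
  smooth_even_mult smooth_even_divide' smooth_even_square smooth_even_power

text \<open>The norm is not differentiable at 0, but the gradient of \<open>f (norm x)\<close> is
  \<open>g (norm x)\<close> times \<open>x\<close>, where \<open>g t = deriv f t / t\<close> extends
  to a smooth even function. The induction passes from \<open>f\<close> to \<open>g\<close>; at the
  origin the derivative is 0 because \<open>deriv f 0 = 0\<close>.\<close>

lemma smooth_even_radial:
  assumes "smooth_even f"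
  shows "smooth_on (\<lambda>x::'a::euclidean_space. f (norm x)) UNIV"
  unfolding smooth_on_def
proof
  fix k
  show "Ck_on k (\<lambda>x::'a. f (norm x)) UNIV"
    using assms
  proof (induction k arbitrary: f)
    case 0
    then have "continuous_on UNIV f" using smooth_on_imp_continuous_on smooth_even_def by blast
    then show ?case by (auto intro!: continuous_on_compose2[of UNIV f] continuous_intros)
  next
    case (Suc k)
    then have f: "smooth_on f UNIV" "\<And>t. f (- t) = 1 * f t" by (auto simp: smooth_even_def)
    have "deriv f (- t) = - deriv f t" for t using deriv_parity[OF f] by simp
    with smooth_on_deriv(2)[OF f(1)] have "\<exists>g. smooth_even g \<and> (\<forall>t. deriv f t = t * g t)"
      by (rule smooth_odd_divide)
    then obtain g where g: "smooth_even g" "\<And>t. deriv f t = t * g t"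
      by blast
    have D: "((\<lambda>x. f (norm x)) has_derivative (\<lambda>v. g (norm x) * (x \<bullet> v))) (at x)" for x :: 'a
    proof (cases "x = 0")
      case False
      have "((\<lambda>x. f (norm x)) has_derivative (\<lambda>v. deriv f (norm x) * (v \<bullet> sgn x))) (at x)"
        using has_derivative_compose[OF has_derivative_norm[OF False]
          smooth_on_deriv(1)[OF f(1), THEN has_field_derivative_imp_has_derivative]]
        by (simp add: inner_commute)
      moreover have "deriv f (norm x) * (v \<bullet> sgn x) = g (norm x) * (x \<bullet> v)" for v
        using False by (simp add: g(2) sgn_div_norm inner_commute)
      ultimately show ?thesis by simp
    next
      case True
      have "(f has_derivative (\<lambda>v. 0)) (at 0)"
        using smooth_on_deriv(1)[OF f(1), of 0] g(2)[of 0]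
        by (auto simp: has_field_derivative_def mult_zero_left[abs_def])
      then have *: "\<forall>e>0. \<exists>d>0. \<forall>y. norm (y - 0) < d \<longrightarrow> norm (f y - f 0 - 0) \<le> e * norm (y - 0)"
        unfolding has_derivative_at_alt by blast
      have "((\<lambda>x::'a. f (norm x)) has_derivative (\<lambda>v. 0)) (at 0)"
        unfolding has_derivative_at_alt
      proof (intro conjI allI impI bounded_linear_zero)
        fix e :: real assume "e > 0"
        then obtain d where "d > 0" "\<And>y. \<bar>y\<bar> < d \<Longrightarrow> \<bar>f y - f 0\<bar> \<le> e * \<bar>y\<bar>"
          using * by auto
        then show "\<exists>d>0. \<forall>y. norm (y - 0) < d \<longrightarrow>
            norm (f (norm y) - f (norm (0::'a)) - 0) \<le> e * norm (y - 0 :: 'a)"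
          by (metis abs_norm_cancel diff_zero norm_zero real_norm_def)
      qed
      then show ?thesis by (simp add: True)
    qed
    show ?case
      by (rule Ck_on_SucI[OF open_UNIV D])
        (intro Ck_on_bilinear[OF open_UNIV bounded_bilinear_mult] Suc.IH g(1)
          Ck_on_bounded_linear open_UNIV bounded_linear_inner_left)
  qed
qed

section \<open>A singular linear system\<close>

text \<open>Each application gains a factor |t| / (n + 1), uniformly in the weight \<open>m\<close>.
  Iteration produces the factorials that make the series in \<open>volterra_fixed_point\<close>
  converge.\<close>

lemma scaled_mean_bound:
  assumes h: "continuous_on UNIV h" "\<And>s. \<bar>s\<bar> \<le> T \<Longrightarrow> \<bar>h s\<bar> \<le> K * \<bar>s\<bar> ^ n" and t: "\<bar>t\<bar> \<le> T"
  shows "\<bar>t * scaled_mean m h t\<bar> \<le> K * \<bar>t\<bar> ^ Suc n / real (Suc n)"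
proof -
  have "((\<lambda>u. u ^ n) has_integral (1 ^ Suc n / real (Suc n) - 0 ^ Suc n / real (Suc n))) {0..1::real}"
    by (rule fundamental_theorem_of_calculus)
      (auto intro!: derivative_eq_intros simp: has_real_derivative_iff_has_vector_derivative[symmetric]
         simp del: power_Suc)
  from has_integral_mult_right[OF this, of "K * \<bar>t\<bar> ^ n"]
  have I: "((\<lambda>u. K * \<bar>t\<bar> ^ n * u ^ n) has_integral K * \<bar>t\<bar> ^ n / real (Suc n)) {0..1::real}" by simp
  have "norm (scaled_mean m h t) \<le> integral {0..1} (\<lambda>u. K * \<bar>t\<bar> ^ n * u ^ n)"
    unfolding scaled_mean_def
  proof (rule integral_norm_bound_integral)
    show "norm (u ^ m * h (t * u)) \<le> K * \<bar>t\<bar> ^ n * u ^ n" if u: "u \<in> {0..1}" for u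
    proof -
      have "\<bar>t * u\<bar> \<le> T" using u t mult_left_mono[of u 1 "\<bar>t\<bar>"] by (simp add: abs_mult)
      have "u ^ m * \<bar>h (t * u)\<bar> \<le> 1 * \<bar>h (t * u)\<bar>"
        using u by (intro mult_right_mono power_le_one) auto
      also have "\<dots> \<le> K * \<bar>t * u\<bar> ^ n" using h(2)[OF \<open>\<bar>t * u\<bar> \<le> T\<close>] by simp
      finally show ?thesis using u by (simp add: abs_mult power_mult_distrib)
    qed
  qed (use scaled_mean_integrable[OF h(1)] I in \<open>auto simp: integrable_on_def\<close>)
  also have "\<dots> = K * \<bar>t\<bar> ^ n / real (Suc n)" using I by (rule integral_unique)
  finally have "\<bar>t\<bar> * \<bar>scaled_mean m h t\<bar> \<le> \<bar>t\<bar> * (K * \<bar>t\<bar> ^ n / real (Suc n))"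
    by (intro mult_left_mono) auto
  then show ?thesis by (simp add: abs_mult mult_ac)
qed

lemma scaled_mean_add:
  assumes "continuous_on UNIV h" "continuous_on UNIV h'"
  shows "scaled_mean n (\<lambda>s. h s + h' s) t = scaled_mean n h t + scaled_mean n h' t"
  using Henstock_Kurzweil_Integration.integral_add[OF scaled_mean_integrable[OF assms(1)] scaled_mean_integrable[OF assms(2)], of n t n t]
  by (simp add: scaled_mean_def distrib_left)

lemma scaled_mean_cmult: "scaled_mean n (\<lambda>s. c * h s) t = c * scaled_mean n h t"
  by (simp add: scaled_mean_def mult.left_commute[of _ c])

text \<open>The factor \<open>t\<close> buys one derivative; this drives the regularity bootstrap
  for the Fuchsian system.\<close>

lemma Ck_on_mult_scaled_mean:
  assumes "Ck_on k h UNIV"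
  shows "Ck_on (Suc k) (\<lambda>t. t * scaled_mean n h t) UNIV"
proof (rule Ck_on_real_SucI[OF has_derivative_scaled_mean])
  show "continuous_on UNIV h" using assms by (rule Ck_on_imp_continuous_on)
  have "Ck_on k (\<lambda>t. h t + (- real n) * scaled_mean n h t) UNIV"
    by (intro Ck_on_add Ck_on_bilinear[OF open_UNIV bounded_bilinear_mult] Ck_on_const
        Ck_on_scaled_mean assms open_UNIV)
  then show "Ck_on k (\<lambda>t. h t - real n * scaled_mean n h t) UNIV" by simp
qed

text \<open>The solution is the Neumann series, the sum of the iterates of \<open>V\<close> on
  \<open>g0\<close>. The estimate bounds the n-th iterate on [-T, T] by a constant times
  \<open>(C * T) ^ n / fact n\<close>. Additivity supplies \<open>V 0 = 0\<close> and the action of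
  \<open>V\<close> on partial sums and differences.\<close>

lemma volterra_fixed_point:
  fixes V :: "('i::finite \<Rightarrow> real \<Rightarrow> real) \<Rightarrow> 'i \<Rightarrow> real \<Rightarrow> real"
  assumes cont: "\<And>g. (\<And>i. continuous_on UNIV (g i)) \<Longrightarrow> (\<And>i. continuous_on UNIV (V g i))"
    and add: "\<And>g h. (\<And>i. continuous_on UNIV (g i)) \<Longrightarrow> (\<And>i. continuous_on UNIV (h i)) \<Longrightarrow>
      (\<And>i t. V (\<lambda>i t. g i t + h i t) i t = V g i t + V h i t)"
    and est: "\<And>T. T > 0 \<Longrightarrow> \<exists>C\<ge>0. \<forall>g M n. (\<forall>i. continuous_on UNIV (g i)) \<longrightarrow> 0 \<le> M \<longrightarrow>
      (\<forall>i s. \<bar>s\<bar> \<le> T \<longrightarrow> \<bar>g i s\<bar> \<le> M * \<bar>s\<bar> ^ n) \<longrightarrow>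
      (\<forall>i t. \<bar>t\<bar> \<le> T \<longrightarrow> \<bar>V g i t\<bar> \<le> C * M * \<bar>t\<bar> ^ Suc n / real (Suc n))"
    and g0: "\<And>i. continuous_on UNIV (g0 i)"
  shows "\<exists>g. (\<forall>i. continuous_on UNIV (g i)) \<and> (\<forall>i t. g i t = g0 i t + V g i t)"
proof -
  define G where "G n = (V ^^ n) g0" for n
  define S where "S N = (\<lambda>i t. \<Sum>n<N. G n i t)" for N :: nat
  define g where "g = (\<lambda>i t. \<Sum>n. G n i t)"
  have G: "continuous_on UNIV (G n i)" for n i
    unfolding G_def using g0 by (induction n arbitrary: i) (auto intro: cont)
  have contS: "continuous_on UNIV (S N i)" for N i
    unfolding S_def by (intro continuous_on_sum G)
  have ul: "uniform_limit {-T..T} (\<lambda>N. S N i) (g i) sequentially" if T: "T > 0" for T i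
  proof -
    obtain C where C0: "C \<ge> 0" and C': "\<forall>g M n. (\<forall>i. continuous_on UNIV (g i)) \<longrightarrow> 0 \<le> M \<longrightarrow>
      (\<forall>i s. \<bar>s\<bar> \<le> T \<longrightarrow> \<bar>g i s\<bar> \<le> M * \<bar>s\<bar> ^ n) \<longrightarrow>
      (\<forall>i t. \<bar>t\<bar> \<le> T \<longrightarrow> \<bar>V g i t\<bar> \<le> C * M * \<bar>t\<bar> ^ Suc n / real (Suc n))"
      using est[OF T] by blast
    have C2: "\<bar>V g i t\<bar> \<le> C * M * \<bar>t\<bar> ^ Suc n / real (Suc n)"
      if "\<And>i. continuous_on UNIV (g i)" "0 \<le> M" "\<And>i s. \<bar>s\<bar> \<le> T \<Longrightarrow> \<bar>g i s\<bar> \<le> M * \<bar>s\<bar> ^ n"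
        "\<bar>t\<bar> \<le> T" for g M n i t
      using C' that by blast
    have "\<exists>M. \<forall>t\<in>{-T..T}. \<bar>g0 i t\<bar> \<le> M" for i
      using compact_imp_bounded[OF compact_continuous_image[OF continuous_on_subset[OF g0] compact_Icc], of "-T" T i]
      by (force simp: bounded_iff)
    then obtain M where M: "\<And>i t. t \<in> {-T..T} \<Longrightarrow> \<bar>g0 i t\<bar> \<le> M i" by metis
    define M' where "M' = (\<Sum>i\<in>UNIV. \<bar>M i\<bar>)"
    have M': "M' \<ge> 0" "\<bar>M i\<bar> \<le> M'" for i
      unfolding M'_def by (auto intro: sum_nonneg member_le_sum)
    have Gb: "\<bar>G n i t\<bar> \<le> (M' * C ^ n / fact n) * \<bar>t\<bar> ^ n" if "\<bar>t\<bar> \<le> T" for n i t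
      using that
    proof (induction n arbitrary: i t)
      case 0
      then have "\<bar>g0 i t\<bar> \<le> M i" using M[of t i] by (auto simp: abs_le_iff)
      then show ?case using M'(2)[of i] by (simp add: G_def)
    next
      case (Suc n)
      have "\<bar>V (G n) i t\<bar> \<le> C * (M' * C ^ n / fact n) * \<bar>t\<bar> ^ Suc n / real (Suc n)"
        using C0 M'(1) by (intro C2 G Suc) auto
      also have "\<dots> = (M' * C ^ Suc n / fact (Suc n)) * \<bar>t\<bar> ^ Suc n" by (simp add: field_simps)
      finally show ?case by (simp add: G_def)
    qed
    have bd: "\<bar>G n i t\<bar> \<le> M' * ((C * T) ^ n / fact n)" if "t \<in> {-T..T}" for n i t
    proof -
      have "\<bar>t\<bar> \<le> T" using that by auto
      then have "\<bar>t\<bar> ^ n \<le> T ^ n" by (intro power_mono) auto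
      then have "(M' * C ^ n / fact n) * \<bar>t\<bar> ^ n \<le> (M' * C ^ n / fact n) * T ^ n"
        using C0 M'(1) by (intro mult_left_mono) auto
      moreover have "\<bar>G n i t\<bar> \<le> (M' * C ^ n / fact n) * \<bar>t\<bar> ^ n" 
        using \<open>\<bar>t\<bar> \<le> T\<close> by (rule Gb)
      ultimately show ?thesis by (simp add: power_mult_distrib)
    qed
    have "summable (\<lambda>n. M' * ((C * T) ^ n / fact n))"
      using summable_exp[of "C * T"] by (intro summable_mult) (simp add: field_simps)
    from Weierstrass_m_test[OF _ this, of "{-T..T}" "\<lambda>n t. G n i t"] bd
    show ?thesis by (simp add: S_def g_def)
  qed
  have contg: "continuous_on UNIV (g i)" for i
  proof -
    have "isCont (g i) t" for t
    proof -
      have "continuous_on {-(\<bar>t\<bar>+1)..\<bar>t\<bar>+1} (g i)"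
        by (rule uniform_limit_theorem[OF _ ul])
          (auto intro!: always_eventually continuous_on_subset[OF contS])
      then show ?thesis
        by (rule continuous_on_interior) (auto simp: abs_if)
    qed
    then show ?thesis by (simp add: continuous_on_eq_continuous_at)
  qed
  have VS: "V (S N) i t = S (Suc N) i t - g0 i t" for N i t
  proof (induction N arbitrary: i t)
    case 0
    have "V (\<lambda>i t. 0 + 0) i t = V (\<lambda>i t. 0) i t + V (\<lambda>i t. 0) i t"
      by (rule add) auto
    then show ?case by (simp add: S_def G_def)
  next
    case (Suc N)
    have "S (Suc N) = (\<lambda>i t. S N i t + G N i t)" by (simp add: S_def)
    then have "V (S (Suc N)) i t = V (S N) i t + V (G N) i t"
      using add[OF contS G] by simp
    then show ?case using Suc by (simp add: S_def G_def)
  qed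
  have "g i t = g0 i t + V g i t" for i t
  proof -
    define T where "T = \<bar>t\<bar> + 1"
    have T: "T > 0" "\<bar>t\<bar> \<le> T" by (auto simp: T_def)
    obtain C where C0: "C \<ge> 0" and C': "\<forall>g M n. (\<forall>i. continuous_on UNIV (g i)) \<longrightarrow> 0 \<le> M \<longrightarrow>
      (\<forall>i s. \<bar>s\<bar> \<le> T \<longrightarrow> \<bar>g i s\<bar> \<le> M * \<bar>s\<bar> ^ n) \<longrightarrow>
      (\<forall>i t. \<bar>t\<bar> \<le> T \<longrightarrow> \<bar>V g i t\<bar> \<le> C * M * \<bar>t\<bar> ^ Suc n / real (Suc n))"
      using est[OF T(1)] by blast
    have C2: "\<bar>V g i t\<bar> \<le> C * M * \<bar>t\<bar> ^ Suc n / real (Suc n)"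
      if "\<And>i. continuous_on UNIV (g i)" "0 \<le> M" "\<And>i s. \<bar>s\<bar> \<le> T \<Longrightarrow> \<bar>g i s\<bar> \<le> M * \<bar>s\<bar> ^ n"
        "\<bar>t\<bar> \<le> T" for g M n i t
      using C' that by blast
    \<comment> \<open>\<open>V\<close> commutes with the limit: the estimate with exponent 0,
      applied to \<open>S N - g\<close>, shows that \<open>V\<close> is continuous for uniform
      convergence. The \<open>+ 1\<close> in \<open>e'\<close> keeps the denominator positive when
      \<open>C * |t|\<close> vanishes.\<close>
    have "(\<lambda>N. V (S N) i t) \<longlonglongrightarrow> V g i t"
      unfolding LIMSEQ_iff
    proof (intro allI impI)
      fix e :: real assume "e > 0"
      define e' where "e' = e / (C * \<bar>t\<bar> + 1)"
      have pos: "C * \<bar>t\<bar> + 1 > 0" using C0 by (simp add: add_nonneg_pos)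
      have e': "e' > 0" using \<open>e > 0\<close> pos by (simp add: e'_def)
      have "\<forall>\<^sub>F N in sequentially. \<forall>i\<in>UNIV. \<forall>s\<in>{-T..T}. dist (S N i s) (g i s) < e'"
        by (rule eventually_ball_finite) (use uniform_limitD[OF ul[OF T(1)] e'] in auto)
      then obtain N0 where N0: "\<And>N i s. N \<ge> N0 \<Longrightarrow> s \<in> {-T..T} \<Longrightarrow> dist (S N i s) (g i s) < e'"
        unfolding eventually_sequentially by (metis UNIV_I)
      show "\<exists>N0. \<forall>N\<ge>N0. norm (V (S N) i t - V g i t) < e"
      proof (intro exI[of _ N0] allI impI)
        fix N assume N: "N \<ge> N0"
        have "V (\<lambda>i t. g i t + (S N i t - g i t)) i t = V g i t + V (\<lambda>i t. S N i t - g i t) i t"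
          by (rule add) (auto intro!: contg contS continuous_intros)
        then have "\<bar>V (S N) i t - V g i t\<bar> = \<bar>V (\<lambda>i t. S N i t - g i t) i t\<bar>" by simp
        also have "\<dots> \<le> C * e' * \<bar>t\<bar> ^ Suc 0 / real (Suc 0)"
        proof (rule C2)
          show "\<bar>S N i s - g i s\<bar> \<le> e' * \<bar>s\<bar> ^ 0" if "\<bar>s\<bar> \<le> T" for i s
            using N0[OF N, of s i] that by (auto simp: dist_real_def abs_le_iff)
        qed (use e' T in \<open>auto intro!: contg contS continuous_intros\<close>)
        also have "\<dots> < e' * (C * \<bar>t\<bar> + 1)" using e' by (simp add: algebra_simps)
        also have "\<dots> = e" using pos by (simp add: e'_def)
        finally show "norm (V (S N) i t - V g i t) < e" by simp
      qed
    qed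
    moreover have "(\<lambda>N. S (Suc N) i t) \<longlonglongrightarrow> g i t"
      by (rule LIMSEQ_Suc, rule tendsto_uniform_limitI[OF ul[OF T(1)]]) (use T(2) in auto)
    then have "(\<lambda>N. V (S N) i t) \<longlonglongrightarrow> g i t - g0 i t"
      unfolding VS by (intro tendsto_intros)
    ultimately have "V g i t = g i t - g0 i t" using LIMSEQ_unique by blast
    then show ?thesis by simp
  qed
  then show ?thesis using contg by blast
qed

text \<open>At \<open>t = 0\<close> the matrix of this Fuchsian system has the eigenvalue \<open>0\<close> on the diagonal of
  \<open>\<real>\<^sup>3\<close> and \<open>-6\<close> on its complement, hence the two means below.\<close>

lemma fuchsian_system_solution:
  fixes r :: "3 \<Rightarrow> real \<Rightarrow> real" and q :: "real \<Rightarrow> real"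
  assumes r: "\<And>k. smooth_even (r k)" "\<And>k. r k 0 = 1" and q: "smooth_even q"
  shows "\<exists>g. \<forall>k. smooth_even (g k) \<and> g k 0 = c \<and>
    (\<forall>t. \<exists>D. (g k has_real_derivative D) (at t) \<and>
       t * D = 2 * (\<Sum>j\<in>UNIV. r j t * g j t) + t\<^sup>2 * q t - (2 + 4 * r k t) * g k t)"
proof -
  have "\<exists>\<rho>. smooth_even \<rho> \<and> (\<forall>t. r k t - 1 = t\<^sup>2 * \<rho> t)" for k
    using r by (intro smooth_even_divide smooth_even_intros) auto
  then obtain \<rho> where \<rho>: "\<And>k. smooth_even (\<rho> k)" "\<And>k t. r k t = 1 + t\<^sup>2 * \<rho> k t"
    by (metis add.commute diff_add_cancel)
  have c\<rho>: "continuous_on UNIV (\<rho> k)" for k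
    using \<rho>(1) smooth_on_imp_continuous_on by (auto simp: smooth_even_def)
  have cq: "continuous_on UNIV q"
    using q smooth_on_imp_continuous_on by (auto simp: smooth_even_def)
  define \<sigma> where "\<sigma> g s = \<rho> 1 s * g 1 s + \<rho> 2 s * g 2 s + \<rho> 3 s * g 3 s" for g :: "3 \<Rightarrow> real \<Rightarrow> real" and s
  \<comment> \<open>With \<open>r k = 1 + t\<^sup>2 * \<rho> k\<close> the perturbation of the
    constant matrix is \<open>t\<^sup>2\<close> times
    \<open>2 * \<sigma> g - 4 * \<rho> k * g k\<close>. Its average over \<open>k\<close> is
    \<open>2/3 * \<sigma> g\<close>, which feeds the eigenvalue 0; the rest,
    \<open>4/3 * \<sigma> g - 4 * \<rho> k * g k\<close>, feeds the eigenvalue -6. One factor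
    \<open>t\<close> is kept here, the other belongs to \<open>t * scaled_mean\<close>.\<close>
  define h0 where "h0 g s = s * (2/3 * \<sigma> g s)" for g s
  define h6 where "h6 g k s = s * (4/3 * \<sigma> g s - 4 * (\<rho> k s * g k s))" for g k s
  define V where "V g k t = t * scaled_mean 0 (h0 g) t + t * scaled_mean 6 (h6 g k) t" for g k t
  define g0 where "g0 k t = c + t * scaled_mean 0 (\<lambda>s. s * q s) t" for k :: 3 and t
  have ch: "continuous_on UNIV (h0 g)" "continuous_on UNIV (h6 g k)"
    if "\<And>k. continuous_on UNIV (g k)" for g :: "3 \<Rightarrow> real \<Rightarrow> real" and k
    unfolding h0_def[abs_def] h6_def[abs_def] \<sigma>_def by (intro continuous_intros c\<rho> that)+
  have "\<exists>g. (\<forall>k. continuous_on UNIV (g k)) \<and> (\<forall>k t. g k t = g0 k t + V g k t)"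
  proof (rule volterra_fixed_point)
    show "continuous_on UNIV (V g k)" if "\<And>k. continuous_on UNIV (g k)" for g k
      unfolding V_def[abs_def] by (intro continuous_intros scaled_mean_continuous ch that)
    show "continuous_on UNIV (g0 k)" for k
      unfolding g0_def[abs_def] by (intro continuous_intros scaled_mean_continuous cq)
    show "V (\<lambda>i t. g i t + h i t) k t = V g k t + V h k t"
      if "\<And>k. continuous_on UNIV (g k)" "\<And>k. continuous_on UNIV (h k)" for g h k t
    proof -
      have 1: "h0 (\<lambda>i t. g i t + h i t) = (\<lambda>s. h0 g s + h0 h s)"
        "h6 (\<lambda>i t. g i t + h i t) k = (\<lambda>s. h6 g k s + h6 h k s)"
        by (auto simp: h0_def h6_def \<sigma>_def field_simps)
      show ?thesis unfolding V_def 1 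
        by (subst (1 2) scaled_mean_add) (auto intro!: ch that simp: algebra_simps)
    qed
  next
    fix T :: real assume T: "T > 0"
    have "\<exists>M. \<forall>t\<in>{-T..T}. \<bar>\<rho> i t\<bar> \<le> M" for i
      using compact_imp_bounded[OF compact_continuous_image[OF continuous_on_subset[OF c\<rho>] compact_Icc], of "-T" T i]
      by (force simp: bounded_iff)
    then obtain M where M: "\<And>i t. t \<in> {-T..T} \<Longrightarrow> \<bar>\<rho> i t\<bar> \<le> M i" by metis
    define R where "R = (\<Sum>i\<in>UNIV. \<bar>M i\<bar>)"
    have R: "R \<ge> 0" "\<bar>M i\<bar> \<le> R" for i
      unfolding R_def by (auto intro: sum_nonneg member_le_sum)
    have \<rho>R: "\<bar>\<rho> i t\<bar> \<le> R" if "\<bar>t\<bar> \<le> T" for i t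
      using M[of t i] R(2)[of i] that by (auto simp: abs_le_iff)
    show "\<exists>C\<ge>0. \<forall>g M n. (\<forall>i. continuous_on UNIV (g i)) \<longrightarrow> 0 \<le> M \<longrightarrow>
      (\<forall>i s. \<bar>s\<bar> \<le> T \<longrightarrow> \<bar>g i s\<bar> \<le> M * \<bar>s\<bar> ^ n) \<longrightarrow>
      (\<forall>i t. \<bar>t\<bar> \<le> T \<longrightarrow> \<bar>V g i t\<bar> \<le> C * M * \<bar>t\<bar> ^ Suc n / real (Suc n))"
    \<comment> \<open>\<open>R\<close> bounds the \<open>\<rho> k\<close> on [-T, T].
      \<open>h0\<close> contributes 3 times 2/3, i.e. 2, and \<open>h6\<close> contributes 3 times
      4/3 plus 4, i.e. 8; the factor \<open>T\<close> bounds the explicit \<open>s\<close>.\<close>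
    proof (intro exI[of _ "10 * R * T"] conjI allI impI)
      fix g :: "3 \<Rightarrow> real \<Rightarrow> real" and M n k t
      assume g: "\<forall>i. continuous_on UNIV (g i)" and M: "0 \<le> (M::real)"
        and b: "\<forall>i s. \<bar>s\<bar> \<le> T \<longrightarrow> \<bar>g i s\<bar> \<le> M * \<bar>s\<bar> ^ n" and t: "\<bar>t\<bar> \<le> T"
      have gb: "\<bar>\<rho> i s * g i s\<bar> \<le> R * M * \<bar>s\<bar> ^ n" if "\<bar>s\<bar> \<le> T" for i s
        using mult_mono[OF \<rho>R[OF that] b[rule_format, OF that] R(1), of i i] by (simp add: abs_mult mult_ac)
      have mm: "\<bar>s * y\<bar> \<le> (K * R * T * M) * \<bar>s\<bar> ^ n" if "\<bar>s\<bar> \<le> T" "\<bar>y\<bar> \<le> K * (R * M * \<bar>s\<bar> ^ n)" for s y K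
        using mult_mono[OF that] T by (simp add: abs_mult mult_ac)
      have "\<bar>h0 g s\<bar> \<le> (2 * R * T * M) * \<bar>s\<bar> ^ n" if "\<bar>s\<bar> \<le> T" for s
        unfolding h0_def using gb[OF that, of 1] gb[OF that, of 2] gb[OF that, of 3]
        by (intro mm that) (simp add: \<sigma>_def abs_le_iff)
      from scaled_mean_bound[OF ch(1) this t] g
      have 1: "\<bar>t * scaled_mean 0 (h0 g) t\<bar> \<le> (2 * R * T * M) * \<bar>t\<bar> ^ Suc n / real (Suc n)" by blast
      have aux: "\<bar>4/3 * (a + b + c) - 4 * d\<bar> \<le> 8 * X"
        if "\<bar>a\<bar> \<le> X" "\<bar>b\<bar> \<le> X" "\<bar>c\<bar> \<le> X" "\<bar>d\<bar> \<le> X" for a b c d X :: real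
        using that unfolding abs_le_iff by (simp add: field_simps)
      have "\<bar>h6 g k s\<bar> \<le> (8 * R * T * M) * \<bar>s\<bar> ^ n" if "\<bar>s\<bar> \<le> T" for s
        unfolding h6_def \<sigma>_def by (intro mm aux gb that)
      from scaled_mean_bound[OF ch(2) this t] g
      have 2: "\<bar>t * scaled_mean 6 (h6 g k) t\<bar> \<le> (8 * R * T * M) * \<bar>t\<bar> ^ Suc n / real (Suc n)" by blast
      have "\<bar>V g k t\<bar> \<le> \<bar>t * scaled_mean 0 (h0 g) t\<bar> + \<bar>t * scaled_mean 6 (h6 g k) t\<bar>"
        unfolding V_def by (rule abs_triangle_ineq)
      also have "\<dots> \<le> (2 * R * T * M) * \<bar>t\<bar> ^ Suc n / real (Suc n) + (8 * R * T * M) * \<bar>t\<bar> ^ Suc n / real (Suc n)"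
        using 1 2 by linarith
      also have "\<dots> = 10 * R * T * M * \<bar>t\<bar> ^ Suc n / real (Suc n)"
        unfolding add_divide_distrib[symmetric] distrib_right[symmetric] by simp
      finally show "\<bar>V g k t\<bar> \<le> 10 * R * T * M * \<bar>t\<bar> ^ Suc n / real (Suc n)" .
    qed (use R T in simp)
  qed
  then obtain f where f: "\<And>k. continuous_on UNIV (f k)" "\<And>k t. f k t = g0 k t + V f k t" by blast
  \<comment> \<open>All data are even, so the reflection of a fixed point is again one; the average
    of both is an even fixed point, and no uniqueness is invoked.\<close>
  define g where "g k t = (f k t + f k (- t)) / 2" for k t
  have cg: "continuous_on UNIV (g k)" for k
    unfolding g_def[abs_def] by (intro continuous_intros continuous_on_compose2[OF f(1)]) auto
  have \<rho>_even: "\<rho> k (- t) = \<rho> k t" and q_even: "q (- t) = q t" for k t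
    using \<rho>(1) q by (auto simp: smooth_even_def)
  have refl: "(- t) * scaled_mean n h (- t) = t * scaled_mean n (\<lambda>s. - h (- s)) t" for n h and t :: real
    using scaled_mean_cmult[of n "-1" "\<lambda>s. h (- s)" t] by (simp add: scaled_mean_def)
  have g_fix: "g k t = g0 k t + V g k t" for k t
  proof -
    let ?f' = "\<lambda>k t. f k (- t)"
    have cf': "continuous_on UNIV (?f' k)" for k
      by (intro continuous_intros continuous_on_compose2[OF f(1)]) auto
    have "V f k (- t) = V ?f' k t"
      unfolding V_def refl by (simp add: h0_def[abs_def] h6_def[abs_def] \<sigma>_def \<rho>_even)
    moreover have "g0 k (- t) = g0 k t"
      unfolding g0_def refl by (simp add: q_even)
    ultimately have "?f' k t = g0 k t + V ?f' k t" using f(2)[of k "- t"] by simp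
    moreover have "V g k t = (V f k t + V ?f' k t) / 2"
    proof -
      have 1: "h0 g = (\<lambda>s. 1/2 * (h0 f s + h0 ?f' s))" "h6 g k = (\<lambda>s. 1/2 * (h6 f k s + h6 ?f' k s))"
        by (auto simp: h0_def h6_def \<sigma>_def g_def field_simps)
      show ?thesis unfolding V_def 1 scaled_mean_cmult
        by (subst (1 2) scaled_mean_add) (auto intro!: ch f(1) cf' simp: field_simps)
    qed
    ultimately show ?thesis using f(2)[of k t] by (simp add: g_def field_simps)
  qed
  have Ckc: "Ck_on n \<rho>' UNIV" if "smooth_even \<rho>'" for n \<rho>'
    using that by (simp add: smooth_even_def smooth_on_def)
  \<comment> \<open>Bootstrap: \<open>g0 + V g\<close> has one derivative more than
    \<open>g\<close>, and it equals \<open>g\<close>.\<close>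
  have "Ck_on n (g k) UNIV" for n k
  proof (induction n arbitrary: k)
    case 0
    then show ?case using cg by simp
  next
    case (Suc n)
    have m: "Ck_on n (\<lambda>s. F s * G s) UNIV" if "Ck_on n F UNIV" "Ck_on n G UNIV" for F G :: "real \<Rightarrow> real"
      using that by (intro Ck_on_bilinear[OF open_UNIV bounded_bilinear_mult])
    have id: "Ck_on n (\<lambda>s::real. s) UNIV"
      by (intro Ck_on_bounded_linear bounded_linear_ident open_UNIV)
    have s: "Ck_on n (\<sigma> g) UNIV"
      unfolding \<sigma>_def[abs_def] by (intro Ck_on_add m Ckc \<rho> Suc open_UNIV)
    have "Ck_on n (h0 g) UNIV"
      unfolding h0_def[abs_def] by (intro m id s Ck_on_const)
    moreover have "Ck_on n (h6 g k) UNIV"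
    proof -
      have "Ck_on n (\<lambda>t. t * (4/3 * \<sigma> g t + (- 4) * (\<rho> k t * g k t))) UNIV"
        by (intro m id s Ck_on_add Ck_on_const Ckc \<rho> Suc open_UNIV)
      then show ?thesis by (simp add: h6_def[abs_def])
    qed
    ultimately have "Ck_on (Suc n) (\<lambda>t. g0 k t + V g k t) UNIV"
      unfolding g0_def V_def
      using Ckc[OF q] by (intro Ck_on_add Ck_on_const Ck_on_mult_scaled_mean m id open_UNIV)
    moreover have "(\<lambda>t. g0 k t + V g k t) = g k" using g_fix by auto
    ultimately show ?case by simp
  qed
  then have smooth: "smooth_even (g k)" for k
    by (simp add: smooth_even_def smooth_on_def g_def)
  have ode: "\<exists>D. (g k has_real_derivative D) (at t) \<and>
       t * D = 2 * (\<Sum>j\<in>UNIV. r j t * g j t) + t\<^sup>2 * q t - (2 + 4 * r k t) * g k t" for k t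
  proof -
    let ?D = "t * q t + (h0 g t + (h6 g k t - 6 * scaled_mean 6 (h6 g k) t))"
    have "((\<lambda>t. c + t * scaled_mean 0 (\<lambda>s. s * q s) t + (t * scaled_mean 0 (h0 g) t + t * scaled_mean 6 (h6 g k) t))
        has_real_derivative (0 + (t * q t - real 0 * scaled_mean 0 (\<lambda>s. s * q s) t) +
        ((h0 g t - real 0 * scaled_mean 0 (h0 g) t) + (h6 g k t - real 6 * scaled_mean 6 (h6 g k) t)))) (at t)"
      by (intro DERIV_add DERIV_const has_derivative_scaled_mean ch cg continuous_intros cq)
    moreover have "(\<lambda>t. c + t * scaled_mean 0 (\<lambda>s. s * q s) t +
        (t * scaled_mean 0 (h0 g) t + t * scaled_mean 6 (h6 g k) t)) = g k"
      using g_fix[of k] by (auto simp: g0_def V_def)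
    ultimately have D: "(g k has_real_derivative ?D) (at t)" by simp
    \<comment> \<open>The three \<open>h6\<close> add up to 0, so these means lie in the complement
      of the diagonal. Therefore the average of the \<open>g k\<close> is the diagonal part
      \<open>G\<close>, and the means can be eliminated from the derivative.\<close>
    have "scaled_mean 6 (h6 g 1) t + scaled_mean 6 (h6 g 2) t + scaled_mean 6 (h6 g 3) t
        = scaled_mean 6 (\<lambda>s. h6 g 1 s + h6 g 2 s + h6 g 3 s) t"
      by (subst scaled_mean_add; (intro continuous_intros ch cg)?; subst scaled_mean_add; (intro continuous_intros ch cg)?; simp)
    also have "(\<lambda>s. h6 g 1 s + h6 g 2 s + h6 g 3 s) = (\<lambda>s. 0)"
      by (auto simp: h6_def \<sigma>_def algebra_simps)
    finally have z: "t * scaled_mean 6 (h6 g 1) t + t * scaled_mean 6 (h6 g 2) t + t * scaled_mean 6 (h6 g 3) t = 0"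
      by (simp add: scaled_mean_def flip: distrib_left)
    define G where "G = g0 1 t + t * scaled_mean 0 (h0 g) t"
    have e: "t * scaled_mean 6 (h6 g k) t = g k t - G" for k
      using g_fix[of k t] by (simp add: V_def G_def g0_def)
    have "3 * G = g 1 t + g 2 t + g 3 t" using z unfolding e by simp
    then have e6: "t * scaled_mean 6 (h6 g k) t = g k t - (g 1 t + g 2 t + g 3 t) / 3"
      using e[of k] by simp
    have "t * ?D = t * t * q t + t * h0 g t + t * h6 g k t - 6 * (t * scaled_mean 6 (h6 g k) t)"
      by (simp add: algebra_simps)
    also have "\<dots> = 2 * (\<Sum>j\<in>UNIV. r j t * g j t) + t\<^sup>2 * q t - (2 + 4 * r k t) * g k t"
      unfolding e6 by (simp add: sum_3 \<rho>(2) h0_def h6_def \<sigma>_def power2_eq_square algebra_simps)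
    finally show ?thesis using D by blast
  qed
  have "g k 0 = c" for k using g_fix[of k 0] by (simp add: g0_def V_def)
  then show ?thesis using smooth ode by (intro exI[of _ g]) blast
qed

text \<open>Energy estimate. The eigenvalues 0 and -6 of the singular part are not positive, so that
  part cannot increase the sum of squares \<open>E\<close>; the remainder carries a factor
  \<open>t\<^sup>2\<close> and gives \<open>E' \<le> K * E\<close>. Thus
  \<open>E t * exp (- K * t)\<close> is non-increasing while it tends to 0 at 0.\<close>

lemma fuchsian_system_unique:
  fixes r d :: "3 \<Rightarrow> real \<Rightarrow> real"
  assumes r: "\<And>k. smooth_even (r k)" "\<And>k. r k 0 = 1"
    and ode: "\<And>k t. t > 0 \<Longrightarrow> \<exists>D. (d k has_real_derivative D) (at t) \<and>
       t * D = 2 * (\<Sum>j\<in>UNIV. r j t * d j t) - (2 + 4 * r k t) * d k t"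
    and lim: "\<And>k. (d k \<longlongrightarrow> 0) (at_right 0)" and T: "T > 0"
  shows "d k T = 0"
proof -
  have "\<exists>\<rho>. smooth_even \<rho> \<and> (\<forall>t. r k t - 1 = t\<^sup>2 * \<rho> t)" for k
    using r by (intro smooth_even_divide smooth_even_intros) auto
  then obtain \<rho> where \<rho>: "\<And>k. smooth_even (\<rho> k)" "\<And>k t. r k t = 1 + t\<^sup>2 * \<rho> k t"
    by (metis add.commute diff_add_cancel)
  have c\<rho>: "continuous_on UNIV (\<rho> k)" for k
    using \<rho>(1) smooth_on_imp_continuous_on by (auto simp: smooth_even_def)
  have "\<exists>M. \<forall>t\<in>{0..T}. \<bar>\<rho> i t\<bar> \<le> M" for i
    using compact_imp_bounded[OF compact_continuous_image[OF continuous_on_subset[OF c\<rho>] compact_Icc], of 0 T i]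
    by (force simp: bounded_iff)
  then obtain M where M: "\<And>i t. t \<in> {0..T} \<Longrightarrow> \<bar>\<rho> i t\<bar> \<le> M i" by metis
  define R where "R = (\<Sum>i\<in>UNIV. \<bar>M i\<bar>)"
  have R: "R \<ge> 0" "\<bar>M i\<bar> \<le> R" for i
    unfolding R_def by (auto intro: sum_nonneg member_le_sum)
  have \<rho>R: "\<bar>\<rho> i t\<bar> \<le> R" if "t \<in> {0..T}" for i t
    using M[of t i] R(2)[of i] that by (auto simp: abs_le_iff)
  define D where "D k t = deriv (d k) t" for k t
  have D: "(d k has_real_derivative D k t) (at t)"
    "t * D k t = 2 * (\<Sum>j\<in>UNIV. r j t * d j t) - (2 + 4 * r k t) * d k t" if "t > 0" for k t
    using ode[OF that, of k] DERIV_imp_deriv unfolding D_def by blast+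
  define E where "E t = (d 1 t)\<^sup>2 + (d 2 t)\<^sup>2 + (d 3 t)\<^sup>2" for t
  define E' where "E' t = 2 * (d 1 t * D 1 t + d 2 t * D 2 t + d 3 t * D 3 t)" for t
  \<comment> \<open>20 is 12 plus 8: the terms \<open>4 * (p * w)\<close> and \<open>- 8 * v\<close>
    below are at most \<open>12 * R * E\<close> and \<open>8 * R * E\<close>.\<close>
  define K where "K = 20 * R * T"
  have DE: "(E has_real_derivative E' t) (at t)" if "t > 0" for t
    unfolding E_def[abs_def] E'_def using D(1)[OF that]
    by (auto intro!: derivative_eq_intros simp: algebra_simps)
  have E'_le: "E' t \<le> K * E t" if t: "0 < t" "t \<le> T" for t
  proof -
    define p where "p = \<rho> 1 t * d 1 t + \<rho> 2 t * d 2 t + \<rho> 3 t * d 3 t"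
    define w where "w = d 1 t + d 2 t + d 3 t"
    define v where "v = \<rho> 1 t * (d 1 t)\<^sup>2 + \<rho> 2 t * (d 2 t)\<^sup>2 + \<rho> 3 t * (d 3 t)\<^sup>2"
    have "t * E' t = 2 * (d 1 t * (t * D 1 t) + d 2 t * (t * D 2 t) + d 3 t * (t * D 3 t))"
      by (simp add: E'_def algebra_simps)
    also have "\<dots> = 4 * w\<^sup>2 - 12 * E t + t\<^sup>2 * (4 * (p * w) - 8 * v)"
      unfolding D(2)[OF t(1)] \<rho>(2) sum_3 p_def w_def E_def v_def by (simp add: power2_eq_square algebra_simps)
    also have "4 * w\<^sup>2 - 12 * E t \<le> 0"
    proof -
      have "12 * E t - 4 * w\<^sup>2 = 4 * ((d 1 t - d 2 t)\<^sup>2 + (d 2 t - d 3 t)\<^sup>2 + (d 1 t - d 3 t)\<^sup>2)"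
        by (simp add: E_def w_def power2_eq_square algebra_simps)
      moreover have "\<dots> \<ge> 0" by simp
      ultimately show ?thesis by linarith
    qed
    also have "4 * (p * w) - 8 * v \<le> 20 * (R * E t)"
    proof -
      let ?S = "\<bar>d 1 t\<bar> + \<bar>d 2 t\<bar> + \<bar>d 3 t\<bar>"
      have \<rho>d: "\<bar>\<rho> i t * x\<bar> \<le> R * \<bar>x\<bar>" for i x
        unfolding abs_mult using t by (intro mult_right_mono \<rho>R) auto
      have "\<bar>p\<bar> \<le> R * ?S"
        using \<rho>d[of 1 "d 1 t"] \<rho>d[of 2 "d 2 t"] \<rho>d[of 3 "d 3 t"]
        unfolding p_def distrib_left by linarith
      moreover have "\<bar>w\<bar> \<le> ?S" by (simp add: w_def)
      ultimately have "\<bar>p\<bar> * \<bar>w\<bar> \<le> (R * ?S) * ?S" by (intro mult_mono) (use R in auto)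
      also have "?S * ?S \<le> 3 * E t"
      proof -
        have "3 * E t - ?S * ?S = (\<bar>d 1 t\<bar> - \<bar>d 2 t\<bar>)\<^sup>2 + (\<bar>d 2 t\<bar> - \<bar>d 3 t\<bar>)\<^sup>2 + (\<bar>d 1 t\<bar> - \<bar>d 3 t\<bar>)\<^sup>2"
          by (simp add: E_def power2_eq_square algebra_simps)
        moreover have "\<dots> \<ge> 0" by simp
        ultimately show ?thesis by linarith
      qed
      then have "(R * ?S) * ?S \<le> R * (3 * E t)"
        using R(1) by (simp only: mult.assoc) (intro mult_left_mono)
      finally have 1: "p * w \<le> 3 * (R * E t)" by (simp add: abs_mult[symmetric] abs_le_iff)
      have 2: "- v \<le> R * E t"
        using \<rho>d[of 1 "(d 1 t)\<^sup>2"] \<rho>d[of 2 "(d 2 t)\<^sup>2"] \<rho>d[of 3 "(d 3 t)\<^sup>2"]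
        unfolding v_def E_def distrib_left by (simp add: abs_le_iff)
      show ?thesis using 1 2 by linarith
    qed
    finally have "t * E' t \<le> t\<^sup>2 * (20 * (R * E t))" by (simp add: mult_left_mono)
    then have "E' t \<le> t * (20 * (R * E t))" using t by (simp add: power2_eq_square mult.assoc)
    also have "\<dots> \<le> T * (20 * (R * E t))"
      using t R(1) by (intro mult_right_mono) (auto simp: E_def)
    finally show ?thesis by (simp add: K_def mult_ac)
  qed
  have mono: "E T * exp (- K * T) \<le> E s * exp (- K * s)" if s: "0 < s" "s \<le> T" for s
  proof (rule DERIV_nonpos_imp_nonincreasing[OF s(2), of "\<lambda>t. E t * exp (- K * t)"])
    fix t assume t: "s \<le> t" "t \<le> T"
    have "((\<lambda>t. E t * exp (- K * t)) has_real_derivative (E' t - K * E t) * exp (- K * t)) (at t)"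
      using DE[of t] t s by (auto intro!: derivative_eq_intros simp: algebra_simps)
    moreover have "(E' t - K * E t) * exp (- K * t) \<le> 0"
      using E'_le[of t] t s by (intro mult_nonpos_nonneg) auto
    ultimately show "\<exists>y. ((\<lambda>t. E t * exp (- K * t)) has_real_derivative y) (at t) \<and> y \<le> 0" by blast
  qed
  have "((\<lambda>s. E s * exp (- K * s)) \<longlongrightarrow> (0\<^sup>2 + 0\<^sup>2 + 0\<^sup>2) * exp (- K * 0)) (at_right 0)"
    unfolding E_def by (intro tendsto_intros lim)
  moreover have "\<forall>\<^sub>F s in at_right 0. E T * exp (- K * T) \<le> E s * exp (- K * s)"
    unfolding eventually_at_right_field by (rule exI[of _ T]) (use T mono in auto)
  ultimately have "E T * exp (- K * T) \<le> 0"
    using tendsto_lowerbound[of "\<lambda>s. E s * exp (- K * s)" 0 "at_right 0" "E T * exp (- K * T)"] by simp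
  then have "E T \<le> 0" by (simp add: mult_le_0_iff)
  then have "d 1 T = 0 \<and> d 2 T = 0 \<and> d 3 T = 0"
    unfolding E_def by (smt (verit) zero_le_power2 power2_eq_iff zero_power2 power_eq_0_iff)
  then show ?thesis by (metis (full_types) exhaust_3)
qed

text \<open>At the first time \<open>s\<close> at which some \<open>g j\<close> is no longer
  positive, \<open>g j\<close> vanishes and the other components are non-negative, so the equation
  gives \<open>s * D \<ge> s\<^sup>2 * q s > 0\<close>. Then \<open>g j\<close> would increase
  through 0 and be negative just before \<open>s\<close>.\<close>

lemma fuchsian_system_pos:
  fixes r g :: "3 \<Rightarrow> real \<Rightarrow> real"
  assumes r: "\<And>k t. r k t > 0" and q: "\<And>t. q t > 0" and g: "\<And>k. g k 0 > 0"
    and ode: "\<And>k t. \<exists>D. (g k has_real_derivative D) (at t) \<and>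
       t * D = 2 * (\<Sum>j\<in>UNIV. r j t * g j t) + t\<^sup>2 * q t - (2 + 4 * r k t) * g k t" and t: "t \<ge> 0"
  shows "g k t > 0"
proof (rule ccontr)
  assume "\<not> g k t > 0"
  define S where "S = (\<Union>k. {0..t} \<inter> g k -` {..0})"
  have cont: "continuous_on UNIV (g k)" for k
    using ode by (meson DERIV_isCont continuous_at_imp_continuous_on)
  have "t \<in> S" using \<open>\<not> g k t > 0\<close> t by (auto simp: S_def not_less)
  have "closed S"
    unfolding S_def by (intro closed_UN finite ballI continuous_closed_preimage)
      (auto intro: continuous_on_subset[OF cont])
  moreover have bdd: "bdd_below S" by (rule bdd_belowI[of _ 0]) (auto simp: S_def)
  ultimately have "Inf S \<in> S" using \<open>t \<in> S\<close> by (intro closed_contains_Inf) auto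
  define s where "s = Inf S"
  obtain j where j: "g j s \<le> 0" "s \<ge> 0" using \<open>Inf S \<in> S\<close> by (auto simp: S_def s_def)
  have "s \<noteq> 0" using j(1) g[of j] by auto
  then have s: "s > 0" using j(2) by simp
  have before: "g i x > 0" if "0 \<le> x" "x < s" for i x
  proof (rule ccontr)
    assume "\<not> g i x > 0"
    moreover have "s \<le> t" using cInf_lower[OF \<open>t \<in> S\<close> bdd] by (simp add: s_def)
    ultimately have "x \<in> S" unfolding S_def using that by (intro UN_I[of i]) auto
    then show False using cInf_lower[OF _ bdd, of x] that by (simp add: s_def)
  qed
  have nn: "g i s \<ge> 0" for i
  proof -
    have "(g i \<longlongrightarrow> g i s) (at_left s)"
      using cont[of i] by (simp add: continuous_on_eq_continuous_at isCont_def filterlim_at_split)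
    moreover have "\<forall>\<^sub>F x in at_left s. g i x \<ge> 0"
      unfolding eventually_at_left_field using s before[of _ i] by (intro exI[of _ 0]) (auto intro: less_imp_le)
    ultimately show ?thesis by (intro tendsto_lowerbound) auto
  qed
  obtain D where D: "(g j has_real_derivative D) (at s)"
      "s * D = 2 * (\<Sum>i\<in>UNIV. r i s * g i s) + s\<^sup>2 * q s - (2 + 4 * r j s) * g j s"
    using ode by blast
  have "(\<Sum>i\<in>UNIV. r i s * g i s) \<ge> 0"
    using nn r by (intro sum_nonneg mult_nonneg_nonneg) (auto intro: less_imp_le)
  moreover have "g j s = 0" using j nn[of j] by simp
  moreover have "s\<^sup>2 * q s > 0" using s q by simp
  ultimately have "s * D > 0" using D(2) by simp
  then have "D > 0" using s by (simp add: zero_less_mult_iff)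
  from DERIV_pos_inc_left[OF D(1) this] obtain e where e: "e > 0" "\<And>h. 0 < h \<Longrightarrow> h < e \<Longrightarrow> g j (s - h) < g j s"
    by blast
  define h where "h = min (e / 2) s"
  have "g j (s - h) < 0" using e(2)[of h] e(1) s \<open>g j s = 0\<close> by (simp add: h_def)
  moreover have "g j (s - h) > 0" using s e(1) by (intro before) (auto simp: h_def)
  ultimately show False by simp
qed

section \<open>The model on \<open>\<real>\<^sup>7\<close>\<close>

lemma exhaust_7:
  fixes x :: 7
  shows "x = 1 \<or> x = 2 \<or> x = 3 \<or> x = 4 \<or> x = 5 \<or> x = 6 \<or> x = 7"
proof (induct x)
  case (of_int z)
  then have "0 \<le> z" and "z < 7" by simp_all
  then have "z = 0 \<or> z = 1 \<or> z = 2 \<or> z = 3 \<or> z = 4 \<or> z = 5 \<or> z = 6" by arith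
  then show ?case by auto
qed

lemma forall_7: "(\<forall>i::7. P i) \<longleftrightarrow> P 1 \<and> P 2 \<and> P 3 \<and> P 4 \<and> P 5 \<and> P 6 \<and> P 7"
  by (metis exhaust_7)

lemma UNIV_7: "UNIV = {1::7, 2, 3, 4, 5, 6, 7}"
  using exhaust_7 by auto

lemma sum_7: "sum f (UNIV::7 set) = f 1 + f 2 + f 3 + f 4 + f 5 + f 6 + f 7"
  unfolding UNIV_7 by (simp add: ac_simps)

lemma inner_7: "(u::real^7) \<bullet> v = u$1* v$1 + u$2* v$2 + u$3* v$3 + u$4* v$4 + u$5* v$5 + u$6* v$6 + u$7* v$7"
  by (simp add: inner_vec_def sum_7)

text \<open>A shuffle with a single first argument is the choice of a position, so the sum over
  shuffles is a cofactor expansion.\<close>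

lemma wedge_1:
  "wedge 1 \<alpha> \<beta> vs = (\<Sum>i<length vs. (- 1) ^ i * \<alpha> [vs ! i] * \<beta> (take i vs @ drop (Suc i) vs))"
proof -
  have nths: "nths vs {i} = [vs ! i] \<and> nths vs (- {i}) = take i vs @ drop (Suc i) vs"
    if "i < length vs" for i and vs :: "'a list"
    using that
  proof (induction vs arbitrary: i)
    case (Cons v vs)
    show ?case
    proof (cases i)
      case 0
      have 1: "{j. Suc j \<in> {0}} = {}" "{j. Suc j \<in> - {0}} = UNIV" by auto
      show ?thesis unfolding 0 nths_Cons 1 by (simp add: nths_all)
    next
      case (Suc k)
      have 1: "{j. Suc j \<in> {Suc k}} = {k}" "{j. Suc j \<in> - {Suc k}} = - {k}" by auto
      show ?thesis using Cons unfolding Suc nths_Cons 1 by simp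
    qed
  qed simp
  have "{I. I \<subseteq> {..<length vs} \<and> card I = 1} = (\<lambda>i. {i}) ` {..<length vs}"
    by (auto simp: card_1_singleton_iff)
  then have "wedge 1 \<alpha> \<beta> vs = (\<Sum>i<length vs. shuffle_sign {i} * \<alpha> (nths vs {i}) * \<beta> (nths vs (- {i})))"
    unfolding wedge_def by (simp add: sum.reindex o_def)
  then show ?thesis by (simp add: nths shuffle_sign_def)
qed

section \<open>Explicit determinants for wedge products of one-forms\<close>

fun det2 :: "real \<times> real \<Rightarrow> real \<times> real \<Rightarrow> real" where
  "det2 (a1, a2) (b1, b2) = a1 * b2 - a2 * b1"

fun det3 :: "real \<times> real \<times> real \<Rightarrow> real \<times> real \<times> real \<Rightarrow> real \<times> real \<times> real \<Rightarrow> real" where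
  "det3 (a1, a2, a3) (b1, b2, b3) (c1, c2, c3) =
     a1 * (b2 * c3 - b3 * c2) - a2 * (b1 * c3 - b3 * c1) + a3 * (b1 * c2 - b2 * c1)"

fun det4 :: "real \<times> real \<times> real \<times> real \<Rightarrow> real \<times> real \<times> real \<times> real \<Rightarrow>
    real \<times> real \<times> real \<times> real \<Rightarrow> real \<times> real \<times> real \<times> real \<Rightarrow> real" where
  "det4 (a1, a2, a3, a4) (b1, b2, b3, b4) (c1, c2, c3, c4) (d1, d2, d3, d4) =
     a1 * det3 (b2, b3, b4) (c2, c3, c4) (d2, d3, d4) - a2 * det3 (b1, b3, b4) (c1, c3, c4) (d1, d3, d4)
     + a3 * det3 (b1, b2, b4) (c1, c2, c4) (d1, d2, d4) - a4 * det3 (b1, b2, b3) (c1, c2, c3) (d1, d2, d3)"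

definition row2 :: "('v \<Rightarrow> real) \<Rightarrow> 'v \<Rightarrow> 'v \<Rightarrow> real \<times> real" where
  "row2 f x y = (f x, f y)"

definition row3 :: "('v \<Rightarrow> real) \<Rightarrow> 'v \<Rightarrow> 'v \<Rightarrow> 'v \<Rightarrow> real \<times> real \<times> real" where
  "row3 f x y z = (f x, f y, f z)"

definition row4 :: "('v \<Rightarrow> real) \<Rightarrow> 'v \<Rightarrow> 'v \<Rightarrow> 'v \<Rightarrow> 'v \<Rightarrow> real \<times> real \<times> real \<times> real" where
  "row4 f x y z w = (f x, f y, f z, f w)"

lemma wedge_1_oneform:
  "wedge 1 (oneform f) \<beta> [x] = f x * \<beta> []"
  "wedge 1 (oneform f) \<beta> [x, y] = f x * \<beta> [y] - f y * \<beta> [x]"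
  "wedge 1 (oneform f) \<beta> [x, y, z] = f x * \<beta> [y, z] - f y * \<beta> [x, z] + f z * \<beta> [x, y]"
  "wedge 1 (oneform f) \<beta> [x, y, z, w] =
     f x * \<beta> [y, z, w] - f y * \<beta> [x, z, w] + f z * \<beta> [x, y, w] - f w * \<beta> [x, y, z]"
  unfolding wedge_1 list.size add_0 add_Suc_right add_0_right sum.lessThan_Suc lessThan_0 sum.empty
  by (simp_all add: oneform_def)

lemma wedge_list_rows:
  "wedge_list [oneform f, oneform g] [x, y] = det2 (row2 f x y) (row2 g x y)"
  "wedge_list [oneform f, oneform g, oneform h] [x, y, z] =
     det3 (row3 f x y z) (row3 g x y z) (row3 h x y z)"
  "wedge_list [oneform f, oneform g, oneform h, oneform k] [x, y, z, w] =
     det4 (row4 f x y z w) (row4 g x y z w) (row4 h x y z w) (row4 k x y z w)"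
  unfolding wedge_list_def foldr.simps o_def id_def wedge_1_oneform row2_def row3_def row4_def
    det2.simps det3.simps det4.simps
  by simp_all

text \<open>The cross product of imaginary octonions that belongs to \<open>phi0\<close>, normalised
  by \<open>phi0 [u, v, w] = cross7 u v \<bullet> w\<close>.\<close>

definition cross7 :: "real^7 \<Rightarrow> real^7 \<Rightarrow> real^7" where
  "cross7 u v = (let d = (\<lambda>i j. u $ i * v $ j - u $ j * v $ i) in
     vector [d 2 3 - d 6 7 + d 4 5, d 3 1 + d 5 7 + d 4 6, d 1 2 - d 5 6 + d 4 7,
       - d 1 5 - d 2 6 - d 3 7, - d 2 7 + d 3 6 + d 1 4, d 1 7 - d 3 5 + d 2 4, - d 1 6 + d 2 5 + d 3 4])"

lemma vector_7:
  "(vector [a,b,c,d,e,f,g] :: real^7) $ 1 = a" "(vector [a,b,c,d,e,f,g] :: real^7) $ 2 = b"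
  "(vector [a,b,c,d,e,f,g] :: real^7) $ 3 = c" "(vector [a,b,c,d,e,f,g] :: real^7) $ 4 = d"
  "(vector [a,b,c,d,e,f,g] :: real^7) $ 5 = e" "(vector [a,b,c,d,e,f,g] :: real^7) $ 6 = f"
  "(vector [a,b,c,d,e,f,g] :: real^7) $ 7 = g"
  unfolding vector_def by auto

lemma cross7_nth:
  "cross7 u v $ 1 = u$2* v$3 - u$3* v$2 - (u$6* v$7 - u$7* v$6) + (u$4* v$5 - u$5* v$4)"
  "cross7 u v $ 2 = u$3* v$1 - u$1* v$3 + (u$5* v$7 - u$7* v$5) + (u$4* v$6 - u$6* v$4)"
  "cross7 u v $ 3 = u$1* v$2 - u$2* v$1 - (u$5* v$6 - u$6* v$5) + (u$4* v$7 - u$7* v$4)"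
  "cross7 u v $ 4 = - (u$1* v$5 - u$5* v$1) - (u$2* v$6 - u$6* v$2) - (u$3* v$7 - u$7* v$3)"
  "cross7 u v $ 5 = - (u$2* v$7 - u$7* v$2) + (u$3* v$6 - u$6* v$3) + (u$1* v$4 - u$4* v$1)"
  "cross7 u v $ 6 = u$1* v$7 - u$7* v$1 - (u$3* v$5 - u$5* v$3) + (u$2* v$4 - u$4* v$2)"
  "cross7 u v $ 7 = - (u$1* v$6 - u$6* v$1) + (u$2* v$5 - u$5* v$2) + (u$3* v$4 - u$4* v$3)"
  by (simp_all add: cross7_def Let_def vector_7)

lemma phi0_eq_cross7: "phi0 [u, v, w] = cross7 u v \<bullet> w"
  by (simp add: phi0_def e3_def wedge_list_rows row3_def inner_7 cross7_nth algebra_simps)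

text \<open>Pascal's recursion; rewriting with it enumerates the 35 triples of positions in
  \<open>hodge7_phi0\<close> and the six pairs in \<open>wedge_2_list4\<close>.\<close>

lemma sum_subsets_card:
  fixes F :: "nat set \<Rightarrow> real"
  shows "(\<Sum>I | I \<subseteq> {..<n} \<and> card I = 0. F I) = F {}"
    "(\<Sum>I | I \<subseteq> {..<0::nat} \<and> card I = Suc p. F I) = 0"
    "(\<Sum>I | I \<subseteq> {..<Suc n} \<and> card I = Suc p. F I) =
      (\<Sum>I | I \<subseteq> {..<n} \<and> card I = Suc p. F I) + (\<Sum>I | I \<subseteq> {..<n} \<and> card I = p. F (insert n I))"
proof -
  have fin: "finite I" if "I \<subseteq> {..<n}" for I and n :: nat
    using that finite_subset by blast
  have "{I. I \<subseteq> {..<n} \<and> card I = 0} = {{}}" using fin by (auto simp: card_eq_0_iff)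
  then show "(\<Sum>I | I \<subseteq> {..<n} \<and> card I = 0. F I) = F {}" by simp
  have "{I. I \<subseteq> {..<0::nat} \<and> card I = Suc p} = {}" by auto
  then show "(\<Sum>I | I \<subseteq> {..<0::nat} \<and> card I = Suc p. F I) = 0" by (simp only: sum.empty)
  have eq: "{I. I \<subseteq> {..<Suc n} \<and> card I = Suc p} =
      {I. I \<subseteq> {..<n} \<and> card I = Suc p} \<union> insert n ` {I. I \<subseteq> {..<n} \<and> card I = p}" (is "?L = ?A \<union> ?B")
  proof (intro equalityI subsetI)
    fix I assume I: "I \<in> ?L"
    show "I \<in> ?A \<union> ?B"
    proof (cases "n \<in> I")
      case True
      have "finite I" using I fin by blast
      then have "card (I - {n}) = p" using I True by simp
      moreover have "I - {n} \<subseteq> {..<n}" using I by (auto simp: less_Suc_eq)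
      ultimately show ?thesis using True by (intro UnI2 image_eqI[of _ _ "I - {n}"]) auto
    next
      case False
      then have "I \<subseteq> {..<n}" using I by (auto simp: less_Suc_eq)
      then show ?thesis using I by auto
    qed
  next
    fix I assume "I \<in> ?A \<union> ?B"
    moreover have "card (insert n J) = Suc (card J)" if "J \<subseteq> {..<n}" for J
      using that fin[OF that] by (subst card_insert_disjoint) auto
    ultimately show "I \<in> ?L" by (auto simp: less_Suc_eq)
  qed
  have "inj_on (insert n) {I. I \<subseteq> {..<n} \<and> card I = p}"
    by (rule inj_onI) (auto dest!: insert_ident[THEN iffD1, rotated 2])
  then show "(\<Sum>I | I \<subseteq> {..<Suc n} \<and> card I = Suc p. F I) =
      (\<Sum>I | I \<subseteq> {..<n} \<and> card I = Suc p. F I) + (\<Sum>I | I \<subseteq> {..<n} \<and> card I = p. F (insert n I))"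
    unfolding eq by (subst sum.union_disjoint) (auto simp: sum.reindex)
qed

lemma nths_frame7:
  "nths frame7 I = (if 0 \<in> I then [axis 1 1] else []) @ (if Suc 0 \<in> I then [axis 2 1] else []) @ (if Suc (Suc 0) \<in> I then [axis 3 1] else []) @ (if Suc (Suc (Suc 0)) \<in> I then [axis 4 1] else []) @ (if Suc (Suc (Suc (Suc 0))) \<in> I then [axis 5 1] else []) @ (if Suc (Suc (Suc (Suc (Suc 0)))) \<in> I then [axis 6 1] else []) @ (if Suc (Suc (Suc (Suc (Suc (Suc 0))))) \<in> I then [axis 7 1] else [])"
  unfolding frame7_def list.map nths_Cons nths_nil mem_Collect_eq append_Nil2 by (rule refl)

lemma nths_coframe7:
  "nths coframe7 I = (if 0 \<in> I then [oneform (\<lambda>v. v $ 1)] else []) @ (if Suc 0 \<in> I then [oneform (\<lambda>v. v $ 2)] else []) @ (if Suc (Suc 0) \<in> I then [oneform (\<lambda>v. v $ 3)] else []) @ (if Suc (Suc (Suc 0)) \<in> I then [oneform (\<lambda>v. v $ 4)] else []) @ (if Suc (Suc (Suc (Suc 0))) \<in> I then [oneform (\<lambda>v. v $ 5)] else []) @ (if Suc (Suc (Suc (Suc (Suc 0)))) \<in> I then [oneform (\<lambda>v. v $ 6)] else []) @ (if Suc (Suc (Suc (Suc (Suc (Suc 0))))) \<in> I then [oneform (\<lambda>v. v $ 7)] else [])"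
  unfolding coframe7_def list.map nths_Cons nths_nil mem_Collect_eq append_Nil2 by (rule refl)

lemma det4_swap:
  "det4 b a c d = - det4 a b c d" "det4 a c b d = - det4 a b c d" "det4 a b d c = - det4 a b c d"
  by (cases a; cases b; cases c; cases d; simp add: algebra_simps)+

text \<open>Only seven of the 35 triples carry a coefficient of \<open>phi0\<close>. The indices are
  ordered as in the monomials of \<open>\<omega>\<^sup>2/2 - dt \<and> \<Omega>\<^sub>2\<close>,
  with 1, 2, 3 for the \<open>\<eta>\<^sub>i\<^sup>-\<close>, 4 for the direction of
  \<open>dt\<close> and 5, 6, 7 for the \<open>\<eta>\<^sub>i\<^sup>+\<close>.\<close>

lemma hodge7_phi0:
  "hodge7 3 phi0 [a, b, c, d] = (let D = (\<lambda>i j k l. det4 (row4 (\<lambda>v. v $ i) a b c d) (row4 (\<lambda>v. v $ j) a b c d)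
      (row4 (\<lambda>v. v $ k) a b c d) (row4 (\<lambda>v. v $ l) a b c d)) in
     D 1 5 2 6 + D 1 5 3 7 + D 2 6 3 7 - D 4 5 6 7 + D 4 1 2 7 + D 4 2 3 5 + D 4 3 1 6)"
proof -
  have n: "{..<7} = {..<Suc (Suc (Suc (Suc (Suc (Suc (Suc 0))))))}" "(card I = 3) = (card I = Suc (Suc (Suc 0)))"
    for I :: "nat set" by (simp_all add: eval_nat_numeral)
  have p: "phi0 [axis i 1, axis j 1, axis k 1] = cross7 (axis i 1) (axis j 1) $ k" for i j k
    by (simp add: phi0_eq_cross7 inner_axis)
  define R where "R i = row4 (\<lambda>v. v $ i) a b c d" for i :: 7
  have D: "det4 (R 1) (R 5) (R 2) (R 6) = - det4 (R 1) (R 2) (R 5) (R 6)"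
    "det4 (R 1) (R 5) (R 3) (R 7) = - det4 (R 1) (R 3) (R 5) (R 7)"
    "det4 (R 2) (R 6) (R 3) (R 7) = - det4 (R 2) (R 3) (R 6) (R 7)"
    "det4 (R 4) (R 1) (R 2) (R 7) = det4 (R 1) (R 2) (R 4) (R 7)"
    "det4 (R 4) (R 2) (R 3) (R 5) = det4 (R 2) (R 3) (R 4) (R 5)"
    "det4 (R 4) (R 3) (R 1) (R 6) = - det4 (R 1) (R 3) (R 4) (R 6)"
    using det4_swap by metis+
  show ?thesis
    unfolding hodge7_def n sum_subsets_card Let_def R_def[symmetric] D
    apply (simp add: nths_frame7 p)
    apply (simp add: cross7_nth axis_def)
    apply (simp add: nths_coframe7 shuffle_sign_def wedge_list_rows R_def)
    done
qed

section \<open>Identities of the cross product\<close>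

lemma cross7_linear: "cross7 (x + y) v = cross7 x v + cross7 y v" "cross7 (c *\<^sub>R x) v = c *\<^sub>R cross7 x v"
    "cross7 v (x + y) = cross7 v x + cross7 v y" "cross7 v (c *\<^sub>R x) = c *\<^sub>R cross7 v x"
    "cross7 v x = - cross7 x v"
  by (simp_all add: vec_eq_iff forall_7 cross7_nth algebra_simps)

lemma cross7_norm: "cross7 u v \<bullet> cross7 u v = (u \<bullet> u) * (v \<bullet> v) - (u \<bullet> v)\<^sup>2"
  by (simp add: inner_7 cross7_nth power2_eq_square algebra_simps)

lemma cross7_cross7: "cross7 u (cross7 u v) = (u \<bullet> v) *\<^sub>R u - (u \<bullet> u) *\<^sub>R v"
  by (simp add: vec_eq_iff forall_7 inner_7 cross7_nth algebra_simps)

lemma cross7_swap: "cross7 u v \<bullet> w = cross7 v w \<bullet> u" "cross7 u v \<bullet> u = 0" "cross7 u v \<bullet> v = 0"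
  by (simp_all add: inner_7 cross7_nth algebra_simps)

lemma det4_last_column:
  "det4 (row4 f a b c d) (row4 g a b c d) (row4 h a b c d) (row4 k a b c d) =
    k d * det3 (row3 f a b c) (row3 g a b c) (row3 h a b c) - h d * det3 (row3 f a b c) (row3 g a b c) (row3 k a b c)
    + g d * det3 (row3 f a b c) (row3 h a b c) (row3 k a b c) - f d * det3 (row3 g a b c) (row3 h a b c) (row3 k a b c)"
  by (simp add: row4_def row3_def algebra_simps)

text \<open>Expressed by the cross product and the inner product alone, the dual form is visibly
  preserved by every isometry that preserves \<open>phi0\<close>.\<close>

lemma star_phi0_eq_cross7:
  "hodge7 3 phi0 [u, v, w, x] = - (cross7 u (cross7 v w) \<bullet> x + (u \<bullet> v) * (w \<bullet> x) - (u \<bullet> w) * (v \<bullet> x))"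
proof -
  define T where "T i j k = det3 (row3 (\<lambda>x. x $ i) u v w) (row3 (\<lambda>x. x $ j) u v w) (row3 (\<lambda>x. x $ k) u v w)" for i j k :: 7
  \<comment> \<open>The coefficients of the last argument \<open>x\<close>, obtained by expanding
    each of the seven determinants along its last column.\<close>
  define z :: "real^7" where "z = vector [- T 5 2 6 - T 5 3 7 + T 4 2 7 - T 4 3 6, - T 1 5 6 - T 6 3 7 - T 4 1 7 + T 4 3 5, - T 1 5 7 - T 2 6 7 - T 4 2 5 + T 4 1 6, T 5 6 7 - T 1 2 7 - T 2 3 5 - T 3 1 6, T 1 2 6 + T 1 3 7 - T 4 6 7 + T 4 2 3, T 1 5 2 + T 2 3 7 + T 4 5 7 + T 4 3 1, T 1 5 3 + T 2 6 3 - T 4 5 6 + T 4 1 2]"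
  have "hodge7 3 phi0 [u, v, w, x] = z \<bullet> x"
    unfolding hodge7_phi0 Let_def det4_last_column T_def[symmetric] inner_7 z_def vector_7
    by (simp add: algebra_simps)
  also have "z = - (cross7 u (cross7 v w) + (u \<bullet> v) *\<^sub>R w - (u \<bullet> w) *\<^sub>R v)"
    unfolding vec_eq_iff forall_7 z_def vector_7 T_def row3_def det3.simps inner_7
    by (intro conjI) (simp_all add: cross7_nth algebra_simps)
  finally show ?thesis by (simp add: inner_diff_left inner_add_left)
qed

lemma cross7_minus: "cross7 v (- x) = - cross7 v x"
  using cross7_linear(4)[of v "-1" x] by simp

lemma cross7_polarized:
  "cross7 u (cross7 v y) = - cross7 v (cross7 u y) + (u \<bullet> y) *\<^sub>R v + (v \<bullet> y) *\<^sub>R u - (2 * (u \<bullet> v)) *\<^sub>R y"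
  by (simp add: vec_eq_iff forall_7 inner_7 cross7_nth algebra_simps)

lemma cross7_inner_cross7:
  "cross7 u x \<bullet> cross7 v x = (u \<bullet> v) * (x \<bullet> x) - (u \<bullet> x) * (v \<bullet> x)"
  by (simp add: inner_7 cross7_nth algebra_simps)

text \<open>\<open>eigen F u \<mu>\<close> says that \<open>u\<close> is an eigenvector of \<open>F\<^sup>TF\<close> with eigenvalue \<open>\<mu>\<close>.\<close>

definition eigen :: "(real^7 \<Rightarrow> real^7) \<Rightarrow> real^7 \<Rightarrow> real \<Rightarrow> bool" where
  "eigen F u \<mu> \<longleftrightarrow> (\<forall>y. F u \<bullet> F y = \<mu> * (u \<bullet> y))"

text \<open>The aim is that \<open>F\<close> is an isometry and preserves
  \<open>hodge7 3 phi0\<close>, which makes \<open>star_phi\<close> independent of the chosen frame.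
  The metric is recovered by comparing the eigenvalues of \<open>F\<^sup>TF\<close> on vectors
  related by the cross product.\<close>

locale phi0_preserving =
  fixes F :: "real^7 \<Rightarrow> real^7"
  assumes linear: "linear F" and bij: "bij F"
    and pres: "\<And>u v w. phi0 [F u, F v, F w] = phi0 [u, v, w]"
begin

lemma cross_pres: "cross7 (F u) (F v) \<bullet> F y = cross7 u v \<bullet> y"
  using pres by (simp add: phi0_eq_cross7)

text \<open>The preimage \<open>n\<close> of \<open>cross7 (F u) (F v)\<close> is pinned down by two
  facts: it is orthogonal to \<open>u\<close>, and
  \<open>cross7 n u = (\<mu> * \<nu>) *\<^sub>R v\<close>, because a double product with
  \<open>F u\<close> returns \<open>- \<mu>\<close> times \<open>F v\<close>. Hence \<open>n\<close>
  is \<open>\<mu> * \<nu>\<close> times \<open>cross7 u v\<close>.\<close>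

lemma eigen_cross7:
  assumes u: "u \<bullet> u = 1" "eigen F u \<mu>" and v: "v \<bullet> v = 1" "eigen F v \<nu>" and uv: "u \<bullet> v = 0"
    and pos: "\<mu> > 0" "\<nu> > 0"
  shows "eigen F (cross7 u v) (1 / (\<mu> * \<nu>))"
proof -
  obtain n where n: "F n = cross7 (F u) (F v)" using bij by (metis bij_pointE)
  have Fu: "F u \<bullet> F u = \<mu>" "F u \<bullet> F v = 0" using u uv by (auto simp: eigen_def)
  have "cross7 (F n) (F u) = - cross7 (F u) (cross7 (F u) (F v))"
    using cross7_linear(5) n by metis
  then have "cross7 (F n) (F u) = \<mu> *\<^sub>R F v" by (simp add: cross7_cross7 Fu)
  then have "cross7 n u \<bullet> y = ((\<mu> * \<nu>) *\<^sub>R v) \<bullet> y" for y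
    using cross_pres[of n u y] v(2) by (simp add: eigen_def)
  then have nu: "cross7 n u = (\<mu> * \<nu>) *\<^sub>R v" using vector_eq_ldot by (metis inner_commute)
  have "\<mu> * (u \<bullet> n) = F u \<bullet> F n" using u(2) by (simp add: eigen_def)
  also have "\<dots> = 0" unfolding n using cross7_swap(2) by (metis inner_commute)
  finally have "u \<bullet> n = 0" using pos by simp
  then have "n = - cross7 u (cross7 u n)" using u(1) by (simp add: cross7_cross7)
  also have "cross7 u n = (- (\<mu> * \<nu>)) *\<^sub>R v" using nu cross7_linear(5)[of u n] by simp
  finally have "n = (\<mu> * \<nu>) *\<^sub>R cross7 u v" by (simp add: cross7_linear(4) cross7_minus)
  then have "F n = (\<mu> * \<nu>) *\<^sub>R F (cross7 u v)" using linear_scale[OF linear] by simp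
  then have "F (cross7 u v) = (1 / (\<mu> * \<nu>)) *\<^sub>R F n" using pos by simp
  then show ?thesis using cross_pres by (simp add: eigen_def n)
qed

text \<open>For such a triple, \<open>cross7 (cross7 u x) (cross7 v x) = - cross7 u v\<close>. Two
  applications of \<open>eigen_cross7\<close> thus give two values for the eigenvalue of
  \<open>cross7 u v\<close>, and comparing them yields
  \<open>(\<mu> * \<nu> * \<xi>)\<^sup>2 = 1\<close>.\<close>

lemma eigenvalue_product:
  assumes u: "u \<bullet> u = 1" "eigen F u \<mu>" "\<mu> > 0" and v: "v \<bullet> v = 1" "eigen F v \<nu>" "\<nu> > 0"
    and x: "x \<bullet> x = 1" "eigen F x \<xi>" "\<xi> > 0"
    and orth: "u \<bullet> v = 0" "u \<bullet> x = 0" "v \<bullet> x = 0" "cross7 u v \<bullet> x = 0"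
  shows "\<mu> * \<nu> * \<xi> = 1"
proof -
  define w where "w = cross7 u v"
  define a where "a = cross7 u x"
  define b where "b = cross7 v x"
  have eig: "eigen F w (1 / (\<mu> * \<nu>))" "eigen F a (1 / (\<mu> * \<xi>))" "eigen F b (1 / (\<nu> * \<xi>))"
    unfolding w_def a_def b_def using u v x orth by (intro eigen_cross7; simp)+
  have norms: "w \<bullet> w = 1" "a \<bullet> a = 1" "b \<bullet> b = 1" "a \<bullet> b = 0"
    using u v x orth by (simp_all add: w_def a_def b_def cross7_norm cross7_inner_cross7)
  have av: "a \<bullet> v = 0"
    using orth(4) cross7_swap(1)[of u v x] cross7_swap(1)[of v x u] cross7_swap(1)[of u x v]
      cross7_linear(5)[of v x] unfolding a_def by simp
  have ax: "a \<bullet> x = 0" by (simp add: a_def cross7_swap)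
  have "cross7 a b = - cross7 a (cross7 x v)"
    unfolding b_def using cross7_linear(5)[of x v] cross7_linear(4)[of a "-1"] by simp
  also have "cross7 a (cross7 x v) = - cross7 x (cross7 a v)"
    using cross7_polarized[of a x v] av ax orth by (simp add: inner_commute)
  also have "cross7 a v = - cross7 v (cross7 u x)"
    unfolding a_def by (rule cross7_linear(5))
  also have "cross7 v (cross7 u x) = - cross7 v (cross7 x u)"
    using cross7_linear(5)[of x u] cross7_linear(4)[of v "-1"] by simp
  also have "cross7 v (cross7 x u) = - cross7 x (cross7 v u)"
    using cross7_polarized[of v x u] orth by (simp add: inner_commute)
  also have "cross7 v u = - w" unfolding w_def by (rule cross7_linear(5))
  finally have "cross7 a b = cross7 x (cross7 x w)"
    using cross7_linear(4)[of x "-1"] by simp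
  also have "\<dots> = - w" using orth x(1) by (simp add: cross7_cross7 w_def inner_commute)
  finally have ab: "cross7 a b = - w" .
  have "eigen F (cross7 a b) (1 / ((1 / (\<mu> * \<xi>)) * (1 / (\<nu> * \<xi>))))"
    using eig norms u v x by (intro eigen_cross7) auto
  then have "F (- w) \<bullet> F (- w) = \<mu> * \<xi> * (\<nu> * \<xi>)" unfolding ab eigen_def using norms by simp
  moreover have "F w \<bullet> F w = 1 / (\<mu> * \<nu>)" using eig(1) norms by (simp add: eigen_def)
  ultimately have "\<mu> * \<xi> * (\<nu> * \<xi>) = 1 / (\<mu> * \<nu>)" using linear_neg[OF linear] by simp
  then have "(\<mu> * \<nu> * \<xi>)\<^sup>2 = 1" using u(3) v(3) by (simp add: field_simps power2_eq_square)
  moreover have "\<mu> * \<nu> * \<xi> > 0" using u v x by simp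
  ultimately show ?thesis by (simp add: power2_eq_1_iff)
qed

text \<open>One step of the spectral theorem: minimise \<open>F y \<bullet> F y\<close> on the unit
  sphere of the orthogonal complement of \<open>W\<close>. Since \<open>W\<close> consists of
  eigenvectors, stationarity within the complement is stationarity in all directions;
  \<open>card W < 7\<close> keeps the sphere non-empty.\<close>

lemma exists_eigen:
  assumes W: "finite W" "card W < 7" "\<And>w. w \<in> W \<Longrightarrow> w \<bullet> w = 1" "\<And>w w'. w \<in> W \<Longrightarrow> w' \<in> W \<Longrightarrow> w \<noteq> w' \<Longrightarrow> w \<bullet> w' = 0"
    "\<And>w. w \<in> W \<Longrightarrow> \<exists>\<mu>. eigen F w \<mu>"
  shows "\<exists>u \<mu>. u \<bullet> u = 1 \<and> (\<forall>w\<in>W. u \<bullet> w = 0) \<and> \<mu> > 0 \<and> eigen F u \<mu> \<and>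
    (\<forall>y. (\<forall>w\<in>W. y \<bullet> w = 0) \<longrightarrow> \<mu> * (y \<bullet> y) \<le> F y \<bullet> F y)"
proof -
  define S where "S = sphere 0 1 \<inter> {y. \<forall>w\<in>W. y \<bullet> w = 0}"
  have "closed {y. \<forall>w\<in>W. y \<bullet> w = 0}"
  proof -
    have "{y. \<forall>w\<in>W. y \<bullet> w = 0} = (\<Inter>w\<in>W. {y. y \<bullet> w = 0})" by auto
    also have "closed \<dots>" by (intro closed_INT ballI closed_Collect_eq continuous_intros)
    finally show ?thesis .
  qed
  then have "compact S" unfolding S_def by (intro compact_Int_closed) auto
  have "dim (span W) < DIM(real^7)" using dim_le_card'[OF W(1)] W(2) by simp
  then obtain z where z: "z \<noteq> 0" "\<And>y. y \<in> span W \<Longrightarrow> orthogonal z y"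
    using orthogonal_to_subspace_exists by (metis dim_span)
  then have "sgn z \<in> S" by (auto simp: S_def norm_sgn sgn_div_norm orthogonal_def span_base)
  moreover have "continuous_on S (\<lambda>y. F y \<bullet> F y)"
    by (intro continuous_intros linear_continuous_on linear_conv_bounded_linear[THEN iffD1] linear)
  ultimately obtain u where u: "u \<in> S" "\<And>y. y \<in> S \<Longrightarrow> F u \<bullet> F u \<le> F y \<bullet> F y"
    using continuous_attains_inf[OF \<open>compact S\<close>] by blast
  define \<mu> where "\<mu> = F u \<bullet> F u"
  have uu: "u \<bullet> u = 1" "u \<noteq> 0" using u(1) by (auto simp: S_def norm_eq_1)
  have "F u \<noteq> 0" using bij linear_0[OF linear] uu(2) by (metis bij_pointE)
  then have \<mu>: "\<mu> > 0" by (simp add: \<mu>_def)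
  have min: "\<mu> * (y \<bullet> y) \<le> F y \<bullet> F y" if y: "\<forall>w\<in>W. y \<bullet> w = 0" for y
  proof (cases "y = 0")
    case False
    then have "sgn y \<in> S" using y by (simp add: S_def norm_sgn sgn_div_norm)
    then have "\<mu> \<le> F (sgn y) \<bullet> F (sgn y)" using u(2) by (simp add: \<mu>_def)
    also have "\<dots> = (F y \<bullet> F y) / (norm y)\<^sup>2"
      by (simp add: sgn_div_norm linear_scale[OF linear] power2_eq_square divide_inverse)
    finally have "\<mu> * (norm y)\<^sup>2 \<le> F y \<bullet> F y" using False by (simp add: pos_le_divide_eq)
    then show ?thesis by (simp only: power2_norm_eq_inner)
  qed (simp add: linear_0[OF linear])
  have perp: "F u \<bullet> F y = 0" if y: "\<forall>w\<in>W. y \<bullet> w = 0" "y \<bullet> u = 0" for y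
  proof -
    define p where "p = F u \<bullet> F y"
    define q where "q = F y \<bullet> F y - \<mu> * (y \<bullet> y)"
    have "0 \<le> 2 * s * p + s\<^sup>2 * q" for s
    proof -
      have "\<forall>w\<in>W. (u + s *\<^sub>R y) \<bullet> w = 0" using u(1) y by (auto simp: S_def inner_add_left)
      from min[OF this] show ?thesis
        using uu y(2) by (simp add: linear_add[OF linear] linear_scale[OF linear] inner_add_left inner_add_right
          p_def q_def \<mu>_def[symmetric] inner_commute power2_eq_square algebra_simps)
    qed
    \<comment> \<open>The quadratic \<open>2 * s * p + s\<^sup>2 * q\<close> is non-negative for all
      \<open>s\<close>, but at \<open>s = - p / K\<close> it is at most
      \<open>- (p\<^sup>2 / K)\<close>, which forces \<open>p = 0\<close>. The \<open>+ 1\<close>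
      keeps \<open>K\<close> positive.\<close>
    define K where "K = \<bar>q\<bar> + 1"
    have K: "K > 0" "q \<le> K" by (auto simp: K_def)
    have "0 \<le> 2 * (- p / K) * p + (- p / K)\<^sup>2 * q" by fact
    also have "(- p / K)\<^sup>2 * q \<le> (- p / K)\<^sup>2 * K" using K by (intro mult_left_mono) auto
    also have "2 * (- p / K) * p + (- p / K)\<^sup>2 * K = - (p\<^sup>2 / K)"
      using K by (simp add: power2_eq_square field_simps)
    finally have "p\<^sup>2 / K \<le> 0" by simp
    then have "p\<^sup>2 \<le> 0" using K by (simp add: divide_le_0_iff)
    then show ?thesis by (simp add: p_def)
  qed
  have "F u \<bullet> F y = \<mu> * (u \<bullet> y)" for y
  proof -
    define y' where "y' = y - (\<Sum>w\<in>W. (y \<bullet> w) *\<^sub>R w) - (y \<bullet> u) *\<^sub>R u"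
    have uw: "u \<bullet> w = 0" if "w \<in> W" for w using u(1) that by (auto simp: S_def)
    have s: "(\<Sum>w\<in>W. (y \<bullet> w) *\<^sub>R w) \<bullet> w' = y \<bullet> w'" if "w' \<in> W" for w'
    proof -
      have "(\<Sum>w\<in>W. (y \<bullet> w) *\<^sub>R w) \<bullet> w' = (\<Sum>w\<in>W. if w = w' then y \<bullet> w' else 0)"
        unfolding inner_sum_left using W(3,4) that by (intro sum.cong) auto
      then show ?thesis using that W(1) by simp
    qed
    have s': "(\<Sum>w\<in>W. (y \<bullet> w) *\<^sub>R w) \<bullet> u = 0"
      unfolding inner_sum_left using uw by (intro sum.neutral) (auto simp: inner_commute)
    have "F u \<bullet> F y' = 0"
    proof (rule perp)
      show "\<forall>w\<in>W. y' \<bullet> w = 0" using s uw by (simp add: y'_def inner_diff_left)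
      show "y' \<bullet> u = 0" using s' uu by (simp add: y'_def inner_diff_left)
    qed
    moreover have "F u \<bullet> F (\<Sum>w\<in>W. (y \<bullet> w) *\<^sub>R w) = 0"
    proof -
      have "F u \<bullet> F w = 0" if "w \<in> W" for w
        using W(5)[OF that] uw[OF that] by (auto simp: eigen_def inner_commute)
      then show ?thesis
        by (simp add: linear_sum[OF linear] linear_scale[OF linear] inner_sum_right)
    qed
    moreover have "F y' = F y - F (\<Sum>w\<in>W. (y \<bullet> w) *\<^sub>R w) - (y \<bullet> u) *\<^sub>R F u"
      by (simp add: y'_def linear_diff[OF linear] linear_scale[OF linear])
    ultimately show ?thesis by (simp add: inner_diff_right \<mu>_def inner_commute)
  qed
  then show ?thesis using u(1) uu \<mu> min by (intro exI[of _ u] exI[of _ \<mu>]) (auto simp: S_def eigen_def)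
qed

text \<open>Let \<open>u\<close> realise the least eigenvalue, \<open>v\<close> be a further
  eigenvector, \<open>w\<close> their cross product and \<open>x\<close> an eigenvector orthogonal
  to all three. \<open>eigenvalue_product\<close> applied to \<open>x\<close> and any two of
  \<open>u\<close>, \<open>v\<close>, \<open>w\<close> makes the eigenvalues of these three equal;
  their product is 1 by \<open>eigen_cross7\<close>, so the least eigenvalue is 1. The same bound
  for the inverse turns this into an equality.\<close>

lemma norm_le: "y \<bullet> y \<le> F y \<bullet> F y"
proof -
  obtain u \<mu> where u: "u \<bullet> u = 1" "\<mu> > 0" "eigen F u \<mu>" and min: "\<And>y. \<mu> * (y \<bullet> y) \<le> F y \<bullet> F y"
    using exists_eigen[of "{}"] by auto
  have "\<exists>v \<nu>. v \<bullet> v = 1 \<and> (\<forall>w\<in>{u}. v \<bullet> w = 0) \<and> \<nu> > 0 \<and> eigen F v \<nu> \<and>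
    (\<forall>y. (\<forall>w\<in>{u}. y \<bullet> w = 0) \<longrightarrow> \<nu> * (y \<bullet> y) \<le> F y \<bullet> F y)"
    using u by (intro exists_eigen) auto
  then obtain v \<nu> where v: "v \<bullet> v = 1" "u \<bullet> v = 0" "\<nu> > 0" "eigen F v \<nu>" by (auto simp: inner_commute)
  define w where "w = cross7 u v"
  define \<kappa> where "\<kappa> = 1 / (\<mu> * \<nu>)"
  have w: "w \<bullet> w = 1" "eigen F w \<kappa>" "\<kappa> > 0"
    using u v eigen_cross7[OF u(1,3) v(1,4,2) u(2) v(3)] cross7_norm[of u v]
    by (simp_all add: w_def \<kappa>_def)
  have uw: "u \<bullet> w = 0" "v \<bullet> w = 0"
    using cross7_swap(2,3)[of u v] unfolding w_def by (metis inner_commute)+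
  have "card {u, v, w} < 7" by (simp add: card_insert_if)
  then have "\<exists>x \<xi>. x \<bullet> x = 1 \<and> (\<forall>y\<in>{u, v, w}. x \<bullet> y = 0) \<and> \<xi> > 0 \<and> eigen F x \<xi> \<and>
    (\<forall>y. (\<forall>z\<in>{u, v, w}. y \<bullet> z = 0) \<longrightarrow> \<xi> * (y \<bullet> y) \<le> F y \<bullet> F y)"
    using u v w uw by (intro exists_eigen) (auto simp: inner_commute)
  then obtain x \<xi> where x: "x \<bullet> x = 1" "u \<bullet> x = 0" "v \<bullet> x = 0" "w \<bullet> x = 0" "\<xi> > 0" "eigen F x \<xi>"
    by (auto simp: inner_commute)
  have "cross7 u w = - v" unfolding w_def using u v by (simp add: cross7_cross7)
  moreover have "cross7 v w = u"
  proof -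
    have "cross7 v w = - cross7 v (cross7 v u)"
      unfolding w_def using cross7_linear(5)[of u v] cross7_linear(4)[of v "-1"] by simp
    then show ?thesis using u v by (simp add: cross7_cross7 inner_commute)
  qed
  ultimately have prods: "\<mu> * \<nu> * \<xi> = 1" "\<mu> * \<kappa> * \<xi> = 1" "\<nu> * \<kappa> * \<xi> = 1"
    using u v w uw x eigenvalue_product[of u \<mu> v \<nu> x \<xi>] eigenvalue_product[of u \<mu> w \<kappa> x \<xi>]
      eigenvalue_product[of v \<nu> w \<kappa> x \<xi>] by (simp_all add: w_def)
  then have "(\<mu> * \<xi>) * \<nu> = (\<mu> * \<xi>) * \<kappa>" "(\<kappa> * \<xi>) * \<mu> = (\<kappa> * \<xi>) * \<nu>" by (simp_all add: mult_ac)
  then have "\<nu> = \<kappa>" "\<mu> = \<nu>" using u(2) w(3) x(5) by simp_all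
  then have "\<mu> = 1 / (\<mu> * \<mu>)" by (simp add: \<kappa>_def)
  then have "\<mu> ^ 3 = 1 ^ 3" using u(2) by (simp add: field_simps power3_eq_cube)
  then have "\<mu> = 1" using u(2) by (subst (asm) power_eq_iff_eq_base) auto
  then show ?thesis using min[of y] by simp
qed

lemma inverse_preserving: "phi0_preserving (inv F)"
proof -
  have "linear (inv F)"
  proof (rule linearI)
    show "inv F (x + y) = inv F x + inv F y" "inv F (c *\<^sub>R x) = c *\<^sub>R inv F x" for x y c
      using bij by (intro inv_f_eq; simp add: bij_is_inj linear_add[OF linear] linear_scale[OF linear]
          surj_f_inv_f bij_is_surj)+
  qed
  moreover have "bij (inv F)" using bij by (rule bij_imp_bij_inv)
  moreover have "phi0 [inv F u, inv F v, inv F w] = phi0 [u, v, w]" for u v w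
    using pres[of "inv F u" "inv F v" "inv F w"] bij by (simp add: surj_f_inv_f bij_is_surj)
  ultimately show ?thesis by (rule phi0_preserving.intro)
qed

lemma inner_pres: "F x \<bullet> F y = x \<bullet> y"
proof -
  have n: "F y \<bullet> F y = y \<bullet> y" for y
    using norm_le[of y] phi0_preserving.norm_le[OF inverse_preserving, of "F y"] bij
    by (simp add: bij_is_inj inv_f_f)
  have "F (x + y) \<bullet> F (x + y) = (x + y) \<bullet> (x + y)" by (rule n)
  then show ?thesis by (simp add: linear_add[OF linear] inner_add_left inner_add_right n inner_commute)
qed

lemma star_phi0_pres:
  assumes "length vs = 4"
  shows "hodge7 3 phi0 (map F vs) = hodge7 3 phi0 vs"
proof -
  have c: "cross7 (F u) (F v) = F (cross7 u v)" for u v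
  proof -
    obtain z where z: "cross7 (F u) (F v) = F z" using bij by (metis bij_pointE)
    have "z \<bullet> y = cross7 u v \<bullet> y" for y using cross_pres[of u v y] by (simp add: z inner_pres)
    then show ?thesis using z vector_eq_rdot by metis
  qed
  obtain a b d e where "vs = [a, b, d, e]"
    using assms by (auto simp: length_Suc_conv eval_nat_numeral)
  then show ?thesis by (simp add: star_phi0_eq_cross7 c inner_pres)
qed

end

text \<open>The transition map between two adapted frames preserves \<open>phi0\<close> and
  therefore \<open>hodge7 3 phi0\<close>, so the frame picked by \<open>SOME\<close> may be replaced
  by any convenient one.\<close>

lemma star_phi_adapted:
  assumes F: "adapted_frame r \<phi> x F" and vs: "length vs = 4" "set vs \<subseteq> tangent r x"
  shows "star_phi r \<phi> x vs = hodge7 3 phi0 (map (inv F) vs)"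
proof -
  define F' where "F' = (SOME F. adapted_frame r \<phi> x F)"
  have F': "adapted_frame r \<phi> x F'" unfolding F'_def using F by (rule someI[where P = "adapted_frame r \<phi> x"])
  define L where "L u = inv F' (F u)" for u
  have inj: "inj F" "inj F'" and range: "range F = tangent r x" "range F' = tangent r x"
    and lin: "linear F" "linear F'"
    using F F' by (auto simp: adapted_frame_def bij_betw_def)
  have F'L: "F' (L u) = F u" for u
    unfolding L_def by (rule f_inv_into_f) (use range in blast)
  interpret phi0_preserving L
  proof (rule phi0_preserving.intro)
    show "linear L"
      by (rule linearI; rule injD[OF inj(2)])
        (simp_all add: F'L linear_add[OF lin(2)] linear_scale[OF lin(2)] linear_add[OF lin(1)] linear_scale[OF lin(1)])
    have "inj L" by (rule injI) (metis F'L inj(1) injD)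
    moreover have "surj L"
    proof (rule surjI[of _ "\<lambda>v. inv F (F' v)"])
      fix v
      have "F (inv F (F' v)) = F' v" by (rule f_inv_into_f) (use range in blast)
      then show "L (inv F (F' v)) = v" using F'L inj(2) injD by metis
    qed
    ultimately show "bij L" by (simp add: bij_def)
    show "phi0 [L u, L v, L w] = phi0 [u, v, w]" for u v w
    proof -
      have "\<phi> x (map F' [L u, L v, L w]) = phi0 [L u, L v, L w]"
        by (rule F'[unfolded adapted_frame_def, THEN conjunct2, THEN conjunct2, rule_format]) simp
      moreover have "\<phi> x (map F [u, v, w]) = phi0 [u, v, w]"
        by (rule F[unfolded adapted_frame_def, THEN conjunct2, THEN conjunct2, rule_format]) simp
      ultimately show ?thesis by (simp add: F'L)
    qed
  qed
  have "map (inv F') vs = map L (map (inv F) vs)"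
  proof -
    have "inv F' v = L (inv F v)" if "v \<in> set vs" for v
    proof -
      have "F (inv F v) = v" by (rule f_inv_into_f) (use range vs that in blast)
      then show ?thesis by (simp add: L_def)
    qed
    then show ?thesis by simp
  qed
  moreover have "hodge7 3 phi0 (map L (map (inv F) vs)) = hodge7 3 phi0 (map (inv F) vs)"
    by (rule star_phi0_pres) (simp add: vs(1))
  ultimately show ?thesis by (simp only: star_phi_def F'_def[symmetric] Let_def)
qed

section \<open>Exterior derivatives of 4-forms\<close>

text \<open>A product rule for a linear form applied to a moving vector, where the form is known to
  be differentiable only against fixed vectors. Expansion in the standard basis reduces it to
  products of real functions.\<close>

lemma has_derivative_slot:
  fixes n :: "'a::real_normed_vector \<Rightarrow> 'b::euclidean_space \<Rightarrow> real"
  assumes S: "open S" "x \<in> S" and lin: "\<And>y. y \<in> S \<Longrightarrow> linear (n y)"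
    and N: "\<And>u. ((\<lambda>y. n y u) has_derivative N u) (at x)" and U: "(U has_derivative U') (at x)"
  shows "((\<lambda>y. n y (U y)) has_derivative (\<lambda>w. N (U x) w + n x (U' w))) (at x)"
proof -
  have rep: "n y u = (\<Sum>b\<in>Basis. (u \<bullet> b) * n y b)" if "y \<in> S" for y u
  proof -
    have "n y u = n y (\<Sum>b\<in>Basis. (u \<bullet> b) *\<^sub>R b)" by (simp add: euclidean_representation)
    then show ?thesis by (simp only: linear_sum[OF lin[OF that]] linear_scale[OF lin[OF that]] real_scaleR_def)
  qed
  have "((\<lambda>y. \<Sum>b\<in>Basis. (U x \<bullet> b) * n y b) has_derivative (\<lambda>w. \<Sum>b\<in>Basis. (U x \<bullet> b) * N b w)) (at x)"
    by (intro has_derivative_sum has_derivative_mult_right N)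
  then have "((\<lambda>y. n y (U x)) has_derivative (\<lambda>w. \<Sum>b\<in>Basis. (U x \<bullet> b) * N b w)) (at x)"
    by (rule has_derivative_transform_within_open[OF _ S]) (simp add: rep[of _ "U x"])
  then have NU: "N (U x) = (\<lambda>w. \<Sum>b\<in>Basis. (U x \<bullet> b) * N b w)"
    using N has_derivative_unique by blast
  have "((\<lambda>y. \<Sum>b\<in>Basis. (U y \<bullet> b) * n y b) has_derivative
      (\<lambda>w. \<Sum>b\<in>Basis. (U x \<bullet> b) * N b w + (U' w \<bullet> b) * n x b)) (at x)"
    by (intro has_derivative_sum has_derivative_mult N has_derivative_inner_left U)
  then have "((\<lambda>y. n y (U y)) has_derivative
      (\<lambda>w. \<Sum>b\<in>Basis. (U x \<bullet> b) * N b w + (U' w \<bullet> b) * n x b)) (at x)"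
    by (rule has_derivative_transform_within_open[OF _ S]) (simp add: rep[of _ "U _"])
  moreover have "(\<Sum>b\<in>Basis. (U x \<bullet> b) * N b w + (U' w \<bullet> b) * n x b) = N (U x) w + n x (U' w)" for w
    by (simp add: NU rep[OF S(2), of "U' w"] sum.distrib)
  ultimately show ?thesis by simp
qed

text \<open>Linearity is stated for the first slot; the adjacent transpositions carry it to the
  others, see \<open>alt4_linear\<close>.\<close>

definition alt4 :: "('v::real_vector list \<Rightarrow> real) \<Rightarrow> bool" where
  "alt4 f \<longleftrightarrow> (\<forall>b c d. linear (\<lambda>a. f [a, b, c, d])) \<and>
     (\<forall>a b c d. f [b, a, c, d] = - f [a, b, c, d] \<and> f [a, c, b, d] = - f [a, b, c, d] \<and>
        f [a, b, d, c] = - f [a, b, c, d])"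

lemma alt4_swap:
  assumes "alt4 f"
  shows "f [b, a, c, d] = - f [a, b, c, d]" "f [a, c, b, d] = - f [a, b, c, d]"
    "f [a, b, d, c] = - f [a, b, c, d]"
  using assms unfolding alt4_def by blast+

lemma alt4_move:
  assumes "alt4 f"
  shows "f [a, s, c, d] = - f [s, a, c, d]" "f [a, b, s, d] = f [s, a, b, d]" "f [a, b, c, s] = - f [s, a, b, c]"
proof -
  note s = alt4_swap[OF assms]
  show "f [a, s, c, d] = - f [s, a, c, d]" by (rule s)
  show "f [a, b, s, d] = f [s, a, b, d]" using s(2)[of a b s d] s(1)[of a s b d] by simp
  show "f [a, b, c, s] = - f [s, a, b, c]" using s(3)[of a b c s] s(2)[of a b s c] s(1)[of a s b c] by simp
qed

lemma alt4_linear: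
  assumes "alt4 f"
  shows "linear (\<lambda>a. f [a, b, c, d])" "linear (\<lambda>a. f [b, a, c, d])"
    "linear (\<lambda>a. f [b, c, a, d])" "linear (\<lambda>a. f [b, c, d, a])"
proof -
  have l: "linear (\<lambda>a. f [a, b, c, d])" for b c d
    using assms unfolding alt4_def by blast
  have e: "(\<lambda>a. f [b, a, c, d]) = (\<lambda>a. - f [a, b, c, d])"
    by (rule ext) (rule alt4_move(1)[OF assms])
  have e2: "(\<lambda>a. f [b, c, a, d]) = (\<lambda>a. f [a, b, c, d])"
    by (rule ext) (rule alt4_move(2)[OF assms])
  have e3: "(\<lambda>a. f [b, c, d, a]) = (\<lambda>a. - f [a, b, c, d])"
    by (rule ext) (rule alt4_move(3)[OF assms])
  show "linear (\<lambda>a. f [a, b, c, d])" by (rule l)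
  show "linear (\<lambda>a. f [b, a, c, d])" by (subst e) (rule linear_compose_neg[OF l])
  show "linear (\<lambda>a. f [b, c, a, d])" by (subst e2) (rule l)
  show "linear (\<lambda>a. f [b, c, d, a])" by (subst e3) (rule linear_compose_neg[OF l])
qed

lemma alt4_compose_linear:
  assumes "alt4 f" "linear L"
  shows "alt4 (\<lambda>vs. f (map L vs))"
  unfolding alt4_def list.map
proof (intro conjI allI)
  show "linear (\<lambda>a. f [L a, L b, L c, L d])" for b c d
    using linear_compose[OF assms(2) alt4_linear(1)[OF assms(1)]] by (simp add: o_def)
qed (rule alt4_swap[OF assms(1)])+

lemma has_derivative_slots4:
  fixes \<mu> :: "'p::real_normed_vector \<Rightarrow> 'b::euclidean_space list \<Rightarrow> real" and \<Psi> :: "'a::real_normed_vector \<Rightarrow> 'p"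
  assumes S: "open S" "x \<in> S" and alt: "\<And>y. y \<in> S \<Longrightarrow> alt4 (\<mu> (\<Psi> y))"
    and M: "\<And>us. length us = 4 \<Longrightarrow> ((\<lambda>z. \<mu> z us) has_derivative M us) (at (\<Psi> x))"
    and \<Psi>: "(\<Psi> has_derivative D\<Psi>) (at x)"
    and a: "(a has_derivative a') (at x)" and b: "(b has_derivative b') (at x)"
    and c: "(c has_derivative c') (at x)" and d: "(d has_derivative d') (at x)"
  shows "((\<lambda>y. \<mu> (\<Psi> y) [a y, b y, c y, d y]) has_derivative
    (\<lambda>w. M [a x, b x, c x, d x] (D\<Psi> w) + \<mu> (\<Psi> x) [a' w, b x, c x, d x] + \<mu> (\<Psi> x) [a x, b' w, c x, d x]
      + \<mu> (\<Psi> x) [a x, b x, c' w, d x] + \<mu> (\<Psi> x) [a x, b x, c x, d' w])) (at x)"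
proof -
  note lin = alt4_linear[OF alt]
  have 0: "((\<lambda>y. \<mu> (\<Psi> y) [p, q, r, s]) has_derivative (\<lambda>w. M [p, q, r, s] (D\<Psi> w))) (at x)" for p q r s
    by (rule has_derivative_compose[OF \<Psi> M]) simp
  have 1: "((\<lambda>y. \<mu> (\<Psi> y) [a y, q, r, s]) has_derivative
      (\<lambda>w. M [a x, q, r, s] (D\<Psi> w) + \<mu> (\<Psi> x) [a' w, q, r, s])) (at x)" for q r s
    by (rule has_derivative_slot[OF S lin(1) 0 a])
  have 2: "((\<lambda>y. \<mu> (\<Psi> y) [a y, b y, r, s]) has_derivative
      (\<lambda>w. M [a x, b x, r, s] (D\<Psi> w) + \<mu> (\<Psi> x) [a' w, b x, r, s] + \<mu> (\<Psi> x) [a x, b' w, r, s])) (at x)" for r s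
    by (rule has_derivative_slot[OF S lin(2) 1 b])
  have 3: "((\<lambda>y. \<mu> (\<Psi> y) [a y, b y, c y, s]) has_derivative
      (\<lambda>w. M [a x, b x, c x, s] (D\<Psi> w) + \<mu> (\<Psi> x) [a' w, b x, c x, s] + \<mu> (\<Psi> x) [a x, b' w, c x, s]
        + \<mu> (\<Psi> x) [a x, b x, c' w, s])) (at x)" for s
    by (rule has_derivative_slot[OF S lin(3) 2 c])
  show ?thesis by (rule has_derivative_slot[OF S lin(4) 3 d])
qed

lemma ext_deriv_4:
  "ext_deriv r \<alpha> x [v0, v1, v2, v3, v4] =
     frechet_derivative (\<lambda>y. pullback r \<alpha> y [v1, v2, v3, v4]) (at x) v0
     - frechet_derivative (\<lambda>y. pullback r \<alpha> y [v0, v2, v3, v4]) (at x) v1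
     + frechet_derivative (\<lambda>y. pullback r \<alpha> y [v0, v1, v3, v4]) (at x) v2
     - frechet_derivative (\<lambda>y. pullback r \<alpha> y [v0, v1, v2, v4]) (at x) v3
     + frechet_derivative (\<lambda>y. pullback r \<alpha> y [v0, v1, v2, v3]) (at x) v4"
  unfolding ext_deriv_def list.size add_0 add_Suc_right add_0_right sum.lessThan_Suc lessThan_0 sum.empty
  by simp

text \<open>The terms with second derivatives of \<open>\<Psi>\<close> cancel in pairs.\<close>

lemma ext_deriv_pullback:
  fixes \<Psi> :: "'a::real_normed_vector \<Rightarrow> 'b::euclidean_space"
  assumes S: "open S" "x \<in> S"
    and \<Psi>: "(\<Psi> has_derivative \<Psi>' x) (at x)"
    and \<Psi>': "\<And>v. ((\<lambda>y. \<Psi>' y v) has_derivative (\<lambda>w. \<Psi>'' w v)) (at x)"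
    and sym: "\<And>v w. \<Psi>'' w v = \<Psi>'' v w"
    and eq: "\<And>y us. y \<in> S \<Longrightarrow> length us = 4 \<Longrightarrow>
      pullback r \<alpha> y us = pullback r2 \<beta> (\<Psi> y) (map (\<Psi>' y) us)"
    and alt: "\<And>y. y \<in> S \<Longrightarrow> alt4 (pullback r2 \<beta> (\<Psi> y))"
    and diff: "\<And>us. length us = 4 \<Longrightarrow> (\<lambda>z. pullback r2 \<beta> z us) differentiable (at (\<Psi> x))"
    and vs: "length vs = 5"
  shows "ext_deriv r \<alpha> x vs = ext_deriv r2 \<beta> (\<Psi> x) (map (\<Psi>' x) vs)"
proof -
  define \<mu> where "\<mu> = pullback r2 \<beta>"
  define M where "M us = frechet_derivative (\<lambda>z. \<mu> z us) (at (\<Psi> x))" for us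
  have M: "((\<lambda>z. \<mu> z us) has_derivative M us) (at (\<Psi> x))" if "length us = 4" for us
    using diff[OF that] by (simp add: M_def \<mu>_def frechet_derivative_works[symmetric])
  have alt': "alt4 (\<mu> (\<Psi> y))" if "y \<in> S" for y using alt[OF that] by (simp add: \<mu>_def)
  define m where "m a b c d = \<mu> (\<Psi> x) [a, b, c, d]" for a b c d
  note move = alt4_move[OF alt'[OF S(2)], folded m_def]
  have D: "frechet_derivative (\<lambda>y. pullback r \<alpha> y [a, b, c, d]) (at x) w =
      M [\<Psi>' x a, \<Psi>' x b, \<Psi>' x c, \<Psi>' x d] (\<Psi>' x w) + m (\<Psi>'' w a) (\<Psi>' x b) (\<Psi>' x c) (\<Psi>' x d)
      - m (\<Psi>'' w b) (\<Psi>' x a) (\<Psi>' x c) (\<Psi>' x d) + m (\<Psi>'' w c) (\<Psi>' x a) (\<Psi>' x b) (\<Psi>' x d)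
      - m (\<Psi>'' w d) (\<Psi>' x a) (\<Psi>' x b) (\<Psi>' x c)" for a b c d w
  proof -
    have "((\<lambda>y. pullback r \<alpha> y [a, b, c, d]) has_derivative
      (\<lambda>w. M [\<Psi>' x a, \<Psi>' x b, \<Psi>' x c, \<Psi>' x d] (\<Psi>' x w) + m (\<Psi>'' w a) (\<Psi>' x b) (\<Psi>' x c) (\<Psi>' x d)
        + m (\<Psi>' x a) (\<Psi>'' w b) (\<Psi>' x c) (\<Psi>' x d) + m (\<Psi>' x a) (\<Psi>' x b) (\<Psi>'' w c) (\<Psi>' x d)
        + m (\<Psi>' x a) (\<Psi>' x b) (\<Psi>' x c) (\<Psi>'' w d))) (at x)"
      unfolding m_def
      by (rule has_derivative_transform_within_open[OF
            has_derivative_slots4[OF S alt' M \<Psi> \<Psi>' \<Psi>' \<Psi>' \<Psi>'] S])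
        (auto simp: eq \<mu>_def)
    from frechet_derivative_at[OF this, symmetric] show ?thesis
      by (simp add: move(1)[of "\<Psi>' x a" "\<Psi>'' w b"] move(2)[of "\<Psi>' x a" "\<Psi>' x b" "\<Psi>'' w c"]
          move(3)[of "\<Psi>' x a" "\<Psi>' x b" "\<Psi>' x c" "\<Psi>'' w d"])
  qed
  obtain v0 v1 v2 v3 v4 where "vs = [v0, v1, v2, v3, v4]"
    using vs by (auto simp: length_Suc_conv eval_nat_numeral)
  then show ?thesis
    unfolding ext_deriv_4 list.map D M_def[symmetric] \<mu>_def[symmetric]
    by (simp add: ext_deriv_4 D M_def[symmetric] \<mu>_def[symmetric] sym[of v1 v0] sym[of v2 v0] sym[of v3 v0]
        sym[of v4 v0] sym[of v2 v1] sym[of v3 v1] sym[of v4 v1] sym[of v3 v2] sym[of v4 v2] sym[of v4 v3])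
qed

section \<open>Quaternions and the invariant coframe\<close>

lemma quat_eq_iff: "x = y \<longleftrightarrow> fst x = fst y \<and> snd x $ 1 = snd y $ 1 \<and> snd x $ 2 = snd y $ 2 \<and> snd x $ 3 = snd y $ 3"
  for x y :: quat
  by (auto simp: prod_eq_iff vec_eq_iff forall_3)

lemma qmult_simps:
  "fst (x \<odot> y) = fst x * fst y - (snd x $ 1 * snd y $ 1 + snd x $ 2 * snd y $ 2 + snd x $ 3 * snd y $ 3)"
  "snd (x \<odot> y) $ 1 = fst x * snd y $ 1 + fst y * snd x $ 1 + (snd x $ 2 * snd y $ 3 - snd x $ 3 * snd y $ 2)"
  "snd (x \<odot> y) $ 2 = fst x * snd y $ 2 + fst y * snd x $ 2 + (snd x $ 3 * snd y $ 1 - snd x $ 1 * snd y $ 3)"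
  "snd (x \<odot> y) $ 3 = fst x * snd y $ 3 + fst y * snd x $ 3 + (snd x $ 1 * snd y $ 2 - snd x $ 2 * snd y $ 1)"
  by (simp_all add: qmult_def inner_vec_def sum_3 cross3_def vector_3)

lemma quat_inner: "x \<bullet> y = fst x * fst y + (snd x $ 1 * snd y $ 1 + snd x $ 2 * snd y $ 2 + snd x $ 3 * snd y $ 3)"
  for x y :: quat
  by (cases x; cases y) (simp add: inner_vec_def sum_3)

lemma qcnj_simps: "fst (qcnj x) = fst x" "snd (qcnj x) = - snd x"
  by (simp_all add: qcnj_def)

lemma qone_simps: "fst qone = 1" "snd qone = 0"
  by (simp_all add: qone_def)

lemmas quat_simps = quat_eq_iff qmult_simps quat_inner qcnj_simps qone_simps

lemma qmult_assoc: "x \<odot> y \<odot> z = x \<odot> (y \<odot> z)"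
  by (simp add: quat_simps algebra_simps)

lemma qmult_qone [simp]: "x \<odot> qone = x" "qone \<odot> x = x"
  by (simp_all add: quat_simps)

lemma qmult_add: "(x + y) \<odot> z = x \<odot> z + y \<odot> z" "x \<odot> (y + z) = x \<odot> y + x \<odot> z"
  and qmult_diff: "(x - y) \<odot> z = x \<odot> z - y \<odot> z" "x \<odot> (y - z) = x \<odot> y - x \<odot> z"
  and qmult_minus [simp]: "(- x) \<odot> z = - (x \<odot> z)" "x \<odot> (- z) = - (x \<odot> z)"
  and qmult_scaleR [simp]: "(c *\<^sub>R x) \<odot> z = c *\<^sub>R (x \<odot> z)" "x \<odot> (c *\<^sub>R z) = c *\<^sub>R (x \<odot> z)"
  and qmult_0 [simp]: "0 \<odot> x = 0" "x \<odot> 0 = 0"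
  by (simp_all add: quat_simps algebra_simps)

lemma qcnj_qmult: "qcnj (x \<odot> y) = qcnj y \<odot> qcnj x"
  by (simp add: quat_simps algebra_simps)

lemma qcnj_qcnj [simp]: "qcnj (qcnj x) = x"
  by (simp add: qcnj_def)

lemma qcnj_linear: "qcnj (x + y) = qcnj x + qcnj y" "qcnj (c *\<^sub>R x) = c *\<^sub>R qcnj x" "qcnj (- x) = - qcnj x"
  "qcnj (x - y) = qcnj x - qcnj y"
  by (simp_all add: quat_simps)

lemma bounded_linear_qcnj: "bounded_linear qcnj"
  by (simp add: linear_conv_bounded_linear[symmetric] linearI qcnj_linear)

lemma qcnj_qmult_self: "qcnj x \<odot> x = (x \<bullet> x) *\<^sub>R qone" "x \<odot> qcnj x = (x \<bullet> x) *\<^sub>R qone"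
  by (simp_all add: quat_simps algebra_simps)

lemma inner_qmult_left: "(a \<odot> x) \<bullet> (a \<odot> y) = (a \<bullet> a) * (x \<bullet> y)"
  by (simp add: quat_simps algebra_simps)

lemma inner_qmult_right: "(x \<odot> a) \<bullet> (y \<odot> a) = (a \<bullet> a) * (x \<bullet> y)"
  by (simp add: quat_simps algebra_simps)

lemma norm_qmult: "norm (x \<odot> y) = norm x * norm y"
  using inner_qmult_left[of x y y] by (simp add: norm_eq_sqrt_inner real_sqrt_mult)

lemma norm_qcnj [simp]: "norm (qcnj x) = norm x"
  by (simp add: norm_eq_sqrt_inner quat_simps)

lemma norm_qone [simp]: "norm qone = 1"
  by (simp add: norm_eq_sqrt_inner quat_simps)

lemma qcnj_unit: "norm x = 1 \<Longrightarrow> qcnj x \<odot> x = qone" "norm x = 1 \<Longrightarrow> x \<odot> qcnj x = qone"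
  by (simp_all add: qcnj_qmult_self norm_eq_1)

lemma qcnj_unit': "norm x = 1 \<Longrightarrow> qcnj x \<odot> (x \<odot> y) = y" "norm x = 1 \<Longrightarrow> x \<odot> (qcnj x \<odot> y) = y"
  by (simp_all add: qmult_assoc[symmetric] qcnj_unit)

lemma fst_qcnj_qmult: "fst (qcnj x \<odot> y) = x \<bullet> y"
  by (simp add: quat_simps)

lemma bounded_bilinear_qmult: "bounded_bilinear (\<odot>)"
proof
  show "\<exists>K. \<forall>a b. norm (a \<odot> b) \<le> norm a * norm b * K"
    by (intro exI[of _ 1]) (simp add: norm_qmult)
qed (simp_all add: qmult_add)

lemma sgn_has_derivative:
  fixes g :: "'a::real_inner"
  assumes "g \<noteq> 0"
  shows "(sgn has_derivative (\<lambda>v. (1 / norm g) *\<^sub>R (v - ((g \<bullet> v) / (g \<bullet> g)) *\<^sub>R g))) (at g)"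
proof -
  have "((\<lambda>x. inverse (norm x) *\<^sub>R x) has_derivative
     (\<lambda>v. inverse (norm g) *\<^sub>R v + (- (inverse (norm g) * (v \<bullet> sgn g) * inverse (norm g))) *\<^sub>R g)) (at g)"
    using assms by (intro has_derivative_scaleR Deriv.has_derivative_inverse has_derivative_norm has_derivative_ident) auto
  moreover have "inverse (norm g) *\<^sub>R v + (- (inverse (norm g) * (v \<bullet> sgn g) * inverse (norm g))) *\<^sub>R g
      = (1 / norm g) *\<^sub>R (v - ((g \<bullet> v) / (g \<bullet> g)) *\<^sub>R g)" for v
    using assms by (simp add: sgn_div_norm scaleR_right_diff_distrib inner_commute power2_eq_square
        divide_inverse flip: power2_norm_eq_inner)
  ultimately show ?thesis by (simp add: sgn_div_norm[abs_def])
qed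

locale su2_frame =
  fixes T :: "3 \<Rightarrow> quat"
  assumes T: "su2_basis T"
begin

definition \<tau> :: "3 \<Rightarrow> real^3" where "\<tau> i = snd (T i)"

lemma T_eq: "T i = (0, \<tau> i)"
proof -
  have "T i \<in> span (range T)" by (simp add: span_base)
  then show ?thesis using T by (auto simp: su2_basis_def \<tau>_def prod_eq_iff)
qed

lemma cross_\<tau>: "cross3 (\<tau> 1) (\<tau> 2) = \<tau> 3" "cross3 (\<tau> 2) (\<tau> 3) = \<tau> 1" "cross3 (\<tau> 3) (\<tau> 1) = \<tau> 2"
proof -
  have c: "2 *\<^sub>R cross3 (\<tau> i) (\<tau> j) = (\<Sum>k\<in>UNIV. (2 * levi_civita i j k) *\<^sub>R \<tau> k)" for i j
  proof -
    have "snd (T i \<odot> T j - T j \<odot> T i) = snd (\<Sum>k\<in>UNIV. (2 * levi_civita i j k) *\<^sub>R T k)"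
      using T by (simp add: su2_basis_def)
    then show ?thesis
      by (simp add: T_eq qmult_def snd_sum cross_skew[of "\<tau> j" "\<tau> i"] scaleR_2)
  qed
  have l: "levi_civita 1 2 k = (if k = 3 then 1 else 0)" "levi_civita 2 3 k = (if k = 1 then 1 else 0)"
    "levi_civita 3 1 k = (if k = 2 then 1 else 0)" for k
    using exhaust_3[of k] by (auto simp: levi_civita_def cross3_def axis_def vector_3)
  show "cross3 (\<tau> 1) (\<tau> 2) = \<tau> 3" "cross3 (\<tau> 2) (\<tau> 3) = \<tau> 1" "cross3 (\<tau> 3) (\<tau> 1) = \<tau> 2"
    using c[of 1 2] c[of 2 3] c[of 3 1] unfolding l by (simp_all add: sum_3)
qed

text \<open>The bracket relations alone force this: they say that
  \<open>cross3 (\<tau> 1) (\<tau> 2) = \<tau> 3\<close> and cyclically, so the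
  \<open>\<tau> i\<close> are orthogonal, and their squared norms satisfy \<open>c = a * b\<close>,
  \<open>a = b * c\<close> and \<open>b = c * a\<close>, with 1 as the only positive
  solution.\<close>

lemma \<tau>_orthonormal: "\<tau> i \<bullet> \<tau> j = (if i = j then 1 else 0)"
proof -
  have o: "\<tau> 1 \<bullet> \<tau> 2 = 0" "\<tau> 2 \<bullet> \<tau> 3 = 0" "\<tau> 1 \<bullet> \<tau> 3 = 0"
    using dot_cross_self[of "\<tau> 1" "\<tau> 2"] dot_cross_self[of "\<tau> 2" "\<tau> 3"] dot_cross_self[of "\<tau> 3" "\<tau> 1"]
    by (simp_all add: cross_\<tau> inner_commute)
  have nz: "\<tau> i \<noteq> 0" for i
    using T dependent_zero[of "range T"] rangeI[of T i] by (auto simp: su2_basis_def T_eq zero_prod_def)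
  define a b c where "a = \<tau> 1 \<bullet> \<tau> 1" "b = \<tau> 2 \<bullet> \<tau> 2" "c = \<tau> 3 \<bullet> \<tau> 3"
  have "c = a * b" "a = b * c" "b = c * a"
    using dot_cross[of "\<tau> 1" "\<tau> 2" "\<tau> 1" "\<tau> 2"] dot_cross[of "\<tau> 2" "\<tau> 3" "\<tau> 2" "\<tau> 3"]
      dot_cross[of "\<tau> 3" "\<tau> 1" "\<tau> 3" "\<tau> 1"] o
    by (simp_all add: cross_\<tau> a_b_c_def inner_commute)
  moreover have "a > 0" "b > 0" "c > 0" using nz by (auto simp: a_b_c_def)
  ultimately have "a * a = 1" "b * b = 1" "c * c = 1"
    by (metis mult.assoc mult.commute mult_cancel_right1 less_irrefl)+
  then have "a = 1" "b = 1" "c = 1"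
    using \<open>a > 0\<close> \<open>b > 0\<close> \<open>c > 0\<close> by (smt (verit) mult_less_cancel_left1 mult_le_cancel_left1)+
  then show ?thesis using o exhaust_3[of i] exhaust_3[of j] by (auto simp: a_b_c_def inner_commute)
qed

lemma \<tau>_expansion: "(\<Sum>i\<in>UNIV. (x \<bullet> \<tau> i) *\<^sub>R \<tau> i) = x"
proof -
  have "(0, x) \<in> span (range T)" using T by (auto simp: su2_basis_def)
  then obtain u where "(0, x) = (\<Sum>v\<in>range T. u v *\<^sub>R v)" by (auto simp: span_finite)
  also have "\<dots> = (\<Sum>i\<in>UNIV. u (T i) *\<^sub>R T i)"
    using T by (subst sum.reindex) (auto simp: su2_basis_def)
  finally have x: "x = (\<Sum>i\<in>UNIV. u (T i) *\<^sub>R \<tau> i)" by (simp add: prod_eq_iff snd_sum T_eq)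
  then have "x \<bullet> \<tau> j = u (T j)" for j
    by (simp add: inner_sum_left \<tau>_orthonormal if_distrib cong: if_cong)
  then show ?thesis using x by simp
qed

definition co :: "3 \<Rightarrow> quat \<Rightarrow> real" where "co i x = snd x \<bullet> \<tau> i"

lemma co_eq_iff: "x = y \<longleftrightarrow> fst x = fst y \<and> co 1 x = co 1 y \<and> co 2 x = co 2 y \<and> co 3 x = co 3 y"
proof
  assume *: "fst x = fst y \<and> co 1 x = co 1 y \<and> co 2 x = co 2 y \<and> co 3 x = co 3 y"
  have "snd x = snd y" using * \<tau>_expansion[of "snd x"] \<tau>_expansion[of "snd y"] by (simp add: sum_3 co_def)
  then show "x = y" using * by (simp add: prod_eq_iff)
qed simp

lemma co_inner: "x \<bullet> y = fst x * fst y + (co 1 x * co 1 y + co 2 x * co 2 y + co 3 x * co 3 y)"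
proof -
  have "snd x \<bullet> snd y = snd x \<bullet> (\<Sum>i\<in>UNIV. (snd y \<bullet> \<tau> i) *\<^sub>R \<tau> i)" by (simp add: \<tau>_expansion)
  also have "\<dots> = co 1 x * co 1 y + co 2 x * co 2 y + co 3 x * co 3 y"
    by (simp add: sum_3 inner_add_right co_def mult_ac)
  finally show ?thesis by (cases x; cases y) simp
qed

text \<open>\<open>\<tau>\<close> is orthonormal and positively oriented, so in its coordinates the
  product has the familiar form of i, j, k, whatever basis \<open>T\<close> was given.\<close>

lemma co_qmult:
  "fst (x \<odot> y) = fst x * fst y - (co 1 x * co 1 y + co 2 x * co 2 y + co 3 x * co 3 y)"
  "co 1 (x \<odot> y) = fst x * co 1 y + fst y * co 1 x + (co 2 x * co 3 y - co 3 x * co 2 y)"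
  "co 2 (x \<odot> y) = fst x * co 2 y + fst y * co 2 x + (co 3 x * co 1 y - co 1 x * co 3 y)"
  "co 3 (x \<odot> y) = fst x * co 3 y + fst y * co 3 x + (co 1 x * co 2 y - co 2 x * co 1 y)"
proof -
  show "fst (x \<odot> y) = fst x * fst y - (co 1 x * co 1 y + co 2 x * co 2 y + co 3 x * co 3 y)"
    using co_inner[of "(0, snd x)" "(0, snd y)"] by (simp add: qmult_def co_def)
  have c: "cross3 a b \<bullet> \<tau> 1 = (a \<bullet> \<tau> 2) * (b \<bullet> \<tau> 3) - (a \<bullet> \<tau> 3) * (b \<bullet> \<tau> 2)"
    "cross3 a b \<bullet> \<tau> 2 = (a \<bullet> \<tau> 3) * (b \<bullet> \<tau> 1) - (a \<bullet> \<tau> 1) * (b \<bullet> \<tau> 3)"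
    "cross3 a b \<bullet> \<tau> 3 = (a \<bullet> \<tau> 1) * (b \<bullet> \<tau> 2) - (a \<bullet> \<tau> 2) * (b \<bullet> \<tau> 1)" for a b
    using dot_cross[of a b "\<tau> 2" "\<tau> 3"] dot_cross[of a b "\<tau> 3" "\<tau> 1"] dot_cross[of a b "\<tau> 1" "\<tau> 2"]
    by (simp_all add: cross_\<tau>)
  show "co 1 (x \<odot> y) = fst x * co 1 y + fst y * co 1 x + (co 2 x * co 3 y - co 3 x * co 2 y)"
    "co 2 (x \<odot> y) = fst x * co 2 y + fst y * co 2 x + (co 3 x * co 1 y - co 1 x * co 3 y)"
    "co 3 (x \<odot> y) = fst x * co 3 y + fst y * co 3 x + (co 1 x * co 2 y - co 2 x * co 1 y)"
    by (simp_all add: co_def qmult_def inner_add_left c)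
qed

lemma co_linear [simp]: "co i (x + y) = co i x + co i y" "co i (c *\<^sub>R x) = c * co i x" "co i (- x) = - co i x"
  "co i (x - y) = co i x - co i y" "co i 0 = 0" "co i qone = 0" "co i (qcnj x) = - co i x" "co i (0, z) = z \<bullet> \<tau> i"
  by (simp_all add: co_def inner_add_left inner_diff_left qone_def qcnj_def)

lemma co_T [simp]: "co i (T j) = (if j = i then 1 else 0)" "fst (T i) = 0"
  by (auto simp: co_def T_eq \<tau>_orthonormal)

lemma representation_T_pm:
  assumes "fst x1 = 0" "fst x2 = 0"
  shows "representation (T_pm T) (x1, x2) (T_plus T i) = (co i x1 + co i x2) / 2"
    "representation (T_pm T) (x1, x2) (T_minus T i) = (co i x1 - co i x2) / 2"
proof -
  have TT: "T i \<bullet> T j = (if i = j then 1 else 0)" for i j by (simp add: T_eq \<tau>_orthonormal)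
  have ip: "T_plus T i \<bullet> T_plus T j = (if i = j then 2 else 0)" "T_minus T i \<bullet> T_minus T j = (if i = j then 2 else 0)"
    "T_plus T i \<bullet> T_minus T j = 0" "T_minus T i \<bullet> T_plus T j = 0" for i j
    by (simp_all add: T_plus_def T_minus_def TT)
  have inj: "T_plus T i = T_plus T j \<longleftrightarrow> i = j" "T_minus T i = T_minus T j \<longleftrightarrow> i = j" "T_plus T i \<noteq> T_minus T j"
     "T_minus T i \<noteq> T_plus T j" for i j
    using ip[of i j] ip(1)[of i i] ip(2)[of i i] by (metis zero_neq_numeral)+
  have ind: "independent (T_pm T)"
  proof (rule pairwise_orthogonal_independent)
    show "pairwise orthogonal (T_pm T)"
    proof (rule pairwiseI)
      have "\<forall>v\<in>T_pm T. \<forall>w\<in>T_pm T. v \<noteq> w \<longrightarrow> v \<bullet> w = 0"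
        unfolding T_pm_def ball_Un by (simp add: ip inj)
      then show "orthogonal v w" if "v \<in> T_pm T" "w \<in> T_pm T" "v \<noteq> w" for v w
        using that unfolding orthogonal_def by blast
    qed
    show "0 \<notin> T_pm T"
    proof
      assume "0 \<in> T_pm T"
      moreover have "\<forall>v\<in>T_pm T. v \<bullet> v = 2" unfolding T_pm_def ball_Un by (simp add: ip)
      ultimately have "(0 :: quat \<times> quat) \<bullet> 0 = 2" by blast
      then show False by simp
    qed
  qed
  have mem: "T_plus T i \<in> T_pm T" "T_minus T i \<in> T_pm T" for i by (auto simp: T_pm_def)
  let ?s = "\<Sum>j\<in>UNIV. ((co j x1 + co j x2) / 2) *\<^sub>R T_plus T j + ((co j x1 - co j x2) / 2) *\<^sub>R T_minus T j"
  have "x1 = (\<Sum>j\<in>UNIV. co j x1 *\<^sub>R T j)" "x2 = (\<Sum>j\<in>UNIV. co j x2 *\<^sub>R T j)"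
    using assms by (simp_all add: co_eq_iff sum_3)
  moreover have "?s = (\<Sum>j\<in>UNIV. (co j x1 *\<^sub>R T j, co j x2 *\<^sub>R T j))"
    by (intro sum.cong) (simp_all add: T_plus_def T_minus_def scaleR_add_left[symmetric] field_simps
        flip: scaleR_diff_left)
  ultimately have s: "(x1, x2) = ?s" by (simp add: prod_eq_iff fst_sum snd_sum)
  have "representation (T_pm T) ?s v = (\<Sum>j\<in>UNIV. ((co j x1 + co j x2) / 2) * (if v = T_plus T j then 1 else 0)
      + ((co j x1 - co j x2) / 2) * (if v = T_minus T j then 1 else 0))" for v
    by (simp add: representation_sum[OF ind] representation_add[OF ind] representation_scale[OF ind]
        representation_basis[OF ind] span_base span_add span_scale mem)
  then show "representation (T_pm T) (x1, x2) (T_plus T i) = (co i x1 + co i x2) / 2"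
    "representation (T_pm T) (x1, x2) (T_minus T i) = (co i x1 - co i x2) / 2"
    unfolding s using exhaust_3[of i] by (auto simp: inj sum_3)
qed

end

section \<open>The forms of the family in coordinates of R^7\<close>

lemma wedge_2_list4:
  "wedge 2 \<alpha> \<beta> [a, b, c, d] = \<alpha> [a, b] * \<beta> [c, d] - \<alpha> [a, c] * \<beta> [b, d] + \<alpha> [a, d] * \<beta> [b, c]
     + \<alpha> [b, c] * \<beta> [a, d] - \<alpha> [b, d] * \<beta> [a, c] + \<alpha> [c, d] * \<beta> [a, b]"
proof -
  have n: "{..<length [a, b, c, d]} = {..<Suc (Suc (Suc (Suc 0)))}" "(card I = 2) = (card I = Suc (Suc 0))"
    for I :: "nat set" by (simp_all add: eval_nat_numeral)
  have l: "nths [a, b, c, d] I = (if 0 \<in> I then [a] else []) @ (if Suc 0 \<in> I then [b] else []) @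
    (if Suc (Suc 0) \<in> I then [c] else []) @ (if Suc (Suc (Suc 0)) \<in> I then [d] else [])" for I
    unfolding nths_Cons nths_nil mem_Collect_eq append_Nil2 by (rule refl)
  show ?thesis
    unfolding wedge_def n sum_subsets_card by (simp add: l shuffle_sign_def)
qed

lemma levi_civita_sum:
  "(\<Sum>i\<in>UNIV. \<Sum>j\<in>UNIV. \<Sum>k\<in>UNIV. levi_civita i j k * f i j k) =
    f 1 2 3 + f 2 3 1 + f 3 1 2 - f 2 1 3 - f 3 2 1 - f 1 3 2"
  by (simp add: sum_3 levi_civita_def cross3_def axis_def vector_3)

text \<open>The components \<open>z $ 1, z $ 2, z $ 3\<close> are the \<open>\<eta>\<^sub>i\<^sup>-\<close>, \<open>z $ 4\<close> is \<open>dt\<close> and \<open>z $ 5, z $ 6, z $ 7\<close> are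
  the \<open>\<eta>\<^sub>i\<^sup>+\<close>; \<open>frame_scale\<close> passes to the orthonormal coframe identifying \<open>\<phi>\<^bsub>A,B\<^esub>\<close> with \<open>\<phi>\<^sub>0\<close>.\<close>

definition frame_scale :: "(3 \<Rightarrow> real) \<Rightarrow> (3 \<Rightarrow> real) \<Rightarrow> real^7 \<Rightarrow> real^7" where
  "frame_scale a b z = vector [2 * b 1 * z$1, 2 * b 2 * z$2, 2 * b 3 * z$3, - z$4, 2 * a 1 * z$5, 2 * a 2 * z$6, 2 * a 3 * z$7]"

lemma frame_scale_nth:
  "frame_scale a b z $ 1 = 2 * b 1 * z$1" "frame_scale a b z $ 2 = 2 * b 2 * z$2" "frame_scale a b z $ 3 = 2 * b 3 * z$3"
  "frame_scale a b z $ 4 = - z$4" "frame_scale a b z $ 5 = 2 * a 1 * z$5" "frame_scale a b z $ 6 = 2 * a 2 * z$6"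
  "frame_scale a b z $ 7 = 2 * a 3 * z$7"
  by (simp_all add: frame_scale_def vector_7)

text \<open>\<open>rows4 a b c d i j k l\<close> is the value of the coordinate form e^ijkl on four
  vectors, and \<open>rows3\<close> that of e^ijk on three.\<close>

definition rows4 :: "real^7 \<Rightarrow> real^7 \<Rightarrow> real^7 \<Rightarrow> real^7 \<Rightarrow> 7 \<Rightarrow> 7 \<Rightarrow> 7 \<Rightarrow> 7 \<Rightarrow> real" where
  "rows4 a b c d i j k l = det4 (row4 (\<lambda>v. v $ i) a b c d) (row4 (\<lambda>v. v $ j) a b c d)
      (row4 (\<lambda>v. v $ k) a b c d) (row4 (\<lambda>v. v $ l) a b c d)"

definition rows3 :: "real^7 \<Rightarrow> real^7 \<Rightarrow> real^7 \<Rightarrow> 7 \<Rightarrow> 7 \<Rightarrow> 7 \<Rightarrow> real" where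
  "rows3 a b c i j k = det3 (row3 (\<lambda>v. v $ i) a b c) (row3 (\<lambda>v. v $ j) a b c) (row3 (\<lambda>v. v $ k) a b c)"

lemma phi0_frame_scale:
  "phi0 (map (frame_scale a b) [x, y, z]) =
    4 * (a 1 * b 1 * rows3 x y z 4 1 5 + a 2 * b 2 * rows3 x y z 4 2 6 + a 3 * b 3 * rows3 x y z 4 3 7)
    + 8 * (b 1 * b 2 * b 3) * rows3 x y z 1 2 3
    - 8 * (a 2 * a 3 * b 1 * rows3 x y z 6 7 1 + a 3 * a 1 * b 2 * rows3 x y z 7 5 2 + a 1 * a 2 * b 3 * rows3 x y z 5 6 3)"
  by (simp add: phi0_def e3_def wedge_list_rows rows3_def row3_def frame_scale_nth algebra_simps)

lemma hodge7_frame_scale: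
  "hodge7 3 phi0 (map (frame_scale a b) [x, y, z, w]) =
    16 * (a 2 * b 2 * a 3 * b 3 * rows4 x y z w 2 6 3 7 + a 1 * b 1 * a 3 * b 3 * rows4 x y z w 1 5 3 7
      + a 1 * b 1 * a 2 * b 2 * rows4 x y z w 1 5 2 6)
    + 8 * (a 1 * a 2 * a 3) * rows4 x y z w 4 5 6 7
    - 8 * (b 2 * b 3 * a 1 * rows4 x y z w 4 2 3 5 + b 3 * b 1 * a 2 * rows4 x y z w 4 3 1 6
      + b 1 * b 2 * a 3 * rows4 x y z w 4 1 2 7)"
proof -
  have s: "row4 (\<lambda>v. v $ i) (frame_scale a b x) (frame_scale a b y) (frame_scale a b z) (frame_scale a b w)
      = c *\<^sub>R row4 (\<lambda>v. v $ i) x y z w" if "\<And>v. frame_scale a b v $ i = c * v $ i" for i c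
    by (simp add: row4_def that)
  have d: "det4 (p *\<^sub>R r1) (q *\<^sub>R r2) (s *\<^sub>R r3) (u *\<^sub>R r4) = p * q * s * u * det4 r1 r2 r3 r4" for p q s u r1 r2 r3 r4
    by (cases r1; cases r2; cases r3; cases r4) (simp add: algebra_simps)
  note r = s[of 1 "2 * b 1"] s[of 2 "2 * b 2"] s[of 3 "2 * b 3"] s[of 4 "-1"] s[of 5 "2 * a 1"] s[of 6 "2 * a 2"]
    s[of 7 "2 * a 3"]
  show ?thesis
    unfolding list.map hodge7_phi0 Let_def rows4_def
    by (simp only: r frame_scale_nth mult_minus1 d) (simp add: algebra_simps)
qed

lemma det4_row4_swap:
  "det4 (row4 f y x z w) (row4 g y x z w) (row4 h y x z w) (row4 k y x z w) =
    - det4 (row4 f x y z w) (row4 g x y z w) (row4 h x y z w) (row4 k x y z w)"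
  "det4 (row4 f x z y w) (row4 g x z y w) (row4 h x z y w) (row4 k x z y w) =
    - det4 (row4 f x y z w) (row4 g x y z w) (row4 h x y z w) (row4 k x y z w)"
  "det4 (row4 f x y w z) (row4 g x y w z) (row4 h x y w z) (row4 k x y w z) =
    - det4 (row4 f x y z w) (row4 g x y z w) (row4 h x y z w) (row4 k x y z w)"
  by (simp_all add: row4_def algebra_simps)

lemma alt4_hodge7: "alt4 (hodge7 3 phi0)"
  unfolding alt4_def
proof (intro conjI allI)
  show "linear (\<lambda>a. hodge7 3 phi0 [a, b, c, d])" for b c d
    by (rule linearI) (simp_all add: star_phi0_eq_cross7 cross7_linear(1-4) inner_add_left algebra_simps)
  show "hodge7 3 phi0 [b, a, c, d] = - hodge7 3 phi0 [a, b, c, d]" for a b c d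
    unfolding hodge7_phi0 Let_def det4_row4_swap(1)[of _ b a] by simp
  show "hodge7 3 phi0 [a, c, b, d] = - hodge7 3 phi0 [a, b, c, d]" for a b c d
    unfolding hodge7_phi0 Let_def det4_row4_swap(2)[of _ a c b] by simp
  show "hodge7 3 phi0 [a, b, d, c] = - hodge7 3 phi0 [a, b, c, d]" for a b c d
    unfolding hodge7_phi0 Let_def det4_row4_swap(3)[of _ a b d c] by simp
qed

lemma linear_frame_scale: "linear (frame_scale a b)"
  by (rule linearI) (simp_all add: vec_eq_iff forall_7 frame_scale_nth algebra_simps)

context su2_frame
begin

text \<open>The factor \<open>1 / (g \<bullet> g)\<close> makes this formula, off the unit sphere,
  the pullback of the left-invariant coframe under \<open>sgn\<close>. Thus \<open>coframe\<close>
  is what \<open>pullback N_retr\<close> produces on the whole neighbourhood; see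
  \<open>N_retr_nbhd\<close>.\<close>

definition left_coord :: "quat \<Rightarrow> quat \<Rightarrow> real^3" where
  "left_coord g v = (1 / (g \<bullet> g)) *\<^sub>R (\<chi> i. co i (qcnj g \<odot> v))"

definition coframe :: "prin \<Rightarrow> prin \<Rightarrow> real^7" where
  "coframe = (\<lambda>(t, g1, g2) (s, v1, v2). let x = left_coord g1 v1; y = left_coord g2 v2 in
     vector [(x$1 - y$1) / 2, (x$2 - y$2) / 2, (x$3 - y$3) / 2, s, (x$1 + y$1) / 2, (x$2 + y$2) / 2, (x$3 + y$3) / 2])"

definition N_retr' :: "prin \<Rightarrow> prin \<Rightarrow> prin" where
  "N_retr' = (\<lambda>(t, g1, g2) (s, v1, v2). (s, (1 / norm g1) *\<^sub>R (v1 - ((g1 \<bullet> v1) / (g1 \<bullet> g1)) *\<^sub>R g1),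
     (1 / norm g2) *\<^sub>R (v2 - ((g2 \<bullet> v2) / (g2 \<bullet> g2)) *\<^sub>R g2)))"

definition N_nbhd :: "prin set" where
  "N_nbhd = {(t, g1, g2). t > 0 \<and> g1 \<noteq> 0 \<and> g2 \<noteq> 0}"

lemma N_retr_has_derivative:
  assumes "y \<in> N_nbhd"
  shows "(N_retr has_derivative N_retr' y) (at y)"
proof -
  obtain t g1 g2 where y: "y = (t, g1, g2)" "g1 \<noteq> 0" "g2 \<noteq> 0" using assms by (auto simp: N_nbhd_def)
  have 1: "((\<lambda>y::prin. sgn (fst (snd y))) has_derivative
      (\<lambda>u. (1 / norm g1) *\<^sub>R (fst (snd u) - ((g1 \<bullet> fst (snd u)) / (g1 \<bullet> g1)) *\<^sub>R g1))) (at y)"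
    by (rule has_derivative_compose[of "\<lambda>y. fst (snd y)"])
      (auto intro!: derivative_eq_intros sgn_has_derivative simp: y)
  have 2: "((\<lambda>y::prin. sgn (snd (snd y))) has_derivative
      (\<lambda>u. (1 / norm g2) *\<^sub>R (snd (snd u) - ((g2 \<bullet> snd (snd u)) / (g2 \<bullet> g2)) *\<^sub>R g2))) (at y)"
    by (rule has_derivative_compose[of "\<lambda>y. snd (snd y)"])
      (auto intro!: derivative_eq_intros sgn_has_derivative simp: y)
  have "((\<lambda>y::prin. (fst y, sgn (fst (snd y)), sgn (snd (snd y)))) has_derivative
      (\<lambda>u. (fst u, (1 / norm g1) *\<^sub>R (fst (snd u) - ((g1 \<bullet> fst (snd u)) / (g1 \<bullet> g1)) *\<^sub>R g1),
        (1 / norm g2) *\<^sub>R (snd (snd u) - ((g2 \<bullet> snd (snd u)) / (g2 \<bullet> g2)) *\<^sub>R g2)))) (at y)"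
    by (intro has_derivative_Pair 1 2 has_derivative_fst has_derivative_ident)
  then show ?thesis by (simp add: N_retr_def N_retr'_def case_prod_unfold y)
qed

end

text \<open>In the type \<open>7\<close> the numeral 7 is 0, so positions are compared as natural
  numbers. The conditions of \<open>rows5_sort\<close> and \<open>rows4_sort\<close> let rewriting
  bring indices into increasing order and then stop.\<close>

definition coord_idx :: "7 \<Rightarrow> nat" where
  "coord_idx i = (if i = 1 then 1 else if i = 2 then 2 else if i = 3 then 3 else if i = 4 then 4
     else if i = 5 then 5 else if i = 6 then 6 else 7)"

text \<open>The value of the coordinate form e^ijklm on five vectors, by Laplace expansion along the
  first two rows.\<close>

definition rows5 :: "real^7 \<Rightarrow> real^7 \<Rightarrow> real^7 \<Rightarrow> real^7 \<Rightarrow> real^7 \<Rightarrow> 7 \<Rightarrow> 7 \<Rightarrow> 7 \<Rightarrow> 7 \<Rightarrow> 7 \<Rightarrow> real" where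
  "rows5 u v x y z i j k l m = (let d = (\<lambda>a b. a$i * b$j - a$j * b$i) in
     d u v * rows3 x y z k l m - d u x * rows3 v y z k l m + d u y * rows3 v x z k l m - d u z * rows3 v x y k l m
     + d v x * rows3 u y z k l m - d v y * rows3 u x z k l m + d v z * rows3 u x y k l m
     + d x y * rows3 u v z k l m - d x z * rows3 u v y k l m + d y z * rows3 u v x k l m)"

lemma rows3_swap: "rows3 x y z j i k = - rows3 x y z i j k" "rows3 x y z i k j = - rows3 x y z i j k"
  by (simp_all add: rows3_def row3_def algebra_simps)

lemma rows5_swap:
  "rows5 u v x y z j i k l m = - rows5 u v x y z i j k l m"
  "rows5 u v x y z i k j l m = - rows5 u v x y z i j k l m"
  "rows5 u v x y z i j l k m = - rows5 u v x y z i j k l m"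
  "rows5 u v x y z i j k m l = - rows5 u v x y z i j k l m"
proof -
  show "rows5 u v x y z j i k l m = - rows5 u v x y z i j k l m"
    by (simp add: rows5_def algebra_simps)
  show "rows5 u v x y z i j l k m = - rows5 u v x y z i j k l m"
    unfolding rows5_def Let_def rows3_swap(1)[of _ _ _ l k] by (simp add: algebra_simps)
  show "rows5 u v x y z i j k m l = - rows5 u v x y z i j k l m"
    unfolding rows5_def Let_def rows3_swap(2)[of _ _ _ k m l] by (simp add: algebra_simps)
  show "rows5 u v x y z i k j l m = - rows5 u v x y z i j k l m"
    unfolding rows5_def Let_def rows3_def row3_def det3.simps by (simp add: algebra_simps)
qed

lemma rows5_sort:
  "coord_idx i < coord_idx j \<Longrightarrow> rows5 u v x y z j i k l m = - rows5 u v x y z i j k l m"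
  "coord_idx j < coord_idx k \<Longrightarrow> rows5 u v x y z i k j l m = - rows5 u v x y z i j k l m"
  "coord_idx k < coord_idx l \<Longrightarrow> rows5 u v x y z i j l k m = - rows5 u v x y z i j k l m"
  "coord_idx l < coord_idx m \<Longrightarrow> rows5 u v x y z i j k m l = - rows5 u v x y z i j k l m"
  by (rule rows5_swap)+

lemma rows5_repeat:
  "rows5 u v x y z i i k l m = 0" "rows5 u v x y z i j j l m = 0" "rows5 u v x y z i j k k m = 0"
  "rows5 u v x y z i j k l l = 0"
  using rows5_swap[of u v x y z] by (metis equal_neg_zero)+

lemma rows4_first_column:
  "rows4 a b c d i j k l = a$i * rows3 b c d j k l - a$j * rows3 b c d i k l + a$k * rows3 b c d i j l - a$l * rows3 b c d i j k"
  by (simp add: rows4_def rows3_def row4_def row3_def algebra_simps)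

lemma rows4_move:
  "rows4 a s c d i j k l = - rows4 s a c d i j k l" "rows4 a b s d i j k l = rows4 s a b d i j k l"
  "rows4 a b c s i j k l = - rows4 s a b c i j k l"
  by (simp_all add: rows4_def row4_def algebra_simps)

text \<open>The Chevalley--Eilenberg differential in the left-invariant coframe; \<open>coframe_bracket x y\<close> is
  \<open>- [x, y] / 2\<close>, cf. \<open>[T\<^sub>i, T\<^sub>j] = 2 \<epsilon>\<^sub>i\<^sub>j\<^sub>k T\<^sub>k\<close>.\<close>

definition coframe_bracket :: "real^7 \<Rightarrow> real^7 \<Rightarrow> real^7" where
  "coframe_bracket x y = (let d = (\<lambda>i j. x$j * y$i - x$i * y$j) in
     vector [d 2 7 + d 6 3, d 3 5 + d 7 1, d 1 6 + d 5 2, 0,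
       d 2 3 + d 6 7, d 3 1 + d 7 5, d 1 2 + d 5 6])"

lemma coframe_bracket_nth:
  "coframe_bracket x y $ 1 = x$7*y$2 - x$2 * y$7 + (x$3 * y$6 - x$6 * y$3)"
  "coframe_bracket x y $ 2 = x$5*y$3 - x$3 * y$5 + (x$1 * y$7 - x$7 * y$1)"
  "coframe_bracket x y $ 3 = x$6*y$1 - x$1 * y$6 + (x$2 * y$5 - x$5 * y$2)"
  "coframe_bracket x y $ 4 = 0"
  "coframe_bracket x y $ 5 = x$3*y$2 - x$2 * y$3 + (x$7 * y$6 - x$6 * y$7)"
  "coframe_bracket x y $ 6 = x$1*y$3 - x$3 * y$1 + (x$5 * y$7 - x$7 * y$5)"
  "coframe_bracket x y $ 7 = x$2*y$1 - x$1 * y$2 + (x$6 * y$5 - x$5 * y$6)"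
  by (simp_all add: coframe_bracket_def Let_def vector_7)

text \<open>The signs are those of \<open>ext_deriv_4\<close>, and the first argument of
  \<open>f\<close> is the direction of differentiation; \<open>bracket_term\<close> is the
  contribution of the coframe varying in that direction.\<close>

definition alternate5 :: "('v \<Rightarrow> 'v \<Rightarrow> 'v \<Rightarrow> 'v \<Rightarrow> 'v \<Rightarrow> real) \<Rightarrow> 'v \<Rightarrow> 'v \<Rightarrow> 'v \<Rightarrow> 'v \<Rightarrow> 'v \<Rightarrow> real" where
  "alternate5 f u v x y z = f u v x y z - f v u x y z + f x u v y z - f y u v x z + f z u v x y"

definition bracket_term ::
  "(real^7 \<Rightarrow> real^7 \<Rightarrow> real^7 \<Rightarrow> real^7 \<Rightarrow> real) \<Rightarrow> real^7 \<Rightarrow> real^7 \<Rightarrow> real^7 \<Rightarrow> real^7 \<Rightarrow> real^7 \<Rightarrow> real" where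
  "bracket_term f w a b c d = f (coframe_bracket w a) b c d + f a (coframe_bracket w b) c d
     + f a b (coframe_bracket w c) d + f a b c (coframe_bracket w d)"

lemma bracket_antisym: "coframe_bracket y x = - coframe_bracket x y"
  by (simp add: vec_eq_iff forall_7 coframe_bracket_nth)

text \<open>Every pair of arguments occurs in both orders, and antisymmetry of the bracket makes the
  two contributions equal. The resulting factor 2 undoes the one half in
  \<open>coframe_bracket\<close>, and the Leibniz rule in the four indices emerges.\<close>

lemma alternate5_bracket:
  "alternate5 (bracket_term (\<lambda>a b c d. rows4 a b c d i j k l)) u v x y z =
    2 * (let W = (\<lambda>p q r s. coframe_bracket u v $ p * rows3 x y z q r s - coframe_bracket u x $ p * rows3 v y z q r s
        + coframe_bracket u y $ p * rows3 v x z q r s - coframe_bracket u z $ p * rows3 v x y q r s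
        + coframe_bracket v x $ p * rows3 u y z q r s - coframe_bracket v y $ p * rows3 u x z q r s
        + coframe_bracket v z $ p * rows3 u x y q r s + coframe_bracket x y $ p * rows3 u v z q r s
        - coframe_bracket x z $ p * rows3 u v y q r s + coframe_bracket y z $ p * rows3 u v x q r s)
      in W i j k l - W j i k l + W k i j l - W l i j k)"
proof -
  note br = bracket_antisym[of v u] bracket_antisym[of x u] bracket_antisym[of y u] bracket_antisym[of z u]
     bracket_antisym[of x v] bracket_antisym[of y v] bracket_antisym[of z v] bracket_antisym[of y x]
     bracket_antisym[of z x] bracket_antisym[of z y]
  show ?thesis
    unfolding alternate5_def bracket_term_def
    unfolding rows4_move(1)[of _ "coframe_bracket p q" for p q] rows4_move(2)[of _ _ "coframe_bracket p q" for p q]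
      rows4_move(3)[of _ _ _ "coframe_bracket p q" for p q]
    unfolding rows4_first_column
    unfolding br vector_uminus_component Let_def
    by (simp add: algebra_simps)
qed

lemma ce_first_row:
  "alternate5 (\<lambda>w a b c d. w$i * rows4 a b c d j k l m) u v x y z = rows5 u v x y z i j k l m"
  unfolding alternate5_def rows4_first_column rows5_def Let_def
  by (simp add: rows3_def row3_def algebra_simps)

lemmas coord_idx_simps = coord_idx_def[of 1, simplified] coord_idx_def[of 2, simplified] coord_idx_def[of 3, simplified]
   coord_idx_def[of 4, simplified] coord_idx_def[of 5, simplified] coord_idx_def[of 6, simplified] coord_idx_def[of 7, simplified]

text \<open>The structure equations of the coframe: twice the right-hand sides say, for instance,
  that d e^1 = -2 (e^27 + e^63). They are dual to the brackets of the
  \<open>T\<^sub>i\<^sup>+\<close> and \<open>T\<^sub>i\<^sup>-\<close>.\<close>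

lemma ce_W:
  fixes u v x y z :: "real^7"
  defines "W \<equiv> (\<lambda>p q r s. coframe_bracket u v $ p * rows3 x y z q r s - coframe_bracket u x $ p * rows3 v y z q r s
        + coframe_bracket u y $ p * rows3 v x z q r s - coframe_bracket u z $ p * rows3 v x y q r s
        + coframe_bracket v x $ p * rows3 u y z q r s - coframe_bracket v y $ p * rows3 u x z q r s
        + coframe_bracket v z $ p * rows3 u x y q r s + coframe_bracket x y $ p * rows3 u v z q r s
        - coframe_bracket x z $ p * rows3 u v y q r s + coframe_bracket y z $ p * rows3 u v x q r s)"
  shows "W 1 q r s = - rows5 u v x y z 2 7 q r s - rows5 u v x y z 6 3 q r s"
    "W 2 q r s = - rows5 u v x y z 3 5 q r s - rows5 u v x y z 7 1 q r s"
    "W 3 q r s = - rows5 u v x y z 1 6 q r s - rows5 u v x y z 5 2 q r s"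
    "W 4 q r s = 0"
    "W 5 q r s = - rows5 u v x y z 2 3 q r s - rows5 u v x y z 6 7 q r s"
    "W 6 q r s = - rows5 u v x y z 3 1 q r s - rows5 u v x y z 7 5 q r s"
    "W 7 q r s = - rows5 u v x y z 1 2 q r s - rows5 u v x y z 5 6 q r s"
  by (simp_all add: W_def coframe_bracket_nth rows5_def Let_def algebra_simps)

text \<open>The first three equations express \<open>d\<omega>\<^sup>2 = 0\<close> on the orbits,
  the others the differential of the terms of \<open>dt \<and> \<Omega>\<^sub>2\<close>. With
  \<open>\<omega>\<^sub>j = \<eta>\<^sub>j\<^sup>- \<and> \<eta>\<^sub>j\<^sup>+\<close> only the
  three forms \<open>dt \<and> \<omega>\<^sub>j \<and> \<omega>\<^sub>k\<close> appear, hence three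
  scalar equations for closedness.\<close>

lemma ce_rows4:
  fixes u v x y z :: "real^7"
  defines "ce \<equiv> (\<lambda>i j k l. alternate5 (bracket_term (\<lambda>a b c d. rows4 a b c d i j k l)) u v x y z)"
    and "Q \<equiv> rows5 u v x y z 4"
  shows "ce 2 6 3 7 = 0" "ce 1 5 3 7 = 0" "ce 1 5 2 6 = 0"
    "ce 4 5 6 7 = - 2 * (Q 2 6 3 7 + Q 1 5 3 7 + Q 1 5 2 6)"
    "ce 4 2 3 5 = - 2 * (Q 2 6 3 7 - Q 1 5 3 7 - Q 1 5 2 6)"
    "ce 4 3 1 6 = - 2 * (Q 1 5 3 7 - Q 2 6 3 7 - Q 1 5 2 6)"
    "ce 4 1 2 7 = - 2 * (Q 1 5 2 6 - Q 2 6 3 7 - Q 1 5 3 7)"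
  unfolding ce_def Q_def alternate5_bracket Let_def ce_W
  by (simp_all add: rows5_sort rows5_repeat coord_idx_simps)

section \<open>The forms of the family on tangent vectors of the principal part\<close>

context su2_frame
begin

lemma coframe_nth:
  "coframe (t, g1, g2) (s, v1, v2) $ 1 = (left_coord g1 v1 $ 1 - left_coord g2 v2 $ 1) / 2"
  "coframe (t, g1, g2) (s, v1, v2) $ 2 = (left_coord g1 v1 $ 2 - left_coord g2 v2 $ 2) / 2"
  "coframe (t, g1, g2) (s, v1, v2) $ 3 = (left_coord g1 v1 $ 3 - left_coord g2 v2 $ 3) / 2"
  "coframe (t, g1, g2) (s, v1, v2) $ 4 = s"
  "coframe (t, g1, g2) (s, v1, v2) $ 5 = (left_coord g1 v1 $ 1 + left_coord g2 v2 $ 1) / 2"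
  "coframe (t, g1, g2) (s, v1, v2) $ 6 = (left_coord g1 v1 $ 2 + left_coord g2 v2 $ 2) / 2"
  "coframe (t, g1, g2) (s, v1, v2) $ 7 = (left_coord g1 v1 $ 3 + left_coord g2 v2 $ 3) / 2"
  by (simp_all add: coframe_def Let_def vector_7)

lemma left_coord_nth: "left_coord g v $ i = co i (qcnj g \<odot> v) / (g \<bullet> g)"
  by (simp add: left_coord_def)

lemma left_coord_linear: "left_coord g (x + y) = left_coord g x + left_coord g y" "left_coord g (c *\<^sub>R x) = c *\<^sub>R left_coord g x"
  by (simp_all add: vec_eq_iff left_coord_nth qmult_add add_divide_distrib)

lemma linear_coframe: "linear (coframe x)"
proof -
  obtain t g1 g2 where x: "x = (t, g1, g2)" by (cases x) auto
  show ?thesis unfolding x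
  proof (rule linearI)
    fix u v :: prin and c :: real
    obtain s v1 v2 where u: "u = (s, v1, v2)" by (cases u) auto
    obtain r w1 w2 where v: "v = (r, w1, w2)" by (cases v) auto
    show "coframe (t, g1, g2) (u + v) = coframe (t, g1, g2) u + coframe (t, g1, g2) v"
      unfolding u v add_Pair by (simp add: vec_eq_iff forall_7 coframe_nth left_coord_linear field_simps)
    show "coframe (t, g1, g2) (c *\<^sub>R u) = c *\<^sub>R coframe (t, g1, g2) u"
      unfolding u scaleR_Pair by (simp add: vec_eq_iff forall_7 coframe_nth left_coord_linear field_simps)
  qed
qed

lemma N_tangent_iff:
  assumes "(t, g1, g2) \<in> N_man"
  shows "(s, v1, v2) \<in> tangent N_retr (t, g1, g2) \<longleftrightarrow> g1 \<bullet> v1 = 0 \<and> g2 \<bullet> v2 = 0"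
proof -
  have n: "g1 \<bullet> g1 = 1" "g2 \<bullet> g2 = 1" "norm g1 = 1" "norm g2 = 1"
    using assms by (auto simp: N_man_def SU2sq_def norm_eq_1)
  then have "(t, g1, g2) \<in> N_nbhd" using assms by (auto simp: N_nbhd_def N_man_def)
  then have tan: "tangent N_retr (t, g1, g2) = range (N_retr' (t, g1, g2))"
    unfolding tangent_def using frechet_derivative_at[OF N_retr_has_derivative] by simp
  show ?thesis
  proof
    assume "(s, v1, v2) \<in> tangent N_retr (t, g1, g2)"
    then show "g1 \<bullet> v1 = 0 \<and> g2 \<bullet> v2 = 0"
      unfolding tan using n by (auto simp: N_retr'_def inner_diff_right)
  next
    assume "g1 \<bullet> v1 = 0 \<and> g2 \<bullet> v2 = 0"
    then have "(s, v1, v2) = N_retr' (t, g1, g2) (s, v1, v2)" using n by (simp add: N_retr'_def)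
    then show "(s, v1, v2) \<in> tangent N_retr (t, g1, g2)" unfolding tan by (rule range_eqI)
  qed
qed

lemma eta_coframe:
  assumes x: "x \<in> N_man" and u: "u \<in> tangent N_retr x"
  shows "representation (T_pm T) (left_trans x u) (T_minus T 1) = coframe x u $ 1"
    "representation (T_pm T) (left_trans x u) (T_minus T 2) = coframe x u $ 2"
    "representation (T_pm T) (left_trans x u) (T_minus T 3) = coframe x u $ 3"
    "fst u = coframe x u $ 4"
    "representation (T_pm T) (left_trans x u) (T_plus T 1) = coframe x u $ 5"
    "representation (T_pm T) (left_trans x u) (T_plus T 2) = coframe x u $ 6"
    "representation (T_pm T) (left_trans x u) (T_plus T 3) = coframe x u $ 7"
proof -
  obtain t g1 g2 s v1 v2 where xu: "x = (t, g1, g2)" "u = (s, v1, v2)" by (cases x; cases u) auto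
  have n: "g1 \<bullet> g1 = 1" "g2 \<bullet> g2 = 1" using x by (auto simp: xu N_man_def SU2sq_def norm_eq_1)
  have "fst (qcnj g1 \<odot> v1) = 0" "fst (qcnj g2 \<odot> v2) = 0"
    using u N_tangent_iff[of t g1 g2 s v1 v2] x by (auto simp: xu fst_qcnj_qmult)
  note r = representation_T_pm[OF this]
  show "representation (T_pm T) (left_trans x u) (T_minus T 1) = coframe x u $ 1"
    "representation (T_pm T) (left_trans x u) (T_minus T 2) = coframe x u $ 2"
    "representation (T_pm T) (left_trans x u) (T_minus T 3) = coframe x u $ 3"
    "fst u = coframe x u $ 4"
    "representation (T_pm T) (left_trans x u) (T_plus T 1) = coframe x u $ 5"
    "representation (T_pm T) (left_trans x u) (T_plus T 2) = coframe x u $ 6"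
    "representation (T_pm T) (left_trans x u) (T_plus T 3) = coframe x u $ 7"
    by (simp_all add: xu left_trans_def coframe_nth left_coord_nth r n)
qed

lemma omega_coframe:
  assumes "x \<in> N_man" "a \<in> tangent N_retr x" "b \<in> tangent N_retr x"
  shows "omega T A B x [a, b] = (let z = coframe x a; w = coframe x b; d = (\<lambda>i j. z$i * w$j - z$j * w$i) in
    4 * (A 1 (fst x) * B 1 (fst x) * d 1 5 + A 2 (fst x) * B 2 (fst x) * d 2 6 + A 3 (fst x) * B 3 (fst x) * d 3 7))"
  by (simp add: omega_def eta_plus_def eta_minus_def wedge_list_rows row2_def sum_3 Let_def
      eta_coframe[OF assms(1,2)] eta_coframe[OF assms(1,3)] algebra_simps)

lemma Omega_coframe:
  assumes "x \<in> N_man" "a \<in> tangent N_retr x" "b \<in> tangent N_retr x" "c \<in> tangent N_retr x"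
  defines "R \<equiv> rows3 (coframe x a) (coframe x b) (coframe x c)"
  shows "Omega1 T A B x [a, b, c] = 8 * (B 1 (fst x) * B 2 (fst x) * B 3 (fst x)) * R 1 2 3
      - 8 * (A 2 (fst x) * A 3 (fst x) * B 1 (fst x) * R 6 7 1 + A 3 (fst x) * A 1 (fst x) * B 2 (fst x) * R 7 5 2
        + A 1 (fst x) * A 2 (fst x) * B 3 (fst x) * R 5 6 3)"
    "Omega2 T A B x [a, b, c] = - 8 * (A 1 (fst x) * A 2 (fst x) * A 3 (fst x)) * R 5 6 7
      + 8 * (B 2 (fst x) * B 3 (fst x) * A 1 (fst x) * R 2 3 5 + B 3 (fst x) * B 1 (fst x) * A 2 (fst x) * R 3 1 6
        + B 1 (fst x) * B 2 (fst x) * A 3 (fst x) * R 1 2 7)"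
proof -
  note e = eta_coframe[OF assms(1,2)] eta_coframe[OF assms(1,3)] eta_coframe[OF assms(1,4)]
  have rows:
    "row3 (\<lambda>v. representation (T_pm T) (left_trans x v) (T_minus T 1)) a b c = row3 (\<lambda>v. v $ 1) (coframe x a) (coframe x b) (coframe x c)"
    "row3 (\<lambda>v. representation (T_pm T) (left_trans x v) (T_minus T 2)) a b c = row3 (\<lambda>v. v $ 2) (coframe x a) (coframe x b) (coframe x c)"
    "row3 (\<lambda>v. representation (T_pm T) (left_trans x v) (T_minus T 3)) a b c = row3 (\<lambda>v. v $ 3) (coframe x a) (coframe x b) (coframe x c)"
    "row3 (\<lambda>v. representation (T_pm T) (left_trans x v) (T_plus T 1)) a b c = row3 (\<lambda>v. v $ 5) (coframe x a) (coframe x b) (coframe x c)"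
    "row3 (\<lambda>v. representation (T_pm T) (left_trans x v) (T_plus T 2)) a b c = row3 (\<lambda>v. v $ 6) (coframe x a) (coframe x b) (coframe x c)"
    "row3 (\<lambda>v. representation (T_pm T) (left_trans x v) (T_plus T 3)) a b c = row3 (\<lambda>v. v $ 7) (coframe x a) (coframe x b) (coframe x c)"
    by (simp_all add: row3_def e)
  have sw: "R j i k = - R i j k" for i j k unfolding R_def by (rule rows3_swap)
  show "Omega1 T A B x [a, b, c] = 8 * (B 1 (fst x) * B 2 (fst x) * B 3 (fst x)) * R 1 2 3
      - 8 * (A 2 (fst x) * A 3 (fst x) * B 1 (fst x) * R 6 7 1 + A 3 (fst x) * A 1 (fst x) * B 2 (fst x) * R 7 5 2
        + A 1 (fst x) * A 2 (fst x) * B 3 (fst x) * R 5 6 3)"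
    unfolding Omega1_def eta_plus_def eta_minus_def wedge_list_rows mult.assoc levi_civita_sum
      rows rows3_def[symmetric] R_def[symmetric] sw[of 7 6] sw[of 7 5] sw[of 6 5]
    by (simp add: algebra_simps)
  show "Omega2 T A B x [a, b, c] = - 8 * (A 1 (fst x) * A 2 (fst x) * A 3 (fst x)) * R 5 6 7
      + 8 * (B 2 (fst x) * B 3 (fst x) * A 1 (fst x) * R 2 3 5 + B 3 (fst x) * B 1 (fst x) * A 2 (fst x) * R 3 1 6
        + B 1 (fst x) * B 2 (fst x) * A 3 (fst x) * R 1 2 7)"
    unfolding Omega2_def eta_plus_def eta_minus_def wedge_list_rows mult.assoc levi_civita_sum
      rows rows3_def[symmetric] R_def[symmetric] sw[of 3 2] sw[of 3 1] sw[of 2 1]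
    by (simp add: algebra_simps)
qed

lemma phi_AB_coframe:
  assumes x: "x \<in> N_man" and us: "length us = 3" "set us \<subseteq> tangent N_retr x"
  shows "phi_AB T A B x us = phi0 (map (frame_scale (\<lambda>i. A i (fst x)) (\<lambda>i. B i (fst x))) (map (coframe x) us))"
proof -
  obtain a b c where abc: "us = [a, b, c]" using us(1) by (auto simp: length_Suc_conv eval_nat_numeral)
  then have t: "a \<in> tangent N_retr x" "b \<in> tangent N_retr x" "c \<in> tangent N_retr x" using us(2) by auto
  show ?thesis
    unfolding phi_AB_def abc list.map phi0_frame_scale[unfolded list.map] dt_def wedge_1_oneform Omega_coframe[OF x t]
      omega_coframe[OF x t(1,2)] omega_coframe[OF x t(1,3)] omega_coframe[OF x t(2,3)]
      eta_coframe(4)[OF x t(1)] eta_coframe(4)[OF x t(2)] eta_coframe(4)[OF x t(3)] Let_def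
    by (simp add: rows3_def row3_def algebra_simps)
qed

lemma star_phi_AB_coframe:
  assumes x: "x \<in> N_man" and us: "length us = 4" "set us \<subseteq> tangent N_retr x"
  shows "star_phi_AB T A B x us = hodge7 3 phi0 (map (frame_scale (\<lambda>i. A i (fst x)) (\<lambda>i. B i (fst x))) (map (coframe x) us))"
proof -
  obtain a b c d where abc: "us = [a, b, c, d]" using us(1) by (auto simp: length_Suc_conv eval_nat_numeral)
  then have t: "a \<in> tangent N_retr x" "b \<in> tangent N_retr x" "c \<in> tangent N_retr x" "d \<in> tangent N_retr x"
    using us(2) by auto
  define p q r w where z: "p = coframe x a" "q = coframe x b" "r = coframe x c" "w = coframe x d"
  define dd where "dd u v i j = u$i * v$j - u$j * v$i" for u v :: "real^7" and i j :: 7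
  define a1 a2 a3 where "a1 = A 1 (fst x) * B 1 (fst x)" "a2 = A 2 (fst x) * B 2 (fst x)" "a3 = A 3 (fst x) * B 3 (fst x)"
  have om: "omega T A B x [a', b'] = 4 * (a1 * dd (coframe x a') (coframe x b') 1 5 + a2 * dd (coframe x a') (coframe x b') 2 6
     + a3 * dd (coframe x a') (coframe x b') 3 7)" if "a' \<in> tangent N_retr x" "b' \<in> tangent N_retr x" for a' b'
    using omega_coframe[OF x that] by (simp add: Let_def dd_def a1_a2_a3_def)
  have 1: "rows4 p q r w i j k l = dd p q i j * dd r w k l - dd p r i j * dd q w k l + dd p w i j * dd q r k l
    + dd q r i j * dd p w k l - dd q w i j * dd p r k l + dd r w i j * dd p q k l" for i j k l
    by (simp add: rows4_def row4_def dd_def algebra_simps)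
  \<comment> \<open>The Pluecker relation: a decomposable 2-form has square 0, so only mixed terms
    of \<open>\<omega> \<and> \<omega>\<close> survive.\<close>
  have 0: "dd p q i j * dd r w i j - dd p r i j * dd q w i j + dd p w i j * dd q r i j = 0" for i j
    by (simp add: dd_def algebra_simps)
  have sq: "1 / 2 * wedge 2 (omega T A B x) (omega T A B x) [a, b, c, d] = 16 * (a2 * a3 * rows4 p q r w 2 6 3 7
     + a1 * a3 * rows4 p q r w 1 5 3 7 + a1 * a2 * rows4 p q r w 1 5 2 6)"
  proof -
    have "1 / 2 * wedge 2 (omega T A B x) (omega T A B x) [a, b, c, d] =
      omega T A B x [a, b] * omega T A B x [c, d] - omega T A B x [a, c] * omega T A B x [b, d]
      + omega T A B x [a, d] * omega T A B x [b, c]"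
      by (simp add: wedge_2_list4)
    also have "\<dots> = 16 * (a2 * a3 * rows4 p q r w 2 6 3 7 + a1 * a3 * rows4 p q r w 1 5 3 7 + a1 * a2 * rows4 p q r w 1 5 2 6)
      + 16 * (a1 * a1 * (dd p q 1 5 * dd r w 1 5 - dd p r 1 5 * dd q w 1 5 + dd p w 1 5 * dd q r 1 5)
        + a2 * a2 * (dd p q 2 6 * dd r w 2 6 - dd p r 2 6 * dd q w 2 6 + dd p w 2 6 * dd q r 2 6)
        + a3 * a3 * (dd p q 3 7 * dd r w 3 7 - dd p r 3 7 * dd q w 3 7 + dd p w 3 7 * dd q r 3 7))"
      unfolding om[OF t(1,2)] om[OF t(3,4)] om[OF t(1,3)] om[OF t(2,4)] om[OF t(1,4)] om[OF t(2,3)] z[symmetric] 1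
      by (simp add: algebra_simps)
    finally show ?thesis unfolding 0 by simp
  qed
  have r4: "rows4 p q r w 4 i j k = p$4 * rows3 q r w i j k - q$4 * rows3 p r w i j k + r$4 * rows3 p q w i j k
      - w$4 * rows3 p q r i j k" for i j k
    by (simp add: rows4_def rows3_def row4_def row3_def)
  show ?thesis
    unfolding star_phi_AB_def abc sq list.map hodge7_frame_scale[unfolded list.map] dt_def wedge_1_oneform
      Omega_coframe(2)[OF x t(2,3,4)] Omega_coframe(2)[OF x t(1,3,4)] Omega_coframe(2)[OF x t(1,2,4)]
      Omega_coframe(2)[OF x t(1,2,3)] eta_coframe(4)[OF x t(1)] eta_coframe(4)[OF x t(2)] eta_coframe(4)[OF x t(3)]
      eta_coframe(4)[OF x t(4)] z[symmetric] r4
    by (simp add: a1_a2_a3_def algebra_simps)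
qed

lemma N_retr_nbhd:
  assumes "y \<in> N_nbhd"
  shows "N_retr y \<in> N_man" "fst (N_retr y) = fst y" "N_retr' y u \<in> tangent N_retr (N_retr y)"
    "coframe (N_retr y) (N_retr' y u) = coframe y u"
proof -
  obtain t g1 g2 where y: "y = (t, g1, g2)" by (cases y) auto
  have g: "g1 \<noteq> 0" "g2 \<noteq> 0" "t > 0" using assms by (auto simp: N_nbhd_def y)
  obtain s v1 v2 where u: "u = (s, v1, v2)" by (cases u) auto
  show N: "N_retr y \<in> N_man" "fst (N_retr y) = fst y"
    using g by (auto simp: N_retr_def y N_man_def SU2sq_def norm_sgn)
  have r: "N_retr y = (t, sgn g1, sgn g2)" by (simp add: N_retr_def y)
  have o: "sgn g \<bullet> ((1 / norm g) *\<^sub>R (v - ((g \<bullet> v) / (g \<bullet> g)) *\<^sub>R g)) = 0" if "g \<noteq> 0" for g v :: quat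
    using that by (simp add: sgn_div_norm inner_diff_right)
  show "N_retr' y u \<in> tangent N_retr (N_retr y)"
    using N(1) N_tangent_iff[of t "sgn g1" "sgn g2"] o g unfolding r by (simp add: N_retr'_def y u)
  have l: "left_coord (sgn g) ((1 / norm g) *\<^sub>R (v - ((g \<bullet> v) / (g \<bullet> g)) *\<^sub>R g)) = left_coord g v" if "g \<noteq> 0" for g v
    unfolding vec_eq_iff left_coord_nth using that
    by (simp add: sgn_div_norm qcnj_linear qmult_diff qcnj_qmult_self power2_norm_eq_inner[symmetric] power2_eq_square field_simps)
  show "coframe (N_retr y) (N_retr' y u) = coframe y u"
    unfolding r by (simp add: N_retr'_def y u coframe_def Let_def l g)
qed

lemma pullback_star_phi_AB:
  assumes y: "y \<in> N_nbhd" and us: "length us = 4"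
  shows "pullback N_retr (star_phi_AB T A B) y us =
    hodge7 3 phi0 (map (frame_scale (\<lambda>i. A i (fst y)) (\<lambda>i. B i (fst y))) (map (coframe y) us))"
proof -
  have "frechet_derivative N_retr (at y) = N_retr' y"
    using frechet_derivative_at[OF N_retr_has_derivative[OF y]] by simp
  then have "pullback N_retr (star_phi_AB T A B) y us = star_phi_AB T A B (N_retr y) (map (N_retr' y) us)"
    by (simp add: pullback_def)
  also have "\<dots> = hodge7 3 phi0 (map (frame_scale (\<lambda>i. A i (fst y)) (\<lambda>i. B i (fst y)))
      (map (coframe (N_retr y)) (map (N_retr' y) us)))"
    using N_retr_nbhd[OF y] us by (subst star_phi_AB_coframe) auto
  also have "map (coframe (N_retr y)) (map (N_retr' y) us) = map (coframe y) us"
    using N_retr_nbhd(4)[OF y] by simp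
  finally show ?thesis .
qed

lemma open_N_nbhd: "open N_nbhd"
proof -
  have "N_nbhd = {y. fst y > 0} \<inter> {y. fst (snd y) \<noteq> 0} \<inter> {y. snd (snd y) \<noteq> 0}"
    by (auto simp: N_nbhd_def)
  moreover have "open \<dots>"
    by (intro open_Int open_Collect_less open_Collect_neq continuous_intros)
  ultimately show ?thesis by simp
qed

lemma N_man_nbhd: "x \<in> N_man \<Longrightarrow> x \<in> N_nbhd"
  by (auto simp: N_man_def N_nbhd_def SU2sq_def)

section \<open>Derivative of the coframe with respect to the base point\<close>

definition left_coord' :: "quat \<Rightarrow> quat \<Rightarrow> quat \<Rightarrow> real^3" where
  "left_coord' g h v = (1 / (g \<bullet> g)) *\<^sub>R (\<chi> i. co i (qcnj h \<odot> v)) - (2 * (g \<bullet> h) / (g \<bullet> g)\<^sup>2) *\<^sub>R (\<chi> i. co i (qcnj g \<odot> v))"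

lemma left_coord_has_derivative:
  assumes "g \<noteq> 0"
  shows "((\<lambda>g. left_coord g v) has_derivative (\<lambda>h. left_coord' g h v)) (at g)"
proof -
  have bl: "bounded_linear (\<lambda>h. \<chi> i. co i (qcnj h \<odot> v))"
    by (simp add: linear_conv_bounded_linear[symmetric] linearI vec_eq_iff qcnj_linear qmult_add)
  have "((\<lambda>g. inverse (g \<bullet> g) *\<^sub>R (\<chi> i. co i (qcnj g \<odot> v))) has_derivative
     (\<lambda>h. inverse (g \<bullet> g) *\<^sub>R (\<chi> i. co i (qcnj h \<odot> v))
       + (- (inverse (g \<bullet> g) * (g \<bullet> h + h \<bullet> g) * inverse (g \<bullet> g))) *\<^sub>R (\<chi> i. co i (qcnj g \<odot> v)))) (at g)"
    using assms by (intro has_derivative_scaleR Deriv.has_derivative_inverse has_derivative_inner has_derivative_ident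
      bounded_linear_imp_has_derivative[OF bl]) auto
  moreover have "inverse (g \<bullet> g) *\<^sub>R (\<chi> i. co i (qcnj h \<odot> v))
       + (- (inverse (g \<bullet> g) * (g \<bullet> h + h \<bullet> g) * inverse (g \<bullet> g))) *\<^sub>R (\<chi> i. co i (qcnj g \<odot> v)) = left_coord' g h v" for h
    by (simp add: left_coord'_def inner_commute[of h] divide_inverse power2_eq_square vec_eq_iff algebra_simps)
  ultimately show ?thesis by (simp add: left_coord_def[abs_def] divide_inverse)
qed

definition coframe' :: "prin \<Rightarrow> prin \<Rightarrow> prin \<Rightarrow> real^7" where
  "coframe' = (\<lambda>(t, g1, g2) (r, h1, h2) (s, v1, v2). let x = left_coord' g1 h1 v1; y = left_coord' g2 h2 v2 in
     vector [(x$1 - y$1) / 2, (x$2 - y$2) / 2, (x$3 - y$3) / 2, 0, (x$1 + y$1) / 2, (x$2 + y$2) / 2, (x$3 + y$3) / 2])"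

lemma coframe_has_derivative:
  assumes "y \<in> N_nbhd"
  shows "((\<lambda>y. coframe y u) has_derivative (\<lambda>w. coframe' y w u)) (at y)"
proof -
  obtain t g1 g2 where y: "y = (t, g1, g2)" by (cases y) auto
  have g: "g1 \<noteq> 0" "g2 \<noteq> 0" using assms by (auto simp: N_nbhd_def y)
  obtain s v1 v2 where u: "u = (s, v1, v2)" by (cases u) auto
  let ?P = "\<lambda>x::real^3. vector [x$1/2, x$2/2, x$3/2, 0, x$1/2, x$2/2, x$3/2] :: real^7"
  let ?Q = "\<lambda>x::real^3. vector [-x$1/2, -x$2/2, -x$3/2, 0, x$1/2, x$2/2, x$3/2] :: real^7"
  have PQ: "bounded_linear ?P" "bounded_linear ?Q"
    by (simp_all add: linear_conv_bounded_linear[symmetric] linearI vec_eq_iff forall_7 vector_7 field_simps)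
  have "((\<lambda>y::prin. left_coord (fst (snd y)) v1) has_derivative (\<lambda>w. left_coord' g1 (fst (snd w)) v1)) (at y)"
    by (rule has_derivative_compose[of "\<lambda>y. fst (snd y)"])
      (auto intro!: derivative_eq_intros left_coord_has_derivative simp: y g)
  moreover have "((\<lambda>y::prin. left_coord (snd (snd y)) v2) has_derivative (\<lambda>w. left_coord' g2 (snd (snd w)) v2)) (at y)"
    by (rule has_derivative_compose[of "\<lambda>y. snd (snd y)"])
      (auto intro!: derivative_eq_intros left_coord_has_derivative simp: y g)
  ultimately have "((\<lambda>y::prin. ?P (left_coord (fst (snd y)) v1) + ?Q (left_coord (snd (snd y)) v2) + s *\<^sub>R axis 4 1) has_derivative
    (\<lambda>w. ?P (left_coord' g1 (fst (snd w)) v1) + ?Q (left_coord' g2 (snd (snd w)) v2) + 0)) (at y)"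
    by (intro has_derivative_add bounded_linear.has_derivative[OF PQ(1)] bounded_linear.has_derivative[OF PQ(2)] has_derivative_const)
  moreover have "?P (left_coord (fst (snd y)) v1) + ?Q (left_coord (snd (snd y)) v2) + s *\<^sub>R axis 4 1 = coframe y u" for y
    by (cases y) (simp add: u vec_eq_iff forall_7 vector_7 coframe_nth axis_def field_simps)
  moreover have "?P (left_coord' g1 (fst (snd w)) v1) + ?Q (left_coord' g2 (snd (snd w)) v2) + 0 = coframe' y w u" for w
    by (cases w) (simp add: y u vec_eq_iff forall_7 vector_7 coframe'_def Let_def field_simps)
  ultimately show ?thesis by simp
qed

text \<open>With \<open>v\<close> constant in the ambient space, differentiating
  \<open>qcnj g \<odot> v\<close> towards \<open>h\<close> gives \<open>qcnj h \<odot> v\<close>. In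
  terms of the imaginary quaternions \<open>P = qcnj g \<odot> h\<close> and
  \<open>Q = qcnj g \<odot> v\<close> this is \<open>- (P \<odot> Q)\<close>, whose imaginary part
  is minus their cross product, i.e. minus half the bracket.\<close>

lemma coframe'_tangent:
  assumes x: "x \<in> N_man" and w: "w \<in> tangent N_retr x" and u: "u \<in> tangent N_retr x"
  shows "coframe' x w u = coframe_bracket (coframe x w) (coframe x u)"
proof -
  obtain t g1 g2 r h1 h2 s v1 v2 where e: "x = (t, g1, g2)" "w = (r, h1, h2)" "u = (s, v1, v2)"
    by (cases x; cases w; cases u) auto
  have n: "g1 \<bullet> g1 = 1" "g2 \<bullet> g2 = 1" "norm g1 = 1" "norm g2 = 1"
    using x by (auto simp: e N_man_def SU2sq_def norm_eq_1)
  have o: "g1 \<bullet> h1 = 0" "g2 \<bullet> h2 = 0" "g1 \<bullet> v1 = 0" "g2 \<bullet> v2 = 0"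
    using N_tangent_iff x w u by (auto simp: e)
  have l: "left_coord' g h v $ 1 = - (left_coord g h $ 2 * left_coord g v $ 3 - left_coord g h $ 3 * left_coord g v $ 2)
     \<and> left_coord' g h v $ 2 = - (left_coord g h $ 3 * left_coord g v $ 1 - left_coord g h $ 1 * left_coord g v $ 3)
     \<and> left_coord' g h v $ 3 = - (left_coord g h $ 1 * left_coord g v $ 2 - left_coord g h $ 2 * left_coord g v $ 1)"
    if "g \<bullet> g = 1" "norm g = 1" "g \<bullet> h = 0" "g \<bullet> v = 0" for g h v
  proof -
    have "qcnj h \<odot> v = qcnj (qcnj g \<odot> h) \<odot> (qcnj g \<odot> v)"
      using that(2) by (simp add: qcnj_qmult qmult_assoc qcnj_unit')
    moreover have "fst (qcnj g \<odot> h) = 0" "fst (qcnj g \<odot> v) = 0" using that by (simp_all add: fst_qcnj_qmult)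
    moreover obtain P Q where "qcnj g \<odot> h = P" "qcnj g \<odot> v = Q" by blast
    ultimately show ?thesis using that by (simp add: left_coord'_def left_coord_nth co_qmult(2-4) qcnj_simps)
  qed
  show ?thesis
    unfolding e vec_eq_iff forall_7 coframe_bracket_nth coframe_nth coframe'_def Let_def prod.case vector_7
    using l[OF n(1,3) o(1,3)] l[OF n(2,4) o(2,4)] by (simp add: field_simps)
qed

end

section \<open>Closedness on the principal part\<close>

lemma length_5_conv: "length vs = 5 \<Longrightarrow> \<exists>a b c d e. vs = [a, b, c, d, e]"
  by (auto simp: length_Suc_conv eval_nat_numeral)

context su2_frame
begin

text \<open>The inverse of \<open>coframe\<close> on tangent spaces: the dual frame, consisting of
  the \<open>T\<^sub>i\<^sup>-\<close>, \<open>\<partial>\<^sub>t\<close> and the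
  \<open>T\<^sub>i\<^sup>+\<close>, left-translated to the point.\<close>

definition frame_vec :: "prin \<Rightarrow> real^7 \<Rightarrow> prin" where
  "frame_vec = (\<lambda>(t, g1, g2) z. (z$4, g1 \<odot> ((z$5 + z$1) *\<^sub>R T 1 + (z$6 + z$2) *\<^sub>R T 2 + (z$7 + z$3) *\<^sub>R T 3),
     g2 \<odot> ((z$5 - z$1) *\<^sub>R T 1 + (z$6 - z$2) *\<^sub>R T 2 + (z$7 - z$3) *\<^sub>R T 3)))"

lemma frame_vec:
  assumes x: "x \<in> N_man"
  shows "linear (frame_vec x)" "frame_vec x z \<in> tangent N_retr x" "coframe x (frame_vec x z) = z"
    "u \<in> tangent N_retr x \<Longrightarrow> frame_vec x (coframe x u) = u"
proof -
  obtain t g1 g2 where e: "x = (t, g1, g2)" by (cases x) auto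
  have n: "g1 \<bullet> g1 = 1" "g2 \<bullet> g2 = 1" "norm g1 = 1" "norm g2 = 1"
    using x by (auto simp: e N_man_def SU2sq_def norm_eq_1)
  show "linear (frame_vec x)"
  proof -
    define p m where "p z = (z$5 + z$1) *\<^sub>R T 1 + (z$6 + z$2) *\<^sub>R T 2 + (z$7 + z$3) *\<^sub>R T 3"
      "m z = (z$5 - z$1) *\<^sub>R T 1 + (z$6 - z$2) *\<^sub>R T 2 + (z$7 - z$3) *\<^sub>R T 3" for z :: "real^7"
    have l: "p (u + v) = p u + p v" "m (u + v) = m u + m v" "p (c *\<^sub>R u) = c *\<^sub>R p u" "m (c *\<^sub>R u) = c *\<^sub>R m u" for u v c
      by (simp_all add: p_m_def co_eq_iff algebra_simps)
    have f: "frame_vec x z = (z$4, g1 \<odot> p z, g2 \<odot> m z)" for z by (simp add: frame_vec_def e p_m_def)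
    show ?thesis by (rule linearI) (simp_all add: f l qmult_add)
  qed
  have ip: "g \<bullet> (g \<odot> y) = fst y" if "g \<bullet> g = 1" for g y
    using inner_qmult_left[of g qone y] that by (simp add: quat_inner qone_simps)
  show "frame_vec x z \<in> tangent N_retr x"
    using N_tangent_iff x by (simp add: e frame_vec_def ip n)
  show "coframe x (frame_vec x z) = z"
    by (simp add: e frame_vec_def vec_eq_iff forall_7 coframe_nth left_coord_nth qcnj_unit' n)
  assume u: "u \<in> tangent N_retr x"
  obtain s v1 v2 where u': "u = (s, v1, v2)" by (cases u) auto
  have "qcnj g1 \<odot> v1 = co 1 (qcnj g1 \<odot> v1) *\<^sub>R T 1 + co 2 (qcnj g1 \<odot> v1) *\<^sub>R T 2 + co 3 (qcnj g1 \<odot> v1) *\<^sub>R T 3"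
    "qcnj g2 \<odot> v2 = co 1 (qcnj g2 \<odot> v2) *\<^sub>R T 1 + co 2 (qcnj g2 \<odot> v2) *\<^sub>R T 2 + co 3 (qcnj g2 \<odot> v2) *\<^sub>R T 3"
    using N_tangent_iff[of t g1 g2 s v1 v2] u x by (simp_all add: e u' co_eq_iff fst_qcnj_qmult)
  then have "g1 \<odot> (co 1 (qcnj g1 \<odot> v1) *\<^sub>R T 1 + co 2 (qcnj g1 \<odot> v1) *\<^sub>R T 2 + co 3 (qcnj g1 \<odot> v1) *\<^sub>R T 3) = v1"
    "g2 \<odot> (co 1 (qcnj g2 \<odot> v2) *\<^sub>R T 1 + co 2 (qcnj g2 \<odot> v2) *\<^sub>R T 2 + co 3 (qcnj g2 \<odot> v2) *\<^sub>R T 3) = v2"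
    using qcnj_unit'(2)[OF n(3), of v1] qcnj_unit'(2)[OF n(4), of v2] by simp_all
  moreover have half: "(p + q) / 2 + (p - q) / 2 = p" "(p + q) / 2 - (p - q) / 2 = q" for p q :: real
    by (simp_all add: field_simps)
  ultimately show "frame_vec x (coframe x u) = u"
    by (simp add: e u' frame_vec_def coframe_nth left_coord_nth n half)
qed

text \<open>The pulled-back form is \<open>\<mu>\<close> with coefficients depending on
  \<open>t\<close>, evaluated on the moving coframe. Differentiating the coefficients gives terms
  with a factor \<open>dt\<close>, differentiating the coframe gives the terms of
  \<open>ce_rows4\<close>; together they are multiples of the three forms
  \<open>dt \<and> \<omega>\<^sub>j \<and> \<omega>\<^sub>k\<close>.\<close>

lemma N_ext_deriv:
  assumes x: "x \<in> N_man"
    and F: "((\<lambda>s. A 2 s * B 2 s * A 3 s * B 3 s) has_real_derivative F1) (at (fst x))"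
      "((\<lambda>s. A 1 s * B 1 s * A 3 s * B 3 s) has_real_derivative F2) (at (fst x))"
      "((\<lambda>s. A 1 s * B 1 s * A 2 s * B 2 s) has_real_derivative F3) (at (fst x))"
    and G: "((\<lambda>s. A 1 s * A 2 s * A 3 s) has_real_derivative G) (at (fst x))"
    and H: "((\<lambda>s. B 2 s * B 3 s * A 1 s) has_real_derivative H1) (at (fst x))"
      "((\<lambda>s. B 3 s * B 1 s * A 2 s) has_real_derivative H2) (at (fst x))"
      "((\<lambda>s. B 1 s * B 2 s * A 3 s) has_real_derivative H3) (at (fst x))"
  shows "length us = 4 \<Longrightarrow> (\<lambda>y. pullback N_retr (star_phi_AB T A B) y us) differentiable (at x)"
    and "set [v0, v1, v2, v3, v4] \<subseteq> tangent N_retr x \<Longrightarrow> ext_deriv N_retr (star_phi_AB T A B) x [v0, v1, v2, v3, v4] =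
      (let t = fst x; g = A 1 t * A 2 t * A 3 t; h1 = B 2 t * B 3 t * A 1 t; h2 = B 3 t * B 1 t * A 2 t;
         h3 = B 1 t * B 2 t * A 3 t;
         Q = rows5 (coframe x v0) (coframe x v1) (coframe x v2) (coframe x v3) (coframe x v4) 4
       in 16 * ((F1 - (g - h1 + h2 + h3)) * Q 2 6 3 7 + (F2 - (g - h2 + h1 + h3)) * Q 1 5 3 7
          + (F3 - (g - h3 + h1 + h2)) * Q 1 5 2 6))"
proof -
  define \<mu> where "\<mu> s us = hodge7 3 phi0 (map (frame_scale (\<lambda>i. A i s) (\<lambda>i. B i s)) us)" for s us
  have alt: "alt4 (\<mu> s)" for s
    unfolding \<mu>_def[abs_def] by (rule alt4_compose_linear[OF alt4_hodge7 linear_frame_scale])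
  define E where "E a b c d = 16 * (F1 * rows4 a b c d 2 6 3 7 + F2 * rows4 a b c d 1 5 3 7 + F3 * rows4 a b c d 1 5 2 6)
    + 8 * G * rows4 a b c d 4 5 6 7
    - 8 * (H1 * rows4 a b c d 4 2 3 5 + H2 * rows4 a b c d 4 3 1 6 + H3 * rows4 a b c d 4 1 2 7)" for a b c d
  define M where "M us = (*) (E (us ! 0) (us ! 1) (us ! 2) (us ! 3))" for us
  have M: "((\<lambda>s. \<mu> s us) has_derivative M us) (at (fst x))" if us: "length us = 4" for us
  proof -
    obtain a b c d where u: "us = [a, b, c, d]" using us by (auto simp: length_Suc_conv eval_nat_numeral)
    have "((\<lambda>s. \<mu> s us) has_real_derivative E a b c d) (at (fst x))"
      unfolding u \<mu>_def hodge7_frame_scale E_def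
      by (intro DERIV_add DERIV_diff DERIV_cmult DERIV_cmult_right F H DERIV_cmult[OF G, of 8])
    then show ?thesis by (simp add: has_field_derivative_def M_def u)
  qed
  have xn: "x \<in> N_nbhd" using x by (rule N_man_nbhd)
  have D: "((\<lambda>y. pullback N_retr (star_phi_AB T A B) y [a, b, c, d]) has_derivative
    (\<lambda>w. M [coframe x a, coframe x b, coframe x c, coframe x d] (fst w)
      + \<mu> (fst x) [coframe' x w a, coframe x b, coframe x c, coframe x d]
      + \<mu> (fst x) [coframe x a, coframe' x w b, coframe x c, coframe x d]
      + \<mu> (fst x) [coframe x a, coframe x b, coframe' x w c, coframe x d]
      + \<mu> (fst x) [coframe x a, coframe x b, coframe x c, coframe' x w d])) (at x)" for a b c d
  proof (rule has_derivative_transform_within_open[OF _ open_N_nbhd xn])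
    show "((\<lambda>y. \<mu> (fst y) [coframe y a, coframe y b, coframe y c, coframe y d]) has_derivative
    (\<lambda>w. M [coframe x a, coframe x b, coframe x c, coframe x d] (fst w)
      + \<mu> (fst x) [coframe' x w a, coframe x b, coframe x c, coframe x d]
      + \<mu> (fst x) [coframe x a, coframe' x w b, coframe x c, coframe x d]
      + \<mu> (fst x) [coframe x a, coframe x b, coframe' x w c, coframe x d]
      + \<mu> (fst x) [coframe x a, coframe x b, coframe x c, coframe' x w d])) (at x)"
      by (rule has_derivative_slots4[where \<mu> = \<mu> and \<Psi> = fst and a = "\<lambda>y. coframe y a" and b = "\<lambda>y. coframe y b"
            and c = "\<lambda>y. coframe y c" and d = "\<lambda>y. coframe y d", OF open_N_nbhd xn alt M])
        (auto intro!: coframe_has_derivative xn derivative_eq_intros)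
    show "\<mu> (fst y) [coframe y a, coframe y b, coframe y c, coframe y d] =
        pullback N_retr (star_phi_AB T A B) y [a, b, c, d]" if "y \<in> N_nbhd" for y
      using that by (subst pullback_star_phi_AB) (auto simp: \<mu>_def)
  qed
  show "(\<lambda>y. pullback N_retr (star_phi_AB T A B) y us) differentiable (at x)" if us: "length us = 4"
  proof -
    obtain a b c d where u: "us = [a, b, c, d]" using us by (auto simp: length_Suc_conv eval_nat_numeral)
    show ?thesis unfolding u using D differentiableI by blast
  qed
  assume vs: "set [v0, v1, v2, v3, v4] \<subseteq> tangent N_retr x"
  define H where "H a b c d = \<mu> (fst x) [a, b, c, d]" for a b c d
  have fd: "frechet_derivative (\<lambda>y. pullback N_retr (star_phi_AB T A B) y [a, b, c, d]) (at x) w =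
     coframe x w $ 4 * E (coframe x a) (coframe x b) (coframe x c) (coframe x d)
     + bracket_term H (coframe x w) (coframe x a) (coframe x b) (coframe x c) (coframe x d)"
    if "{w, a, b, c, d} \<subseteq> tangent N_retr x" for w a b c d
    unfolding frechet_derivative_at[OF D, symmetric] using that eta_coframe(4)[OF x, of w]
    by (simp add: M_def H_def bracket_term_def coframe'_tangent[OF x])
  define t where "t = fst x"
  define f1 f2 f3 where "f1 = A 2 t * B 2 t * A 3 t * B 3 t" "f2 = A 1 t * B 1 t * A 3 t * B 3 t" "f3 = A 1 t * B 1 t * A 2 t * B 2 t"
  define g where "g = A 1 t * A 2 t * A 3 t"
  define h1 h2 h3 where "h1 = B 2 t * B 3 t * A 1 t" "h2 = B 3 t * B 1 t * A 2 t" "h3 = B 1 t * B 2 t * A 3 t"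
  have H: "H a b c d = 16 * (f1 * rows4 a b c d 2 6 3 7 + f2 * rows4 a b c d 1 5 3 7 + f3 * rows4 a b c d 1 5 2 6)
    + 8 * g * rows4 a b c d 4 5 6 7
    - 8 * (h1 * rows4 a b c d 4 2 3 5 + h2 * rows4 a b c d 4 3 1 6 + h3 * rows4 a b c d 4 1 2 7)" for a b c d
    unfolding H_def \<mu>_def hodge7_frame_scale by (simp add: f1_f2_f3_def g_def h1_h2_h3_def t_def)
  have lin: "alternate5 (\<lambda>w a b c d. w$4 * E a b c d + bracket_term H w a b c d) u v x y z =
     16 * (F1 * alternate5 (\<lambda>w a b c d. w$4 * rows4 a b c d 2 6 3 7) u v x y z
       + F2 * alternate5 (\<lambda>w a b c d. w$4 * rows4 a b c d 1 5 3 7) u v x y z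
       + F3 * alternate5 (\<lambda>w a b c d. w$4 * rows4 a b c d 1 5 2 6) u v x y z)
     + 8 * G * alternate5 (\<lambda>w a b c d. w$4 * rows4 a b c d 4 5 6 7) u v x y z
     - 8 * (H1 * alternate5 (\<lambda>w a b c d. w$4 * rows4 a b c d 4 2 3 5) u v x y z
       + H2 * alternate5 (\<lambda>w a b c d. w$4 * rows4 a b c d 4 3 1 6) u v x y z
       + H3 * alternate5 (\<lambda>w a b c d. w$4 * rows4 a b c d 4 1 2 7) u v x y z)
     + 16 * (f1 * alternate5 (bracket_term (\<lambda>a b c d. rows4 a b c d 2 6 3 7)) u v x y z
       + f2 * alternate5 (bracket_term (\<lambda>a b c d. rows4 a b c d 1 5 3 7)) u v x y z
       + f3 * alternate5 (bracket_term (\<lambda>a b c d. rows4 a b c d 1 5 2 6)) u v x y z)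
     + 8 * g * alternate5 (bracket_term (\<lambda>a b c d. rows4 a b c d 4 5 6 7)) u v x y z
     - 8 * (h1 * alternate5 (bracket_term (\<lambda>a b c d. rows4 a b c d 4 2 3 5)) u v x y z
       + h2 * alternate5 (bracket_term (\<lambda>a b c d. rows4 a b c d 4 3 1 6)) u v x y z
       + h3 * alternate5 (bracket_term (\<lambda>a b c d. rows4 a b c d 4 1 2 7)) u v x y z)" for u v x y z
    unfolding alternate5_def bracket_term_def H E_def by (simp add: algebra_simps)
  have "ext_deriv N_retr (star_phi_AB T A B) x [v0, v1, v2, v3, v4] =
    alternate5 (\<lambda>w a b c d. w$4 * E a b c d + bracket_term H w a b c d)
      (coframe x v0) (coframe x v1) (coframe x v2) (coframe x v3) (coframe x v4)"
    using vs unfolding ext_deriv_4 alternate5_def by (simp add: fd)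
  also have "\<dots> = 16 * ((F1 - (g - h1 + h2 + h3)) * rows5 (coframe x v0) (coframe x v1) (coframe x v2) (coframe x v3) (coframe x v4) 4 2 6 3 7
     + (F2 - (g - h2 + h1 + h3)) * rows5 (coframe x v0) (coframe x v1) (coframe x v2) (coframe x v3) (coframe x v4) 4 1 5 3 7
          + (F3 - (g - h3 + h1 + h2)) * rows5 (coframe x v0) (coframe x v1) (coframe x v2) (coframe x v3) (coframe x v4) 4 1 5 2 6)"
    unfolding lin ce_rows4 ce_first_row rows5_repeat by (simp add: algebra_simps)
  finally show "ext_deriv N_retr (star_phi_AB T A B) x [v0, v1, v2, v3, v4] =
      (let t = fst x; g = A 1 t * A 2 t * A 3 t; h1 = B 2 t * B 3 t * A 1 t; h2 = B 3 t * B 1 t * A 2 t;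
         h3 = B 1 t * B 2 t * A 3 t;
         Q = rows5 (coframe x v0) (coframe x v1) (coframe x v2) (coframe x v3) (coframe x v4) 4
       in 16 * ((F1 - (g - h1 + h2 + h3)) * Q 2 6 3 7 + (F2 - (g - h2 + h1 + h3)) * Q 1 5 3 7
          + (F3 - (g - h3 + h1 + h2)) * Q 1 5 2 6))"
    by (simp add: Let_def g_def h1_h2_h3_def t_def)
qed

end

text \<open>The components of \<open>\<partial>\<^sub>t (\<omega>\<^sup>2/2) = -
  d\<Omega>\<^sub>2\<close> along the forms \<open>\<omega>\<^sub>j \<and> \<omega>\<^sub>k\<close>.
  Only products of the functions are differentiated, which suits the passage to the linear
  system.\<close>

definition flow_ode :: "(3 \<Rightarrow> real \<Rightarrow> real) \<Rightarrow> (3 \<Rightarrow> real \<Rightarrow> real) \<Rightarrow> real \<Rightarrow> bool" where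
  "flow_ode A B t \<longleftrightarrow> (let g = A 1 t * A 2 t * A 3 t; h1 = B 2 t * B 3 t * A 1 t; h2 = B 3 t * B 1 t * A 2 t;
      h3 = B 1 t * B 2 t * A 3 t in
     ((\<lambda>s. A 2 s * B 2 s * A 3 s * B 3 s) has_real_derivative (g - h1 + h2 + h3)) (at t) \<and>
     ((\<lambda>s. A 1 s * B 1 s * A 3 s * B 3 s) has_real_derivative (g - h2 + h1 + h3)) (at t) \<and>
     ((\<lambda>s. A 1 s * B 1 s * A 2 s * B 2 s) has_real_derivative (g - h3 + h1 + h2)) (at t))"

context su2_frame
begin

lemma closed_star_phi_AB_iff:
  assumes A: "\<And>i t. t > 0 \<Longrightarrow> A i differentiable (at t)" and B: "\<And>i t. t > 0 \<Longrightarrow> B i differentiable (at t)"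
  shows "closed_form 4 N_man N_retr (star_phi_AB T A B) \<longleftrightarrow> (\<forall>t>0. flow_ode A B t)"
proof -
  have AB: "\<exists>D. ((\<lambda>s. f s) has_real_derivative D) (at t)" if "f differentiable (at t)" for f :: "real \<Rightarrow> real" and t
    using that by (simp add: real_differentiable_def)
  note d = differentiable_mult A B
  show ?thesis
  proof
    assume c: "\<forall>t>0. flow_ode A B t"
    show "closed_form 4 N_man N_retr (star_phi_AB T A B)"
      unfolding closed_form_def
    proof (intro ballI conjI allI impI)
      fix x assume x: "x \<in> N_man"
      then have t: "fst x > 0" by (auto simp: N_man_def)
      obtain G where G: "((\<lambda>s. A 1 s * A 2 s * A 3 s) has_real_derivative G) (at (fst x))"
        using AB[of "\<lambda>s. A 1 s * A 2 s * A 3 s"] t by (metis (no_types) d)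
      obtain H1 where H1: "((\<lambda>s. B 2 s * B 3 s * A 1 s) has_real_derivative H1) (at (fst x))"
        using AB[of "\<lambda>s. B 2 s * B 3 s * A 1 s"] t by (metis (no_types) d)
      obtain H2 where H2: "((\<lambda>s. B 3 s * B 1 s * A 2 s) has_real_derivative H2) (at (fst x))"
        using AB[of "\<lambda>s. B 3 s * B 1 s * A 2 s"] t by (metis (no_types) d)
      obtain H3 where H3: "((\<lambda>s. B 1 s * B 2 s * A 3 s) has_real_derivative H3) (at (fst x))"
        using AB[of "\<lambda>s. B 1 s * B 2 s * A 3 s"] t by (metis (no_types) d)
      note ode = c[rule_format, OF t, unfolded flow_ode_def Let_def]
      note e = N_ext_deriv[OF x ode[THEN conjunct1] ode[THEN conjunct2, THEN conjunct1]
          ode[THEN conjunct2, THEN conjunct2] G H1 H2 H3]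
      show "(\<lambda>y. pullback N_retr (star_phi_AB T A B) y us) differentiable (at x)" if "length us = 4" for us
        using that by (rule e(1))
      show "ext_deriv N_retr (star_phi_AB T A B) x vs = 0" if "length vs = Suc 4" "set vs \<subseteq> tangent N_retr x" for vs
      proof -
        have "length vs = 5" using that(1) by simp
        from length_5_conv[OF this] obtain v0 v1 v2 v3 v4 where v: "vs = [v0, v1, v2, v3, v4]" by blast
        show ?thesis using that(2) unfolding v by (subst e(2)) (auto simp: Let_def)
      qed
    qed
  next
    assume c: "closed_form 4 N_man N_retr (star_phi_AB T A B)"
    show "\<forall>t>0. flow_ode A B t"
    proof (intro allI impI)
      fix t :: real assume t: "t > 0"
      \<comment> \<open>One point on each orbit is enough here. On each of the three choices of five
        dual frame vectors below exactly one \<open>Q\<close> is nonzero, so each choice isolates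
        one equation.\<close>
      define x where "x = (t, qone, qone)"
      have x: "x \<in> N_man" "fst x = t" using t by (auto simp: x_def N_man_def SU2sq_def)
      obtain F1 where F1: "((\<lambda>s. A 2 s * B 2 s * A 3 s * B 3 s) has_real_derivative F1) (at (fst x))"
        using AB[of "\<lambda>s. A 2 s * B 2 s * A 3 s * B 3 s"] t x by (metis (no_types) d)
      obtain F2 where F2: "((\<lambda>s. A 1 s * B 1 s * A 3 s * B 3 s) has_real_derivative F2) (at (fst x))"
        using AB[of "\<lambda>s. A 1 s * B 1 s * A 3 s * B 3 s"] t x by (metis (no_types) d)
      obtain F3 where F3: "((\<lambda>s. A 1 s * B 1 s * A 2 s * B 2 s) has_real_derivative F3) (at (fst x))"
        using AB[of "\<lambda>s. A 1 s * B 1 s * A 2 s * B 2 s"] t x by (metis (no_types) d)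
      obtain G where G: "((\<lambda>s. A 1 s * A 2 s * A 3 s) has_real_derivative G) (at (fst x))"
        using AB[of "\<lambda>s. A 1 s * A 2 s * A 3 s"] t x by (metis (no_types) d)
      obtain H1 where H1: "((\<lambda>s. B 2 s * B 3 s * A 1 s) has_real_derivative H1) (at (fst x))"
        using AB[of "\<lambda>s. B 2 s * B 3 s * A 1 s"] t x by (metis (no_types) d)
      obtain H2 where H2: "((\<lambda>s. B 3 s * B 1 s * A 2 s) has_real_derivative H2) (at (fst x))"
        using AB[of "\<lambda>s. B 3 s * B 1 s * A 2 s"] t x by (metis (no_types) d)
      obtain H3 where H3: "((\<lambda>s. B 1 s * B 2 s * A 3 s) has_real_derivative H3) (at (fst x))"
        using AB[of "\<lambda>s. B 1 s * B 2 s * A 3 s"] t x by (metis (no_types) d)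
      note e = N_ext_deriv(2)[OF x(1) F1 F2 F3 G H1 H2 H3]
      have z: "ext_deriv N_retr (star_phi_AB T A B) x [frame_vec x a, frame_vec x b, frame_vec x c, frame_vec x d, frame_vec x e] = 0"
        and m: "set [frame_vec x a, frame_vec x b, frame_vec x c, frame_vec x d, frame_vec x e] \<subseteq> tangent N_retr x" for a b c d e
        using c x(1) frame_vec(2)[OF x(1)] by (simp_all add: closed_form_def)
      note r = e[OF m, unfolded z frame_vec(3)[OF x(1)]]
      have "F1 = A 1 t * A 2 t * A 3 t - B 2 t * B 3 t * A 1 t + B 3 t * B 1 t * A 2 t + B 1 t * B 2 t * A 3 t"
        using r[of "axis 4 1" "axis 2 1" "axis 6 1" "axis 3 1" "axis 7 1"] x(2)
        by (simp add: Let_def rows5_def rows3_def row3_def axis_def)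
      moreover have "F2 = A 1 t * A 2 t * A 3 t - B 3 t * B 1 t * A 2 t + B 2 t * B 3 t * A 1 t + B 1 t * B 2 t * A 3 t"
        using r[of "axis 4 1" "axis 1 1" "axis 5 1" "axis 3 1" "axis 7 1"] x(2)
        by (simp add: Let_def rows5_def rows3_def row3_def axis_def)
      moreover have "F3 = A 1 t * A 2 t * A 3 t - B 1 t * B 2 t * A 3 t + B 2 t * B 3 t * A 1 t + B 3 t * B 1 t * A 2 t"
        using r[of "axis 4 1" "axis 1 1" "axis 5 1" "axis 2 1" "axis 6 1"] x(2)
        by (simp add: Let_def rows5_def rows3_def row3_def axis_def)
      ultimately show "flow_ode A B t" using F1 F2 F3 x(2) by (simp add: flow_ode_def Let_def)
    qed
  qed
qed

end

section \<open>The orbit map\<close>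

lemma M_retr_has_derivative:
  assumes "x \<in> M_nbhd"
  shows "(M_retr has_derivative (\<lambda>u. (fst u, (1 / norm (snd x)) *\<^sub>R (snd u - ((snd x \<bullet> snd u) / (snd x \<bullet> snd x)) *\<^sub>R snd x)))) (at x)"
proof -
  obtain p q where x: "x = (p, q)" "q \<noteq> 0" using assms by (auto simp: M_nbhd_def)
  have "((\<lambda>x::quat \<times> quat. sgn (snd x)) has_derivative
      (\<lambda>u. (1 / norm q) *\<^sub>R (snd u - ((q \<bullet> snd u) / (q \<bullet> q)) *\<^sub>R q))) (at x)"
    by (rule has_derivative_compose[of "\<lambda>y. snd y"])
      (auto intro!: derivative_eq_intros sgn_has_derivative simp: x)
  then have "((\<lambda>x::quat \<times> quat. (fst x, sgn (snd x))) has_derivative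
      (\<lambda>u. (fst u, (1 / norm q) *\<^sub>R (snd u - ((q \<bullet> snd u) / (q \<bullet> q)) *\<^sub>R q)))) (at x)"
    by (intro has_derivative_Pair has_derivative_fst has_derivative_ident)
  then show ?thesis by (simp add: M_retr_def case_prod_unfold x)
qed

lemmas M_retr_frechet = frechet_derivative_at[OF M_retr_has_derivative, symmetric]

lemma M_man_nbhd: "x \<in> M_man \<Longrightarrow> x \<in> M_nbhd"
  by (auto simp: M_man_def M_nbhd_def)

lemma open_M_nbhd: "open M_nbhd"
proof -
  have "M_nbhd = {x. snd x \<noteq> 0}" by (auto simp: M_nbhd_def)
  moreover have "open \<dots>" by (intro open_Collect_neq continuous_intros)
  ultimately show ?thesis by simp
qed

lemma M_tangent_iff:
  assumes "(p, q) \<in> M_man"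
  shows "(v, w) \<in> tangent M_retr (p, q) \<longleftrightarrow> q \<bullet> w = 0"
proof -
  have n: "q \<bullet> q = 1" "norm q = 1" using assms by (auto simp: M_man_def norm_eq_1)
  have tan: "tangent M_retr (p, q) = range (\<lambda>u. (fst u, snd u - (q \<bullet> snd u) *\<^sub>R q))"
    unfolding tangent_def M_retr_frechet[OF M_man_nbhd[OF assms]] by (simp add: n)
  show ?thesis
  proof
    assume "(v, w) \<in> tangent M_retr (p, q)"
    then show "q \<bullet> w = 0" unfolding tan using n by (auto simp: inner_diff_right)
  next
    assume "q \<bullet> w = 0"
    then have "(v, w) = (fst (v, w), snd (v, w) - (q \<bullet> snd (v, w)) *\<^sub>R q)" by simp
    then show "(v, w) \<in> tangent M_retr (p, q)" unfolding tan by (rule range_eqI)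
  qed
qed

lemma orbit_map_eq: "orbit_map (t, g1, g2) = (t *\<^sub>R g1, g1 \<odot> qcnj g2)"
  by (simp add: orbit_map_def act_def gam_def)

definition orbit' :: "prin \<Rightarrow> prin \<Rightarrow> quat \<times> quat" where
  "orbit' = (\<lambda>(t, g1, g2) (s, v1, v2). (s *\<^sub>R g1 + t *\<^sub>R v1, v1 \<odot> qcnj g2 + g1 \<odot> qcnj v2))"

lemma orbit_map_has_derivative: "(orbit_map has_derivative orbit' x) (at x)"
proof -
  obtain t g1 g2 where x: "x = (t, g1, g2)" by (cases x) auto
  have "((\<lambda>y::prin. (fst y *\<^sub>R fst (snd y), fst (snd y) \<odot> qcnj (snd (snd y)))) has_derivative
    (\<lambda>u. (fst x *\<^sub>R fst (snd u) + fst u *\<^sub>R fst (snd x),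
      fst (snd x) \<odot> qcnj (snd (snd u)) + fst (snd u) \<odot> qcnj (snd (snd x))))) (at x)"
    by (intro has_derivative_Pair has_derivative_scaleR bounded_bilinear.FDERIV[OF bounded_bilinear_qmult]
        bounded_linear.has_derivative[OF bounded_linear_qcnj] has_derivative_fst has_derivative_snd has_derivative_ident)
  moreover have "orbit_map = (\<lambda>y. (fst y *\<^sub>R fst (snd y), fst (snd y) \<odot> qcnj (snd (snd y))))"
    by (simp add: orbit_map_def act_def gam_def case_prod_unfold fun_eq_iff)
  moreover have "orbit' x = (\<lambda>u. (fst x *\<^sub>R fst (snd u) + fst u *\<^sub>R fst (snd x),
      fst (snd x) \<odot> qcnj (snd (snd u)) + fst (snd u) \<odot> qcnj (snd (snd x))))"
    by (simp add: orbit'_def x case_prod_unfold fun_eq_iff add.commute)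
  ultimately show ?thesis by simp
qed

lemmas orbit_map_frechet = frechet_derivative_at[OF orbit_map_has_derivative, symmetric]

lemma linear_orbit': "linear (orbit' x)"
  using orbit_map_has_derivative by (rule has_derivative_linear)

lemma orbit_map_M: "x \<in> N_man \<Longrightarrow> orbit_map x \<in> M_man"
  using norm_qmult[of "fst (snd x)" "qcnj (snd (snd x))"]
  by (simp add: N_man_def SU2sq_def M_man_def orbit_map_def act_def gam_def case_prod_unfold)

lemma orbit_map_surj:
  assumes "(p, q) \<in> M_man" "p \<noteq> 0"
  shows "\<exists>x\<in>N_man. orbit_map x = (p, q) \<and> fst x = norm p"
proof
  have n: "norm (sgn p) = 1" "norm q = 1" using assms by (auto simp: M_man_def norm_sgn)
  \<comment> \<open>Since \<open>orbit_map\<close> sends \<open>(t, g1, g2)\<close> to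
    \<open>(t *\<^sub>R g1, g1 \<odot> qcnj g2)\<close>, the first component fixes \<open>t\<close>
    and \<open>g1\<close>, and \<open>g1 \<odot> qcnj g2 = q\<close> is solved for
    \<open>g2\<close>.\<close>
  show "(norm p, sgn p, qcnj q \<odot> sgn p) \<in> N_man"
    using n assms(2) by (simp add: N_man_def SU2sq_def norm_qmult)
  have c: "inverse (norm p) * (inverse (norm p) * (norm p * norm p)) = 1"
    using assms(2) by (simp add: field_simps)
  show "orbit_map (norm p, sgn p, qcnj q \<odot> sgn p) = (p, q) \<and> fst (norm p, sgn p, qcnj q \<odot> sgn p) = norm p"
    using assms(2) n by (simp add: orbit_map_eq qcnj_qmult sgn_div_norm qcnj_linear qmult_assoc[symmetric] qcnj_qmult_self
       power2_norm_eq_inner[symmetric] power2_eq_square c)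
qed

context su2_frame
begin

lemma orbit'_tangent:
  assumes x: "x \<in> N_man"
  shows "u \<in> tangent N_retr x \<Longrightarrow> orbit' x u \<in> tangent M_retr (orbit_map x)"
    and "X \<in> tangent M_retr (orbit_map x) \<Longrightarrow> \<exists>u\<in>tangent N_retr x. orbit' x u = X"
    and "u \<in> tangent N_retr x \<Longrightarrow> orbit' x u = 0 \<Longrightarrow> u = 0"
proof -
  obtain t g1 g2 where e: "x = (t, g1, g2)" by (cases x) auto
  have n: "g1 \<bullet> g1 = 1" "g2 \<bullet> g2 = 1" "norm g1 = 1" "norm g2 = 1" "t > 0"
    using x by (auto simp: e N_man_def SU2sq_def norm_eq_1)
  have M: "(t *\<^sub>R g1, g1 \<odot> qcnj g2) \<in> M_man" using orbit_map_M[OF x] by (simp add: e orbit_map_eq)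
  have q1: "(g1 \<odot> qcnj g2) \<bullet> (v1 \<odot> qcnj g2) = g1 \<bullet> v1" "(g1 \<odot> qcnj g2) \<bullet> (g1 \<odot> qcnj v2) = g2 \<bullet> v2" for v1 v2
    using n inner_qmult_right[of g1 "qcnj g2" v1] inner_qmult_left[of g1 "qcnj g2" "qcnj v2"]
    by (simp_all add: quat_inner qcnj_simps)
  show "orbit' x u \<in> tangent M_retr (orbit_map x)" if u: "u \<in> tangent N_retr x"
  proof -
    obtain s v1 v2 where u': "u = (s, v1, v2)" by (cases u) auto
    have "g1 \<bullet> v1 = 0" "g2 \<bullet> v2 = 0" using N_tangent_iff x u by (auto simp: e u')
    then show ?thesis
      by (simp add: e u' orbit_map_eq orbit'_def M_tangent_iff[OF M] inner_add_right q1)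
  qed
  show "\<exists>u\<in>tangent N_retr x. orbit' x u = X" if X: "X \<in> tangent M_retr (orbit_map x)"
  proof -
    obtain v w where X': "X = (v, w)" by (cases X) auto
    have w: "(g1 \<odot> qcnj g2) \<bullet> w = 0" using X by (simp add: X' e orbit_map_eq M_tangent_iff[OF M])
    define s where "s = g1 \<bullet> v"
    define v1 where "v1 = (1 / t) *\<^sub>R (v - s *\<^sub>R g1)"
    define v2 where "v2 = qcnj (qcnj g1 \<odot> (w - v1 \<odot> qcnj g2))"
    have o1: "g1 \<bullet> v1 = 0" by (simp add: v1_def inner_diff_right n s_def)
    have "g2 \<bullet> v2 = (g1 \<odot> qcnj g2) \<bullet> (g1 \<odot> qcnj v2)" by (rule q1(2)[symmetric])
    also have "g1 \<odot> qcnj v2 = w - v1 \<odot> qcnj g2" by (simp add: v2_def qcnj_unit' n)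
    finally have o2: "g2 \<bullet> v2 = 0" by (simp add: inner_diff_right w q1 o1)
    have "(s, v1, v2) \<in> tangent N_retr x" using N_tangent_iff x o1 o2 by (simp add: e)
    moreover have "orbit' x (s, v1, v2) = X"
      using n by (simp add: e X' orbit'_def v1_def v2_def qcnj_unit')
    ultimately show ?thesis by blast
  qed
  show "u = 0" if u: "u \<in> tangent N_retr x" and z: "orbit' x u = 0"
  proof -
    obtain s v1 v2 where u': "u = (s, v1, v2)" by (cases u) auto
    have o: "g1 \<bullet> v1 = 0" "g2 \<bullet> v2 = 0" using N_tangent_iff x u by (auto simp: e u')
    have z1: "s *\<^sub>R g1 + t *\<^sub>R v1 = 0" and z2: "v1 \<odot> qcnj g2 + g1 \<odot> qcnj v2 = 0"
      using z by (simp_all add: e u' orbit'_def zero_prod_def)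
    have "g1 \<bullet> (s *\<^sub>R g1 + t *\<^sub>R v1) = s" using o n by (simp add: inner_add_right)
    then have s: "s = 0" using z1 by simp
    then have v1: "v1 = 0" using z1 n by simp
    then have "qcnj g1 \<odot> (g1 \<odot> qcnj v2) = 0" using z2 by simp
    then have "qcnj v2 = 0" by (simp add: qcnj_unit' n)
    then have "v2 = 0" by (metis qcnj_qcnj qcnj_linear(2) scaleR_zero_left)
    then show "u = 0" using s v1 by (simp add: u' zero_prod_def)
  qed
qed

lemma frame_scale_inverse:
  assumes "\<And>i. a i \<noteq> 0 \<and> b i \<noteq> 0"
  shows "\<exists>S. linear S \<and> (\<forall>z. frame_scale a b (S z) = z) \<and> (\<forall>z. S (frame_scale a b z) = z)"
proof (intro exI conjI allI)
  let ?S = "\<lambda>z::real^7. vector [z$1 / (2 * b 1), z$2 / (2 * b 2), z$3 / (2 * b 3), - z$4, z$5 / (2 * a 1),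
    z$6 / (2 * a 2), z$7 / (2 * a 3)] :: real^7"
  show "linear ?S" by (rule linearI) (simp_all add: vec_eq_iff forall_7 vector_7 add_divide_distrib)
  show "frame_scale a b (?S z) = z" "?S (frame_scale a b z) = z" for z
    using assms by (simp_all add: vec_eq_iff forall_7 vector_7 frame_scale_nth)
qed

text \<open>An adapted frame on the principal part is the image of the rescaled dual frame.\<close>

lemma restricts_star_phi:
  assumes r: "restricts_to T A B \<phi>" and nz: "\<And>i t. t > 0 \<Longrightarrow> A i t \<noteq> 0 \<and> B i t \<noteq> 0" and x: "x \<in> N_man"
  shows "\<exists>F. adapted_frame M_retr \<phi> (orbit_map x) F"
    and "length us = 4 \<Longrightarrow> set us \<subseteq> tangent N_retr x \<Longrightarrow>
      star_phi M_retr \<phi> (orbit_map x) (map (orbit' x) us) = star_phi_AB T A B x us"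
proof -
  have t: "fst x > 0" using x by (auto simp: N_man_def)
  define sc where "sc = frame_scale (\<lambda>i. A i (fst x)) (\<lambda>i. B i (fst x))"
  obtain S where S: "linear S" "\<And>z. sc (S z) = z" "\<And>z. S (sc z) = z"
    using frame_scale_inverse[of "\<lambda>i. A i (fst x)" "\<lambda>i. B i (fst x)"] nz[OF t] unfolding sc_def by blast
  define F where "F z = orbit' x (frame_vec x (S z))" for z
  note fv = frame_vec[OF x] and ot = orbit'_tangent[OF x]
  have lin: "linear F"
    unfolding F_def[abs_def]
    using linear_compose[OF linear_compose[OF S(1) fv(1)] linear_orbit', of x] by (simp add: o_def)
  have inj: "inj F"
  proof (rule injI)
    fix y z assume "F y = F z"
    then have "F (y - z) = 0" by (simp add: linear_diff[OF lin])
    then have "frame_vec x (S (y - z)) = 0" unfolding F_def by (rule ot(3)[OF fv(2)])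
    then have "coframe x (frame_vec x (S (y - z))) = 0" using linear_0[OF linear_coframe] by simp
    then have "sc (S (y - z)) = sc 0" by (simp add: fv(3))
    then have "y - z = sc 0" by (simp add: S(2))
    then show "y = z" using linear_0[OF linear_frame_scale] by (simp add: sc_def)
  qed
  have Fu: "F (sc (coframe x u)) = orbit' x u" if "u \<in> tangent N_retr x" for u
    unfolding F_def S(3) using fv(4)[OF that] by simp
  have "range F = tangent M_retr (orbit_map x)"
  proof (intro equalityI subsetI)
    show "X \<in> tangent M_retr (orbit_map x)" if "X \<in> range F" for X
      using that ot(1)[OF fv(2)] by (auto simp: F_def)
    show "X \<in> range F" if "X \<in> tangent M_retr (orbit_map x)" for X
    proof -
      from ot(2)[OF that] obtain u where "u \<in> tangent N_retr x" "orbit' x u = X" by blast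
      then show ?thesis using Fu[of u] by (metis rangeI)
    qed
  qed
  moreover have "\<phi> (orbit_map x) (map F us) = phi0 us" if us: "length us = 3" for us
  proof -
    have "\<phi> (orbit_map x) (map F us) = pullback orbit_map \<phi> x (map (\<lambda>z. frame_vec x (S z)) us)"
      by (simp add: pullback_def orbit_map_frechet F_def[abs_def] o_def)
    also have "\<dots> = phi_AB T A B x (map (\<lambda>z. frame_vec x (S z)) us)"
      using r x us fv(2) unfolding restricts_to_def by (metis (no_types, lifting) image_subset_iff length_map list.set_map)
    also have "\<dots> = phi0 (map sc (map (coframe x) (map (\<lambda>z. frame_vec x (S z)) us)))"
      unfolding sc_def by (rule phi_AB_coframe[OF x]) (use us fv(2) in auto)
    also have "map sc (map (coframe x) (map (\<lambda>z. frame_vec x (S z)) us)) = us"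
      by (simp add: fv(3) S(2) o_def)
    finally show ?thesis .
  qed
  ultimately have F: "adapted_frame M_retr \<phi> (orbit_map x) F"
    using lin inj by (simp add: adapted_frame_def bij_betw_def)
  then show "\<exists>F. adapted_frame M_retr \<phi> (orbit_map x) F" by blast
  assume us: "length us = 4" "set us \<subseteq> tangent N_retr x"
  have "star_phi M_retr \<phi> (orbit_map x) (map (orbit' x) us) = hodge7 3 phi0 (map (inv F) (map (orbit' x) us))"
    by (rule star_phi_adapted[OF F]) (use us ot(1) in auto)
  also have "map (inv F) (map (orbit' x) us) = map sc (map (coframe x) us)"
  proof -
    have "inv F (orbit' x u) = sc (coframe x u)" if "u \<in> set us" for u
      by (rule inv_f_eq[OF inj Fu]) (use us(2) that in blast)
    then show ?thesis by simp
  qed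
  also have "hodge7 3 phi0 \<dots> = star_phi_AB T A B x us"
    unfolding sc_def by (rule star_phi_AB_coframe[OF x us, symmetric])
  finally show "star_phi M_retr \<phi> (orbit_map x) (map (orbit' x) us) = star_phi_AB T A B x us" .
qed

end

section \<open>Extension over the singular orbit\<close>

lemma smooth_on_subset: "smooth_on f V \<Longrightarrow> U \<subseteq> V \<Longrightarrow> smooth_on f U"
proof -
  have "Ck_on k f V \<Longrightarrow> U \<subseteq> V \<Longrightarrow> Ck_on k f U" for k f
    by (induction k arbitrary: f) (auto intro: continuous_on_subset)
  then show "smooth_on f V \<Longrightarrow> U \<subseteq> V \<Longrightarrow> smooth_on f U" by (auto simp: smooth_on_def)
qed

definition qconj :: "quat \<Rightarrow> quat \<Rightarrow> quat" where "qconj a x = a \<odot> x \<odot> qcnj a"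

lemma qconj_simps:
  assumes "norm a = 1"
  shows "qconj a x \<bullet> qconj a y = x \<bullet> y" "(a \<odot> v) \<bullet> (a \<odot> w) = v \<bullet> w"
    "qconj a x \<odot> qconj a y = qconj a (x \<odot> y)" "qconj a x \<odot> (a \<odot> v) = a \<odot> (x \<odot> v)"
    "(a \<odot> v) \<odot> y = a \<odot> (v \<odot> y)" "(a \<odot> (v \<odot> qcnj (a \<odot> w))) = qconj a (v \<odot> qcnj w)"
    "qconj a x - qconj a y = qconj a (x - y)" "c *\<^sub>R qconj a x = qconj a (c *\<^sub>R x)"
    "a \<odot> v - a \<odot> w = a \<odot> (v - w)"
proof -
  have a: "a \<bullet> a = 1" "qcnj a \<bullet> qcnj a = 1" using assms by (simp_all add: norm_eq_1 quat_inner qcnj_simps)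
  show "(a \<odot> v) \<bullet> (a \<odot> w) = v \<bullet> w" by (simp add: inner_qmult_left a)
  show "qconj a x \<bullet> qconj a y = x \<bullet> y" by (simp add: qconj_def inner_qmult_left inner_qmult_right a)
  show "qconj a x \<odot> qconj a y = qconj a (x \<odot> y)" "qconj a x \<odot> (a \<odot> v) = a \<odot> (x \<odot> v)"
    by (simp_all add: qconj_def qmult_assoc qcnj_unit' assms)
  show "(a \<odot> v) \<odot> y = a \<odot> (v \<odot> y)" by (rule qmult_assoc)
  show "(a \<odot> (v \<odot> qcnj (a \<odot> w))) = qconj a (v \<odot> qcnj w)" by (simp add: qconj_def qcnj_qmult qmult_assoc)
  show "qconj a x - qconj a y = qconj a (x - y)" "c *\<^sub>R qconj a x = qconj a (c *\<^sub>R x)"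
    "a \<odot> v - a \<odot> w = a \<odot> (v - w)"
    by (simp_all add: qconj_def qmult_diff)
qed

text \<open>Invariant forms on \<open>M\<close> depend on a point \<open>(p, q)\<close> only through \<open>p\<close>, and on a tangent vector
  \<open>(v, w)\<close> through \<open>v\<close> and the imaginary quaternion \<open>w q\<^sup>*\<close>; the pair of these is the second
  argument below. The group element \<open>(a\<^sub>1, a\<^sub>2)\<close> acts by \<open>p \<mapsto> a\<^sub>1 p\<close> and \<open>(v, \<theta>) \<mapsto> (a\<^sub>1 v, a\<^sub>1 \<theta> a\<^sub>1\<^sup>*)\<close>.\<close>

type_synonym tvec = "quat \<times> quat"

definition wedge12 :: "('v \<Rightarrow> real) \<Rightarrow> ('v \<Rightarrow> 'v \<Rightarrow> real) \<Rightarrow> 'v \<Rightarrow> 'v \<Rightarrow> 'v \<Rightarrow> real" where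
  "wedge12 f g x y z = f x * g y z - f y * g x z + f z * g x y"

definition wedge22 :: "('v \<Rightarrow> 'v \<Rightarrow> real) \<Rightarrow> ('v \<Rightarrow> 'v \<Rightarrow> real) \<Rightarrow> 'v \<Rightarrow> 'v \<Rightarrow> 'v \<Rightarrow> 'v \<Rightarrow> real" where
  "wedge22 f g x y z w = f x y * g z w - f x z * g y w + f x w * g y z + f y z * g x w - f y w * g x z + f z w * g x y"

definition wedge11 :: "('v \<Rightarrow> real) \<Rightarrow> ('v \<Rightarrow> real) \<Rightarrow> 'v \<Rightarrow> 'v \<Rightarrow> real" where
  "wedge11 f g x y = f x * g y - f y * g x"

definition tcomm :: "tvec \<Rightarrow> tvec \<Rightarrow> quat" where
  "tcomm d e = (1 / 2) *\<^sub>R (snd d \<odot> snd e - snd e \<odot> snd d)"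

definition rho_form :: "quat \<Rightarrow> tvec \<Rightarrow> real" where "rho_form p d = fst d \<bullet> p"

text \<open>The sum over the three axes of \<open>\<theta>\<^sub>i\<close> wedged with the 2-form of
  left multiplication by \<open>T i\<close> on R^4. It does not involve \<open>p\<close>, so it is
  the part with two arguments tangent to R^4 that survives on the singular orbit.\<close>

definition twist_form :: "tvec \<Rightarrow> tvec \<Rightarrow> tvec \<Rightarrow> real" where
  "twist_form d e f = (snd d \<odot> fst e) \<bullet> fst f - (snd e \<odot> fst d) \<bullet> fst f + (snd f \<odot> fst d) \<bullet> fst e"

definition radial_comm_form :: "quat \<Rightarrow> tvec \<Rightarrow> tvec \<Rightarrow> tvec \<Rightarrow> real" where
  "radial_comm_form p d e f = (fst d \<odot> qcnj p) \<bullet> tcomm e f - (fst e \<odot> qcnj p) \<bullet> tcomm d f + (fst f \<odot> qcnj p) \<bullet> tcomm d e"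

definition theta_form :: "tvec \<Rightarrow> tvec \<Rightarrow> tvec \<Rightarrow> real" where
  "theta_form d e f = snd d \<bullet> tcomm e f"

text \<open>A polynomial expression for the determinant of four quaternions, chosen because its
  invariance under left multiplication by unit quaternions is immediate.\<close>

definition qvol :: "quat \<Rightarrow> quat \<Rightarrow> quat \<Rightarrow> quat \<Rightarrow> real" where
  "qvol x y z w = ((1 / 2) *\<^sub>R (z \<odot> (qcnj y \<odot> x) - x \<odot> (qcnj y \<odot> z))) \<bullet> w"

definition vol_form :: "tvec \<Rightarrow> tvec \<Rightarrow> tvec \<Rightarrow> tvec \<Rightarrow> real" where
  "vol_form d e f g = qvol (fst d) (fst e) (fst f) (fst g)"

definition vol_twist_form :: "quat \<Rightarrow> tvec \<Rightarrow> tvec \<Rightarrow> tvec \<Rightarrow> tvec \<Rightarrow> real" where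
  "vol_twist_form p d e f g = qvol (snd d \<odot> p) (fst e) (fst f) (fst g) - qvol (snd e \<odot> p) (fst d) (fst f) (fst g)
     + qvol (snd f \<odot> p) (fst d) (fst e) (fst g) - qvol (snd g \<odot> p) (fst d) (fst e) (fst f)"

definition comm_twist_form :: "tvec \<Rightarrow> tvec \<Rightarrow> tvec \<Rightarrow> tvec \<Rightarrow> real" where
  "comm_twist_form d e f g = (let J = (\<lambda>d e f g. (tcomm d e \<odot> fst f) \<bullet> fst g) in
     J d e f g - J d f e g + J d g e f + J e f d g - J e g d f + J f g d e)"

definition rho_theta_form :: "quat \<Rightarrow> tvec \<Rightarrow> tvec \<Rightarrow> tvec \<Rightarrow> tvec \<Rightarrow> real" where
  "rho_theta_form p d e f g = rho_form p d * theta_form e f g - rho_form p e * theta_form d f g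
     + rho_form p f * theta_form d e g - rho_form p g * theta_form d e f"

definition tact :: "quat \<Rightarrow> tvec \<Rightarrow> tvec" where
  "tact a d = (a \<odot> fst d, qconj a (snd d))"

context su2_frame
begin

text \<open>At \<open>p = t\<close> these are \<open>t\<^sup>2 \<theta>\<^sub>i\<close>,
  \<open>t v\<^sub>i\<close> and so on, see \<open>basic_forms_coord\<close>: an axis is marked by
  \<open>p \<odot> T i\<close>, which is smooth at \<open>p = 0\<close> at the price of one power of
  \<open>t\<close> for each factor \<open>p\<close>. The right multiplication in
  \<open>kappa_form\<close> marks it without any price, since the group acts on R^4 from the
  left.\<close>

definition alpha_form :: "3 \<Rightarrow> quat \<Rightarrow> tvec \<Rightarrow> real" where "alpha_form i p d = snd d \<bullet> (p \<odot> (T i \<odot> qcnj p))"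
definition beta_form :: "3 \<Rightarrow> quat \<Rightarrow> tvec \<Rightarrow> real" where "beta_form i p d = fst d \<bullet> (p \<odot> T i)"
definition kappa_form :: "3 \<Rightarrow> tvec \<Rightarrow> tvec \<Rightarrow> real" where "kappa_form i d e = (fst d \<odot> T i) \<bullet> fst e"
definition chi_form :: "3 \<Rightarrow> quat \<Rightarrow> tvec \<Rightarrow> tvec \<Rightarrow> real" where "chi_form i p d e = tcomm d e \<bullet> (p \<odot> (T i \<odot> qcnj p))"

lemma basic_forms_invariant:
  assumes a: "norm a = 1"
  shows "alpha_form i (a \<odot> p) (tact a d) = alpha_form i p d" "beta_form i (a \<odot> p) (tact a d) = beta_form i p d"
    "kappa_form i (tact a d) (tact a e) = kappa_form i d e" "tcomm (tact a d) (tact a e) = qconj a (tcomm d e)"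
    "chi_form i (a \<odot> p) (tact a d) (tact a e) = chi_form i p d e" "rho_form (a \<odot> p) (tact a d) = rho_form p d"
    "twist_form (tact a d) (tact a e) (tact a f) = twist_form d e f"
    "radial_comm_form (a \<odot> p) (tact a d) (tact a e) (tact a f) = radial_comm_form p d e f"
    "theta_form (tact a d) (tact a e) (tact a f) = theta_form d e f"
    "vol_form (tact a d) (tact a e) (tact a f) (tact a g) = vol_form d e f g"
    "vol_twist_form (a \<odot> p) (tact a d) (tact a e) (tact a f) (tact a g) = vol_twist_form p d e f g"
    "comm_twist_form (tact a d) (tact a e) (tact a f) (tact a g) = comm_twist_form d e f g"
    "rho_theta_form (a \<odot> p) (tact a d) (tact a e) (tact a f) (tact a g) = rho_theta_form p d e f g"
proof -
  note q = qconj_simps[OF a]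
  have c: "a \<odot> (p \<odot> (x \<odot> qcnj (a \<odot> p))) = qconj a (p \<odot> (x \<odot> qcnj p))" for x p
    by (simp add: qconj_def qcnj_qmult qmult_assoc)
  have v: "qvol (a \<odot> x) (a \<odot> y) (a \<odot> z) (a \<odot> w) = qvol x y z w" for x y z w
    by (simp add: qvol_def qcnj_qmult qmult_assoc qcnj_unit' a qmult_diff[symmetric] inner_qmult_left norm_eq_1[symmetric])
  show com: "tcomm (tact a d) (tact a e) = qconj a (tcomm d e)" for d e
    by (simp add: tcomm_def tact_def q)
  show "alpha_form i (a \<odot> p) (tact a d) = alpha_form i p d" "beta_form i (a \<odot> p) (tact a d) = beta_form i p d"
    by (simp_all add: alpha_form_def beta_form_def tact_def q(1,2,5) c)
  show "kappa_form i (tact a d) (tact a e) = kappa_form i d e"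
    by (simp add: kappa_form_def tact_def q(2,5))
  show "chi_form i (a \<odot> p) (tact a d) (tact a e) = chi_form i p d e"
    by (simp add: chi_form_def com q(1,5) c)
  show rho: "rho_form (a \<odot> p) (tact a d) = rho_form p d" for d by (simp add: rho_form_def tact_def q(2))
  show "twist_form (tact a d) (tact a e) (tact a f) = twist_form d e f"
    by (simp add: twist_form_def tact_def q(2,4))
  show "radial_comm_form (a \<odot> p) (tact a d) (tact a e) (tact a f) = radial_comm_form p d e f"
    unfolding radial_comm_form_def com by (simp add: tact_def q(1,5,6))
  show th: "theta_form (tact a d) (tact a e) (tact a f) = theta_form d e f" for d e f
    unfolding theta_form_def com by (simp add: tact_def q(1))
  show "vol_form (tact a d) (tact a e) (tact a f) (tact a g) = vol_form d e f g"
    by (simp add: vol_form_def tact_def v)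
  show "vol_twist_form (a \<odot> p) (tact a d) (tact a e) (tact a f) (tact a g) = vol_twist_form p d e f g"
    by (simp add: vol_twist_form_def tact_def q(4) v)
  show "comm_twist_form (tact a d) (tact a e) (tact a f) (tact a g) = comm_twist_form d e f g"
    unfolding comm_twist_form_def com Let_def by (simp add: tact_def q(2,4))
  show "rho_theta_form (a \<odot> p) (tact a d) (tact a e) (tact a f) (tact a g) = rho_theta_form p d e f g"
    unfolding rho_theta_form_def rho th by simp
qed

section \<open>Values of the invariant forms along the normal geodesic\<close>

definition tcoord :: "tvec \<Rightarrow> real^7" where
  "tcoord d = vector [co 1 (snd d), co 2 (snd d), co 3 (snd d), fst (fst d), co 1 (fst d), co 2 (fst d), co 3 (fst d)]"

lemma tcoord_nth:
  "tcoord d $ 1 = co 1 (snd d)" "tcoord d $ 2 = co 2 (snd d)" "tcoord d $ 3 = co 3 (snd d)" "tcoord d $ 4 = fst (fst d)"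
  "tcoord d $ 5 = co 1 (fst d)" "tcoord d $ 6 = co 2 (fst d)" "tcoord d $ 7 = co 3 (fst d)"
  by (simp_all add: tcoord_def vector_7)

lemma basic_forms_coord:
  assumes "fst (snd d) = 0" "fst (snd e) = 0"
  shows "alpha_form 1 (t *\<^sub>R qone) d = t\<^sup>2 * tcoord d $ 1" "alpha_form 2 (t *\<^sub>R qone) d = t\<^sup>2 * tcoord d $ 2"
    "alpha_form 3 (t *\<^sub>R qone) d = t\<^sup>2 * tcoord d $ 3"
    "beta_form 1 (t *\<^sub>R qone) d = t * tcoord d $ 5" "beta_form 2 (t *\<^sub>R qone) d = t * tcoord d $ 6"
    "beta_form 3 (t *\<^sub>R qone) d = t * tcoord d $ 7" "rho_form (t *\<^sub>R qone) d = t * tcoord d $ 4"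
    "kappa_form 1 d e = tcoord d $ 4 * tcoord e $ 5 - tcoord d $ 5 * tcoord e $ 4 - (tcoord d $ 6 * tcoord e $ 7 - tcoord d $ 7 * tcoord e $ 6)"
    "kappa_form 2 d e = tcoord d $ 4 * tcoord e $ 6 - tcoord d $ 6 * tcoord e $ 4 - (tcoord d $ 7 * tcoord e $ 5 - tcoord d $ 5 * tcoord e $ 7)"
    "kappa_form 3 d e = tcoord d $ 4 * tcoord e $ 7 - tcoord d $ 7 * tcoord e $ 4 - (tcoord d $ 5 * tcoord e $ 6 - tcoord d $ 6 * tcoord e $ 5)"
    "chi_form 1 (t *\<^sub>R qone) d e = t\<^sup>2 * (tcoord d $ 2 * tcoord e $ 3 - tcoord d $ 3 * tcoord e $ 2)"
    "chi_form 2 (t *\<^sub>R qone) d e = t\<^sup>2 * (tcoord d $ 3 * tcoord e $ 1 - tcoord d $ 1 * tcoord e $ 3)"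
    "chi_form 3 (t *\<^sub>R qone) d e = t\<^sup>2 * (tcoord d $ 1 * tcoord e $ 2 - tcoord d $ 2 * tcoord e $ 1)"
    "fst (tcomm d e) = 0"
    "co 1 (tcomm d e) = tcoord d $ 2 * tcoord e $ 3 - tcoord d $ 3 * tcoord e $ 2"
    "co 2 (tcomm d e) = tcoord d $ 3 * tcoord e $ 1 - tcoord d $ 1 * tcoord e $ 3"
    "co 3 (tcomm d e) = tcoord d $ 1 * tcoord e $ 2 - tcoord d $ 2 * tcoord e $ 1"
  by (simp_all add: alpha_form_def beta_form_def rho_form_def kappa_form_def chi_form_def tcomm_def tcoord_nth
      co_inner co_qmult qcnj_linear qone_simps assms power2_eq_square algebra_simps qcnj_simps)

lemma forms3_coord:
  fixes t :: real
  assumes i: "fst (snd d) = 0" "fst (snd e) = 0" "fst (snd f) = 0"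
  defines "R \<equiv> rows3 (tcoord d) (tcoord e) (tcoord f)" and "p \<equiv> t *\<^sub>R qone"
  shows "twist_form d e f = R 1 4 5 + R 1 6 7 + R 2 4 6 + R 2 7 5 + R 3 4 7 + R 3 5 6"
    "radial_comm_form p d e f = t * (R 5 2 3 + R 6 3 1 + R 7 1 2)"
    "theta_form d e f = R 1 2 3"
    "wedge12 (alpha_form 1 p) (\<lambda>x y. wedge11 (rho_form p) (beta_form 1 p) x y + wedge11 (beta_form 2 p) (beta_form 3 p) x y) d e f
      = t ^ 4 * (R 1 4 5 + R 1 6 7)"
    "wedge12 (alpha_form 2 p) (\<lambda>x y. wedge11 (rho_form p) (beta_form 2 p) x y + wedge11 (beta_form 3 p) (beta_form 1 p) x y) d e f
      = t ^ 4 * (R 2 4 6 + R 2 7 5)"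
    "wedge12 (alpha_form 3 p) (\<lambda>x y. wedge11 (rho_form p) (beta_form 3 p) x y + wedge11 (beta_form 1 p) (beta_form 2 p) x y) d e f
      = t ^ 4 * (R 3 4 7 + R 3 5 6)"
    "wedge12 (alpha_form 1 p) (kappa_form 1) d e f = t\<^sup>2 * (R 1 4 5 - R 1 6 7)"
    "wedge12 (alpha_form 2 p) (kappa_form 2) d e f = t\<^sup>2 * (R 2 4 6 - R 2 7 5)"
    "wedge12 (alpha_form 3 p) (kappa_form 3) d e f = t\<^sup>2 * (R 3 4 7 - R 3 5 6)"
    "wedge12 (beta_form 1 p) (chi_form 1 p) d e f = t ^ 3 * R 5 2 3"
    "wedge12 (beta_form 2 p) (chi_form 2 p) d e f = t ^ 3 * R 6 3 1"
    "wedge12 (beta_form 3 p) (chi_form 3 p) d e f = t ^ 3 * R 7 1 2"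
proof -
  note c = basic_forms_coord[OF i(1,2)] basic_forms_coord[OF i(1,3)] basic_forms_coord[OF i(2,3)]
    basic_forms_coord(1-7)[OF i(3,3)]
  show "twist_form d e f = R 1 4 5 + R 1 6 7 + R 2 4 6 + R 2 7 5 + R 3 4 7 + R 3 5 6"
    by (simp add: twist_form_def co_inner co_qmult i R_def rows3_def row3_def tcoord_nth algebra_simps)
  show "radial_comm_form p d e f = t * (R 5 2 3 + R 6 3 1 + R 7 1 2)" "theta_form d e f = R 1 2 3"
    by (simp_all add: radial_comm_form_def theta_form_def p_def co_inner qcnj_linear co_qmult qone_simps i c R_def
        rows3_def row3_def tcoord_nth qcnj_simps algebra_simps)
  show "wedge12 (alpha_form 1 p) (\<lambda>x y. wedge11 (rho_form p) (beta_form 1 p) x y + wedge11 (beta_form 2 p) (beta_form 3 p) x y) d e f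
      = t ^ 4 * (R 1 4 5 + R 1 6 7)"
    "wedge12 (alpha_form 2 p) (\<lambda>x y. wedge11 (rho_form p) (beta_form 2 p) x y + wedge11 (beta_form 3 p) (beta_form 1 p) x y) d e f
      = t ^ 4 * (R 2 4 6 + R 2 7 5)"
    "wedge12 (alpha_form 3 p) (\<lambda>x y. wedge11 (rho_form p) (beta_form 3 p) x y + wedge11 (beta_form 1 p) (beta_form 2 p) x y) d e f
      = t ^ 4 * (R 3 4 7 + R 3 5 6)"
    "wedge12 (alpha_form 1 p) (kappa_form 1) d e f = t\<^sup>2 * (R 1 4 5 - R 1 6 7)"
    "wedge12 (alpha_form 2 p) (kappa_form 2) d e f = t\<^sup>2 * (R 2 4 6 - R 2 7 5)"
    "wedge12 (alpha_form 3 p) (kappa_form 3) d e f = t\<^sup>2 * (R 3 4 7 - R 3 5 6)"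
    "wedge12 (beta_form 1 p) (chi_form 1 p) d e f = t ^ 3 * R 5 2 3"
    "wedge12 (beta_form 2 p) (chi_form 2 p) d e f = t ^ 3 * R 6 3 1"
    "wedge12 (beta_form 3 p) (chi_form 3 p) d e f = t ^ 3 * R 7 1 2"
    unfolding wedge12_def wedge11_def p_def c
    by (simp_all add: R_def rows3_def row3_def power2_eq_square power3_eq_cube power4_eq_xxxx algebra_simps)
qed

lemma forms4_coord:
  fixes t :: real
  assumes i: "fst (snd d) = 0" "fst (snd e) = 0" "fst (snd f) = 0" "fst (snd g) = 0"
  defines "R \<equiv> rows4 (tcoord d) (tcoord e) (tcoord f) (tcoord g)" and "p \<equiv> t *\<^sub>R qone"
  shows "vol_form d e f g = R 4 5 6 7"
    "vol_twist_form p d e f g = t * (R 4 1 6 7 + R 4 2 7 5 + R 4 3 5 6)"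
    "comm_twist_form d e f g = R 2 3 4 5 + R 2 3 6 7 + R 3 1 4 6 + R 3 1 7 5 + R 1 2 4 7 + R 1 2 5 6"
    "wedge22 (chi_form 1 p) (\<lambda>x y. wedge11 (rho_form p) (beta_form 1 p) x y + wedge11 (beta_form 2 p) (beta_form 3 p) x y) d e f g
      = t ^ 4 * (R 2 3 4 5 + R 2 3 6 7)"
    "wedge22 (chi_form 2 p) (\<lambda>x y. wedge11 (rho_form p) (beta_form 2 p) x y + wedge11 (beta_form 3 p) (beta_form 1 p) x y) d e f g
      = t ^ 4 * (R 3 1 4 6 + R 3 1 7 5)"
    "wedge22 (chi_form 3 p) (\<lambda>x y. wedge11 (rho_form p) (beta_form 3 p) x y + wedge11 (beta_form 1 p) (beta_form 2 p) x y) d e f g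
      = t ^ 4 * (R 1 2 4 7 + R 1 2 5 6)"
    "wedge22 (chi_form 1 p) (kappa_form 1) d e f g = t\<^sup>2 * (R 2 3 4 5 - R 2 3 6 7)"
    "wedge22 (chi_form 2 p) (kappa_form 2) d e f g = t\<^sup>2 * (R 3 1 4 6 - R 3 1 7 5)"
    "wedge22 (chi_form 3 p) (kappa_form 3) d e f g = t\<^sup>2 * (R 1 2 4 7 - R 1 2 5 6)"
    "rho_theta_form p d e f g = t * R 4 1 2 3"
proof -
  note c = basic_forms_coord[OF i(1,2)] basic_forms_coord[OF i(1,3)] basic_forms_coord[OF i(1,4)]
    basic_forms_coord[OF i(2,3)] basic_forms_coord[OF i(2,4)] basic_forms_coord[OF i(3,4)]
    basic_forms_coord(1-7)[OF i(4,4)]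
  have v: "qvol x y z w = det4 (row4 (\<lambda>x. fst x) x y z w) (row4 (co 1) x y z w) (row4 (co 2) x y z w) (row4 (co 3) x y z w)"
    for x y z w
    by (simp add: qvol_def co_inner co_qmult qcnj_simps row4_def algebra_simps)
  show "vol_form d e f g = R 4 5 6 7"
    by (simp add: vol_form_def v R_def rows4_def row4_def tcoord_nth)
  show "vol_twist_form p d e f g = t * (R 4 1 6 7 + R 4 2 7 5 + R 4 3 5 6)"
    by (simp add: vol_twist_form_def v R_def rows4_def row4_def tcoord_nth p_def i algebra_simps)
  show "comm_twist_form d e f g = R 2 3 4 5 + R 2 3 6 7 + R 3 1 4 6 + R 3 1 7 5 + R 1 2 4 7 + R 1 2 5 6"
    unfolding comm_twist_form_def Let_def co_inner co_qmult c
    by (simp add: R_def rows4_def row4_def tcoord_nth algebra_simps)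
  show "wedge22 (chi_form 1 p) (\<lambda>x y. wedge11 (rho_form p) (beta_form 1 p) x y + wedge11 (beta_form 2 p) (beta_form 3 p) x y) d e f g
      = t ^ 4 * (R 2 3 4 5 + R 2 3 6 7)"
    "wedge22 (chi_form 2 p) (\<lambda>x y. wedge11 (rho_form p) (beta_form 2 p) x y + wedge11 (beta_form 3 p) (beta_form 1 p) x y) d e f g
      = t ^ 4 * (R 3 1 4 6 + R 3 1 7 5)"
    "wedge22 (chi_form 3 p) (\<lambda>x y. wedge11 (rho_form p) (beta_form 3 p) x y + wedge11 (beta_form 1 p) (beta_form 2 p) x y) d e f g
      = t ^ 4 * (R 1 2 4 7 + R 1 2 5 6)"
    "wedge22 (chi_form 1 p) (kappa_form 1) d e f g = t\<^sup>2 * (R 2 3 4 5 - R 2 3 6 7)"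
    "wedge22 (chi_form 2 p) (kappa_form 2) d e f g = t\<^sup>2 * (R 3 1 4 6 - R 3 1 7 5)"
    "wedge22 (chi_form 3 p) (kappa_form 3) d e f g = t\<^sup>2 * (R 1 2 4 7 - R 1 2 5 6)"
    unfolding wedge22_def wedge11_def p_def c
    by (simp_all add: R_def rows4_def row4_def power2_eq_square power4_eq_xxxx algebra_simps)
  show "rho_theta_form p d e f g = t * R 4 1 2 3"
    unfolding rho_theta_form_def theta_form_def p_def co_inner c i
    by (simp add: R_def rows4_def row4_def tcoord_nth algebra_simps)
qed

end

section \<open>Exterior derivatives compared through the orbit map\<close>

definition sgn' :: "quat \<Rightarrow> quat \<Rightarrow> quat" where
  "sgn' g v = (1 / norm g) *\<^sub>R (v - ((g \<bullet> v) / (g \<bullet> g)) *\<^sub>R g)"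

text \<open>The second derivative of \<open>sgn\<close> at a unit quaternion; its symmetry in
  \<open>v\<close> and \<open>w\<close> enters the hypothesis on second derivatives of
  \<open>ext_deriv_pullback\<close>.\<close>

definition sgn'' :: "quat \<Rightarrow> quat \<Rightarrow> quat \<Rightarrow> quat" where
  "sgn'' g w v = (3 * (g \<bullet> v) * (g \<bullet> w)) *\<^sub>R g - (g \<bullet> w) *\<^sub>R v - (g \<bullet> v) *\<^sub>R w - (w \<bullet> v) *\<^sub>R g"

lemma sgn'_has_derivative:
  assumes g: "norm g = 1"
  shows "((\<lambda>g. sgn' g v) has_derivative (\<lambda>w. sgn'' g w v)) (at g)"
proof -
  have g0: "g \<noteq> 0" using g by auto
  have i: "((\<lambda>g::quat. inverse (norm g)) has_derivative (\<lambda>w. - (g \<bullet> w))) (at g)"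
    using Deriv.has_derivative_inverse[OF _ has_derivative_norm[OF g0]] g
    by (simp add: sgn_div_norm inner_commute)
  have c: "((\<lambda>g::quat. (inverse (norm g)) ^ 3) has_derivative (\<lambda>w. - 3 * (g \<bullet> w))) (at g)"
    using has_derivative_power[OF i, of 3] g by (simp add: algebra_simps)
  have "((\<lambda>g. inverse (norm g) *\<^sub>R v - ((g \<bullet> v) * (inverse (norm g)) ^ 3) *\<^sub>R g) has_derivative
    (\<lambda>w. (- (g \<bullet> w)) *\<^sub>R v - (((g \<bullet> v) * (inverse (norm g)) ^ 3) *\<^sub>R w
      + ((g \<bullet> v) * (- 3 * (g \<bullet> w)) + (w \<bullet> v) * (inverse (norm g)) ^ 3) *\<^sub>R g))) (at g)"
    by (intro has_derivative_diff has_derivative_scaleR_left i has_derivative_scaleR has_derivative_ident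
        has_derivative_mult c has_derivative_inner_left)
  moreover have "inverse (norm h) *\<^sub>R v - ((h \<bullet> v) * (inverse (norm h)) ^ 3) *\<^sub>R h = sgn' h v" for h
    by (simp add: sgn'_def scaleR_right_diff_distrib power3_eq_cube divide_inverse power2_norm_eq_inner[symmetric]
        power2_eq_square mult_ac)
  moreover have "(- (g \<bullet> w)) *\<^sub>R v - (((g \<bullet> v) * (inverse (norm g)) ^ 3) *\<^sub>R w
      + ((g \<bullet> v) * (- 3 * (g \<bullet> w)) + (w \<bullet> v) * (inverse (norm g)) ^ 3) *\<^sub>R g) = sgn'' g w v" for w
    using g by (simp add: sgn''_def quat_eq_iff algebra_simps)
  ultimately show ?thesis by simp
qed

lemma sgn_has_derivative': "g \<noteq> 0 \<Longrightarrow> (sgn has_derivative sgn' g) (at g)"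
  using sgn_has_derivative[of g] by (simp add: sgn'_def[abs_def])

lemma alt4_pullback_star_phi:
  assumes F: "adapted_frame r \<phi> x F" and r: "r x = x" "(r has_derivative r') (at x)"
  shows "alt4 (pullback r (star_phi r \<phi>) x)"
proof -
  define L where "L v = inv F (r' v)" for v
  have r': "frechet_derivative r (at x) = r'" using frechet_derivative_at[OF r(2)] by simp
  have F': "linear F" "inj F" "range F = range r'"
    using F by (auto simp: adapted_frame_def bij_betw_def tangent_def r')
  have FL: "F (L v) = r' v" for v unfolding L_def by (rule f_inv_into_f) (use F'(3) in blast)
  have "linear L"
    by (rule linearI; rule injD[OF F'(2)]) (simp_all add: FL linear_add[OF F'(1)] linear_scale[OF F'(1)]
        linear_add[OF has_derivative_linear[OF r(2)]] linear_scale[OF has_derivative_linear[OF r(2)]])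
  then have a: "alt4 (\<lambda>vs. hodge7 3 phi0 (map L vs))" by (rule alt4_compose_linear[OF alt4_hodge7])
  have eq: "pullback r (star_phi r \<phi>) x [a, b, c, d] = hodge7 3 phi0 (map L [a, b, c, d])" for a b c d
    unfolding pullback_def r' r(1)
    by (subst star_phi_adapted[OF F]) (auto simp: L_def tangent_def r')
  show ?thesis using a unfolding alt4_def eq .
qed

lemma M_retr_tangent:
  assumes "x \<in> M_man"
  shows "M_retr x = x" "X \<in> tangent M_retr x \<Longrightarrow> frechet_derivative M_retr (at x) X = X"
proof -
  obtain p q where x: "x = (p, q)" by (cases x) auto
  have n: "norm q = 1" "q \<bullet> q = 1" using assms by (auto simp: x M_man_def norm_eq_1)
  show "M_retr x = x" using n by (simp add: x M_retr_def sgn_div_norm)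
  assume "X \<in> tangent M_retr x"
  moreover obtain v w where X: "X = (v, w)" by (cases X) auto
  ultimately have "q \<bullet> w = 0" using M_tangent_iff assms by (simp add: x)
  then show "frechet_derivative M_retr (at x) X = X"
    using M_retr_frechet[OF M_man_nbhd[OF assms]] n by (simp add: x X)
qed

context su2_frame
begin

lemma N_retr'_eq: "N_retr' (t, g1, g2) (s, v1, v2) = (s, sgn' g1 v1, sgn' g2 v2)"
  by (simp add: N_retr'_def sgn'_def)

text \<open>Naturality of the exterior derivative for
  \<open>\<Psi> = orbit_map \<circ> N_retr\<close>. Composing with the retraction makes
  \<open>\<Psi>'\<close> take values in the tangent spaces of \<open>M\<close>, on which the
  derivative of \<open>M_retr\<close> is the identity, so the pulled-back forms agree on all of
  \<open>N_nbhd\<close> and can be differentiated there.\<close>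

lemma ext_deriv_orbit:
  assumes r: "restricts_to T A B \<phi>" and nz: "\<And>i t. t > 0 \<Longrightarrow> A i t \<noteq> 0 \<and> B i t \<noteq> 0" and x: "x \<in> N_man"
    and diff: "\<And>us. length us = 4 \<Longrightarrow> (\<lambda>z. pullback M_retr (star_phi M_retr \<phi>) z us) differentiable (at (orbit_map x))"
    and vs: "length vs = 5" "set vs \<subseteq> tangent N_retr x"
  shows "ext_deriv N_retr (star_phi_AB T A B) x vs = ext_deriv M_retr (star_phi M_retr \<phi>) (orbit_map x) (map (orbit' x) vs)"
proof -
  obtain t g1 g2 where e: "x = (t, g1, g2)" by (cases x) auto
  have n: "g1 \<bullet> g1 = 1" "g2 \<bullet> g2 = 1" "norm g1 = 1" "norm g2 = 1" "t > 0"
    using x by (auto simp: e N_man_def SU2sq_def norm_eq_1)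
  have g0: "g1 \<noteq> 0" "g2 \<noteq> 0" using n by auto
  have xn: "x \<in> N_nbhd" using x by (rule N_man_nbhd)
  have Nx: "N_retr x = x" using n by (simp add: e N_retr_def sgn_div_norm)
  define \<Psi> where "\<Psi> y = orbit_map (N_retr y)" for y
  define \<Psi>' where "\<Psi>' y v = orbit' (N_retr y) (N_retr' y v)" for y v
  define \<Psi>'' where "\<Psi>'' w v = (fst v *\<^sub>R sgn' g1 (fst (snd w)) + (fst w *\<^sub>R sgn' g1 (fst (snd v)) + t *\<^sub>R sgn'' g1 (fst (snd w)) (fst (snd v))),
      (sgn' g1 (fst (snd v)) \<odot> qcnj (sgn' g2 (snd (snd w))) + sgn'' g1 (fst (snd w)) (fst (snd v)) \<odot> qcnj g2)
      + (g1 \<odot> qcnj (sgn'' g2 (snd (snd w)) (snd (snd v))) + sgn' g1 (fst (snd w)) \<odot> qcnj (sgn' g2 (snd (snd v)))))" for w v :: prin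
  have "ext_deriv N_retr (star_phi_AB T A B) x vs = ext_deriv M_retr (star_phi M_retr \<phi>) (\<Psi> x) (map (\<Psi>' x) vs)"
  proof (rule ext_deriv_pullback[OF open_N_nbhd xn])
    show "(\<Psi> has_derivative \<Psi>' x) (at x)"
      unfolding \<Psi>_def[abs_def] \<Psi>'_def[abs_def]
      by (rule has_derivative_compose[OF N_retr_has_derivative[OF xn] orbit_map_has_derivative])
    show "((\<lambda>y. \<Psi>' y v) has_derivative (\<lambda>w. \<Psi>'' w v)) (at x)" for v
    proof -
      obtain s v1 v2 where v: "v = (s, v1, v2)" by (cases v) auto
      have s1: "((\<lambda>y::prin. sgn (fst (snd y))) has_derivative (\<lambda>w. sgn' g1 (fst (snd w)))) (at x)"
        by (rule has_derivative_compose[of "\<lambda>y. fst (snd y)"])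
          (auto intro!: derivative_eq_intros sgn_has_derivative' simp: e g0)
      have s2: "((\<lambda>y::prin. sgn (snd (snd y))) has_derivative (\<lambda>w. sgn' g2 (snd (snd w)))) (at x)"
        by (rule has_derivative_compose[of "\<lambda>y. snd (snd y)"])
          (auto intro!: derivative_eq_intros sgn_has_derivative' simp: e g0)
      have d1: "((\<lambda>y::prin. sgn' (fst (snd y)) v1) has_derivative (\<lambda>w. sgn'' g1 (fst (snd w)) v1)) (at x)"
        by (rule has_derivative_compose[of "\<lambda>y. fst (snd y)"])
          (auto intro!: derivative_eq_intros sgn'_has_derivative simp: e n)
      have d2: "((\<lambda>y::prin. sgn' (snd (snd y)) v2) has_derivative (\<lambda>w. sgn'' g2 (snd (snd w)) v2)) (at x)"
        by (rule has_derivative_compose[of "\<lambda>y. snd (snd y)"])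
          (auto intro!: derivative_eq_intros sgn'_has_derivative simp: e n)
      have "((\<lambda>y::prin. (s *\<^sub>R sgn (fst (snd y)) + fst y *\<^sub>R sgn' (fst (snd y)) v1,
          sgn' (fst (snd y)) v1 \<odot> qcnj (sgn (snd (snd y))) + sgn (fst (snd y)) \<odot> qcnj (sgn' (snd (snd y)) v2)))
        has_derivative (\<lambda>w. (s *\<^sub>R sgn' g1 (fst (snd w)) + (fst x *\<^sub>R sgn'' g1 (fst (snd w)) v1 + fst w *\<^sub>R sgn' (fst (snd x)) v1),
          (sgn' (fst (snd x)) v1 \<odot> qcnj (sgn' g2 (snd (snd w))) + sgn'' g1 (fst (snd w)) v1 \<odot> qcnj (sgn (snd (snd x))))
          + (sgn (fst (snd x)) \<odot> qcnj (sgn'' g2 (snd (snd w)) v2) + sgn' g1 (fst (snd w)) \<odot> qcnj (sgn' (snd (snd x)) v2))))) (at x)"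
        by (intro has_derivative_Pair has_derivative_add has_derivative_scaleR_right s1 has_derivative_scaleR d1 s2 d2
            bounded_bilinear.FDERIV[OF bounded_bilinear_qmult] bounded_linear.has_derivative[OF bounded_linear_qcnj]
            has_derivative_fst has_derivative_ident)
      moreover have "\<Psi>' y v = (s *\<^sub>R sgn (fst (snd y)) + fst y *\<^sub>R sgn' (fst (snd y)) v1,
          sgn' (fst (snd y)) v1 \<odot> qcnj (sgn (snd (snd y))) + sgn (fst (snd y)) \<odot> qcnj (sgn' (snd (snd y)) v2))" for y
      proof -
        obtain t' h1 h2 where "y = (t', h1, h2)" by (cases y) auto
        then show ?thesis by (simp add: \<Psi>'_def v N_retr'_eq orbit'_def N_retr_def)
      qed
      ultimately show ?thesis
        using n by (simp add: \<Psi>''_def[abs_def] v e sgn_div_norm add_ac)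
    qed
    show "\<Psi>'' w v = \<Psi>'' v w" for v w
    proof -
      have s: "sgn'' g a b = sgn'' g b a" for g a b by (simp add: sgn''_def inner_commute algebra_simps)
      show ?thesis unfolding \<Psi>''_def by (simp add: s[of g1 "fst (snd w)"] s[of g2 "snd (snd w)"] algebra_simps)
    qed
    show "pullback N_retr (star_phi_AB T A B) y us = pullback M_retr (star_phi M_retr \<phi>) (\<Psi> y) (map (\<Psi>' y) us)"
      if y: "y \<in> N_nbhd" and us: "length us = 4" for y us
    proof -
      note N = N_retr_nbhd[OF y]
      have M: "orbit_map (N_retr y) \<in> M_man" by (rule orbit_map_M[OF N(1)])
      have "frechet_derivative N_retr (at y) = N_retr' y"
        using frechet_derivative_at[OF N_retr_has_derivative[OF y]] by simp
      then have "pullback N_retr (star_phi_AB T A B) y us = star_phi_AB T A B (N_retr y) (map (N_retr' y) us)"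
        by (simp add: pullback_def)
      also have "\<dots> = star_phi M_retr \<phi> (orbit_map (N_retr y)) (map (orbit' (N_retr y)) (map (N_retr' y) us))"
        by (rule restricts_star_phi(2)[OF r nz N(1), symmetric]) (use us N(3) in auto)
      also have "map (orbit' (N_retr y)) (map (N_retr' y) us) = map (frechet_derivative M_retr (at (orbit_map (N_retr y)))) (map (\<Psi>' y) us)"
        using M_retr_tangent(2)[OF M orbit'_tangent(1)[OF N(1) N(3)]] by (simp add: \<Psi>'_def)
      finally show ?thesis by (simp add: pullback_def \<Psi>_def M_retr_tangent(1)[OF M])
    qed
    show "alt4 (pullback M_retr (star_phi M_retr \<phi>) (\<Psi> y))" if y: "y \<in> N_nbhd" for y
    proof -
      note N = N_retr_nbhd(1)[OF y]
      have M: "orbit_map (N_retr y) \<in> M_man" by (rule orbit_map_M[OF N])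
      from restricts_star_phi(1)[OF r nz N] obtain F where F: "adapted_frame M_retr \<phi> (orbit_map (N_retr y)) F" by blast
      show ?thesis unfolding \<Psi>_def
        by (rule alt4_pullback_star_phi[OF F M_retr_tangent(1)[OF M] M_retr_has_derivative[OF M_man_nbhd[OF M]]])
    qed
    show "(\<lambda>z. pullback M_retr (star_phi M_retr \<phi>) z us) differentiable (at (\<Psi> x))" if "length us = 4" for us
      using diff[OF that] by (simp add: \<Psi>_def Nx)
  qed (rule vs(1))
  also have "map (\<Psi>' x) vs = map (orbit' x) vs"
  proof -
    have "N_retr' x v = v" if "v \<in> set vs" for v
    proof -
      obtain s v1 v2 where v: "v = (s, v1, v2)" by (cases v) auto
      have "g1 \<bullet> v1 = 0" "g2 \<bullet> v2 = 0" using N_tangent_iff[of t g1 g2 s v1 v2] x vs(2) that by (auto simp: e v)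
      then show ?thesis using n by (simp add: e v N_retr'_def)
    qed
    then show ?thesis by (simp add: \<Psi>'_def Nx)
  qed
  finally show ?thesis by (simp add: \<Psi>_def Nx)
qed

end

text \<open>Taking the imaginary part discards the component normal to the sphere, and dividing by
  \<open>snd x \<bullet> snd x\<close> makes the result scale-invariant. Hence forms written in
  \<open>tvec_of\<close> are unchanged by pulling back along \<open>M_retr\<close>, see
  \<open>tvec_of_retr\<close>.\<close>

definition tvec_of :: "quat \<times> quat \<Rightarrow> quat \<times> quat \<Rightarrow> tvec" where
  "tvec_of x X = (fst X, inverse (snd x \<bullet> snd x) *\<^sub>R (0, snd (snd X \<odot> qcnj (snd x))))"

lemma tvec_of_imaginary [simp]: "fst (snd (tvec_of x X)) = 0"
  by (simp add: tvec_of_def)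

lemma tvec_of_retr:
  assumes "x \<in> M_nbhd"
  shows "tvec_of (M_retr x) (frechet_derivative M_retr (at x) X) = tvec_of x X"
proof -
  obtain p q v w where e: "x = (p, q)" "X = (v, w)" by (cases x; cases X) auto
  have q: "q \<noteq> 0" using assms by (auto simp: e M_nbhd_def)
  have s: "sgn q \<bullet> sgn q = 1" using q by (simp add: norm_sgn flip: power2_norm_eq_inner)
  have "snd (((1 / norm q) *\<^sub>R (w - ((q \<bullet> w) / (q \<bullet> q)) *\<^sub>R q)) \<odot> qcnj (sgn q)) = inverse (q \<bullet> q) *\<^sub>R snd (w \<odot> qcnj q)"
    using q by (simp add: sgn_div_norm qcnj_linear qmult_diff qcnj_qmult_self qone_simps divide_inverse
        power2_norm_eq_inner[symmetric] power2_eq_square)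
  then show ?thesis
    unfolding M_retr_frechet[OF assms] by (simp add: e tvec_of_def M_retr_def s)
qed

lemma tvec_of_act:
  assumes a: "norm a1 = 1" "norm a2 = 1"
  shows "tvec_of (act (a1, a2) (p, q)) (act (a1, a2) (v, w)) = tact a1 (tvec_of (p, q) (v, w))"
proof -
  have n: "(a1 \<odot> q \<odot> qcnj a2) \<bullet> (a1 \<odot> q \<odot> qcnj a2) = q \<bullet> q"
  proof -
    have "a1 \<bullet> a1 = 1" "qcnj a2 \<bullet> qcnj a2 = 1" using a by (simp_all add: norm_eq_1 quat_inner qcnj_simps)
    then show ?thesis by (simp add: inner_qmult_left inner_qmult_right)
  qed
  have c: "(a1 \<odot> w \<odot> qcnj a2) \<odot> qcnj (a1 \<odot> q \<odot> qcnj a2) = qconj a1 (w \<odot> qcnj q)"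
    by (simp add: qconj_def qcnj_qmult qmult_assoc qcnj_unit' a)
  have i: "(0, snd (qconj a1 x)) = qconj a1 (0, snd x)" for x
  proof -
    have "fst (qconj a1 x) = (a1 \<bullet> a1) * fst x" for x by (simp add: qconj_def quat_simps algebra_simps)
    moreover have "snd (qconj a1 (fst x, 0)) = 0" for x :: quat
      by (simp add: qconj_def vec_eq_iff forall_3 quat_simps algebra_simps)
    moreover have "qconj a1 x = qconj a1 (fst x, 0) + qconj a1 (0, snd x)"
      unfolding qconj_def qmult_add[symmetric] by simp
    ultimately show ?thesis using a(1) by (simp add: prod_eq_iff)
  qed
  show ?thesis
    by (simp add: tvec_of_def act_def tact_def n c i qconj_simps(8)[OF a(1)])
qed

lemma smooth_on_tvec_of: "smooth_on (\<lambda>x. snd (tvec_of x X)) M_nbhd" "smooth_on (\<lambda>x. fst (tvec_of x X)) M_nbhd"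
proof -
  have "smooth_on (\<lambda>x::quat \<times> quat. snd x \<bullet> snd x) M_nbhd"
    by (intro smooth_on_inner smooth_on_bounded_linear open_M_nbhd bounded_linear_snd)
  then have "smooth_on (\<lambda>x::quat \<times> quat. inverse (snd x \<bullet> snd x)) M_nbhd"
    by (rule smooth_on_inverse[OF open_M_nbhd]) (auto simp: M_nbhd_def)
  moreover have "bounded_linear (\<lambda>x::quat \<times> quat. (0::real, snd (snd X \<odot> qcnj (snd x))))"
    by (simp add: linear_conv_bounded_linear[symmetric] linearI qcnj_linear qmult_add)
  from smooth_on_bounded_linear[OF open_M_nbhd this]
  have "smooth_on (\<lambda>x::quat \<times> quat. (0::real, snd (snd X \<odot> qcnj (snd x)))) M_nbhd" .
  ultimately show "smooth_on (\<lambda>x. snd (tvec_of x X)) M_nbhd"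
    unfolding tvec_of_def snd_conv by (rule smooth_on_scaleR[OF open_M_nbhd])
  show "smooth_on (\<lambda>x. fst (tvec_of x X)) M_nbhd"
    unfolding tvec_of_def fst_conv by (rule smooth_on_const)
qed

lemma smooth_on_norm_fst: "smooth_even f \<Longrightarrow> smooth_on (\<lambda>x::quat \<times> quat. f (norm (fst x))) M_nbhd"
  using smooth_on_compose_affine[OF open_UNIV smooth_even_radial, of f fst 0] bounded_linear_fst
  by (auto intro: smooth_on_subset)

lemmas smooth_on_qmult = smooth_on_bilinear[OF _ bounded_bilinear_qmult]
lemmas smooth_on_qcnj = smooth_on_compose_linear[OF _ bounded_linear_qcnj]

text \<open>Up to sign, \<open>a k * B k\<close> and the product of \<open>B k\<close> with the
  other two \<open>a i\<close> are the coefficients of \<open>\<theta>\<^sub>k\<close> wedged with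
  two 2-forms on R^4. The difference of these 2-forms extends with a factor \<open>t\<^sup>2\<close>
  (\<open>kappa_form\<close>), their sum for a single axis with \<open>t ^ 4\<close>, and the sum
  over all axes with no factor (\<open>twist_form\<close>). This dictates the decompositions
  \<open>c\<close> and \<open>d\<close>, with \<open>u\<close> common to all axes. \<open>n\<close>
  is the condition for one argument tangent to R^4, and \<open>g\<close>, \<open>h\<close> are the
  counterparts for the dual 4-form.\<close>

locale extension_data = su2_frame T for T +
  fixes a B :: "3 \<Rightarrow> real \<Rightarrow> real" and b :: real and u U :: "real \<Rightarrow> real" and z s l Z S :: "3 \<Rightarrow> real \<Rightarrow> real"
  assumes even: "\<And>i. smooth_even (a i)" "\<And>i. smooth_even (B i)" "smooth_even u" "\<And>i. smooth_even (z i)"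
      "\<And>i. smooth_even (s i)" "\<And>i. smooth_even (l i)" "smooth_even U" "\<And>i. smooth_even (Z i)" "\<And>i. smooth_even (S i)"
    and aB0: "\<And>i. a i 0 = 1" "\<And>i. B i 0 = b" "b \<noteq> 0"
    and nz: "\<And>i t. t > 0 \<Longrightarrow> a i t \<noteq> 0 \<and> B i t \<noteq> 0"
    and c: "\<And>k t. a k t * B k t = u t + t ^ 4 * z k t + t\<^sup>2 * s k t"
    and d: "\<And>t. a 2 t * a 3 t * B 1 t = u t + t ^ 4 * z 1 t - t\<^sup>2 * s 1 t"
      "\<And>t. a 3 t * a 1 t * B 2 t = u t + t ^ 4 * z 2 t - t\<^sup>2 * s 2 t"
      "\<And>t. a 1 t * a 2 t * B 3 t = u t + t ^ 4 * z 3 t - t\<^sup>2 * s 3 t"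
    and n: "\<And>t. a 1 t * (a 2 t * B 3 t + a 3 t * B 2 t) = 2 * b + t\<^sup>2 * l 1 t"
      "\<And>t. a 2 t * (a 3 t * B 1 t + a 1 t * B 3 t) = 2 * b + t\<^sup>2 * l 2 t"
      "\<And>t. a 3 t * (a 1 t * B 2 t + a 2 t * B 1 t) = 2 * b + t\<^sup>2 * l 3 t"
    and g: "\<And>t. a 2 t * a 3 t * B 2 t * B 3 t = U t + t ^ 4 * Z 1 t + t\<^sup>2 * S 1 t"
      "\<And>t. a 3 t * a 1 t * B 3 t * B 1 t = U t + t ^ 4 * Z 2 t + t\<^sup>2 * S 2 t"
      "\<And>t. a 1 t * a 2 t * B 1 t * B 2 t = U t + t ^ 4 * Z 3 t + t\<^sup>2 * S 3 t"
    and h: "\<And>t. B 2 t * B 3 t * a 1 t - t\<^sup>2 * (a 1 t * a 2 t * a 3 t) / 4 = U t + t ^ 4 * Z 1 t - t\<^sup>2 * S 1 t"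
      "\<And>t. B 3 t * B 1 t * a 2 t - t\<^sup>2 * (a 1 t * a 2 t * a 3 t) / 4 = U t + t ^ 4 * Z 2 t - t\<^sup>2 * S 2 t"
      "\<And>t. B 1 t * B 2 t * a 3 t - t\<^sup>2 * (a 1 t * a 2 t * a 3 t) / 4 = U t + t ^ 4 * Z 3 t - t\<^sup>2 * S 3 t"
begin

definition cyc_form :: "3 \<Rightarrow> 3 \<Rightarrow> 3 \<Rightarrow> quat \<Rightarrow> tvec \<Rightarrow> tvec \<Rightarrow> real" where
  "cyc_form i j k p x y = wedge11 (rho_form p) (beta_form i p) x y + wedge11 (beta_form j p) (beta_form k p) x y"

definition phi3 :: "quat \<Rightarrow> tvec \<Rightarrow> tvec \<Rightarrow> tvec \<Rightarrow> real" where
  "phi3 p d e f = (let t = norm p in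
     - u t * twist_form d e f
     - (z 1 t * wedge12 (alpha_form 1 p) (cyc_form 1 2 3 p) d e f + z 2 t * wedge12 (alpha_form 2 p) (cyc_form 2 3 1 p) d e f
        + z 3 t * wedge12 (alpha_form 3 p) (cyc_form 3 1 2 p) d e f)
     - (s 1 t * wedge12 (alpha_form 1 p) (kappa_form 1) d e f + s 2 t * wedge12 (alpha_form 2 p) (kappa_form 2) d e f
        + s 3 t * wedge12 (alpha_form 3 p) (kappa_form 3) d e f)
     + b * radial_comm_form p d e f
     + 1 / 2 * (l 1 t * wedge12 (beta_form 1 p) (chi_form 1 p) d e f + l 2 t * wedge12 (beta_form 2 p) (chi_form 2 p) d e f
        + l 3 t * wedge12 (beta_form 3 p) (chi_form 3 p) d e f)
     + (B 1 t * B 2 t * B 3 t - t\<^sup>2 * (a 2 t * a 3 t * B 1 t + a 3 t * a 1 t * B 2 t + a 1 t * a 2 t * B 3 t) * (1 / 4)) * theta_form d e f)"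

definition phi4 :: "quat \<Rightarrow> tvec \<Rightarrow> tvec \<Rightarrow> tvec \<Rightarrow> tvec \<Rightarrow> real" where
  "phi4 p d e f g = (let t = norm p; v = a 1 t * a 2 t * a 3 t in
     v * vol_form d e f g - 1 / 2 * v * vol_twist_form p d e f g - U t * comm_twist_form d e f g
     - (Z 1 t * wedge22 (chi_form 1 p) (cyc_form 1 2 3 p) d e f g + Z 2 t * wedge22 (chi_form 2 p) (cyc_form 2 3 1 p) d e f g
        + Z 3 t * wedge22 (chi_form 3 p) (cyc_form 3 1 2 p) d e f g)
     + (S 1 t * wedge22 (chi_form 1 p) (kappa_form 1) d e f g + S 2 t * wedge22 (chi_form 2 p) (kappa_form 2) d e f g
        + S 3 t * wedge22 (chi_form 3 p) (kappa_form 3) d e f g)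
     + (1 / 2 * (B 2 t * B 3 t * a 1 t + B 3 t * B 1 t * a 2 t + B 1 t * B 2 t * a 3 t) - 1 / 8 * v * t\<^sup>2) * rho_theta_form p d e f g)"

lemma cyc_form_invariant: "norm r = 1 \<Longrightarrow> cyc_form i j k (r \<odot> p) (tact r d) (tact r e) = cyc_form i j k p d e"
  by (simp add: cyc_form_def wedge11_def basic_forms_invariant)

lemma phi3_invariant: "norm r = 1 \<Longrightarrow> phi3 (r \<odot> p) (tact r d) (tact r e) (tact r f) = phi3 p d e f"
  by (simp add: phi3_def wedge12_def basic_forms_invariant cyc_form_invariant norm_qmult)

lemma phi4_invariant: "norm r = 1 \<Longrightarrow> phi4 (r \<odot> p) (tact r d) (tact r e) (tact r f) (tact r g) = phi4 p d e f g"
  by (simp add: phi4_def wedge22_def basic_forms_invariant cyc_form_invariant norm_qmult)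

lemma smooth_on_blocks:
  "smooth_on (\<lambda>x. alpha_form i (fst x) (tvec_of x X)) M_nbhd" "smooth_on (\<lambda>x. beta_form i (fst x) (tvec_of x X)) M_nbhd"
  "smooth_on (\<lambda>x. kappa_form i (tvec_of x X) (tvec_of x Y)) M_nbhd" "smooth_on (\<lambda>x. chi_form i (fst x) (tvec_of x X) (tvec_of x Y)) M_nbhd"
  "smooth_on (\<lambda>x. rho_form (fst x) (tvec_of x X)) M_nbhd"
  "smooth_on (\<lambda>x. cyc_form i j k (fst x) (tvec_of x X) (tvec_of x Y)) M_nbhd"
  unfolding alpha_form_def beta_form_def kappa_form_def chi_form_def tcomm_def rho_form_def cyc_form_def wedge11_def
  by (intro smooth_on_inner smooth_on_tvec_of smooth_on_qmult smooth_on_qcnj smooth_on_const smooth_on_scaleR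
      smooth_on_diff smooth_on_add smooth_on_mult smooth_on_bounded_linear bounded_linear_fst open_M_nbhd)+

lemma smooth_on_phi3: "smooth_on (\<lambda>x. phi3 (fst x) (tvec_of x X) (tvec_of x Y) (tvec_of x W)) M_nbhd"
  unfolding phi3_def Let_def wedge12_def twist_form_def radial_comm_form_def theta_form_def tcomm_def
  by (intro smooth_on_add smooth_on_diff smooth_on_mult smooth_on_uminus smooth_on_const smooth_on_blocks smooth_on_norm_fst even
      smooth_on_inner smooth_on_qmult smooth_on_qcnj smooth_on_tvec_of smooth_on_scaleR smooth_on_bounded_linear bounded_linear_fst
      open_M_nbhd smooth_even_intros)

lemma smooth_on_phi4: "smooth_on (\<lambda>x. phi4 (fst x) (tvec_of x X) (tvec_of x Y) (tvec_of x W) (tvec_of x V)) M_nbhd"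
  unfolding phi4_def Let_def wedge22_def vol_form_def vol_twist_form_def comm_twist_form_def rho_theta_form_def theta_form_def
    tcomm_def qvol_def
  by (intro smooth_on_add smooth_on_diff smooth_on_mult smooth_on_uminus smooth_on_const smooth_on_blocks smooth_on_norm_fst even
      smooth_on_inner smooth_on_qmult smooth_on_qcnj smooth_on_tvec_of smooth_on_scaleR smooth_on_bounded_linear bounded_linear_fst
      open_M_nbhd smooth_even_intros)

text \<open>The decompositions \<open>c\<close>, \<open>d\<close> and \<open>n\<close> are read
  backwards: they collapse the polynomial building blocks to one coefficient for each coordinate
  form.\<close>

lemma phi3_coord:
  assumes i: "fst (snd d') = 0" "fst (snd e) = 0" "fst (snd f) = 0" and t: "t \<ge> 0"
  defines "R \<equiv> rows3 (tcoord d') (tcoord e) (tcoord f)"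
  shows "phi3 (t *\<^sub>R qone) d' e f =
    - (a 1 t * B 1 t * R 1 4 5 + a 2 t * B 2 t * R 2 4 6 + a 3 t * B 3 t * R 3 4 7)
    - (a 2 t * a 3 t * B 1 t * R 1 6 7 + a 3 t * a 1 t * B 2 t * R 2 7 5 + a 1 t * a 2 t * B 3 t * R 3 5 6)
    + 1 / 2 * t * (a 1 t * (a 2 t * B 3 t + a 3 t * B 2 t) * R 5 2 3 + a 2 t * (a 3 t * B 1 t + a 1 t * B 3 t) * R 6 3 1
      + a 3 t * (a 1 t * B 2 t + a 2 t * B 1 t) * R 7 1 2)
    + (B 1 t * B 2 t * B 3 t - t\<^sup>2 * (a 2 t * a 3 t * B 1 t + a 3 t * a 1 t * B 2 t + a 1 t * a 2 t * B 3 t) * (1 / 4)) * R 1 2 3"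
proof -
  have nt: "norm (t *\<^sub>R qone) = t" using t by simp
  show ?thesis
    unfolding phi3_def Let_def nt cyc_form_def[abs_def] forms3_coord[OF i] R_def[symmetric] c n
    unfolding d
    by (simp add: algebra_simps power2_eq_square power3_eq_cube power4_eq_xxxx)
qed

lemma phi4_coord:
  assumes i: "fst (snd d') = 0" "fst (snd e) = 0" "fst (snd f) = 0" "fst (snd g') = 0" and t: "t \<ge> 0"
  defines "R \<equiv> rows4 (tcoord d') (tcoord e) (tcoord f) (tcoord g')" and "v \<equiv> a 1 t * a 2 t * a 3 t"
  shows "phi4 (t *\<^sub>R qone) d' e f g' = v * R 4 5 6 7 - 1 / 2 * v * t * (R 4 1 6 7 + R 4 2 7 5 + R 4 3 5 6)
    - (a 2 t * a 3 t * B 2 t * B 3 t * R 2 3 6 7 + a 3 t * a 1 t * B 3 t * B 1 t * R 3 1 7 5 + a 1 t * a 2 t * B 1 t * B 2 t * R 1 2 5 6)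
    - ((B 2 t * B 3 t * a 1 t - t\<^sup>2 * v / 4) * R 2 3 4 5 + (B 3 t * B 1 t * a 2 t - t\<^sup>2 * v / 4) * R 3 1 4 6
      + (B 1 t * B 2 t * a 3 t - t\<^sup>2 * v / 4) * R 1 2 4 7)
    + (1 / 2 * (B 2 t * B 3 t * a 1 t + B 3 t * B 1 t * a 2 t + B 1 t * B 2 t * a 3 t) - 1 / 8 * v * t\<^sup>2) * (t * R 4 1 2 3)"
proof -
  have nt: "norm (t *\<^sub>R qone) = t" using t by simp
  show ?thesis
    unfolding phi4_def Let_def nt cyc_form_def[abs_def] forms4_coord[OF i] R_def[symmetric] v_def g h
    by (simp add: algebra_simps power2_eq_square power4_eq_xxxx)
qed

end

text \<open>The derivative of the orbit map in coordinates after moving back to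
  \<open>g1 = 1\<close>: the S^3 part is the difference of the two left-translated components,
  \<open>2 \<eta>\<^sub>i\<^sup>-\<close>, and the R^4 part consists of \<open>dt\<close> and
  \<open>t (\<eta>\<^sub>i\<^sup>+ + \<eta>\<^sub>i\<^sup>-)\<close>.\<close>

definition orbit_coord :: "real \<Rightarrow> real^7 \<Rightarrow> real^7" where
  "orbit_coord t z = vector [2 * z$1, 2 * z$2, 2 * z$3, z$4, t * (z$5 + z$1), t * (z$6 + z$2), t * (z$7 + z$3)]"

lemma orbit_coord_nth:
  "orbit_coord t z $ 1 = 2 * z$1" "orbit_coord t z $ 2 = 2 * z$2" "orbit_coord t z $ 3 = 2 * z$3" "orbit_coord t z $ 4 = z$4"
  "orbit_coord t z $ 5 = t * (z$5 + z$1)" "orbit_coord t z $ 6 = t * (z$6 + z$2)" "orbit_coord t z $ 7 = t * (z$7 + z$3)"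
  by (simp_all add: orbit_coord_def vector_7)

lemma rows3_orbit_coord:
  fixes x y w :: "real^7" and t :: real
  defines "R \<equiv> rows3 x y w" and "C \<equiv> rows3 (orbit_coord t x) (orbit_coord t y) (orbit_coord t w)"
  shows "C 1 4 5 = - 2 * t * R 4 1 5" "C 2 4 6 = - 2 * t * R 4 2 6" "C 3 4 7 = - 2 * t * R 4 3 7" "C 1 2 3 = 8 * R 1 2 3"
    "C 1 6 7 = 2 * t\<^sup>2 * (R 6 7 1 + R 6 3 1 + R 7 1 2 + R 1 2 3)" "C 2 7 5 = 2 * t\<^sup>2 * (R 7 5 2 + R 7 1 2 + R 5 2 3 + R 1 2 3)"
    "C 3 5 6 = 2 * t\<^sup>2 * (R 5 6 3 + R 5 2 3 + R 6 3 1 + R 1 2 3)"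
    "C 5 2 3 = 4 * t * (R 5 2 3 + R 1 2 3)" "C 6 3 1 = 4 * t * (R 6 3 1 + R 1 2 3)" "C 7 1 2 = 4 * t * (R 7 1 2 + R 1 2 3)"
  unfolding R_def C_def rows3_def row3_def orbit_coord_nth
  by (simp_all add: power2_eq_square algebra_simps)

lemma rows4_swap: "rows4 x y z w j i k l = - rows4 x y z w i j k l" "rows4 x y z w i k j l = - rows4 x y z w i j k l"
  "rows4 x y z w i j l k = - rows4 x y z w i j k l"
  unfolding rows4_def by (rule det4_swap)+

lemma rows4_sort:
  "coord_idx i < coord_idx j \<Longrightarrow> rows4 x y z w j i k l = - rows4 x y z w i j k l"
  "coord_idx j < coord_idx k \<Longrightarrow> rows4 x y z w i k j l = - rows4 x y z w i j k l"
  "coord_idx k < coord_idx l \<Longrightarrow> rows4 x y z w i j l k = - rows4 x y z w i j k l"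
  by (rule rows4_swap)+

lemma rows4_orbit_coord:
  fixes x y w v :: "real^7" and t :: real
  defines "R \<equiv> rows4 x y w v" and "C \<equiv> rows4 (orbit_coord t x) (orbit_coord t y) (orbit_coord t w) (orbit_coord t v)"
  shows "C 4 5 6 7 = t ^ 3 * (R 4 5 6 7 + R 4 5 6 3 + R 4 5 2 7 + R 4 5 2 3 + R 4 1 6 7 + R 4 1 6 3 + R 4 1 2 7 + R 4 1 2 3)"
    "C 4 1 6 7 = 2 * t\<^sup>2 * (R 4 1 6 7 + R 4 1 6 3 + R 4 1 2 7 + R 4 1 2 3)"
    "C 4 2 7 5 = 2 * t\<^sup>2 * (R 4 2 7 5 + R 4 2 7 1 + R 4 2 3 5 + R 4 2 3 1)"
    "C 4 3 5 6 = 2 * t\<^sup>2 * (R 4 3 5 6 + R 4 3 5 2 + R 4 3 1 6 + R 4 3 1 2)"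
    "C 2 3 6 7 = 4 * t\<^sup>2 * R 2 3 6 7" "C 3 1 7 5 = 4 * t\<^sup>2 * R 3 1 7 5" "C 1 2 5 6 = 4 * t\<^sup>2 * R 1 2 5 6"
    "C 2 3 4 5 = 4 * t * (R 2 3 4 5 + R 2 3 4 1)" "C 3 1 4 6 = 4 * t * (R 3 1 4 6 + R 3 1 4 2)"
    "C 1 2 4 7 = 4 * t * (R 1 2 4 7 + R 1 2 4 3)" "C 4 1 2 3 = 8 * R 4 1 2 3"
  unfolding R_def C_def rows4_def row4_def orbit_coord_nth
  by (simp_all add: power2_eq_square power3_eq_cube algebra_simps)

context su2_frame
begin

text \<open>Separates the group translation, which invariant forms do not see, from the vector
  \<open>d\<close>, which depends on \<open>u\<close> only through its left-translated
  components.\<close>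

lemma tvec_of_orbit:
  assumes x: "(t, g1, g2) \<in> N_man" and u: "u \<in> tangent N_retr (t, g1, g2)"
  shows "\<exists>d. tvec_of (orbit_map (t, g1, g2)) (orbit' (t, g1, g2) u) = tact g1 d \<and> fst (snd d) = 0 \<and>
    tcoord d = orbit_coord t (coframe (t, g1, g2) u)"
proof -
  obtain s v1 v2 where e: "u = (s, v1, v2)" by (cases u) auto
  have n: "g1 \<bullet> g1 = 1" "g2 \<bullet> g2 = 1" "norm g1 = 1" "norm g2 = 1"
    using x by (auto simp: N_man_def SU2sq_def norm_eq_1)
  have o: "fst (qcnj g1 \<odot> v1) = 0" "fst (qcnj g2 \<odot> v2) = 0"
    using N_tangent_iff[OF x, of s v1 v2] u by (simp_all add: e fst_qcnj_qmult)
  define d where "d = (s *\<^sub>R qone + t *\<^sub>R (qcnj g1 \<odot> v1), qcnj g1 \<odot> v1 - qcnj g2 \<odot> v2)"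
  have q: "(g1 \<odot> qcnj g2) \<bullet> (g1 \<odot> qcnj g2) = 1"
    using n norm_qmult[of g1 "qcnj g2"] by (simp add: norm_eq_1[symmetric])
  have w: "(v1 \<odot> qcnj g2 + g1 \<odot> qcnj v2) \<odot> qcnj (g1 \<odot> qcnj g2) = qconj g1 (snd d)"
  proof -
    have "qcnj v2 \<odot> g2 = - (qcnj g2 \<odot> v2)"
    proof -
      have "qcnj v2 \<odot> g2 = qcnj (qcnj g2 \<odot> v2)" by (simp add: qcnj_qmult)
      also have "\<dots> = - (qcnj g2 \<odot> v2)" using o(2) by (simp add: prod_eq_iff qcnj_simps)
      finally show ?thesis .
    qed
    moreover have "(v1 \<odot> qcnj g2 + g1 \<odot> qcnj v2) \<odot> qcnj (g1 \<odot> qcnj g2) = v1 \<odot> qcnj g1 + g1 \<odot> (qcnj v2 \<odot> g2) \<odot> qcnj g1"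
      using n by (simp add: qmult_add qcnj_qmult qmult_assoc qcnj_unit')
    ultimately show ?thesis
      using n by (simp add: d_def qconj_def qmult_diff qcnj_unit' qmult_assoc)
  qed
  have "fst (qconj g1 (snd d)) = 0"
  proof -
    have "fst (qconj g1 y) = (g1 \<bullet> g1) * fst y" for y by (simp add: qconj_def quat_simps algebra_simps)
    then show ?thesis using o by (simp add: d_def)
  qed
  then have "(0, snd (qconj g1 (snd d))) = qconj g1 (snd d)" by (simp add: prod_eq_iff)
  moreover have "snd (v1 \<odot> qcnj g2 \<odot> qcnj (g1 \<odot> qcnj g2)) + snd (g1 \<odot> qcnj v2 \<odot> qcnj (g1 \<odot> qcnj g2)) = snd (qconj g1 (snd d))"
    using arg_cong[OF w, of snd] by (simp add: qmult_add)
  ultimately have "tvec_of (orbit_map (t, g1, g2)) (orbit' (t, g1, g2) u) = tact g1 d"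
    using n by (simp add: tvec_of_def tact_def orbit_map_eq orbit'_def e q d_def qmult_add qcnj_unit')
  moreover have "tcoord d = orbit_coord t (coframe (t, g1, g2) u)"
    using n o by (simp add: vec_eq_iff forall_7 tcoord_nth orbit_coord_nth coframe_nth left_coord_nth d_def e qone_simps
        fst_qcnj_qmult field_simps)
  moreover have "fst (snd d) = 0" using o by (simp add: d_def)
  ultimately show ?thesis by blast
qed

end

section \<open>Adapted frames for the extended form\<close>

context extension_data
begin

abbreviation "A \<equiv> \<lambda>i t. t / 2 * a i t"

lemma phi3_frame_scale:
  assumes "tcoord d' = orbit_coord t x" "tcoord e = orbit_coord t y" "tcoord f = orbit_coord t w"
    and i: "fst (snd d') = 0" "fst (snd e) = 0" "fst (snd f) = 0" and t: "t \<ge> 0"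
  shows "phi3 (t *\<^sub>R qone) d' e f = phi0 (map (frame_scale (\<lambda>i. A i t) (\<lambda>i. B i t)) [x, y, w])"
  unfolding phi3_coord[OF i t] assms(1-3) rows3_orbit_coord phi0_frame_scale
  by (simp add: power2_eq_square algebra_simps)

lemma phi4_frame_scale:
  assumes "tcoord d' = orbit_coord t x" "tcoord e = orbit_coord t y" "tcoord f = orbit_coord t w" "tcoord g' = orbit_coord t v"
    and i: "fst (snd d') = 0" "fst (snd e) = 0" "fst (snd f) = 0" "fst (snd g') = 0" and t: "t \<ge> 0"
  shows "phi4 (t *\<^sub>R qone) d' e f g' = hodge7 3 phi0 (map (frame_scale (\<lambda>i. A i t) (\<lambda>i. B i t)) [x, y, w, v])"
  unfolding phi4_coord[OF i t] assms(1-4) rows4_orbit_coord hodge7_frame_scale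
  by (simp add: rows4_sort coord_idx_simps) (simp add: power2_eq_square power3_eq_cube field_simps)

text \<open>At \<open>t = 0\<close> the map \<open>orbit_coord\<close> degenerates, so the adapted
  coframe is taken from \<open>tcoord\<close> directly. The halves cancel the factor 2 in
  \<open>frame_scale\<close>, leaving the scale 1 on R^4 (up to the sign in slot 4) and
  \<open>b\<close> on S^3.\<close>

lemma phi3_frame_scale_0:
  assumes i: "fst (snd d') = 0" "fst (snd e) = 0" "fst (snd f) = 0"
  shows "phi3 0 d' e f = phi0 (map (frame_scale (\<lambda>i. 1 / 2) (\<lambda>i. b / 2)) [tcoord d', tcoord e, tcoord f])"
proof -
  have r: "rows3 x y w 1 4 5 = - rows3 x y w 4 1 5" "rows3 x y w 2 4 6 = - rows3 x y w 4 2 6"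
    "rows3 x y w 3 4 7 = - rows3 x y w 4 3 7" "rows3 x y w 1 6 7 = rows3 x y w 6 7 1" "rows3 x y w 2 7 5 = rows3 x y w 7 5 2"
    "rows3 x y w 3 5 6 = rows3 x y w 5 6 3" for x y w
    by (simp_all add: rows3_def row3_def algebra_simps)
  show ?thesis
    using phi3_coord[OF i order_refl] unfolding phi0_frame_scale r by (simp add: aB0 algebra_simps)
qed

lemma phi4_frame_scale_0:
  assumes i: "fst (snd d') = 0" "fst (snd e) = 0" "fst (snd f) = 0" "fst (snd g') = 0"
  shows "phi4 0 d' e f g' = hodge7 3 phi0 (map (frame_scale (\<lambda>i. 1 / 2) (\<lambda>i. b / 2)) [tcoord d', tcoord e, tcoord f, tcoord g'])"
  using phi4_coord[OF i order_refl] unfolding hodge7_frame_scale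
  by (simp add: aB0 rows4_sort coord_idx_simps)

definition phi :: "(quat \<times> quat) dform" where
  "phi x Xs = phi3 (fst x) (tvec_of x (Xs ! 0)) (tvec_of x (Xs ! 1)) (tvec_of x (Xs ! 2))"

definition psi :: "(quat \<times> quat) dform" where
  "psi x Xs = phi4 (fst x) (tvec_of x (Xs ! 0)) (tvec_of x (Xs ! 1)) (tvec_of x (Xs ! 2)) (tvec_of x (Xs ! 3))"

lemma phi_orbit:
  assumes x: "x \<in> N_man" and us: "length us = 3" "set us \<subseteq> tangent N_retr x"
  shows "phi (orbit_map x) (map (orbit' x) us) = phi_AB T A B x us"
proof -
  obtain t g1 g2 where e: "x = (t, g1, g2)" by (cases x) auto
  have n: "norm g1 = 1" "t > 0" using x by (auto simp: e N_man_def SU2sq_def)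
  obtain v1 v2 v3 where v: "us = [v1, v2, v3]" using us(1) by (auto simp: length_Suc_conv eval_nat_numeral)
  have m: "v1 \<in> tangent N_retr (t, g1, g2)" "v2 \<in> tangent N_retr (t, g1, g2)" "v3 \<in> tangent N_retr (t, g1, g2)"
    using us(2) by (auto simp: v e)
  note tv = tvec_of_orbit[OF x[unfolded e]]
  obtain d1 d2 d3 where d:
    "tvec_of (orbit_map x) (orbit' x v1) = tact g1 d1" "fst (snd d1) = 0" "tcoord d1 = orbit_coord t (coframe x v1)"
    "tvec_of (orbit_map x) (orbit' x v2) = tact g1 d2" "fst (snd d2) = 0" "tcoord d2 = orbit_coord t (coframe x v2)"
    "tvec_of (orbit_map x) (orbit' x v3) = tact g1 d3" "fst (snd d3) = 0" "tcoord d3 = orbit_coord t (coframe x v3)"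
    using tv[OF m(1)] tv[OF m(2)] tv[OF m(3)] unfolding e by blast
  have p: "fst (orbit_map x) = g1 \<odot> (t *\<^sub>R qone)" by (simp add: e orbit_map_eq)
  have "phi (orbit_map x) (map (orbit' x) us) = phi3 (t *\<^sub>R qone) d1 d2 d3"
    by (simp add: phi_def v d p phi3_invariant n del: qmult_scaleR)
  also have "\<dots> = phi0 (map (frame_scale (\<lambda>i. A i t) (\<lambda>i. B i t)) (map (coframe x) us))"
    using n by (subst phi3_frame_scale[OF d(3,6,9,2,5,8)]) (simp_all add: v)
  also have "\<dots> = phi_AB T A B x us"
    using phi_AB_coframe[OF x us, of A B] by (simp add: e)
  finally show ?thesis .
qed

lemma psi_orbit:
  assumes x: "x \<in> N_man" and us: "length us = 4" "set us \<subseteq> tangent N_retr x"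
  shows "psi (orbit_map x) (map (orbit' x) us) = star_phi_AB T A B x us"
proof -
  obtain t g1 g2 where e: "x = (t, g1, g2)" by (cases x) auto
  have n: "norm g1 = 1" "t > 0" using x by (auto simp: e N_man_def SU2sq_def)
  obtain v1 v2 v3 v4 where v: "us = [v1, v2, v3, v4]" using us(1) by (auto simp: length_Suc_conv eval_nat_numeral)
  have m: "v1 \<in> tangent N_retr (t, g1, g2)" "v2 \<in> tangent N_retr (t, g1, g2)" "v3 \<in> tangent N_retr (t, g1, g2)"
    "v4 \<in> tangent N_retr (t, g1, g2)"
    using us(2) by (auto simp: v e)
  note tv = tvec_of_orbit[OF x[unfolded e]]
  obtain d1 d2 d3 d4 where d:
    "tvec_of (orbit_map x) (orbit' x v1) = tact g1 d1" "fst (snd d1) = 0" "tcoord d1 = orbit_coord t (coframe x v1)"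
    "tvec_of (orbit_map x) (orbit' x v2) = tact g1 d2" "fst (snd d2) = 0" "tcoord d2 = orbit_coord t (coframe x v2)"
    "tvec_of (orbit_map x) (orbit' x v3) = tact g1 d3" "fst (snd d3) = 0" "tcoord d3 = orbit_coord t (coframe x v3)"
    "tvec_of (orbit_map x) (orbit' x v4) = tact g1 d4" "fst (snd d4) = 0" "tcoord d4 = orbit_coord t (coframe x v4)"
    using tv[OF m(1)] tv[OF m(2)] tv[OF m(3)] tv[OF m(4)] unfolding e by blast
  have p: "fst (orbit_map x) = g1 \<odot> (t *\<^sub>R qone)" by (simp add: e orbit_map_eq)
  have "psi (orbit_map x) (map (orbit' x) us) = phi4 (t *\<^sub>R qone) d1 d2 d3 d4"
    by (simp add: psi_def v d p phi4_invariant n del: qmult_scaleR)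
  also have "\<dots> = hodge7 3 phi0 (map (frame_scale (\<lambda>i. A i t) (\<lambda>i. B i t)) (map (coframe x) us))"
    using n by (subst phi4_frame_scale[OF d(3,6,9,12,2,5,8,11)]) (simp_all add: v)
  also have "\<dots> = star_phi_AB T A B x us"
    using star_phi_AB_coframe[OF x us, of A B] by (simp add: e)
  finally show ?thesis .
qed

lemma phi_restricts: "restricts_to T A B phi"
  unfolding restricts_to_def pullback_def orbit_map_frechet using phi_orbit by blast

lemma A_B_nonzero: "t > 0 \<Longrightarrow> A i t \<noteq> 0 \<and> B i t \<noteq> 0"
  using nz[of t i] by simp

lemma singular_orbit_frame:
  assumes q: "(0, q) \<in> M_man"
  defines "F \<equiv> \<lambda>z::real^7. ((- z$4) *\<^sub>R qone + z$5 *\<^sub>R T 1 + z$6 *\<^sub>R T 2 + z$7 *\<^sub>R T 3,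
    ((z$1 / b) *\<^sub>R T 1 + (z$2 / b) *\<^sub>R T 2 + (z$3 / b) *\<^sub>R T 3) \<odot> q)"
    and "G \<equiv> \<lambda>X. frame_scale (\<lambda>i. 1 / 2) (\<lambda>i. b / 2) (tcoord (tvec_of (0, q) X))"
  shows "adapted_frame M_retr phi (0, q) F" "X \<in> tangent M_retr (0, q) \<Longrightarrow> inv F X = G X"
proof -
  have n: "norm q = 1" "q \<bullet> q = 1" using q by (auto simp: M_man_def norm_eq_1)
  have tv: "tvec_of (0, q) (F z) = (fst (F z), (z$1 / b) *\<^sub>R T 1 + (z$2 / b) *\<^sub>R T 2 + (z$3 / b) *\<^sub>R T 3)" for z
    by (simp add: tvec_of_def F_def n qmult_assoc qcnj_unit prod_eq_iff)
  have GF: "G (F z) = z" for z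
    unfolding G_def tv using aB0(3) by (simp add: vec_eq_iff forall_7 frame_scale_nth tcoord_nth F_def qone_simps)
  have lin: "linear F"
  proof (rule linearI)
    define m where "m z = (z$1 / b) *\<^sub>R T 1 + (z$2 / b) *\<^sub>R T 2 + (z$3 / b) *\<^sub>R T 3" for z :: "real^7"
    have m: "m (y + z) = m y + m z" "m (r *\<^sub>R z) = r *\<^sub>R m z" for y z r
      by (simp_all add: m_def co_eq_iff add_divide_distrib)
    have F: "F z = ((- z$4) *\<^sub>R qone + z$5 *\<^sub>R T 1 + z$6 *\<^sub>R T 2 + z$7 *\<^sub>R T 3, m z \<odot> q)" for z
      by (simp add: F_def m_def)
    show "F (y + z) = F y + F z" "F (r *\<^sub>R z) = r *\<^sub>R F z" for y z r
      by (simp_all add: F m qmult_add) (simp_all add: co_eq_iff qone_simps algebra_simps)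
  qed
  have tan: "F z \<in> tangent M_retr (0, q)" for z
  proof -
    have "q \<bullet> (y \<odot> q) = fst y" for y using inner_qmult_right[of qone q y] n by (simp add: quat_inner qone_simps)
    then show ?thesis using M_tangent_iff[OF q] by (simp add: F_def)
  qed
  have FG: "F (G X) = X" if X: "X \<in> tangent M_retr (0, q)" for X
  proof -
    obtain v w where e: "X = (v, w)" by (cases X) auto
    have "fst (w \<odot> qcnj q) = 0" using X M_tangent_iff[OF q] by (simp add: e quat_simps algebra_simps)
    then have "(co 1 (w \<odot> qcnj q)) *\<^sub>R T 1 + (co 2 (w \<odot> qcnj q)) *\<^sub>R T 2 + (co 3 (w \<odot> qcnj q)) *\<^sub>R T 3 = w \<odot> qcnj q"
      by (simp add: co_eq_iff)
    then have "((co 1 (w \<odot> qcnj q)) *\<^sub>R T 1 + (co 2 (w \<odot> qcnj q)) *\<^sub>R T 2 + (co 3 (w \<odot> qcnj q)) *\<^sub>R T 3) \<odot> q = w"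
      using n by (simp add: qmult_assoc qcnj_unit)
    moreover have "fst v *\<^sub>R qone + co 1 v *\<^sub>R T 1 + co 2 v *\<^sub>R T 2 + co 3 v *\<^sub>R T 3 = v"
      by (simp add: co_eq_iff qone_simps)
    moreover have "co 1 v *\<^sub>R T 1 + fst v *\<^sub>R qone + co 2 v *\<^sub>R T 2 + co 3 v *\<^sub>R T 3 = v"
      by (simp add: co_eq_iff qone_simps)
    moreover have "co i (0, snd y) = co i y" for i y by (simp add: co_def)
    ultimately show ?thesis
      using aB0(3) by (simp add: F_def G_def e tvec_of_def frame_scale_nth tcoord_nth n del: co_linear(8))
  qed
  have "inj F" using GF by (metis injI)
  moreover have "range F = tangent M_retr (0, q)" using tan FG by (metis (no_types) equalityI image_subset_iff rangeI subsetI)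
  moreover have "phi (0, q) (map F us) = phi0 us" if us: "length us = 3" for us
  proof -
    obtain x y w where v: "us = [x, y, w]" using us by (auto simp: length_Suc_conv eval_nat_numeral)
    have "phi (0, q) (map F us) = phi0 (map G (map F us))"
      unfolding phi_def v by (simp add: phi3_frame_scale_0 G_def)
    then show ?thesis by (simp add: GF o_def)
  qed
  ultimately show "adapted_frame M_retr phi (0, q) F"
    using lin by (simp add: adapted_frame_def bij_betw_def)
  show "inv F X = G X" if "X \<in> tangent M_retr (0, q)"
    using FG[OF that] \<open>inj F\<close> inv_f_eq by metis
qed

lemma M_man_cases:
  assumes "x \<in> M_man"
  shows "(\<exists>q. x = (0, q)) \<or> (\<exists>n\<in>N_man. orbit_map n = x)"
proof -
  obtain p q where "x = (p, q)" by (cases x) auto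
  then show ?thesis using orbit_map_surj[of p q] assms by (cases "p = 0") auto
qed

lemma phi_adapted_frame:
  assumes "x \<in> M_man"
  shows "\<exists>F. adapted_frame M_retr phi x F"
  using M_man_cases[OF assms]
proof
  assume "\<exists>q. x = (0, q)"
  then show ?thesis using singular_orbit_frame(1) assms by blast
next
  assume "\<exists>n\<in>N_man. orbit_map n = x"
  then show ?thesis using restricts_star_phi(1)[OF phi_restricts A_B_nonzero] by blast
qed

lemma star_phi_psi:
  assumes x: "x \<in> M_man" and vs: "length vs = 4" "set vs \<subseteq> tangent M_retr x"
  shows "star_phi M_retr phi x vs = psi x vs"
  using M_man_cases[OF x]
proof
  assume "\<exists>q. x = (0, q)"
  then obtain q where q: "x = (0, q)" by blast
  obtain v1 v2 v3 v4 where v: "vs = [v1, v2, v3, v4]" using vs(1) by (auto simp: length_Suc_conv eval_nat_numeral)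
  note f = singular_orbit_frame[OF x[unfolded q]]
  have m: "v1 \<in> tangent M_retr (0, q)" "v2 \<in> tangent M_retr (0, q)" "v3 \<in> tangent M_retr (0, q)" "v4 \<in> tangent M_retr (0, q)"
    using vs(2) by (auto simp: v q)
  show ?thesis
    unfolding q star_phi_adapted[OF f(1) vs(1) vs(2)[unfolded q]]
    unfolding v list.map f(2)[OF m(1)] f(2)[OF m(2)] f(2)[OF m(3)] f(2)[OF m(4)]
    by (simp add: psi_def phi4_frame_scale_0 eval_nat_numeral)
next
  assume "\<exists>n\<in>N_man. orbit_map n = x"
  then obtain n where n: "n \<in> N_man" "orbit_map n = x" by blast
  have "\<exists>u. u \<in> tangent N_retr n \<and> orbit' n u = X" if "X \<in> set vs" for X
    using orbit'_tangent(2)[OF n(1)] vs(2) that n(2) by blast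
  then obtain f where f: "\<And>X. X \<in> set vs \<Longrightarrow> f X \<in> tangent N_retr n \<and> orbit' n (f X) = X" by metis
  then have v: "vs = map (orbit' n) (map f vs)" by (simp add: map_idI)
  have l: "length (map f vs) = 4" "set (map f vs) \<subseteq> tangent N_retr n" using vs(1) f by auto
  show ?thesis
    using restricts_star_phi(2)[OF phi_restricts A_B_nonzero n(1) l] psi_orbit[OF n(1) l] v n(2) by simp
qed

end

section \<open>Smoothness, invariance and coclosedness of the extended form\<close>

lemma M_retr_in_M: "x \<in> M_nbhd \<Longrightarrow> M_retr x \<in> M_man"
  by (cases x) (simp add: M_nbhd_def M_retr_def M_man_def norm_sgn)

lemma M_retr_derivative_tangent:
  assumes "x \<in> M_nbhd"
  shows "frechet_derivative M_retr (at x) X \<in> tangent M_retr (M_retr x)"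
proof -
  obtain p q v w where e: "x = (p, q)" "X = (v, w)" by (cases x; cases X) auto
  have q: "q \<noteq> 0" using assms by (auto simp: e M_nbhd_def)
  have "q \<bullet> (w - ((q \<bullet> w) / (q \<bullet> q)) *\<^sub>R q) = 0" using q by (simp add: inner_diff_right)
  then show ?thesis
    using M_tangent_iff[of p "sgn q"] M_retr_in_M[OF assms]
    unfolding M_retr_frechet[OF assms] by (simp add: e M_retr_def sgn_div_norm)
qed

lemma act_frechet: "frechet_derivative (act a) (at x) = act a"
proof -
  obtain a1 a2 where a: "a = (a1, a2)" by (cases a)
  have "linear (act a)"
    by (rule linearI) (simp_all add: a act_def case_prod_unfold qmult_add qmult_scaleR)
  then have "bounded_linear (act a)" by (simp add: linear_conv_bounded_linear)
  then show ?thesis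
    using frechet_derivative_at[OF bounded_linear_imp_has_derivative] by metis
qed

context extension_data
begin

lemma phi_smooth_form: "smooth_form 3 M_nbhd M_retr phi"
  unfolding smooth_form_def
proof (intro allI impI)
  fix vs :: "(quat \<times> quat) list"
  assume "length vs = 3"
  then obtain X Y W where v: "vs = [X, Y, W]" by (auto simp: length_Suc_conv eval_nat_numeral)
  show "smooth_on (\<lambda>x. pullback M_retr phi x vs) M_nbhd"
  proof (rule smooth_on_cong[OF open_M_nbhd _ smooth_on_phi3[of X Y W]])
    fix x :: "quat \<times> quat"
    assume x: "x \<in> M_nbhd"
    have "fst (M_retr x) = fst x" by (simp add: M_retr_def case_prod_unfold)
    then show "phi3 (fst x) (tvec_of x X) (tvec_of x Y) (tvec_of x W) = pullback M_retr phi x vs"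
      by (simp add: pullback_def phi_def v tvec_of_retr[OF x])
  qed
qed

lemma phi_invariant: "invariant_form 3 phi"
  unfolding invariant_form_def
proof (intro ballI allI impI)
  fix a x and vs :: "(quat \<times> quat) list"
  assume a: "a \<in> SU2sq" and x: "x \<in> M_man" and l: "length vs = 3"
  obtain a1 a2 where e: "a = (a1, a2)" "norm a1 = 1" "norm a2 = 1" using a by (auto simp: SU2sq_def)
  obtain X Y W where v: "vs = [X, Y, W]" using l by (auto simp: length_Suc_conv eval_nat_numeral)
  have t: "tvec_of (act a x) (act a V) = tact a1 (tvec_of x V)" for V
    using tvec_of_act[OF e(2,3), of "fst x" "snd x" "fst V" "snd V"] by (simp add: e)
  have f: "fst (act a x) = a1 \<odot> fst x" by (simp add: e act_def case_prod_unfold)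
  show "pullback (act a) phi x vs = phi x vs"
    by (simp add: pullback_def act_frechet phi_def v t f phi3_invariant[OF e(2)])
qed

lemma star_phi_smooth:
  assumes "length us = 4"
  shows "smooth_on (\<lambda>x. pullback M_retr (star_phi M_retr phi) x us) M_nbhd"
proof -
  obtain X Y W V where v: "us = [X, Y, W, V]" using assms by (auto simp: length_Suc_conv eval_nat_numeral)
  show ?thesis
  proof (rule smooth_on_cong[OF open_M_nbhd _ smooth_on_phi4[of X Y W V]])
    fix x :: "quat \<times> quat"
    assume x: "x \<in> M_nbhd"
    have f: "fst (M_retr x) = fst x" by (simp add: M_retr_def case_prod_unfold)
    have "star_phi M_retr phi (M_retr x) (map (frechet_derivative M_retr (at x)) us)
        = psi (M_retr x) (map (frechet_derivative M_retr (at x)) us)"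
      by (rule star_phi_psi[OF M_retr_in_M[OF x]]) (use M_retr_derivative_tangent[OF x] assms in auto)
    then show "phi4 (fst x) (tvec_of x X) (tvec_of x Y) (tvec_of x W) (tvec_of x V)
        = pullback M_retr (star_phi M_retr phi) x us"
      by (simp add: pullback_def psi_def v tvec_of_retr[OF x] f)
  qed
qed

lemma star_phi_differentiable:
  assumes "x \<in> M_nbhd" "length us = 4"
  shows "(\<lambda>x. pullback M_retr (star_phi M_retr phi) x us) differentiable (at x)"
  using smooth_on_has_derivative[OF star_phi_smooth[OF assms(2)] assms(1)] unfolding differentiable_def by blast

lemma continuous_on_ext_deriv_star:
  assumes "length vs = 5"
  shows "continuous_on M_nbhd (\<lambda>x. ext_deriv M_retr (star_phi M_retr phi) x vs)"
proof -
  obtain v0 v1 v2 v3 v4 where v: "vs = [v0, v1, v2, v3, v4]" using assms by (auto simp: length_Suc_conv eval_nat_numeral)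
  show ?thesis
    unfolding v ext_deriv_4
    by (intro continuous_on_add continuous_on_diff smooth_on_imp_continuous_on smooth_on_frechet star_phi_smooth) simp_all
qed

lemma coclosed_orbit:
  assumes c: "closed_form 4 N_man N_retr (star_phi_AB T A B)"
    and n: "n \<in> N_man" and vs: "length vs = 5" "set vs \<subseteq> tangent M_retr (orbit_map n)"
  shows "ext_deriv M_retr (star_phi M_retr phi) (orbit_map n) vs = 0"
proof -
  have "\<forall>X\<in>tangent M_retr (orbit_map n). \<exists>u. u \<in> tangent N_retr n \<and> orbit' n u = X"
    using orbit'_tangent(2)[OF n] by blast
  from bchoice[OF this] obtain f where f: "\<forall>X\<in>tangent M_retr (orbit_map n). f X \<in> tangent N_retr n \<and> orbit' n (f X) = X" ..
  have "orbit' n (f X) = X" if "X \<in> set vs" for X using f vs(2) that by blast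
  then have m: "map (orbit' n) (map f vs) = vs" by (simp add: map_idI)
  have "ext_deriv N_retr (star_phi_AB T A B) n (map f vs) = ext_deriv M_retr (star_phi M_retr phi) (orbit_map n) (map (orbit' n) (map f vs))"
    by (rule ext_deriv_orbit[OF phi_restricts A_B_nonzero n])
      (use star_phi_differentiable[OF M_man_nbhd[OF orbit_map_M[OF n]]] vs f in auto)
  moreover have "ext_deriv N_retr (star_phi_AB T A B) n (map f vs) = 0"
  proof -
    have "\<forall>us. length us = Suc 4 \<longrightarrow> set us \<subseteq> tangent N_retr n \<longrightarrow> ext_deriv N_retr (star_phi_AB T A B) n us = 0"
      using c n unfolding closed_form_def by blast
    moreover have "set (map f vs) \<subseteq> tangent N_retr n" using f vs(2) unfolding set_map by blast
    ultimately show ?thesis using vs(1) by simp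
  qed
  ultimately show ?thesis unfolding m by simp
qed

lemma phi_coclosed:
  assumes c: "closed_form 4 N_man N_retr (star_phi_AB T A B)"
  shows "coclosed M_man M_retr phi"
  unfolding coclosed_def closed_form_def
proof (intro ballI conjI allI impI)
  fix x and vs :: "(quat \<times> quat) list"
  assume x: "x \<in> M_man"
  show "(\<lambda>y. pullback M_retr (star_phi M_retr phi) y vs) differentiable (at x)" if "length vs = 4"
    using star_phi_differentiable[OF M_man_nbhd[OF x] that] .
  show "ext_deriv M_retr (star_phi M_retr phi) x vs = 0"
    if l: "length vs = Suc 4" and vs: "set vs \<subseteq> tangent M_retr x"
    using M_man_cases[OF x]
  proof
    assume "\<exists>n\<in>N_man. orbit_map n = x"
    then show ?thesis using coclosed_orbit[OF c] l vs by auto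
  next
    assume "\<exists>q. x = (0, q)"
    then obtain q where q: "x = (0, q)" by blast
    \<comment> \<open>Continuity along a ray ending at \<open>(0, q)\<close>: tangency at
      \<open>(p, q)\<close> is a condition involving \<open>q\<close> alone, so the same vectors
      \<open>vs\<close> serve at every \<open>s\<close>.\<close>
    define E where "E s = ext_deriv M_retr (star_phi M_retr phi) (s *\<^sub>R qone, q) vs" for s
    have M: "(s *\<^sub>R qone, q) \<in> M_man" for s using x by (auto simp: q M_man_def)
    have "E s = 0" if "s > 0" for s
    proof -
      have "s *\<^sub>R qone \<noteq> 0" using that by (simp add: qone_def zero_prod_def)
      then obtain n where n: "n \<in> N_man" "orbit_map n = (s *\<^sub>R qone, q)" using orbit_map_surj[OF M] by blast
      have "set vs \<subseteq> tangent M_retr (s *\<^sub>R qone, q)"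
      proof
        fix X assume "X \<in> set vs"
        then have "X \<in> tangent M_retr (0, q)" using vs q by auto
        then show "X \<in> tangent M_retr (s *\<^sub>R qone, q)"
          using M_tangent_iff[OF M[of 0]] M_tangent_iff[OF M[of s]] by (cases X) simp
      qed
      then show ?thesis using coclosed_orbit[OF c n(1)] l unfolding E_def n(2) by simp
    qed
    then have "(E \<longlongrightarrow> 0) (at_right 0)"
      by (intro tendsto_eventually) (auto simp: eventually_at_right_less eventually_at_filter)
    moreover have "continuous_on UNIV E"
      unfolding E_def
      by (rule continuous_on_compose2[OF continuous_on_ext_deriv_star])
        (use l M_man_nbhd[OF M] in \<open>auto intro!: continuous_intros simp del: split_paired_All\<close>)
    then have "(E \<longlongrightarrow> E 0) (at_right 0)"
      by (auto simp: continuous_on_def intro: filterlim_mono[OF _ order_refl at_le])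
    ultimately have "E 0 = 0" using tendsto_unique trivial_limit_at_right_real by blast
    then show ?thesis by (simp add: E_def q)
  qed
qed

theorem phi_invariant_coclosed_G2:
  "closed_form 4 N_man N_retr (star_phi_AB T A B) \<Longrightarrow> invariant_coclosed_G2 phi"
  using phi_smooth_form phi_adapted_frame phi_invariant phi_coclosed
  by (simp add: invariant_coclosed_G2_def G2_structure_def)

end

section \<open>The flow in terms of \<open>2 A\<^sub>i / t\<close>\<close>

definition order4 :: "(real \<Rightarrow> real) \<Rightarrow> bool" where
  "order4 f \<longleftrightarrow> (\<exists>z. smooth_even z \<and> (\<forall>t. f t = t ^ 4 * z t))"

lemma order4_mult: "order4 f \<Longrightarrow> smooth_even h \<Longrightarrow> order4 (\<lambda>t. f t * h t)"
  unfolding order4_def by (metis (no_types, lifting) mult.assoc smooth_even_mult)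

lemma order4_add: "order4 f \<Longrightarrow> order4 h \<Longrightarrow> order4 (\<lambda>t. f t + h t)"
  unfolding order4_def by (metis (no_types, lifting) distrib_left smooth_even_add)

lemma order4_prod:
  assumes "smooth_even f" "f 0 = 0" "smooth_even h" "h 0 = 0"
  shows "order4 (\<lambda>t. f t * h t)"
proof -
  obtain x y where x: "smooth_even x" "\<And>t. f t = t\<^sup>2 * x t" and y: "smooth_even y" "\<And>t. h t = t\<^sup>2 * y t"
    using smooth_even_divide assms by metis
  have "f t * h t = t ^ 4 * (x t * y t)" for t unfolding x y by (simp add: power4_eq_xxxx power2_eq_square)
  then show ?thesis unfolding order4_def using smooth_even_mult[OF x(1) y(1)] by blast
qed

lemma smooth_even_continuous: "smooth_even f \<Longrightarrow> isCont f t"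
  using smooth_on_imp_continuous_on[of f UNIV] by (simp add: smooth_even_def continuous_on_eq_continuous_at)

locale family_data =
  fixes a :: "3 \<Rightarrow> real \<Rightarrow> real" and b :: real
  assumes a_even: "smooth_even (a i)" and a0 [simp]: "a i 0 = 1" and a_pos: "a i t > 0" and b: "b \<noteq> 0"
begin

definition vol :: "real \<Rightarrow> real" where "vol t = a 1 t * a 2 t * a 3 t"

text \<open>This is \<open>a k\<close> divided by the other two \<open>a i\<close>; it turns
  \<open>g k\<close> into \<open>a k\<close> times the product of the other two \<open>B i\<close>,
  the quantity on the right of \<open>flow_ode\<close>.\<close>

definition rate :: "3 \<Rightarrow> real \<Rightarrow> real" where "rate k t = (a k t)\<^sup>2 / vol t"

lemma vol: "smooth_even vol" "vol 0 = 1" "vol t > 0"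
  using a_pos by (auto simp: vol_def[abs_def] intro!: smooth_even_intros a_even)

lemma rate: "smooth_even (rate k)" "rate k 0 = 1" "rate k t > 0"
  using vol a_pos[of k t] by (auto simp: rate_def[abs_def] less_imp_neq[symmetric] intro!: smooth_even_intros a_even)

text \<open>The inhomogeneity \<open>vol t / 2\<close> stems from
  \<open>A 1 t * A 2 t * A 3 t = t ^ 3 / 8 * vol t\<close> in \<open>flow_ode\<close>.\<close>

definition g :: "3 \<Rightarrow> real \<Rightarrow> real" where
  "g = (SOME g. \<forall>k. smooth_even (g k) \<and> g k 0 = b\<^sup>2 \<and> (\<forall>t. \<exists>D. (g k has_real_derivative D) (at t) \<and>
     t * D = 2 * (\<Sum>j\<in>UNIV. rate j t * g j t) + t\<^sup>2 * (vol t / 2) - (2 + 4 * rate k t) * g k t))"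

lemma g_all: "\<forall>k. smooth_even (g k) \<and> g k 0 = b\<^sup>2 \<and> (\<forall>t. \<exists>D. (g k has_real_derivative D) (at t) \<and>
     t * D = 2 * (\<Sum>j\<in>UNIV. rate j t * g j t) + t\<^sup>2 * (vol t / 2) - (2 + 4 * rate k t) * g k t)"
proof -
  have "smooth_even (\<lambda>t. vol t / 2)" by (intro smooth_even_intros vol) auto
  from fuchsian_system_solution[of rate "\<lambda>t. vol t / 2" "b\<^sup>2", OF rate(1,2) this]
  show ?thesis unfolding g_def by (rule someI_ex)
qed

lemma g: "smooth_even (g k)" "g k 0 = b\<^sup>2"
  "\<exists>D. (g k has_real_derivative D) (at t) \<and>
     t * D = 2 * (\<Sum>j\<in>UNIV. rate j t * g j t) + t\<^sup>2 * (vol t / 2) - (2 + 4 * rate k t) * g k t"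
  using g_all by blast+

lemma g_pos: "g k t > 0"
proof -
  have "g k \<bar>t\<bar> > 0"
    by (rule fuchsian_system_pos[of rate "\<lambda>t. vol t / 2" g]) (use rate vol g b in auto)
  then show ?thesis using g(1)[of k] by (auto simp: smooth_even_def abs_if split: if_splits)
qed

definition m :: "3 \<Rightarrow> real \<Rightarrow> real" where "m k t = g k t * a k t"

lemma m: "smooth_even (m k)" "m k 0 = b\<^sup>2" "m k t > 0"
  using g_pos[of k t] a_pos[of k t] by (auto simp: m_def[abs_def] g intro!: smooth_even_intros a_even)

text \<open>By the differential equation the \<open>t\<^sup>2\<close> coefficient of \<open>g k + b\<^sup>2 * a k\<close> is the same for all \<open>k\<close>.\<close>

lemma m_diff: "order4 (\<lambda>t. m k t - m l t)"
proof -
  obtain d where d: "smooth_even d" "\<And>t. g k t - g l t = t\<^sup>2 * d t"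
    using smooth_even_divide[OF smooth_even_diff[OF g(1)[of k] g(1)[of l]]] by (auto simp: g)
  obtain \<alpha> where \<alpha>: "smooth_even \<alpha>" "\<And>t. a k t - a l t = t\<^sup>2 * \<alpha> t"
    using smooth_even_divide[OF smooth_even_diff[OF a_even[of k] a_even[of l]]] by auto
  define \<mu> where "\<mu> t = g k t * \<alpha> t + a l t * d t" for t
  have \<mu>: "smooth_even \<mu>" unfolding \<mu>_def by (intro smooth_even_intros g a_even \<alpha> d)
  have m\<mu>: "m k t - m l t = t\<^sup>2 * \<mu> t" for t
  proof -
    have "m k t - m l t = g k t * (a k t - a l t) + a l t * (g k t - g l t)" by (simp add: m_def algebra_simps)
    then show ?thesis by (simp add: \<mu>_def \<alpha> d algebra_simps)
  qed
  \<comment> \<open>Subtracting the equations for \<open>k\<close> and \<open>l\<close> gives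
    \<open>t\<^sup>2 * F t = 0\<close>. So \<open>F\<close> vanishes away from 0 and, by continuity,
    at 0, where its value is \<open>8 * \<mu> 0\<close>.\<close>
  define F where "F t = 4 * d t + t * deriv d t + 4 * (a k t * \<mu> t + \<alpha> t * m l t) / vol t" for t
  have "F t = 0" if "t \<noteq> 0" for t
  proof -
    obtain D E where D: "(g k has_real_derivative D) (at t)" "(g l has_real_derivative E) (at t)"
      and e: "t * D = 2 * (\<Sum>j\<in>UNIV. rate j t * g j t) + t\<^sup>2 * (vol t / 2) - (2 + 4 * rate k t) * g k t"
        "t * E = 2 * (\<Sum>j\<in>UNIV. rate j t * g j t) + t\<^sup>2 * (vol t / 2) - (2 + 4 * rate l t) * g l t"
      using g(3)[of k t] g(3)[of l t] by blast
    have "((\<lambda>t. t\<^sup>2 * d t) has_real_derivative (t\<^sup>2 * deriv d t + 2 * t * d t)) (at t)"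
      using smooth_on_deriv(1)[of d t] d(1) by (auto simp: smooth_even_def intro!: derivative_eq_intros)
    then have "D - E = t\<^sup>2 * deriv d t + 2 * t * d t"
      using DERIV_diff[OF D] unfolding d(2) using DERIV_unique by blast
    then have "t * (t\<^sup>2 * deriv d t + 2 * t * d t) = t * D - t * E" by (simp add: algebra_simps)
    also have "\<dots> = - 2 * (g k t - g l t) - 4 * (rate k t * g k t - rate l t * g l t)"
      unfolding e by (simp add: algebra_simps)
    also have "rate k t * g k t - rate l t * g l t = (a k t * (m k t - m l t) + (a k t - a l t) * m l t) / vol t"
      using vol(3)[of t] by (simp add: rate_def m_def field_simps power2_eq_square)
    finally have "t\<^sup>2 * F t = 0"
      unfolding d(2) m\<mu> \<alpha>(2) F_def by (simp add: algebra_simps power2_eq_square add_divide_distrib)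
    then show ?thesis using that by simp
  qed
  then have "(F \<longlongrightarrow> 0) (at 0)" by (intro tendsto_eventually) (auto simp: eventually_at_filter)
  moreover have "isCont F 0"
  proof -
    have "continuous_on UNIV (deriv d)"
      using smooth_on_imp_continuous_on[OF smooth_on_deriv(2)[of d]] d(1) by (simp add: smooth_even_def)
    then have "isCont (deriv d) 0" by (simp add: continuous_on_eq_continuous_at)
    moreover have "vol 0 \<noteq> 0" by (simp add: vol(2))
    ultimately show ?thesis unfolding F_def
      by (intro continuous_intros smooth_even_continuous[OF d(1)] smooth_even_continuous[OF \<mu>] smooth_even_continuous[OF \<alpha>(1)]
          smooth_even_continuous[OF m(1)] smooth_even_continuous[OF a_even] smooth_even_continuous[OF vol(1)])
  qed
  ultimately have "F 0 = 0" using isContD tendsto_unique[OF trivial_limit_at] by blast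
  then have "\<mu> 0 = 0" by (simp add: F_def \<mu>_def vol g m algebra_simps)
  then obtain z where z: "smooth_even z" "\<And>t. \<mu> t = t\<^sup>2 * z t" using smooth_even_divide[OF \<mu>] by blast
  have "m k t - m l t = t ^ 4 * z t" for t unfolding m\<mu> z(2) by (simp add: power4_eq_xxxx power2_eq_square)
  then show ?thesis using z(1) unfolding order4_def by blast
qed

text \<open>For the solution sought, \<open>g 1 * g 2 * g 3\<close> is the square of the product of
  all \<open>a i\<close> and \<open>B i\<close>. \<open>P\<close> stands for that product, with the
  sign of \<open>b\<close>; then \<open>P / g k = a k * B k\<close>, which gives the formula for
  \<open>B k\<close>.\<close>

definition P :: "real \<Rightarrow> real" where "P t = sgn b * sqrt (g 1 t * g 2 t * g 3 t)"

definition B :: "3 \<Rightarrow> real \<Rightarrow> real" where "B k t = P t / m k t"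

lemma P: "smooth_even P" "P 0 = b ^ 3" "P t \<noteq> 0" "(P t)\<^sup>2 = g 1 t * g 2 t * g 3 t"
proof -
  show "smooth_even P" unfolding P_def[abs_def]
    by (intro smooth_even_intros smooth_even_sqrt g mult_pos_pos g_pos)
  have "g 1 0 * g 2 0 * g 3 0 = (b ^ 3)\<^sup>2" unfolding g by (simp add: power2_eq_square power3_eq_cube)
  then have "P 0 = sgn b * \<bar>b ^ 3\<bar>" unfolding P_def by (simp only: real_sqrt_abs)
  then show "P 0 = b ^ 3" using b by (auto simp: sgn_if abs_if zero_less_power_eq zero_le_power_eq)
  have p: "g 1 t * g 2 t * g 3 t > 0" by (intro mult_pos_pos g_pos)
  show "P t \<noteq> 0" "(P t)\<^sup>2 = g 1 t * g 2 t * g 3 t"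
    using p b g_pos[THEN less_imp_neq, symmetric] by (simp_all add: P_def sgn_if power_mult_distrib)
qed

lemma B: "smooth_even (B k)" "B k 0 = b" "B k t \<noteq> 0"
proof -
  show "smooth_even (B k)" unfolding B_def[abs_def]
    by (intro smooth_even_intros P m) (use m(3) less_irrefl in metis)
  show "B k 0 = b" using b by (simp add: B_def P m power2_eq_square power3_eq_cube)
  show "B k t \<noteq> 0" using P m(3)[of k t] by (simp add: B_def)
qed

lemma B_prod: "a 2 t * a 3 t * B 2 t * B 3 t = g 1 t" "a 3 t * a 1 t * B 3 t * B 1 t = g 2 t"
  "a 1 t * a 2 t * B 1 t * B 2 t = g 3 t"
proof -
  have a: "a k t \<noteq> 0" "g k t \<noteq> 0" for k using a_pos[of k t] g_pos[of k t] by auto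
  have "B j t * B k t = g 1 t * g 2 t * g 3 t / (m j t * m k t)" for j k
    by (simp add: B_def P(4)[symmetric] power2_eq_square)
  then have *: "a i t * a k t * B i t * B k t = a i t * a k t * (g 1 t * g 2 t * g 3 t / (m i t * m k t))" for i k
    by (simp add: mult.assoc)
  show "a 2 t * a 3 t * B 2 t * B 3 t = g 1 t" "a 3 t * a 1 t * B 3 t * B 1 t = g 2 t"
    "a 1 t * a 2 t * B 1 t * B 2 t = g 3 t"
    unfolding * m_def using a[of 1] a[of 2] a[of 3] by (simp_all add: field_simps)
qed

end

section \<open>The flow equations as the singular linear system\<close>

lemma scaled_square_derivative_iff:
  fixes F G :: "real \<Rightarrow> real"
  assumes FG: "\<And>s. s > 0 \<Longrightarrow> F s = s\<^sup>2 / 4 * G s" and t: "t > 0"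
  shows "(F has_real_derivative E) (at t) \<longleftrightarrow>
    (\<exists>D. (G has_real_derivative D) (at t) \<and> E = t / 2 * G t + t\<^sup>2 / 4 * D)"
proof
  assume F: "(F has_real_derivative E) (at t)"
  define D where "D = (E - t / 2 * G t) * 4 / t\<^sup>2"
  have "((\<lambda>s. 4 * F s / s\<^sup>2) has_real_derivative D) (at t)"
    using t by (auto intro!: derivative_eq_intros F simp: D_def FG power2_eq_square field_simps)
  moreover have "\<forall>\<^sub>F s in nhds t. 4 * F s / s\<^sup>2 = G s"
    using eventually_nhds_in_open[of "{0<..}" t] t by (auto simp: FG elim!: eventually_mono)
  ultimately have "(G has_real_derivative D) (at t)"
    by (simp add: DERIV_cong_ev)
  moreover have "t\<^sup>2 * D = 4 * (E - t / 2 * G t)" using t by (simp add: D_def)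
  then have "E = t / 2 * G t + t\<^sup>2 / 4 * D" by (simp add: field_simps)
  ultimately show "\<exists>D. (G has_real_derivative D) (at t) \<and> E = t / 2 * G t + t\<^sup>2 / 4 * D" by blast
next
  assume "\<exists>D. (G has_real_derivative D) (at t) \<and> E = t / 2 * G t + t\<^sup>2 / 4 * D"
  then obtain D where D: "(G has_real_derivative D) (at t)" "E = t / 2 * G t + t\<^sup>2 / 4 * D" by blast
  have "((\<lambda>s. s\<^sup>2 / 4 * G s) has_real_derivative E) (at t)"
    by (auto intro!: derivative_eq_intros D(1) simp: D(2))
  moreover have "\<forall>\<^sub>F s in nhds t. s\<^sup>2 / 4 * G s = F s"
    using eventually_nhds_in_open[of "{0<..}" t] t by (auto simp: FG elim!: eventually_mono)
  ultimately show "(F has_real_derivative E) (at t)"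
    by (simp add: DERIV_cong_ev)
qed

lemma nonvanishing_sign:
  fixes f :: "real \<Rightarrow> real"
  assumes "continuous_on {0..} f" "\<And>t. t > 0 \<Longrightarrow> f t \<noteq> 0" "f 0 = c" "c \<noteq> 0" "t \<ge> 0"
  shows "c * f t > 0"
proof (rule ccontr)
  assume "\<not> c * f t > 0"
  moreover have "continuous_on {0..t} (\<lambda>s. c * f s)"
    using assms(1) by (auto intro!: continuous_intros elim: continuous_on_subset)
  ultimately obtain s where "0 \<le> s" "s \<le> t" "c * f s = 0"
    using IVT2'[of "\<lambda>s. c * f s" t 0 0] assms(3,5) by (auto simp: not_less)
  then show False using assms(2)[of s] assms(3,4) by (cases "s = 0") auto
qed

context family_data
begin

definition prods :: "(3 \<Rightarrow> real \<Rightarrow> real) \<Rightarrow> 3 \<Rightarrow> real \<Rightarrow> real" where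
  "prods B' k t = (vector [a 2 t * a 3 t * B' 2 t * B' 3 t, a 3 t * a 1 t * B' 3 t * B' 1 t,
     a 1 t * a 2 t * B' 1 t * B' 2 t] :: real^3) $ k"

lemma prods_simps:
  "prods B' 1 t = a 2 t * a 3 t * B' 2 t * B' 3 t" "prods B' 2 t = a 3 t * a 1 t * B' 3 t * B' 1 t"
  "prods B' 3 t = a 1 t * a 2 t * B' 1 t * B' 2 t"
  by (simp_all add: prods_def)

text \<open>The differentiated products are \<open>t\<^sup>2 / 4\<close> times
  \<open>prods B' k\<close>, so each left-hand side is
  \<open>t / 2 * prods B' k t + t\<^sup>2 / 4 * D\<close>; multiplication by \<open>4 / t\<close>
  brings the equations into Fuchsian form.\<close>

lemma flow_ode_iff:
  assumes A: "\<forall>i. \<forall>t>0. A i t = t / 2 * a i t" and t: "t > 0"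
  shows "flow_ode A B' t \<longleftrightarrow> (\<forall>k. \<exists>D. (prods B' k has_real_derivative D) (at t) \<and>
     t * D = 2 * (\<Sum>j\<in>UNIV. rate j t * prods B' j t) + t\<^sup>2 * (vol t / 2) - (2 + 4 * rate k t) * prods B' k t)"
proof -
  have rp: "rate 1 t * prods B' 1 t = a 1 t * B' 2 t * B' 3 t" "rate 2 t * prods B' 2 t = a 2 t * B' 3 t * B' 1 t"
    "rate 3 t * prods B' 3 t = a 3 t * B' 1 t * B' 2 t"
    using a_pos[of 1 t] a_pos[of 2 t] a_pos[of 3 t] by (simp_all add: rate_def vol_def prods_simps power2_eq_square)
  have f: "A 2 s * B' 2 s * A 3 s * B' 3 s = s\<^sup>2 / 4 * prods B' 1 s" "A 1 s * B' 1 s * A 3 s * B' 3 s = s\<^sup>2 / 4 * prods B' 2 s"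
    "A 1 s * B' 1 s * A 2 s * B' 2 s = s\<^sup>2 / 4 * prods B' 3 s" if "s > 0" for s
    using that by (simp_all add: A prods_simps power2_eq_square)
  have sd:
    "((\<lambda>s. A 2 s * B' 2 s * A 3 s * B' 3 s) has_real_derivative E) (at t) \<longleftrightarrow>
      (\<exists>D. (prods B' 1 has_real_derivative D) (at t) \<and> E = t / 2 * prods B' 1 t + t\<^sup>2 / 4 * D)"
    "((\<lambda>s. A 1 s * B' 1 s * A 3 s * B' 3 s) has_real_derivative E) (at t) \<longleftrightarrow>
      (\<exists>D. (prods B' 2 has_real_derivative D) (at t) \<and> E = t / 2 * prods B' 2 t + t\<^sup>2 / 4 * D)"
    "((\<lambda>s. A 1 s * B' 1 s * A 2 s * B' 2 s) has_real_derivative E) (at t) \<longleftrightarrow>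
      (\<exists>D. (prods B' 3 has_real_derivative D) (at t) \<and> E = t / 2 * prods B' 3 t + t\<^sup>2 / 4 * D)" for E
    by (rule scaled_square_derivative_iff[OF _ t]; simp only: f)+
  define S where "S = rate 1 t * prods B' 1 t + rate 2 t * prods B' 2 t + rate 3 t * prods B' 3 t"
  have S: "(\<Sum>j\<in>UNIV. rate j t * prods B' j t) = S" by (simp add: S_def sum_3)
  have E: "A 1 t * A 2 t * A 3 t - B' 2 t * B' 3 t * A 1 t + B' 3 t * B' 1 t * A 2 t + B' 1 t * B' 2 t * A 3 t
      = t / 2 * (t\<^sup>2 * (vol t / 2) / 2 + S - 2 * (rate 1 t * prods B' 1 t))"
    "A 1 t * A 2 t * A 3 t - B' 3 t * B' 1 t * A 2 t + B' 2 t * B' 3 t * A 1 t + B' 1 t * B' 2 t * A 3 t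
      = t / 2 * (t\<^sup>2 * (vol t / 2) / 2 + S - 2 * (rate 2 t * prods B' 2 t))"
    "A 1 t * A 2 t * A 3 t - B' 1 t * B' 2 t * A 3 t + B' 2 t * B' 3 t * A 1 t + B' 3 t * B' 1 t * A 2 t
      = t / 2 * (t\<^sup>2 * (vol t / 2) / 2 + S - 2 * (rate 3 t * prods B' 3 t))"
    using t unfolding S_def rp by (simp_all add: A vol_def power2_eq_square algebra_simps)
  have eq: "t / 2 * (w / 2 + S - 2 * p) = t / 2 * x + t\<^sup>2 / 4 * D \<longleftrightarrow> t * D = 2 * S + w - (2 * x + 4 * p)" for w p x D
  proof -
    have "t / 2 * x + t\<^sup>2 / 4 * D - t / 2 * (w / 2 + S - 2 * p) = t / 4 * (t * D - (2 * S + w - (2 * x + 4 * p)))"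
      by (simp add: power2_eq_square algebra_simps)
    then show ?thesis using t by (metis divide_eq_0_iff eq_iff_diff_eq_0 mult_eq_0_iff less_irrefl zero_neq_numeral)
  qed
  show ?thesis
    unfolding flow_ode_def Let_def sd E eq forall_3 S
    by (simp add: distrib_right mult.assoc)
qed

lemma flow_ode_B:
  assumes "\<forall>i. \<forall>t>0. A i t = t / 2 * a i t" "t > 0"
  shows "flow_ode A B t"
proof -
  have "\<forall>k. prods B k s = g k s" for s
    unfolding forall_3 prods_simps by (simp only: B_prod)
  then have p: "prods B = g" by blast
  show ?thesis unfolding flow_ode_iff[OF assms] p using g(3) by blast
qed

text \<open>The differences of the products solve the homogeneous system and tend to 0 at 0, hence
  vanish. Pairwise products determine the squares of the \<open>B' i\<close>, and a continuous
  function without zeros keeps the sign of its initial value \<open>b\<close>.\<close>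

lemma flow_unique:
  assumes A: "\<forall>i. \<forall>t>0. A i t = t / 2 * a i t"
    and c: "\<And>i. continuous_on {0..} (B' i)" and B0: "\<And>i. B' i 0 = b"
    and ode: "\<And>t. t > 0 \<Longrightarrow> flow_ode A B' t" and t: "t \<ge> 0"
  shows "B' i t = B i t"
proof -
  have p: "prods B' k s = g k s" if s: "s > 0" for k s
  proof -
    have "(\<lambda>t. prods B' k t - g k t) s = 0"
    proof (rule fuchsian_system_unique[where d = "\<lambda>k t. prods B' k t - g k t", OF rate(1,2) _ _ s])
      fix k and t :: real
      assume t: "t > 0"
      obtain D where D: "(prods B' k has_real_derivative D) (at t)"
        "t * D = 2 * (\<Sum>j\<in>UNIV. rate j t * prods B' j t) + t\<^sup>2 * (vol t / 2) - (2 + 4 * rate k t) * prods B' k t"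
        using ode[OF t] unfolding flow_ode_iff[OF A t] by blast
      obtain E where E: "(g k has_real_derivative E) (at t)"
        "t * E = 2 * (\<Sum>j\<in>UNIV. rate j t * g j t) + t\<^sup>2 * (vol t / 2) - (2 + 4 * rate k t) * g k t"
        using g(3) by blast
      have "((\<lambda>t. prods B' k t - g k t) has_real_derivative (D - E)) (at t)" by (rule DERIV_diff[OF D(1) E(1)])
      moreover have "t * (D - E) = 2 * (\<Sum>j\<in>UNIV. rate j t * (prods B' j t - g j t)) - (2 + 4 * rate k t) * (prods B' k t - g k t)"
        using D(2) E(2) by (simp add: sum_3 algebra_simps)
      ultimately show "\<exists>D. ((\<lambda>t. prods B' k t - g k t) has_real_derivative D) (at t) \<and>
         t * D = 2 * (\<Sum>j\<in>UNIV. rate j t * (prods B' j t - g j t)) - (2 + 4 * rate k t) * (prods B' k t - g k t)"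
        by blast
    next
      fix k :: 3
      have B': "(B' i \<longlongrightarrow> b) (at_right 0)" for i
      proof -
        have "(B' i \<longlongrightarrow> B' i 0) (at 0 within {0..})" using c[of i] by (simp add: continuous_on_def)
        then show ?thesis unfolding B0 by (rule filterlim_mono) (auto intro: at_le)
      qed
      have a: "(a i \<longlongrightarrow> 1) (at_right 0)" for i
        using smooth_even_continuous[of "a i" 0, OF a_even] unfolding isCont_def a0
        by (rule filterlim_mono) (auto intro: at_le)
      have "(g k \<longlongrightarrow> b\<^sup>2) (at_right 0)"
        using smooth_even_continuous[of "g k" 0, OF g(1)] unfolding isCont_def g(2)
        by (rule filterlim_mono) (auto intro: at_le)
      moreover have "(prods B' k \<longlongrightarrow> b\<^sup>2) (at_right 0)"
      proof -
        have "((\<lambda>t. a i t * a j t * B' i t * B' j t) \<longlongrightarrow> 1 * 1 * b * b) (at_right 0)" for i j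
          by (intro tendsto_mult a B')
        then have "\<forall>k. (prods B' k \<longlongrightarrow> b\<^sup>2) (at_right 0)"
          unfolding forall_3 prods_simps[abs_def] by (simp add: power2_eq_square)
        then show ?thesis ..
      qed
      ultimately show "((\<lambda>t. prods B' k t - g k t) \<longlongrightarrow> 0) (at_right 0)"
        using tendsto_diff[of "prods B' k" "b\<^sup>2" "at_right 0" "g k" "b\<^sup>2"] by simp
    qed
    then show ?thesis by simp
  qed
  have a: "a i s \<noteq> 0" for i s using a_pos[of i s] by simp
  have pp: "B' 2 s * B' 3 s = B 2 s * B 3 s" "B' 3 s * B' 1 s = B 3 s * B 1 s" "B' 1 s * B' 2 s = B 1 s * B 2 s" if "s > 0" for s
    using p[OF that, of 1] p[OF that, of 2] p[OF that, of 3] a[of 1 s] a[of 2 s] a[of 3 s]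
    unfolding prods_simps B_prod[symmetric] by (simp_all add: mult.assoc)
  have nz: "B' 1 s \<noteq> 0" "B' 2 s \<noteq> 0" "B' 3 s \<noteq> 0" if "s > 0" for s
    using pp[OF that] B(3)[of 1 s] B(3)[of 2 s] B(3)[of 3 s] by auto
  have sq: "(B' 1 s)\<^sup>2 = (B 1 s)\<^sup>2 \<and> (B' 2 s)\<^sup>2 = (B 2 s)\<^sup>2 \<and> (B' 3 s)\<^sup>2 = (B 3 s)\<^sup>2" if s: "s > 0" for s
  proof -
    have "x\<^sup>2 = x'\<^sup>2" if "y * z = y' * z'" "z * x = z' * x'" "x * y = x' * y'" "y' * z' \<noteq> 0" for x y z x' y' z' :: real
    proof -
      have "x\<^sup>2 * (y * z) = (z * x) * (x * y)" by (simp add: power2_eq_square)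
      also have "\<dots> = x'\<^sup>2 * (y' * z')" unfolding that(2,3) by (simp add: power2_eq_square)
      finally show ?thesis using that(1,4) by simp
    qed
    note * = this
    show ?thesis
      using *[OF pp(1,2,3)[OF s]] *[OF pp(2,3,1)[OF s]] *[OF pp(3,1,2)[OF s]] B(3)[of 1 s] B(3)[of 2 s] B(3)[of 3 s] by simp
  qed
  show ?thesis
  proof (cases "t = 0")
    case False
    have n: "B' i s \<noteq> 0" if "s > 0" for s using nz[OF that] exhaust_3[of i] by auto
    have "b * B' i t > 0" by (rule nonvanishing_sign[OF c n B0 b t])
    moreover have "b * B i t > 0"
      by (rule nonvanishing_sign[where f = "B i", OF _ B(3,2) b t])
        (use B(1)[of i] smooth_even_continuous in \<open>auto intro: continuous_at_imp_continuous_on\<close>)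
    moreover have "(B' i t)\<^sup>2 = (B i t)\<^sup>2" using sq[of t] False t exhaust_3[of i] by auto
    ultimately show ?thesis by (auto simp: power2_eq_iff zero_less_mult_iff)
  qed (simp add: B0 B(2))
qed

section \<open>Splitting the coefficients of the 3-form and the 4-form\<close>

lemma order4_sum_diff:
  assumes f: "smooth_even f" and h: "\<And>k. order4 (\<lambda>t. n k t - n l t)" and n: "\<And>k. smooth_even (n k)"
    and p: "\<And>k. smooth_even (p k)" "order4 (\<lambda>t. p k t - p l t)"
  shows "order4 (\<lambda>t. f t * (n k t * p k t) - f t * (n l t * p l t))"
proof -
  have "order4 (\<lambda>t. (n k t - n l t) * (f t * p k t) + (p k t - p l t) * (f t * n l t))"
    by (intro order4_add order4_mult h p smooth_even_intros f n)
  then show ?thesis by (simp add: algebra_simps)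
qed

definition other :: "3 \<Rightarrow> real \<Rightarrow> real" where
  "other k t = (vector [a 2 t * a 3 t, a 3 t * a 1 t, a 1 t * a 2 t] :: real^3) $ k"

lemma other_simps: "other 1 t = a 2 t * a 3 t" "other 2 t = a 3 t * a 1 t" "other 3 t = a 1 t * a 2 t"
  by (simp_all add: other_def)

lemma other: "smooth_even (other k)" "other k 0 = 1"
proof -
  have "\<forall>k. smooth_even (other k)"
    unfolding forall_3 other_simps[abs_def] by (intro conjI smooth_even_intros a_even)
  then show "smooth_even (other k)" ..
  have "\<forall>k. other k 0 = 1" unfolding forall_3 other_simps by simp
  then show "other k 0 = 1" ..
qed

text \<open>The difference factors, for instance as \<open>(a 2 t - a 1 t) * (1 - a 3 t)\<close>,
  and both factors are of order \<open>t\<^sup>2\<close>.\<close>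

lemma other_diff: "order4 (\<lambda>t. (a k t + other k t) - (a 1 t + other 1 t))"
proof -
  have 1: "order4 (\<lambda>t. (a i t - a j t) * (1 - a l t))" for i j l
    by (rule order4_prod) (auto intro!: smooth_even_intros a_even)
  have "order4 (\<lambda>t. (a 1 t - a 1 t) * (1 - a 1 t))" "order4 (\<lambda>t. (a 2 t - a 1 t) * (1 - a 3 t))"
    "order4 (\<lambda>t. (a 3 t - a 1 t) * (1 - a 2 t))" by (rule 1)+
  then have "\<forall>k. order4 (\<lambda>t. (a k t + other k t) - (a 1 t + other 1 t))"
    unfolding forall_3 other_simps by (simp add: algebra_simps)
  then show ?thesis ..
qed

lemma B_diff: "order4 (\<lambda>t. B k t - B 1 t)"
proof -
  have m0: "m k t \<noteq> 0" for k t using m(3)[of k t] by simp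
  have "order4 (\<lambda>t. (m 1 t - m k t) * (P t / (m k t * m 1 t)))"
    by (intro order4_mult m_diff smooth_even_intros P m) (simp add: m0)
  moreover have "(m 1 t - m k t) * (P t / (m k t * m 1 t)) = B k t - B 1 t" for t
    using m0[of 1 t] m0[of k t] by (simp add: B_def field_simps)
  ultimately show ?thesis by simp
qed

text \<open>The half-sum supplies \<open>u\<close> and \<open>z\<close>, the half-difference
  \<open>s\<close>. That the sums differ between axes only to order 4 is what allows a common
  \<open>u\<close>, taken here from axis 1.\<close>

lemma half_sum_split:
  fixes x y :: "3 \<Rightarrow> real \<Rightarrow> real"
  assumes "\<And>k. smooth_even (x k)" "\<And>k. smooth_even (y k)" "\<And>k. x k 0 = y k 0"
    "\<And>k. order4 (\<lambda>t. (x k t + y k t) - (x 1 t + y 1 t))"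
  shows "\<exists>u z s. smooth_even u \<and> (\<forall>k. smooth_even (z k) \<and> smooth_even (s k)) \<and>
    (\<forall>k t. x k t = u t + t ^ 4 * z k t + t\<^sup>2 * s k t \<and> y k t = u t + t ^ 4 * z k t - t\<^sup>2 * s k t)"
proof -
  have "\<forall>k. \<exists>z. smooth_even z \<and> (\<forall>t. (x k t + y k t) - (x 1 t + y 1 t) = t ^ 4 * z t)"
    using assms(4) unfolding order4_def by blast
  from choice[OF this] obtain z where z: "\<forall>k. smooth_even (z k) \<and> (\<forall>t. (x k t + y k t) - (x 1 t + y 1 t) = t ^ 4 * z k t)" ..
  have "\<forall>k. \<exists>s. smooth_even s \<and> (\<forall>t. x k t - y k t = t\<^sup>2 * s t)"
    using smooth_even_divide[OF smooth_even_diff[OF assms(1,2)]] assms(3) by simp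
  from choice[OF this] obtain s where s: "\<forall>k. smooth_even (s k) \<and> (\<forall>t. x k t - y k t = t\<^sup>2 * s k t)" ..
  have eq: "x k t = (x 1 t + y 1 t) * (1 / 2) + t ^ 4 * (z k t * (1 / 2)) + t\<^sup>2 * (s k t * (1 / 2))"
    "y k t = (x 1 t + y 1 t) * (1 / 2) + t ^ 4 * (z k t * (1 / 2)) - t\<^sup>2 * (s k t * (1 / 2))" for k t
  proof -
    have "(x k t + y k t) - (x 1 t + y 1 t) = t ^ 4 * z k t" "x k t - y k t = t\<^sup>2 * s k t" using z s by blast+
    then show "x k t = (x 1 t + y 1 t) * (1 / 2) + t ^ 4 * (z k t * (1 / 2)) + t\<^sup>2 * (s k t * (1 / 2))"
      "y k t = (x 1 t + y 1 t) * (1 / 2) + t ^ 4 * (z k t * (1 / 2)) - t\<^sup>2 * (s k t * (1 / 2))"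
      by (simp_all add: field_simps)
  qed
  show ?thesis
  proof (intro exI conjI allI)
    fix k t
    show "smooth_even (\<lambda>t. (x 1 t + y 1 t) * (1 / 2))"
      by (intro smooth_even_add smooth_even_mult smooth_even_const assms)
    show "smooth_even (\<lambda>t. z k t * (1 / 2))" "smooth_even (\<lambda>t. s k t * (1 / 2))"
      using z s smooth_even_mult smooth_even_const by blast+
  qed (rule eq)+
qed

lemma extension_data_exists:
  assumes "su2_frame T"
  shows "\<exists>u U z s l Z S. extension_data T a B b u U z s l Z S"
proof -
  have v0: "vol t \<noteq> 0" for t using vol(3)[of t] by simp
  have o1: "order4 (\<lambda>t. (a k t * B k t + other k t * B k t) - (a 1 t * B 1 t + other 1 t * B 1 t))" for k
    using order4_sum_diff[of "\<lambda>t. 1" B 1 "\<lambda>k t. a k t + other k t" k] B_diff other_diff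
    by (simp add: B other a_even smooth_even_add smooth_even_const algebra_simps)
  have "\<exists>u z s. smooth_even u \<and> (\<forall>k. smooth_even (z k) \<and> smooth_even (s k)) \<and>
      (\<forall>k t. a k t * B k t = u t + t ^ 4 * z k t + t\<^sup>2 * s k t \<and> other k t * B k t = u t + t ^ 4 * z k t - t\<^sup>2 * s k t)"
    by (rule half_sum_split[of "\<lambda>k t. a k t * B k t" "\<lambda>k t. other k t * B k t", OF _ _ _ o1]) (auto simp: B other a_even smooth_even_mult)
  then obtain u z s where u': "smooth_even u \<and> (\<forall>k. smooth_even (z k) \<and> smooth_even (s k)) \<and>
      (\<forall>k t. a k t * B k t = u t + t ^ 4 * z k t + t\<^sup>2 * s k t \<and> other k t * B k t = u t + t ^ 4 * z k t - t\<^sup>2 * s k t)"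
    by blast
  have u: "smooth_even u" "smooth_even (z k)" "smooth_even (s k)" "a k t * B k t = u t + t ^ 4 * z k t + t\<^sup>2 * s k t"
    "other k t * B k t = u t + t ^ 4 * z k t - t\<^sup>2 * s k t" for k t
    using u' by blast+
  define h where "h k t = rate k t * g k t - t\<^sup>2 * (vol t * (1 / 4))" for k t
  have h: "smooth_even (h k)" "h k 0 = b\<^sup>2" for k
    unfolding h_def by (intro smooth_even_intros rate g vol) (simp add: rate g)
  \<comment> \<open>The sum factors through \<open>m k\<close> and \<open>a k + other k\<close>,
    which depend on \<open>k\<close> only to order 4 by \<open>m_diff\<close> and
    \<open>other_diff\<close>; the remaining term is common to all axes.\<close>
  have gh: "g k t + h k t = 1 / vol t * (m k t * (a k t + other k t)) - t\<^sup>2 * (vol t * (1 / 4))" for k t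
  proof -
    have "\<forall>k. a k t * other k t = vol t" unfolding forall_3 other_simps vol_def by simp
    then have "1 / vol t * (m k t * (a k t + other k t)) = g k t + rate k t * g k t"
      using v0[of t] by (simp add: m_def rate_def power2_eq_square field_simps)
    then show ?thesis by (simp add: h_def)
  qed
  have o2: "order4 (\<lambda>t. (g k t + h k t) - (g 1 t + h 1 t))" for k
    using order4_sum_diff[of "\<lambda>t. 1 / vol t" m 1 "\<lambda>k t. a k t + other k t" k] m_diff other_diff v0
    unfolding gh by (simp add: m other a_even vol smooth_even_add smooth_even_const smooth_even_divide')
  have "\<exists>U Z S. smooth_even U \<and> (\<forall>k. smooth_even (Z k) \<and> smooth_even (S k)) \<and>
      (\<forall>k t. g k t = U t + t ^ 4 * Z k t + t\<^sup>2 * S k t \<and> h k t = U t + t ^ 4 * Z k t - t\<^sup>2 * S k t)"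
    by (rule half_sum_split[of g h, OF _ _ _ o2]) (auto simp: g h)
  then obtain U Z S where U': "smooth_even U \<and> (\<forall>k. smooth_even (Z k) \<and> smooth_even (S k)) \<and>
      (\<forall>k t. g k t = U t + t ^ 4 * Z k t + t\<^sup>2 * S k t \<and> h k t = U t + t ^ 4 * Z k t - t\<^sup>2 * S k t)"
    by blast
  have U: "smooth_even U" "smooth_even (Z k)" "smooth_even (S k)" "g k t = U t + t ^ 4 * Z k t + t\<^sup>2 * S k t"
    "h k t = U t + t ^ 4 * Z k t - t\<^sup>2 * S k t" for k t
    using U' by blast+
  have "\<exists>l. smooth_even l \<and> (\<forall>t. a i t * (a j t * B k t + a k t * B j t) - 2 * b = t\<^sup>2 * l t)" for i j k
    by (rule smooth_even_divide) (auto intro!: smooth_even_intros B a_even simp: B)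
  then obtain L where L: "\<And>i j k. smooth_even (L i j k)"
    "\<And>i j k t. a i t * (a j t * B k t + a k t * B j t) - 2 * b = t\<^sup>2 * L i j k t" by metis
  define l where "l k = (if k = 1 then L 1 2 3 else if k = 2 then L 2 3 1 else L 3 1 2)" for k :: 3
  have L': "a i t * (a j t * B k t + a k t * B j t) = 2 * b + t\<^sup>2 * L i j k t" for i j k t
    using L(2)[of i t j k] by simp
  have hB: "h 1 t = B 2 t * B 3 t * a 1 t - t\<^sup>2 * (a 1 t * a 2 t * a 3 t) / 4"
    "h 2 t = B 3 t * B 1 t * a 2 t - t\<^sup>2 * (a 1 t * a 2 t * a 3 t) / 4"
    "h 3 t = B 1 t * B 2 t * a 3 t - t\<^sup>2 * (a 1 t * a 2 t * a 3 t) / 4" for t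
    using a_pos[of 1 t] a_pos[of 2 t] a_pos[of 3 t]
    by (simp_all add: h_def rate_def vol_def B_prod[symmetric] power2_eq_square)
  have "extension_data T a B b u U z s l Z S"
  proof (rule extension_data.intro[OF assms], rule extension_data_axioms.intro)
    fix i k :: 3 and t :: real
    show "smooth_even (a i)" "smooth_even (B i)" "smooth_even u" "smooth_even (z i)" "smooth_even (s i)" "smooth_even U"
      "smooth_even (Z i)" "smooth_even (S i)" "a i 0 = 1" "B i 0 = b" "b \<noteq> 0"
      by (rule a_even B u U a0 b)+
    show "smooth_even (l i)" using L(1) by (simp add: l_def)
    show "a i t \<noteq> 0 \<and> B i t \<noteq> 0" using a_pos[of i t] B(3) by simp
    show "a k t * B k t = u t + t ^ 4 * z k t + t\<^sup>2 * s k t" by (rule u)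
    show "a 2 t * a 3 t * B 1 t = u t + t ^ 4 * z 1 t - t\<^sup>2 * s 1 t" "a 3 t * a 1 t * B 2 t = u t + t ^ 4 * z 2 t - t\<^sup>2 * s 2 t"
      "a 1 t * a 2 t * B 3 t = u t + t ^ 4 * z 3 t - t\<^sup>2 * s 3 t"
      unfolding other_simps[symmetric] by (rule u)+
    show "a 1 t * (a 2 t * B 3 t + a 3 t * B 2 t) = 2 * b + t\<^sup>2 * l 1 t" "a 2 t * (a 3 t * B 1 t + a 1 t * B 3 t) = 2 * b + t\<^sup>2 * l 2 t"
      "a 3 t * (a 1 t * B 2 t + a 2 t * B 1 t) = 2 * b + t\<^sup>2 * l 3 t"
      unfolding L' by (simp_all add: l_def)
    show "a 2 t * a 3 t * B 2 t * B 3 t = U t + t ^ 4 * Z 1 t + t\<^sup>2 * S 1 t"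
      "a 3 t * a 1 t * B 3 t * B 1 t = U t + t ^ 4 * Z 2 t + t\<^sup>2 * S 2 t"
      "a 1 t * a 2 t * B 1 t * B 2 t = U t + t ^ 4 * Z 3 t + t\<^sup>2 * S 3 t"
      unfolding B_prod by (rule U)+
    show "B 2 t * B 3 t * a 1 t - t\<^sup>2 * (a 1 t * a 2 t * a 3 t) / 4 = U t + t ^ 4 * Z 1 t - t\<^sup>2 * S 1 t"
      "B 3 t * B 1 t * a 2 t - t\<^sup>2 * (a 1 t * a 2 t * a 3 t) / 4 = U t + t ^ 4 * Z 2 t - t\<^sup>2 * S 2 t"
      "B 1 t * B 2 t * a 3 t - t\<^sup>2 * (a 1 t * a 2 t * a 3 t) / 4 = U t + t ^ 4 * Z 3 t - t\<^sup>2 * S 3 t"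
      unfolding hB[symmetric] by (rule U)+
  qed
  then show ?thesis by blast
qed

end

section \<open>Existence and uniqueness\<close>

lemma odd_ext_nonneg: "t \<ge> 0 \<Longrightarrow> odd_ext f t = f t"
  by (simp add: odd_ext_def)

lemma family_params_factor:
  assumes "family_params A b"
  shows "\<exists>a. family_data a b \<and> (\<forall>i. \<forall>t\<ge>0. A i t = t / 2 * a i t)"
proof -
  have A: "smooth_on (odd_ext (A i)) UNIV" "t > 0 \<Longrightarrow> A i t > 0"
    "(\<lambda>t. A i t - t / 2) \<in> O[at_right 0](\<lambda>t. t ^ 3)" for i t
    using assms by (auto simp: family_params_def smooth_odd_def)
  have "(\<lambda>t::real. t ^ 3) \<in> o[at_right 0](\<lambda>t. t)"
  proof (rule smalloI_tendsto)
    have "((\<lambda>t::real. t\<^sup>2) \<longlongrightarrow> 0) (at_right 0)" by (auto intro!: tendsto_eq_intros)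
    then show "((\<lambda>t::real. t ^ 3 / t) \<longlongrightarrow> 0) (at_right 0)"
      by (rule Lim_transform_eventually) (auto simp: eventually_at_filter power3_eq_cube power2_eq_square)
  qed (auto simp: eventually_at_filter)
  moreover have "(\<lambda>t::real. t) \<in> o[at_right 0](\<lambda>t. 1)"
    by (rule smalloI_tendsto) (auto intro!: tendsto_eq_intros)
  ultimately have o: "(\<lambda>t. A i t - t / 2) \<in> o[at_right 0](\<lambda>t. t)" and o1: "(\<lambda>t::real. t) \<in> o[at_right 0](\<lambda>t. 1)" for i
    using landau_o.big_small_trans[OF A(3)] by blast+
  \<comment> \<open>The asymptotic condition concerns \<open>t > 0\<close> only; continuity of the
    odd extension carries it to the value at 0.\<close>
  have A0: "A i 0 = 0" for i
  proof -
    have "(\<lambda>t. A i t - t / 2) \<in> o[at_right 0](\<lambda>t. 1)" using landau_o.small_trans[OF o o1] .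
    then have "((\<lambda>t. A i t - t / 2) \<longlongrightarrow> 0) (at_right 0)" using smalloD_tendsto by fastforce
    moreover have "((\<lambda>t::real. t / 2) \<longlongrightarrow> 0) (at_right 0)" by (auto intro!: tendsto_eq_intros)
    ultimately have "((\<lambda>t. (A i t - t / 2) + t / 2) \<longlongrightarrow> 0 + 0) (at_right 0)" by (rule tendsto_add)
    then have "(A i \<longlongrightarrow> 0) (at_right 0)" by simp
    moreover have "(odd_ext (A i) \<longlongrightarrow> odd_ext (A i) 0) (at_right 0)"
      using smooth_on_imp_continuous_on[OF A(1), of i]
      by (auto simp: continuous_on_def intro: filterlim_mono[OF _ order_refl at_le])
    then have "(A i \<longlongrightarrow> A i 0) (at_right 0)"
      unfolding odd_ext_nonneg[OF order_refl]
      by (rule Lim_transform_eventually) (auto simp: odd_ext_def eventually_at_filter)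
    ultimately show ?thesis using tendsto_unique trivial_limit_at_right_real by blast
  qed
  have "\<exists>g. smooth_even g \<and> (\<forall>t. odd_ext (A i) t = t * g t)" for i
    by (rule smooth_odd_divide[OF A(1)]) (auto simp: odd_ext_def A0)
  then obtain g where g: "\<And>i. smooth_even (g i)" "\<And>i t. odd_ext (A i) t = t * g i t" by metis
  have Ag: "A i t = t * g i t" if "t \<ge> 0" for i t using g(2)[of i t] that by (simp add: odd_ext_def)
  have g0: "g i 0 = 1 / 2" for i
  proof -
    have "((\<lambda>t. (A i t - t / 2) / t) \<longlongrightarrow> 0) (at_right 0)" using smalloD_tendsto[OF o] .
    then have "((\<lambda>t. g i t - 1 / 2) \<longlongrightarrow> 0) (at_right 0)"
      by (rule Lim_transform_eventually) (auto simp: eventually_at_filter Ag field_simps)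
    moreover have "((\<lambda>t. g i t - 1 / 2) \<longlongrightarrow> g i 0 - 1 / 2) (at_right 0)"
      using smooth_even_continuous[OF g(1), where t = 0, unfolded isCont_def]
      by (intro tendsto_intros) (auto intro: filterlim_mono at_le)
    ultimately show ?thesis using tendsto_unique trivial_limit_at_right_real by fastforce
  qed
  have pos: "g i t > 0" for i t
  proof -
    have p: "g i t > 0" if "t > 0" for t using A(2)[OF that, of i] Ag[of t i] that by (simp add: zero_less_mult_iff)
    show ?thesis
    proof (cases t "0::real" rule: linorder_cases)
      case less
      then show ?thesis using p[of "- t"] g(1)[of i] by (simp add: smooth_even_def)
    qed (use p in \<open>auto simp: g0\<close>)
  qed
  have "family_data (\<lambda>i t. 2 * g i t) b"
    by unfold_locales (use g(1) pos assms in \<open>auto intro!: smooth_even_intros simp: family_params_def g0\<close>)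
  then show ?thesis using Ag by (intro exI[of _ "\<lambda>i t. 2 * g i t"]) simp
qed

lemma restricts_to_cong:
  assumes "\<And>i t. t > 0 \<Longrightarrow> A i t = A' i t \<and> B i t = B' i t"
  shows "restricts_to T A B \<phi> \<longleftrightarrow> restricts_to T A' B' \<phi>"
proof -
  have "phi_AB T A B x vs = phi_AB T A' B' x vs" if "x \<in> N_man" for x vs
    using assms[of "fst x"] that by (simp add: N_man_def case_prod_unfold phi_AB_def[abs_def] omega_def[abs_def] Omega1_def[abs_def])
  then show ?thesis by (simp add: restricts_to_def)
qed

context su2_frame
begin

theorem family_extension:
  assumes "family_params A b"
  shows "\<exists>B. family_solution T A b B \<and> (\<forall>i. \<forall>t>0. B i t \<noteq> 0) \<and>
    (\<forall>B'. family_solution T A b B' \<longrightarrow> (\<forall>i. \<forall>t\<ge>0. B' i t = B i t)) \<and>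
    (\<exists>\<phi>. invariant_coclosed_G2 \<phi> \<and> restricts_to T A B \<phi>)"
proof -
  obtain a where a: "family_data a b" and A0: "\<forall>i. \<forall>t\<ge>0. A i t = t / 2 * a i t"
    using family_params_factor[OF assms] by blast
  interpret family_data a b by (rule a)
  have A: "\<forall>i. \<forall>t>0. A i t = t / 2 * a i t" using A0 by simp
  have fd: "f differentiable (at t)" if "smooth_even f" for f and t :: real
    using smooth_on_deriv(1)[of f t] that by (auto simp: smooth_even_def real_differentiable_def)
  have Ad': "(\<lambda>t. t / 2 * a i t) differentiable (at t)" for i t
    by (intro derivative_intros fd a_even) simp
  have Ad: "A i differentiable (at t)" if "t > 0" for i t
  proof -
    obtain D where "((\<lambda>t. t / 2 * a i t) has_real_derivative D) (at t)"
      using Ad'[of i t] by (auto simp: real_differentiable_def)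
    moreover have "\<forall>\<^sub>F s in nhds t. s / 2 * a i s = A i s"
      using eventually_nhds_in_open[of "{0<..}" t] that A by (auto elim!: eventually_mono)
    ultimately have "(A i has_real_derivative D) (at t)" by (simp add: DERIV_cong_ev)
    then show ?thesis by (auto simp: real_differentiable_def)
  qed
  have Bd: "B i differentiable (at t)" for i t by (rule fd[OF B(1)])
  show ?thesis
  proof (intro exI[of _ B] conjI allI impI)
    have "closed_form 4 N_man N_retr (star_phi_AB T A B)"
      using closed_star_phi_AB_iff[of A B, OF Ad Bd] flow_ode_B[OF A] by blast
    then show "family_solution T A b B"
      using B(2) Bd by (auto simp: family_solution_def intro!: continuous_at_imp_continuous_on smooth_even_continuous B(1))
    show "B i t \<noteq> 0" for i t by (rule B(3))
    show "B' i t = B i t" if B': "family_solution T A b B'" and t: "t \<ge> 0" for B' i t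
    proof (rule flow_unique[OF A _ _ _ t])
      show "continuous_on {0..} (B' i)" "B' i 0 = b" for i using B' by (auto simp: family_solution_def)
      have "B' i differentiable (at t)" if "t > 0" for i t using B' that by (simp add: family_solution_def)
      then show "flow_ode A B' t" if "t > 0" for t
        using closed_star_phi_AB_iff[of A B', OF Ad] B' that by (simp add: family_solution_def)
    qed
    obtain u U z s l Z S where "extension_data T a B b u U z s l Z S"
      using extension_data_exists[OF su2_frame_axioms] by blast
    then interpret E: extension_data T a B b u U z s l Z S .
    \<comment> \<open>The extension is built for the functions \<open>t / 2 * a i t\<close>, which
      need not equal \<open>A i t\<close> at negative \<open>t\<close>; \<open>restricts_to\<close>
      compares values at \<open>t > 0\<close> only.\<close>
    have "closed_form 4 N_man N_retr (star_phi_AB T (\<lambda>i t. t / 2 * a i t) B)"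
      using closed_star_phi_AB_iff[of "\<lambda>i t. t / 2 * a i t" B, OF Ad' Bd] flow_ode_B[of "\<lambda>i t. t / 2 * a i t"] by blast
    then have "invariant_coclosed_G2 E.phi" by (rule E.phi_invariant_coclosed_G2)
    moreover have "restricts_to T A B E.phi"
      using E.phi_restricts restricts_to_cong[of A "\<lambda>i t. t / 2 * a i t" B B] A by simp
    ultimately show "\<exists>\<phi>. invariant_coclosed_G2 \<phi> \<and> restricts_to T A B \<phi>" by blast
  qed
qed

end

section \<open>Structures of half-flat type\<close>

context su2_frame
begin

text \<open>Coclosedness is pulled back by the orbit map. The differentiability assumptions will
  hold for normalised functions, whereas \<open>half_flat_type\<close> grants no regularity of
  \<open>A\<close> and \<open>B\<close>.\<close>

lemma coclosed_restriction:
  assumes r: "restricts_to T A B \<phi>" and nz: "\<And>i t. t > 0 \<Longrightarrow> A i t \<noteq> 0 \<and> B i t \<noteq> 0"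
    and A: "\<And>i t. t > 0 \<Longrightarrow> A i differentiable (at t)" and B: "\<And>i t. t > 0 \<Longrightarrow> B i differentiable (at t)"
    and c: "coclosed M_man M_retr \<phi>"
  shows "closed_form 4 N_man N_retr (star_phi_AB T A B)"
  unfolding closed_form_def
proof (intro ballI conjI allI impI)
  fix x assume x: "x \<in> N_man"
  then have t: "fst x > 0" by (auto simp: N_man_def)
  have AB: "((\<lambda>s. f s) has_real_derivative deriv f t) (at t)" if "f differentiable (at t)" for f :: "real \<Rightarrow> real" and t
    using that DERIV_deriv_iff_real_differentiable by auto
  note d = AB[OF differentiable_mult[OF differentiable_mult[OF differentiable_mult]]]
  note d3 = AB[OF differentiable_mult[OF differentiable_mult]]
  show "(\<lambda>y. pullback N_retr (star_phi_AB T A B) y us) differentiable (at x)" if "length us = 4" for us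
    by (rule N_ext_deriv(1)[OF x d d d d3 d3 d3 d3 that]) (use A B t in blast)+
  have m: "orbit_map x \<in> M_man" using orbit_map_M[OF x] .
  show "ext_deriv N_retr (star_phi_AB T A B) x vs = 0" if vs: "length vs = Suc 4" "set vs \<subseteq> tangent N_retr x" for vs
  proof -
    have "ext_deriv N_retr (star_phi_AB T A B) x vs = ext_deriv M_retr (star_phi M_retr \<phi>) (orbit_map x) (map (orbit' x) vs)"
      by (rule ext_deriv_orbit[OF r nz x]) (use c m vs in \<open>auto simp: coclosed_def closed_form_def\<close>)
    moreover have "set (map (orbit' x) vs) \<subseteq> tangent M_retr (orbit_map x)"
      using orbit'_tangent(1)[OF x] vs(2) unfolding set_map by blast
    ultimately show ?thesis using c m vs(1) unfolding coclosed_def closed_form_def by simp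
  qed
qed

end

section \<open>Components of an invariant structure along the normal geodesic\<close>

lemma gam_M: "gam t \<in> M_man"
  by (simp add: gam_def M_man_def qone_def)

lemma gam_tangent_iff: "(v, w) \<in> tangent M_retr (gam t) \<longleftrightarrow> fst w = 0"
  using M_tangent_iff[of "t *\<^sub>R qone" qone v w] gam_M[of t] by (cases w) (simp add: gam_def qone_def)

locale restricted_G2 = su2_frame T for T +
  fixes A B :: "3 \<Rightarrow> real \<Rightarrow> real" and \<phi> :: "(quat \<times> quat) dform"
  assumes G2: "invariant_coclosed_G2 \<phi>" and res: "restricts_to T A B \<phi>"
    and nz: "\<And>i t. t > 0 \<Longrightarrow> A i t \<noteq> 0 \<and> B i t \<noteq> 0"
begin

definition comp :: "quat \<Rightarrow> quat \<Rightarrow> quat \<Rightarrow> real \<Rightarrow> real" where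
  "comp v1 v2 w s = \<phi> (gam s) [(v1, 0), (v2, 0), (0, w)]"

lemma frame: "x \<in> M_man \<Longrightarrow> \<exists>F. adapted_frame M_retr \<phi> x F"
  using G2 by (simp add: invariant_coclosed_G2_def G2_structure_def)

lemma smooth_along_gam:
  assumes "set [X, Y, Z] \<subseteq> range (\<lambda>(v, w). (v, (0, w)))"
  shows "smooth_on (\<lambda>s. \<phi> (gam s) [X, Y, Z]) UNIV"
proof -
  have "smooth_on (\<lambda>x. pullback M_retr \<phi> x [X, Y, Z]) M_nbhd"
    using G2 by (simp add: invariant_coclosed_G2_def G2_structure_def smooth_form_def)
  note sm = smooth_on_compose_affine[OF open_M_nbhd this bounded_linear_scaleR_left]
  have "smooth_on (\<lambda>s. pullback M_retr \<phi> ((0, qone) + s *\<^sub>R (qone, 0)) [X, Y, Z]) UNIV"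
    by (rule sm) (simp add: M_nbhd_def qone_def zero_prod_def)
  moreover have "pullback M_retr \<phi> ((0, qone) + s *\<^sub>R (qone, 0)) [X, Y, Z] = \<phi> (gam s) [X, Y, Z]" for s
  proof -
    have "X \<in> tangent M_retr (gam s)" "Y \<in> tangent M_retr (gam s)" "Z \<in> tangent M_retr (gam s)"
      using assms by (auto simp: gam_tangent_iff)
    then show ?thesis
      using M_retr_tangent[OF gam_M[of s]] by (simp add: pullback_def gam_def)
  qed
  ultimately show ?thesis by simp
qed

lemma equivariant:
  assumes "norm a1 = 1" "norm a2 = 1" "fst (snd X) = 0" "fst (snd Y) = 0" "fst (snd Z) = 0"
  shows "\<phi> (act (a1, a2) (gam s)) [act (a1, a2) X, act (a1, a2) Y, act (a1, a2) Z] = \<phi> (gam s) [X, Y, Z]"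
proof -
  have "X \<in> tangent M_retr (gam s)" "Y \<in> tangent M_retr (gam s)" "Z \<in> tangent M_retr (gam s)"
    using assms(3-5) gam_tangent_iff[of "fst X" "snd X"] gam_tangent_iff[of "fst Y" "snd Y"] gam_tangent_iff[of "fst Z" "snd Z"] by auto
  moreover have "invariant_form 3 \<phi>" "(a1, a2) \<in> SU2sq"
    using G2 assms(1,2) by (simp_all add: invariant_coclosed_G2_def SU2sq_def)
  note this(1)[unfolded invariant_form_def, rule_format, OF this(2) gam_M, of "[X, Y, Z]" s]
  ultimately have "pullback (act (a1, a2)) \<phi> (gam s) [X, Y, Z] = \<phi> (gam s) [X, Y, Z]" by simp
  then show ?thesis by (simp add: pullback_def act_frechet)
qed

text \<open>The group element with both entries -1 maps \<open>gam s\<close> to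
  \<open>gam (- s)\<close> and \<open>(v, w)\<close> to \<open>(- v, w)\<close>; the signs of the
  two arguments tangent to R^4 cancel. Linearity of \<open>\<phi>\<close> is obtained from an
  adapted frame.\<close>

lemma comp_even:
  assumes w: "fst w = 0"
  shows "smooth_even (comp v1 v2 w)"
proof -
  have "smooth_on (comp v1 v2 w) UNIV"
    unfolding comp_def[abs_def]
    by (rule smooth_along_gam) (use w in \<open>auto simp: image_iff prod_eq_iff\<close>)
  moreover have "comp v1 v2 w (- s) = comp v1 v2 w s" for s
  proof -
    have qq: "(- qone) \<odot> v = - v" "v \<odot> qcnj (- qone) = - v" for v
      by (simp_all add: quat_eq_iff quat_simps qone_simps)
    have "act (- qone, - qone) (gam s) = gam (- s)" "act (- qone, - qone) (v, w) = (- v, w)" for v w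
      by (simp_all add: act_def gam_def qq)
    then have e: "\<phi> (gam (- s)) [(- v1, 0), (- v2, 0), (0, w)] = comp v1 v2 w s"
      using equivariant[of "- qone" "- qone" "(v1, 0)" "(v2, 0)" "(0, w)" s] w by (simp add: comp_def qone_def)
    obtain F where F: "adapted_frame M_retr \<phi> (gam (- s)) F" using frame[OF gam_M] by blast
    then have lin: "linear F" and sur: "range F = tangent M_retr (gam (- s))"
      and eq: "\<And>us. length us = 3 \<Longrightarrow> \<phi> (gam (- s)) (map F us) = phi0 us"
      by (auto simp: adapted_frame_def bij_betw_def)
    have "(v1, 0) \<in> range F" "(v2, 0) \<in> range F" "(0, w) \<in> range F"
      unfolding sur gam_tangent_iff using w by simp_all
    then obtain x y z where xyz: "F x = (v1, 0)" "F y = (v2, 0)" "F z = (0, w)" by (metis imageE)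
    have "\<phi> (gam (- s)) (map F [- x, - y, z]) = \<phi> (gam (- s)) (map F [x, y, z])"
      by (subst (1 2) eq) (simp_all add: phi0_eq_cross7 inner_7 cross7_nth)
    then show ?thesis using e by (simp add: linear_neg[OF lin] xyz comp_def)
  qed
  ultimately show ?thesis by (simp add: smooth_even_def)
qed

lemma phi_gam:
  assumes t: "t > 0" and w: "fst w1 = 0" "fst w2 = 0" "fst w3 = 0"
  defines "\<xi> \<equiv> \<lambda>v w. vector [co 1 w / 2, co 2 w / 2, co 3 w / 2, fst v, co 1 v / t - co 1 w / 2, co 2 v / t - co 2 w / 2,
     co 3 v / t - co 3 w / 2] :: real^7"
  shows "\<phi> (gam t) [(v1, w1), (v2, w2), (v3, w3)] =
    phi0 (map (frame_scale (\<lambda>i. A i t) (\<lambda>i. B i t)) [\<xi> v1 w1, \<xi> v2 w2, \<xi> v3 w3])"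
proof -
  \<comment> \<open>The preimage of \<open>(v, w)\<close> under the derivative of the orbit map at
    \<open>(t, qone, qone)\<close>; its coframe coordinates are \<open>\<xi> v w\<close>.\<close>
  define u where "u v w = (fst v, (1 / t) *\<^sub>R ((0, snd v) :: quat), (1 / t) *\<^sub>R (0, snd v) - w)" for v w :: quat
  have x: "(t, qone, qone) \<in> N_man" using t by (simp add: N_man_def SU2sq_def qone_def)
  have q1: "qcnj qone = qone" "v \<odot> qone = v" "qone \<odot> v = v" "qone \<bullet> qone = 1" for v
    by (simp_all add: quat_eq_iff quat_simps qone_simps quat_inner)
  have o: "orbit' (t, qone, qone) (u v w) = (v, w)" if "fst w = 0" for v w
  proof -
    have "qcnj x = - x" if "fst x = 0" for x using that by (simp add: qcnj_def prod_eq_iff)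
    then have "qcnj ((1 / t) *\<^sub>R (0, snd v) - w) = w - (1 / t) *\<^sub>R (0, snd v)" using that by simp
    then show ?thesis using t by (simp add: orbit'_def u_def q1) (simp add: qone_def prod_eq_iff)
  qed
  have m: "u v w \<in> tangent N_retr (t, qone, qone)" if "fst w = 0" for v w
    unfolding u_def N_tangent_iff[OF x] using that by (cases w) (simp add: qone_def inner_diff_right)
  have c: "coframe (t, qone, qone) (u v w) = \<xi> v w" for v w
    by (simp add: vec_eq_iff forall_7 u_def coframe_nth \<xi>_def vector_7 left_coord_nth q1 co_def inner_diff_left field_simps)
  have "pullback orbit_map \<phi> (t, qone, qone) [u v1 w1, u v2 w2, u v3 w3] = phi_AB T A B (t, qone, qone) [u v1 w1, u v2 w2, u v3 w3]"
    using res x m w by (simp add: restricts_to_def)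
  moreover have "phi_AB T A B (t, qone, qone) [u v1 w1, u v2 w2, u v3 w3]
    = phi0 (map (frame_scale (\<lambda>i. A i t) (\<lambda>i. B i t)) [\<xi> v1 w1, \<xi> v2 w2, \<xi> v3 w3])"
    by (subst phi_AB_coframe[OF x]) (use m w in \<open>simp_all add: c\<close>)
  moreover have "orbit_map (t, qone, qone) = gam t" by (simp add: orbit_map_eq q1 gam_def)
  ultimately show ?thesis using w by (simp add: pullback_def orbit_map_frechet o)
qed

text \<open>For \<open>t > 0\<close> and with \<open>a i\<close> standing for
  \<open>2 * A i t / t\<close>, \<open>c k\<close> is \<open>a k * B k\<close> and
  \<open>d k\<close> is \<open>B k\<close> times the other two \<open>a i\<close>, see
  \<open>c_d_pos\<close>. These components are smooth up to \<open>t = 0\<close>, so the functions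
  are recovered from them.\<close>

definition c :: "3 \<Rightarrow> real \<Rightarrow> real" where "c k s = - comp qone (T k) (T k) s"

definition d :: "3 \<Rightarrow> real \<Rightarrow> real" where
  "d k s = - (vector [comp (T 2) (T 3) (T 1) s, comp (T 3) (T 1) (T 2) s, comp (T 1) (T 2) (T 3) s] :: real^3) $ k"

lemma d_simps: "d 1 s = - comp (T 2) (T 3) (T 1) s" "d 2 s = - comp (T 3) (T 1) (T 2) s" "d 3 s = - comp (T 1) (T 2) (T 3) s"
  by (simp_all add: d_def)

lemma c_even: "smooth_even (c k)"
  unfolding c_def[abs_def] by (intro smooth_even_uminus comp_even) simp

lemma d_even: "smooth_even (d k)"
proof -
  have "\<forall>k. smooth_even (d k)"
    unfolding forall_3 d_simps[abs_def] by (intro conjI smooth_even_uminus comp_even) simp_all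
  then show ?thesis ..
qed

lemma comp_pos:
  assumes t: "t > 0" and w: "fst w = 0"
  shows "comp v1 v2 w t = - (2 * A 1 t / t * B 1 t * co 1 w * (fst v1 * co 1 v2 - fst v2 * co 1 v1)
      + 2 * A 2 t / t * B 2 t * co 2 w * (fst v1 * co 2 v2 - fst v2 * co 2 v1)
      + 2 * A 3 t / t * B 3 t * co 3 w * (fst v1 * co 3 v2 - fst v2 * co 3 v1)
      + 2 * A 2 t / t * (2 * A 3 t / t) * B 1 t * co 1 w * (co 2 v1 * co 3 v2 - co 3 v1 * co 2 v2)
      + 2 * A 3 t / t * (2 * A 1 t / t) * B 2 t * co 2 w * (co 3 v1 * co 1 v2 - co 1 v1 * co 3 v2)
      + 2 * A 1 t / t * (2 * A 2 t / t) * B 3 t * co 3 w * (co 1 v1 * co 2 v2 - co 2 v1 * co 1 v2))"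
  unfolding comp_def phi_gam[OF t fst_zero fst_zero w] phi0_frame_scale rows3_def row3_def
  using t by (simp add: vector_7) (simp add: field_simps)

lemma c_d_pos:
  assumes t: "t > 0"
  shows "c k t = 2 * A k t / t * B k t" "d 1 t = 2 * A 2 t / t * (2 * A 3 t / t) * B 1 t"
    "d 2 t = 2 * A 3 t / t * (2 * A 1 t / t) * B 2 t" "d 3 t = 2 * A 1 t / t * (2 * A 2 t / t) * B 3 t"
proof -
  have "\<forall>k. c k t = 2 * A k t / t * B k t"
    unfolding forall_3 c_def comp_pos[OF t co_T(2)] by (simp add: qone_def)
  then show "c k t = 2 * A k t / t * B k t" ..
  show "d 1 t = 2 * A 2 t / t * (2 * A 3 t / t) * B 1 t"
    "d 2 t = 2 * A 3 t / t * (2 * A 1 t / t) * B 2 t" "d 3 t = 2 * A 1 t / t * (2 * A 2 t / t) * B 3 t"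
    unfolding d_simps comp_pos[OF t co_T(2)] by simp_all
qed

lemma right_limit_unique:
  fixes f h :: "real \<Rightarrow> real"
  assumes "isCont f 0" "isCont h 0" "\<And>t. t > 0 \<Longrightarrow> f t = h t"
  shows "f 0 = h 0"
proof (rule tendsto_unique[OF trivial_limit_at_right_real])
  show "(f \<longlongrightarrow> f 0) (at_right 0)" using assms(1) unfolding isCont_def by (rule filterlim_mono) (auto intro: at_le)
  have "(h \<longlongrightarrow> h 0) (at_right 0)" using assms(2) unfolding isCont_def by (rule filterlim_mono) (auto intro: at_le)
  then show "(f \<longlongrightarrow> h 0) (at_right 0)"
    by (rule Lim_transform_eventually) (auto simp: eventually_at_filter assms(3))
qed

lemma comp_0:
  assumes w: "fst w = 0"
  shows "comp v1 v2 w 0 = - (c 1 0 * co 1 w * (fst v1 * co 1 v2 - fst v2 * co 1 v1)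
      + c 2 0 * co 2 w * (fst v1 * co 2 v2 - fst v2 * co 2 v1) + c 3 0 * co 3 w * (fst v1 * co 3 v2 - fst v2 * co 3 v1)
      + d 1 0 * co 1 w * (co 2 v1 * co 3 v2 - co 3 v1 * co 2 v2) + d 2 0 * co 2 w * (co 3 v1 * co 1 v2 - co 1 v1 * co 3 v2)
      + d 3 0 * co 3 w * (co 1 v1 * co 2 v2 - co 2 v1 * co 1 v2))"
proof (rule right_limit_unique[where f = "comp v1 v2 w"])
  note i = smooth_even_continuous[OF c_even] smooth_even_continuous[OF d_even]
  show "isCont (comp v1 v2 w) 0" by (intro smooth_even_continuous comp_even w)
  show "isCont (\<lambda>s. - (c 1 s * co 1 w * (fst v1 * co 1 v2 - fst v2 * co 1 v1)
      + c 2 s * co 2 w * (fst v1 * co 2 v2 - fst v2 * co 2 v1) + c 3 s * co 3 w * (fst v1 * co 3 v2 - fst v2 * co 3 v1)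
      + d 1 s * co 1 w * (co 2 v1 * co 3 v2 - co 3 v1 * co 2 v2) + d 2 s * co 2 w * (co 3 v1 * co 1 v2 - co 1 v1 * co 3 v2)
      + d 3 s * co 3 w * (co 1 v1 * co 2 v2 - co 2 v1 * co 1 v2))) 0"
    by (intro continuous_intros i)
qed (simp add: c_d_pos comp_pos[OF _ w])

text \<open>No monomial of \<open>phi_AB\<close> survives on three vectors tangent to R^4 at
  \<open>t > 0\<close>; the singular point is reached by continuity.\<close>

lemma radial_0: "\<phi> (gam 0) [(v1, 0), (v2, 0), (v3, 0)] = 0"
proof -
  have "smooth_on (\<lambda>s. \<phi> (gam s) [(v1, 0), (v2, 0), (v3, 0)]) UNIV"
    by (rule smooth_along_gam) (auto simp: image_iff prod_eq_iff)
  from smooth_on_imp_continuous_on[OF this] have "isCont (\<lambda>s. \<phi> (gam s) [(v1, 0), (v2, 0), (v3, 0)]) 0"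
    by (simp add: continuous_on_eq_continuous_at)
  then show ?thesis
    by (rule right_limit_unique[where h = "\<lambda>_. 0"])
      (simp_all add: phi_gam phi0_frame_scale rows3_def row3_def vector_7 del: list.map)
qed

end

section \<open>Isotropy at the singular orbit and normalisation of the coefficients\<close>

lemma smooth_even_sign:
  assumes "smooth_even f" "\<And>t. t > 0 \<Longrightarrow> f t \<noteq> 0" "f 0 = b" "b \<noteq> 0"
  shows "b * f s > 0"
proof -
  have "continuous_on {0..} f"
    using smooth_even_continuous[OF assms(1)] by (auto intro: continuous_at_imp_continuous_on)
  from nonvanishing_sign[OF this assms(2-4), of "\<bar>s\<bar>"] have "b * f \<bar>s\<bar> > 0" by simp
  moreover have "f \<bar>s\<bar> = f s" using assms(1) by (simp add: smooth_even_def abs_if)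
  ultimately show ?thesis by simp
qed

context restricted_G2
begin

lemma rotation:
  assumes r: "norm r = 1" and w: "fst w = 0"
  shows "comp (r \<odot> v1) (r \<odot> v2) (r \<odot> w \<odot> qcnj r) 0 = comp v1 v2 w 0"
proof -
  have "r \<odot> qone = r" by (simp add: quat_eq_iff quat_simps qone_simps)
  then have "r \<odot> qone \<odot> qcnj r = qone" using r by (simp add: qcnj_unit)
  then have "act (r, r) (gam 0) = gam 0" by (simp add: act_def gam_def)
  then show ?thesis using equivariant[OF r r, of "(v1, 0)" "(v2, 0)" "(0, w)" 0] w by (simp add: comp_def act_def)
qed

lemma c_d_0: "c k 0 = c 1 0" "d k 0 = c 1 0"
proof -
  \<comment> \<open>A unit quaternion with rational coordinates whose conjugation rotates about axis
    \<open>i\<close>. Invariance under \<open>r 1\<close> gives enough linear relations to identify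
    \<open>c\<close> and \<open>d\<close> for the axes 2 and 3, and \<open>r 2\<close> does the same
    for the axes 3 and 1.\<close>
  define r where "r i = (3 / 5) *\<^sub>R qone + (4 / 5) *\<^sub>R T i" for i
  have n: "norm (r i) = 1" for i
  proof -
    have "r i \<bullet> r i = 1" using exhaust_3[of i] by (auto simp: co_inner r_def qone_simps)
    then show ?thesis by (simp add: norm_eq_1)
  qed
  have f: "fst (r i \<odot> T j \<odot> qcnj (r i)) = 0" for i j
    using exhaust_3[of i] exhaust_3[of j] by (auto simp: co_qmult r_def qone_simps qcnj_simps)
  have R: "comp (r i \<odot> v1) (r i \<odot> v2) (r i \<odot> T j \<odot> qcnj (r i)) 0 = comp v1 v2 (T j) 0" for i j v1 v2
    by (rule rotation[OF n co_T(2)])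
  note s = co_qmult r_def qone_simps qcnj_simps
  have 1: "c 2 0 = c 3 0 \<and> d 2 0 = c 3 0 \<and> d 3 0 = c 3 0"
    using R[of 1 qone "T 2" 2] R[of 1 qone "T 3" 3] R[of 1 "T 3" "T 1" 2] R[of 1 "T 1" "T 2" 3]
    unfolding comp_0[OF f] comp_0[OF co_T(2)] by (simp add: s)
  have 2: "c 3 0 = c 1 0 \<and> d 3 0 = c 1 0 \<and> d 1 0 = c 1 0"
    using R[of 2 qone "T 3" 3] R[of 2 qone "T 1" 1] R[of 2 "T 1" "T 2" 3] R[of 2 "T 2" "T 3" 1]
    unfolding comp_0[OF f] comp_0[OF co_T(2)] by (simp add: s)
  have "\<forall>k. c k 0 = c 1 0 \<and> d k 0 = c 1 0" unfolding forall_3 using 1 2 by simp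
  then show "c k 0 = c 1 0" "d k 0 = c 1 0" by blast+
qed

text \<open>If the common value were 0, then by \<open>comp_0\<close> and \<open>radial_0\<close>
  the form would vanish as soon as two arguments are tangent to R^4. The preimages \<open>x\<close>,
  \<open>y\<close> of two independent such vectors would have cross product 0, and
  \<open>cross7_cross7\<close> would make them linearly dependent.\<close>

lemma c_nonzero: "c 1 0 \<noteq> 0"
proof
  assume z: "c 1 0 = 0"
  have comp0: "comp v1 v2 w 0 = 0" if "fst w = 0" for v1 v2 w
  proof -
    have "c k 0 = 0" "d k 0 = 0" for k using c_d_0[of k] z by simp_all
    then show ?thesis unfolding comp_0[OF that] by simp
  qed
  obtain F where F: "adapted_frame M_retr \<phi> (gam 0) F" using frame[OF gam_M] by blast
  then have lin: "linear F" and sur: "range F = tangent M_retr (gam 0)" and inj: "inj F"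
    and eq: "\<And>us. length us = 3 \<Longrightarrow> \<phi> (gam 0) (map F us) = phi0 us"
    by (auto simp: adapted_frame_def bij_betw_def)
  have ran: "(v, w) \<in> range F" if "fst w = 0" for v w unfolding sur gam_tangent_iff by (rule that)
  obtain x y where xy: "F x = (qone, 0)" "F y = (T 1, 0)" using ran[of 0 qone] ran[of 0 "T 1"] by (metis imageE fst_zero)
  have "cross7 x y \<bullet> z = 0" for z
  proof -
    obtain v w where vw: "F z = (v, w)" by (cases "F z")
    then have w: "fst w = 0" using sur gam_tangent_iff by (metis rangeI)
    obtain z1 z2 where z: "F z1 = (v, 0)" "F z2 = (0, w)" using ran[of 0 v] ran[OF w, of 0] by (metis imageE fst_zero)
    have "F z = F (z1 + z2)" by (simp add: linear_add[OF lin] z vw)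
    then have zz: "z = z1 + z2" using inj by (simp add: injD)
    have "\<phi> (gam 0) (map F [x, y, z1]) = 0" "\<phi> (gam 0) (map F [x, y, z2]) = 0"
      using radial_0 comp0[OF w] by (simp_all add: xy z comp_def)
    then have "cross7 x y \<bullet> z1 = 0" "cross7 x y \<bullet> z2 = 0"
      by (simp_all add: eq phi0_eq_cross7 del: list.map)
    then show ?thesis by (simp add: zz inner_add_right)
  qed
  then have "cross7 x y = 0" using inner_eq_zero_iff by blast
  then have "(x \<bullet> y) *\<^sub>R x - (x \<bullet> x) *\<^sub>R y = 0" using cross7_cross7[of x y] by (simp add: vec_eq_iff forall_7 cross7_nth)
  then have "(x \<bullet> y) *\<^sub>R F x = (x \<bullet> x) *\<^sub>R F y" by (metis eq_iff_diff_eq_0 lin linear_scale)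
  then have "(x \<bullet> x) *\<^sub>R T 1 = (x \<bullet> y) *\<^sub>R qone" by (simp add: xy)
  then have "co 1 ((x \<bullet> x) *\<^sub>R T 1) = co 1 ((x \<bullet> y) *\<^sub>R qone)" by simp
  then have "x = 0" by simp
  then show False using xy(1) linear_0[OF lin] by (simp add: qone_def zero_prod_def)
qed

definition b :: real where "b = c 1 0"

lemma b: "b \<noteq> 0" "c k 0 = b" "d k 0 = b"
  using c_nonzero c_d_0[of k] by (simp_all add: b_def)

lemma c_d_sign: "b * c k s > 0" "b * d k s > 0"
proof -
  show "b * c k s > 0" by (rule smooth_even_sign[OF c_even _ b(2,1)]) (simp add: c_d_pos nz)
  have "\<forall>k. d k t \<noteq> 0" if "t > 0" for t using that by (simp add: forall_3 c_d_pos nz)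
  then show "b * d k s > 0" by (intro smooth_even_sign[OF d_even _ b(3,1)]) blast
qed

text \<open>If \<open>c k = a k * B k\<close> and \<open>d k\<close> is \<open>B k\<close> times the
  other two \<open>a i\<close>, then \<open>V = a 1 * a 2 * a 3\<close> and
  \<open>V * (c k / d k) = (a k)\<^sup>2\<close>. The square root in \<open>a'\<close> then selects
  the positive sign.\<close>

definition V :: "real \<Rightarrow> real" where "V s = d 1 s * d 2 s * d 3 s / (c 1 s * c 2 s * c 3 s)"

definition a' :: "3 \<Rightarrow> real \<Rightarrow> real" where "a' k s = sqrt (V s * (c k s / d k s))"

definition B' :: "3 \<Rightarrow> real \<Rightarrow> real" where "B' k s = c k s / a' k s"

lemma c_d_neq: "c k s \<noteq> 0" "d k s \<noteq> 0"
  using c_d_sign[of k s] by auto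

lemma V: "smooth_even V" "V 0 = 1" "V s > 0"
proof -
  show "smooth_even V" unfolding V_def[abs_def] by (intro smooth_even_intros c_even d_even) (simp add: c_d_neq)
  show "V 0 = 1" using b(1) by (simp add: V_def b)
  have "V s = (b * d 1 s) * (b * d 2 s) * (b * d 3 s) / ((b * c 1 s) * (b * c 2 s) * (b * c 3 s))"
    using b(1) c_d_neq by (simp add: V_def)
  also have "\<dots> > 0" by (intro divide_pos_pos mult_pos_pos c_d_sign)
  finally show "V s > 0" .
qed

lemma a': "smooth_even (a' k)" "a' k 0 = 1" "a' k s > 0"
proof -
  have p: "V s * (c k s / d k s) > 0" for s
  proof -
    have "c k s / d k s = (b * c k s) / (b * d k s)" using b(1) by simp
    also have "\<dots> > 0" by (intro divide_pos_pos c_d_sign)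
    finally show ?thesis by (rule mult_pos_pos[OF V(3)])
  qed
  show "smooth_even (a' k)" unfolding a'_def[abs_def]
    by (intro smooth_even_sqrt smooth_even_intros V c_even d_even p) (simp add: c_d_neq)
  show "a' k 0 = 1" "a' k s > 0" using p[of s] b(1) by (simp_all add: a'_def V b)
qed

lemma B': "smooth_even (B' k)" "B' k 0 = b" "B' k s \<noteq> 0"
proof -
  show "smooth_even (B' k)" unfolding B'_def[abs_def]
    by (intro smooth_even_intros c_even a') (use a'(3) less_irrefl in metis)
  show "B' k 0 = b" "B' k s \<noteq> 0" using a'(3)[of k s] c_d_neq[of k s] by (simp_all add: B'_def b a'(2))
qed

text \<open>For \<open>t > 0\<close> the functions \<open>a' k\<close>, \<open>B' k\<close> agree with \<open>2 * A k t / t\<close>, \<open>B k\<close> up to signs whose product is 1.\<close>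

lemma coefficients:
  assumes t: "t > 0"
  shows "t / 2 * a' k t * B' k t = A k t * B k t" "B' 1 t * B' 2 t * B' 3 t = B 1 t * B 2 t * B 3 t"
    "t / 2 * a' 2 t * (t / 2 * a' 3 t) * B' 1 t = A 2 t * A 3 t * B 1 t"
    "t / 2 * a' 3 t * (t / 2 * a' 1 t) * B' 2 t = A 3 t * A 1 t * B 2 t"
    "t / 2 * a' 1 t * (t / 2 * a' 2 t) * B' 3 t = A 1 t * A 2 t * B 3 t"
proof -
  define \<alpha> where "\<alpha> k = 2 * A k t / t" for k
  have A: "A k t = t / 2 * \<alpha> k" for k using t by (simp add: \<alpha>_def)
  have n: "\<alpha> k \<noteq> 0" "B k t \<noteq> 0" for k using nz[OF t] t by (simp_all add: \<alpha>_def)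
  note cd = c_d_pos[OF t, folded \<alpha>_def]
  have V\<alpha>: "V t = \<alpha> 1 * \<alpha> 2 * \<alpha> 3" using n by (simp add: V_def cd field_simps)
  have "\<forall>k. V t * (c k t / d k t) = (\<alpha> k)\<^sup>2"
    unfolding forall_3 V\<alpha> cd using n by (simp add: power2_eq_square field_simps)
  then have a: "a' k t = \<bar>\<alpha> k\<bar>" for k by (simp add: a'_def)
  \<comment> \<open>\<open>V\<close> is positive, so the signs of the three
    \<open>\<alpha> k\<close> multiply to 1.\<close>
  have ab: "\<bar>\<alpha> 1\<bar> * \<bar>\<alpha> 2\<bar> * \<bar>\<alpha> 3\<bar> = \<alpha> 1 * \<alpha> 2 * \<alpha> 3"
    using V(3)[of t] unfolding V\<alpha> by (simp add: abs_mult[symmetric])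
  show "t / 2 * a' k t * B' k t = A k t * B k t" using a'(3)[of k t] by (simp add: B'_def cd A)
  have "B' 1 t * B' 2 t * B' 3 t = (\<alpha> 1 * \<alpha> 2 * \<alpha> 3) * (B 1 t * B 2 t * B 3 t) / (\<bar>\<alpha> 1\<bar> * \<bar>\<alpha> 2\<bar> * \<bar>\<alpha> 3\<bar>)"
    by (simp add: B'_def cd a)
  then show "B' 1 t * B' 2 t * B' 3 t = B 1 t * B 2 t * B 3 t" unfolding ab using n by simp
  have "\<bar>y\<bar> * \<bar>z\<bar> * (x * u / \<bar>x\<bar>) = y * z * u" if "\<bar>x\<bar> * \<bar>y\<bar> * \<bar>z\<bar> = x * y * z" "x \<noteq> 0" for x y z u :: real
  proof -
    have "\<bar>y\<bar> * \<bar>z\<bar> * (x * u / \<bar>x\<bar>) = (\<bar>x\<bar> * \<bar>y\<bar> * \<bar>z\<bar>) * (x * u) / (\<bar>x\<bar> * \<bar>x\<bar>)"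
      using that(2) by (simp add: field_simps del: abs_mult_self_eq)
    also have "\<dots> = (x * y * z) * (x * u) / (x * x)" unfolding that(1) by simp
    finally show ?thesis using that(2) by simp
  qed
  note * = this
  have "\<bar>\<alpha> 2\<bar> * \<bar>\<alpha> 3\<bar> * B' 1 t = \<alpha> 2 * \<alpha> 3 * B 1 t" "\<bar>\<alpha> 3\<bar> * \<bar>\<alpha> 1\<bar> * B' 2 t = \<alpha> 3 * \<alpha> 1 * B 2 t"
    "\<bar>\<alpha> 1\<bar> * \<bar>\<alpha> 2\<bar> * B' 3 t = \<alpha> 1 * \<alpha> 2 * B 3 t"
    unfolding B'_def cd a by (rule *; use ab n in \<open>simp add: mult_ac\<close>)+
  then show "t / 2 * a' 2 t * (t / 2 * a' 3 t) * B' 1 t = A 2 t * A 3 t * B 1 t"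
    "t / 2 * a' 3 t * (t / 2 * a' 1 t) * B' 2 t = A 3 t * A 1 t * B 2 t"
    "t / 2 * a' 1 t * (t / 2 * a' 2 t) * B' 3 t = A 1 t * A 2 t * B 3 t"
    unfolding a A by (simp_all add: mult_ac)
qed

text \<open>By \<open>phi0_frame_scale\<close> the form depends on the functions only through the
  products listed in \<open>coefficients\<close>, which the change of signs leaves alone.\<close>

lemma normalised_restricts: "restricts_to T (\<lambda>i t. t / 2 * a' i t) B' \<phi>"
  unfolding restricts_to_def
proof (intro ballI allI impI)
  fix x us assume x: "x \<in> N_man" and us: "length us = 3" "set us \<subseteq> tangent N_retr x"
  have t: "fst x > 0" using x by (auto simp: N_man_def)
  obtain u v w where u: "map (coframe x) us = [u, v, w]" using us(1) by (auto simp: length_Suc_conv eval_nat_numeral)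
  have "phi_AB T A B x us = phi_AB T (\<lambda>i t. t / 2 * a' i t) B' x us"
    unfolding phi_AB_coframe[OF x us] u phi0_frame_scale coefficients[OF t] ..
  then show "pullback orbit_map \<phi> x us = phi_AB T (\<lambda>i t. t / 2 * a' i t) B' x us"
    using res x us by (simp add: restricts_to_def)
qed

lemma normalised_params: "family_params (\<lambda>i t. t / 2 * a' i t) b"
  unfolding family_params_def
proof (intro conjI allI impI b(1))
  fix i
  have e: "smooth_even (a' i)" by (rule a')
  have "odd_ext (\<lambda>t. t / 2 * a' i t) = (\<lambda>t. t * (1 / 2) * a' i t)"
    using e by (auto simp: odd_ext_def smooth_even_def)
  moreover have "smooth_on (\<lambda>t::real. t * (1 / 2)) UNIV"
    by (intro smooth_on_bounded_linear bounded_linear_mult_left open_UNIV)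
  then have "smooth_on (\<lambda>t. t * (1 / 2) * a' i t) UNIV"
    by (rule smooth_on_mult[OF open_UNIV]) (use e in \<open>simp add: smooth_even_def\<close>)
  ultimately show "smooth_odd (\<lambda>t. t / 2 * a' i t)" by (simp add: smooth_odd_def)
  show "0 < t / 2 * a' i t" if "t > 0" for t using a'(3)[of i t] that by simp
  \<comment> \<open>Evenness excludes a linear term, so \<open>a' i t - 1\<close> is of order
    \<open>t\<^sup>2\<close>; the extra factor \<open>t / 2\<close> gives order
    \<open>t ^ 3\<close>.\<close>
  obtain z where z: "smooth_even z" "\<And>t. a' i t - 1 = t\<^sup>2 * z t"
    using smooth_even_divide[OF smooth_even_diff[OF e smooth_even_const[of 1]]] by (auto simp: a')
  have "(\<lambda>t. (t / 2 * a' i t - t / 2) / t ^ 3) = (\<lambda>t. if t = 0 then 0 else z t / 2)"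
  proof
    fix t :: real
    have "t / 2 * a' i t - t / 2 = t / 2 * (a' i t - 1)" by (simp add: algebra_simps)
    then show "(t / 2 * a' i t - t / 2) / t ^ 3 = (if t = 0 then 0 else z t / 2)"
      unfolding z(2) by (simp add: power3_eq_cube power2_eq_square)
  qed
  moreover have "((\<lambda>t. z t / 2) \<longlongrightarrow> z 0 / 2) (at_right 0)"
    using smooth_even_continuous[OF z(1), of 0] unfolding isCont_def
    by (intro tendsto_divide tendsto_const) (auto intro: filterlim_mono at_le)
  then have "((\<lambda>t. if t = 0 then 0 else z t / 2) \<longlongrightarrow> z 0 / 2) (at_right 0)"
    by (rule Lim_transform_eventually) (auto simp: eventually_at_filter)
  ultimately show "(\<lambda>t. t / 2 * a' i t - t / 2) \<in> O[at_right 0](\<lambda>t. t ^ 3)"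
    by (intro bigoI_tendsto[where c = "z 0 / 2"]) (auto simp: eventually_at_filter)
qed

lemma normalised_solution: "family_solution T (\<lambda>i t. t / 2 * a' i t) b B'"
proof -
  have fd: "f differentiable (at t)" if "smooth_even f" for f and t :: real
    using smooth_on_deriv(1)[of f t] that by (auto simp: smooth_even_def real_differentiable_def)
  have "closed_form 4 N_man N_retr (star_phi_AB T (\<lambda>i t. t / 2 * a' i t) B')"
  proof (rule coclosed_restriction[OF normalised_restricts])
    show "t / 2 * a' i t \<noteq> 0 \<and> B' i t \<noteq> 0" if "t > 0" for i t using that a'(3)[of i t] B'(3) by simp
    show "(\<lambda>t. t / 2 * a' i t) differentiable (at t)" for i t by (intro derivative_intros fd a') simp
    show "B' i differentiable (at t)" for i t by (intro fd B')
    show "coclosed M_man M_retr \<phi>" using G2 by (simp add: invariant_coclosed_G2_def)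
  qed
  then show ?thesis
    using B'(2) fd[OF B'(1)] by (auto simp: family_solution_def intro!: continuous_at_imp_continuous_on smooth_even_continuous B'(1))
qed

end

theorem theorem1p1:
  fixes T :: "3 \<Rightarrow> quat"
  assumes "su2_basis T"
  shows "(\<forall>A b0. family_params A b0 \<longrightarrow>
            (\<exists>B. family_solution T A b0 B \<and>
                 (\<forall>i. \<forall>t>0. B i t \<noteq> 0) \<and>
                 (\<forall>B'. family_solution T A b0 B' \<longrightarrow> (\<forall>i. \<forall>t\<ge>0. B' i t = B i t)) \<and>
                 (\<exists>\<phi>. invariant_coclosed_G2 \<phi> \<and> restricts_to T A B \<phi>)))
       \<and> (\<forall>\<phi>. invariant_coclosed_G2 \<phi> \<and> half_flat_type T \<phi> \<longrightarrow>
            (\<exists>A b0 B. family_params A b0 \<and> family_solution T A b0 B \<and> restricts_to T A B \<phi>))"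
proof -
  interpret su2_frame T by (rule su2_frame.intro[OF assms])
  show ?thesis
  proof (intro conjI allI impI)
    fix A b0 assume "family_params A b0"
    then show "\<exists>B. family_solution T A b0 B \<and> (\<forall>i. \<forall>t>0. B i t \<noteq> 0) \<and>
      (\<forall>B'. family_solution T A b0 B' \<longrightarrow> (\<forall>i. \<forall>t\<ge>0. B' i t = B i t)) \<and>
      (\<exists>\<phi>. invariant_coclosed_G2 \<phi> \<and> restricts_to T A B \<phi>)"
      by (rule family_extension)
  next
    fix \<phi> assume *: "invariant_coclosed_G2 \<phi> \<and> half_flat_type T \<phi>"
    then obtain A B where AB: "\<forall>i. \<forall>t>0. A i t \<noteq> 0 \<and> B i t \<noteq> 0" "restricts_to T A B \<phi>"
      unfolding half_flat_type_def by blast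
    interpret restricted_G2 T A B \<phi>
      by unfold_locales (use * AB in simp_all)
    show "\<exists>A b0 B. family_params A b0 \<and> family_solution T A b0 B \<and> restricts_to T A B \<phi>"
      using normalised_params normalised_solution normalised_restricts by blast
  qed
qed

end
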